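(* Let $(Y,g_Y,\nabla_Y)$ be an affine-Kähler manifold such that $\nabla_Y$ defines an integral affine structure, with $\nabla_Y$-covariant lattice $TY^{\mathbb{Z}}\subset TY$. Let $(Y^\vee,g_{Y^\vee},\nabla_{Y^\vee})=(Y,g_Y,\nabla_Y^\vee)$ be its dual affine-Kähler manifold, with dual lattice $(TY^{\mathbb{Z}})^\vee\subset TY$. Then there is a canonically induced almost $2$-Kähler structure $(\omega_1,\omega_2,\mathbf{h})$ on $$X_Y=\left(TY/TY^{\mathbb{Z}}\right)\times_Y\left(TY/(TY^{\mathbb{Z}})^\vee\right)$$ (the one described in the context), and with this structure $X_Y$ is self-dual.
   Context: An affine-Kähler manifold is a triple $(Y,g,\nabla)$ with $(Y,g)$ a smooth Riemannian manifold and $\nabla$ a flat connection on $TY$ such that $\nabla$ defines an affine structure on $Y$ (i.e. $\nabla$ is torsion-free) and locally, in affine coordinates $(x_1,\dots,x_n)$, $g_{ij}=\partial^2K/\partial x_i\partial x_j$ for some smooth real-valued (locally defined) function $K$. The affine structure is integral if there is given a $\nabla$-covariant lattice $TY^{\mathbb{Z}}\subset TY$ (a full-rank lattice in each fibre, locally spanned by $\nabla$-parallel sections). The dual connection $\nabla^\vee$ is determined by $d(g(u,v))=g(\nabla u,v)+g(u,\nabla^\vee v)$; $(Y,g,\nabla^\vee)$ is again affine-Kähler, and the dual lattice $(TY^{\mathbb{Z}})^\vee=\{u: g(u,v)\in\mathbb{Z}\ \forall v\in TY^{\mathbb{Z}}\text{ in the same fibre}\}$ is $\nabla^\vee$-covariant.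 For a $2$-form $\alpha$, $\alpha^\perp$ is the distribution of vectors $v$ with $\iota_v\alpha=0$. An almost $2$-Kähler manifold $(X,\omega_1,\omega_2,\mathbf{h})$ is a $3n$-dimensional manifold with closed $2$-forms $\omega_1,\omega_2$ and a Riemannian metric $\mathbf{h}$ such that $\omega_1^\perp+\omega_2^\perp$ is integrable and each $T_pX$ has an $\mathbf{h}$-orthonormal basis $v_1,\dots,v_n,w^1_1,\dots,w^1_n,w^2_1,\dots,w^2_n$ with $\omega_j=\sum_i v_i^*\wedge (w_i^j)^*$. Its dualizing form is $\omega_D=\sum_i(w_i^1)^*\wedge (w_i^2)^*$ (independent of the choice of such basis). It is self-dual if $d\omega_D=0$ and all leaves of the foliation $\omega_1^\perp+\omega_2^\perp$ have Riemannian volume one. The canonical structure on $X_Y$: let $\omega_{TY}$ be the pull-back to $TY$, via the bundle isomorphism $TY\to T^*Y$ given by $g_Y$, of the standard symplectic form of $T^*Y$; in coordinates $(x,y)$ on $TY$ induced by affine coordinates $x$ of $\nabla_Y$, $\omega_{TY}=\sum_{i,k}g_{ik}(x)\,dx_i\wedge dy_k$. On $TY\times_YTY$ put $\omega_i=\pi_i^*\omega_{TY}$, $\pi_i$ being the projection to the $i$-th factor. Let $K_1$ (resp. $K_2$) $:T(TY)\to TY$ be the vertical projection (connection map) of $\nabla_Y$ (resp. $\nabla_Y^\vee$), with kernel its horizontal distribution, and let $\pi:TY\to Y$ be the bundle projection. For tangent vectors $(a,b),(a',b')$ to $TY\times_YTY$ at the same point (so $d\pi(a)=d\pi(b)$,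 $d\pi(a')=d\pi(b')$) put $$\mathbf{h}\big((a,b),(a',b')\big)=g_Y(d\pi(a),d\pi(a'))+g_Y(K_1a,K_1a')+g_Y(K_2b,K_2b').$$ The data $\omega_1,\omega_2,\mathbf{h}$ are invariant under translation by the lattices $TY^{\mathbb{Z}}$ (first factor) and $(TY^{\mathbb{Z}})^\vee$ (second factor), and so induce data on $X_Y$. *)

theory Defs
  imports "HOL-Analysis.Analysis"
begin

section \<open>Smooth functions on open subsets of Euclidean spaces\<close>

text \<open>Only used for open \<open>S\<close>, where it says that all iterated directional derivatives up to
  order \<open>k\<close> exist and are continuous.\<close>

primrec Ck_on :: "nat \<Rightarrow> 'e::euclidean_space set \<Rightarrow> ('e \<Rightarrow> 'b::real_normed_vector) \<Rightarrow> bool" where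
  "Ck_on 0 S f \<longleftrightarrow> continuous_on S f"
| "Ck_on (Suc k) S f \<longleftrightarrow>
     f differentiable_on S \<and> (\<forall>v. Ck_on k S (\<lambda>x. frechet_derivative f (at x) v))"

definition smooth_on :: "'e::euclidean_space set \<Rightarrow> ('e \<Rightarrow> 'b::real_normed_vector) \<Rightarrow> bool" where
  "smooth_on S f \<longleftrightarrow> (\<forall>k. Ck_on k S f)"

definition partial :: "'n::finite \<Rightarrow> (real^'n \<Rightarrow> real) \<Rightarrow> real^'n \<Rightarrow> real" where
  "partial i f x = frechet_derivative f (at x) (axis i 1)"

section \<open>Smooth manifolds\<close>

text \<open>A chart is a domain together with a coordinate map, whose values off the domain are
  irrelevant. A manifold is represented by its maximal atlas; its underlying set is the union of
  the chart domains, and its topology the one induced by the charts. The dimension of the model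
  space \<open>'e\<close> is the dimension of the manifold.\<close>

type_synonym ('a, 'e) chart = "'a set \<times> ('a \<Rightarrow> 'e)"
type_synonym ('a, 'e) atlas = "('a, 'e) chart set"

abbreviation dom_ch :: "('a, 'e) chart \<Rightarrow> 'a set" where
  "dom_ch c \<equiv> fst c"

abbreviation map_ch :: "('a, 'e) chart \<Rightarrow> 'a \<Rightarrow> 'e" where
  "map_ch c \<equiv> snd c"

definition inv_ch :: "('a, 'e) chart \<Rightarrow> 'e \<Rightarrow> 'a" where
  "inv_ch c = inv_into (dom_ch c) (map_ch c)"

definition img_ch :: "('a, 'e) chart \<Rightarrow> 'e set" where
  "img_ch c = map_ch c ` dom_ch c"

definition points :: "('a, 'e) atlas \<Rightarrow> 'a set" where
  "points M = (\<Union>c\<in>M. dom_ch c)"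

definition is_chart :: "('a, 'e::euclidean_space) chart \<Rightarrow> bool" where
  "is_chart c \<longleftrightarrow> inj_on (map_ch c) (dom_ch c) \<and> open (img_ch c)"

definition compatible :: "('a, 'e::euclidean_space) chart \<Rightarrow> ('a, 'e) chart \<Rightarrow> bool" where
  "compatible c d \<longleftrightarrow>
     open (map_ch c ` (dom_ch c \<inter> dom_ch d)) \<and> open (map_ch d ` (dom_ch c \<inter> dom_ch d)) \<and>
     smooth_on (map_ch c ` (dom_ch c \<inter> dom_ch d)) (map_ch d \<circ> inv_ch c) \<and>
     smooth_on (map_ch d ` (dom_ch c \<inter> dom_ch d)) (map_ch c \<circ> inv_ch d)"

definition max_atlas :: "('a, 'e::euclidean_space) atlas \<Rightarrow> ('a, 'e) atlas" where
  "max_atlas A = {c. is_chart c \<and> dom_ch c \<subseteq> points A \<and> (\<forall>d\<in>A. compatible c d)}"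

definition manifold_topology :: "('a, 'e::euclidean_space) atlas \<Rightarrow> 'a topology" where
  "manifold_topology M =
     topology (\<lambda>W. W \<subseteq> points M \<and> (\<forall>c\<in>M. open (map_ch c ` (W \<inter> dom_ch c))))"

definition smooth_manifold :: "('a, 'e::euclidean_space) atlas \<Rightarrow> bool" where
  "smooth_manifold M \<longleftrightarrow> M = max_atlas M \<and>
     Hausdorff_space (manifold_topology M) \<and> second_countable (manifold_topology M)"

abbreviation open_nbhd :: "('a, 'e::euclidean_space) atlas \<Rightarrow> 'a \<Rightarrow> 'a set \<Rightarrow> bool" where
  "open_nbhd M p U \<equiv> openin (manifold_topology M) U \<and> p \<in> U"

text \<open>A choice of chart around a point, used below only in expressions that do not depend on it.\<close>

definition chart_at :: "('a, 'e) atlas \<Rightarrow> 'a \<Rightarrow> ('a, 'e) chart" where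
  "chart_at M p = (SOME c. c \<in> M \<and> p \<in> dom_ch c)"

definition smooth_map :: "('a, 'e::euclidean_space) atlas \<Rightarrow> ('b, 'f::euclidean_space) atlas
    \<Rightarrow> ('a \<Rightarrow> 'b) \<Rightarrow> bool" where
  "smooth_map M N f \<longleftrightarrow> f ` points M \<subseteq> points N \<and>
     (\<forall>p\<in>points M. \<forall>c\<in>M. \<forall>d\<in>N. p \<in> dom_ch c \<and> f p \<in> dom_ch d \<longrightarrow>
        (\<exists>W. open W \<and> map_ch c p \<in> W \<and> W \<subseteq> img_ch c \<and> f ` inv_ch c ` W \<subseteq> dom_ch d \<and>
             smooth_on W (map_ch d \<circ> f \<circ> inv_ch c)))"

section \<open>Tangent vectors and vector fields\<close>

text \<open>A tangent vector at \<open>p\<close> is the family of its components in all charts around \<open>p\<close>,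
  transforming by the derivatives of the coordinate changes (and \<open>0\<close> at all other charts, so that
  the tangent space is a vector space under pointwise operations).\<close>

type_synonym ('a, 'e) tvec = "('a, 'e) chart \<Rightarrow> 'e"

definition tangent_space :: "('a, 'e::euclidean_space) atlas \<Rightarrow> 'a \<Rightarrow> ('a, 'e) tvec set" where
  "tangent_space M p =
     {v. (\<forall>c. \<not> (c \<in> M \<and> p \<in> dom_ch c) \<longrightarrow> v c = 0) \<and>
         (\<forall>c\<in>M. \<forall>d\<in>M. p \<in> dom_ch c \<and> p \<in> dom_ch d \<longrightarrow>
            v d = frechet_derivative (map_ch d \<circ> inv_ch c) (at (map_ch c p)) (v c))}"

definition tzero :: "('a, 'e::real_vector) tvec" where
  "tzero = (\<lambda>c. 0)"

definition tadd :: "('a, 'e::real_vector) tvec \<Rightarrow> ('a, 'e) tvec \<Rightarrow> ('a, 'e) tvec" where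
  "tadd u v = (\<lambda>c. u c + v c)"

definition tdiff :: "('a, 'e::real_vector) tvec \<Rightarrow> ('a, 'e) tvec \<Rightarrow> ('a, 'e) tvec" where
  "tdiff u v = (\<lambda>c. u c - v c)"

definition tscale :: "real \<Rightarrow> ('a, 'e::real_vector) tvec \<Rightarrow> ('a, 'e) tvec" where
  "tscale r v = (\<lambda>c. r *\<^sub>R v c)"

definition tcomb :: "('n::finite \<Rightarrow> real) \<Rightarrow> ('n \<Rightarrow> ('a, 'e::real_vector) tvec) \<Rightarrow> ('a, 'e) tvec" where
  "tcomb r s = (\<lambda>c. \<Sum>i\<in>UNIV. r i *\<^sub>R s i c)"

text \<open>The tangent vector at \<open>p\<close> whose components in the chart \<open>c\<close> are \<open>e\<close>;
  for fixed \<open>e\<close> this is a coordinate vector field.\<close>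

definition coord_vec ::
    "('a, 'e::euclidean_space) atlas \<Rightarrow> ('a, 'e) chart \<Rightarrow> 'a \<Rightarrow> 'e \<Rightarrow> ('a, 'e) tvec" where
  "coord_vec M c p e = (\<lambda>d. if d \<in> M \<and> p \<in> dom_ch d
     then frechet_derivative (map_ch d \<circ> inv_ch c) (at (map_ch c p)) e else 0)"

definition differential :: "('a, 'e::euclidean_space) atlas \<Rightarrow> ('b, 'f::euclidean_space) atlas
    \<Rightarrow> ('a \<Rightarrow> 'b) \<Rightarrow> 'a \<Rightarrow> ('a, 'e) tvec \<Rightarrow> ('b, 'f) tvec" where
  "differential M N f p v = (let c = chart_at M p in
     (\<lambda>d. if d \<in> N \<and> f p \<in> dom_ch d
        then frechet_derivative (map_ch d \<circ> f \<circ> inv_ch c) (at (map_ch c p)) (v c) else 0))"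

definition fun_deriv :: "('a, 'e::euclidean_space) atlas \<Rightarrow> 'a \<Rightarrow> ('a, 'e) tvec
    \<Rightarrow> ('a \<Rightarrow> real) \<Rightarrow> real" where
  "fun_deriv M p u f = (let c = chart_at M p in
     frechet_derivative (f \<circ> inv_ch c) (at (map_ch c p)) (u c))"

definition smooth_fun_on :: "('a, 'e::euclidean_space) atlas \<Rightarrow> 'a set \<Rightarrow> ('a \<Rightarrow> real) \<Rightarrow> bool" where
  "smooth_fun_on M U f \<longleftrightarrow> (\<forall>c\<in>M. smooth_on (map_ch c ` (U \<inter> dom_ch c)) (f \<circ> inv_ch c))"

definition smooth_field_on ::
    "('a, 'e::euclidean_space) atlas \<Rightarrow> 'a set \<Rightarrow> ('a \<Rightarrow> ('a, 'e) tvec) \<Rightarrow> bool" where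
  "smooth_field_on M U V \<longleftrightarrow> (\<forall>p\<in>U. V p \<in> tangent_space M p) \<and>
     (\<forall>c\<in>M. smooth_on (map_ch c ` (U \<inter> dom_ch c)) (\<lambda>x. V (inv_ch c x) c))"

text \<open>In each chart, \<open>[X,Y] = DY(X) - DX(Y)\<close>.\<close>

definition lie_bracket :: "('a, 'e::euclidean_space) atlas \<Rightarrow> ('a \<Rightarrow> ('a, 'e) tvec)
    \<Rightarrow> ('a \<Rightarrow> ('a, 'e) tvec) \<Rightarrow> 'a \<Rightarrow> ('a, 'e) tvec" where
  "lie_bracket M X Y p = (\<lambda>c. if c \<in> M \<and> p \<in> dom_ch c
     then frechet_derivative (\<lambda>x. Y (inv_ch c x) c) (at (map_ch c p)) (X p c)
        - frechet_derivative (\<lambda>x. X (inv_ch c x) c) (at (map_ch c p)) (Y p c)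
     else 0)"

section \<open>Covariant 2-tensors\<close>

text \<open>Tensor fields are functions of a point and two tangent vectors at it, normalized to \<open>0\<close> when
  the arguments are not a point of \<open>M\<close> and tangent vectors there, so that equality of tensor
  fields is equality of functions.\<close>

type_synonym ('a, 'e) tensor2 = "'a \<Rightarrow> ('a, 'e) tvec \<Rightarrow> ('a, 'e) tvec \<Rightarrow> real"

definition tensor_comp :: "('a, 'e::euclidean_space) atlas \<Rightarrow> ('a, 'e) tensor2
    \<Rightarrow> ('a, 'e) chart \<Rightarrow> 'e \<Rightarrow> 'e \<Rightarrow> 'e \<Rightarrow> real" where
  "tensor_comp M T c x a b =
     (let p = inv_ch c x in T p (coord_vec M c p a) (coord_vec M c p b))"

definition tensor2_field :: "('a, 'e::euclidean_space) atlas \<Rightarrow> ('a, 'e) tensor2 \<Rightarrow> bool" where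
  "tensor2_field M T \<longleftrightarrow>
     (\<forall>p u v. \<not> (p \<in> points M \<and> u \<in> tangent_space M p \<and> v \<in> tangent_space M p) \<longrightarrow> T p u v = 0) \<and>
     (\<forall>c\<in>M. (\<forall>x\<in>img_ch c. bilinear (tensor_comp M T c x)) \<and>
             (\<forall>a b. smooth_on (img_ch c) (\<lambda>x. tensor_comp M T c x a b)))"

definition riemannian_metric :: "('a, 'e::euclidean_space) atlas \<Rightarrow> ('a, 'e) tensor2 \<Rightarrow> bool" where
  "riemannian_metric M g \<longleftrightarrow> tensor2_field M g \<and>
     (\<forall>p\<in>points M. \<forall>u\<in>tangent_space M p. \<forall>v\<in>tangent_space M p.
        g p u v = g p v u \<and> (u \<noteq> tzero \<longrightarrow> g p u u > 0))"

definition two_form :: "('a, 'e::euclidean_space) atlas \<Rightarrow> ('a, 'e) tensor2 \<Rightarrow> bool" where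
  "two_form M \<alpha> \<longleftrightarrow> tensor2_field M \<alpha> \<and>
     (\<forall>p\<in>points M. \<forall>u\<in>tangent_space M p. \<alpha> p u u = 0)"

text \<open>The last clause is \<open>d\<alpha> = 0\<close>, evaluated on coordinate vector fields.\<close>

definition closed_two_form :: "('a, 'e::euclidean_space) atlas \<Rightarrow> ('a, 'e) tensor2 \<Rightarrow> bool" where
  "closed_two_form M \<alpha> \<longleftrightarrow> two_form M \<alpha> \<and>
     (\<forall>c\<in>M. \<forall>x\<in>img_ch c. \<forall>u v w.
        frechet_derivative (\<lambda>y. tensor_comp M \<alpha> c y v w) (at x) u
      + frechet_derivative (\<lambda>y. tensor_comp M \<alpha> c y w u) (at x) v
      + frechet_derivative (\<lambda>y. tensor_comp M \<alpha> c y u v) (at x) w = 0)"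

definition pullback :: "('a, 'e::euclidean_space) atlas \<Rightarrow> ('b, 'f::euclidean_space) atlas
    \<Rightarrow> ('a \<Rightarrow> 'b) \<Rightarrow> ('b, 'f) tensor2 \<Rightarrow> ('a, 'e) tensor2" where
  "pullback M N f T p u v =
     (if p \<in> points M \<and> u \<in> tangent_space M p \<and> v \<in> tangent_space M p
      then T (f p) (differential M N f p u) (differential M N f p v) else 0)"

section \<open>Connections and affine-Kaehler structures\<close>

text \<open>A connection maps a tangent vector \<open>u\<close> at \<open>p\<close> and a vector field \<open>V\<close>, smooth near \<open>p\<close>,
  to \<open>\<nabla>\<^sub>u V\<close> in the tangent space at \<open>p\<close>.\<close>

type_synonym ('a, 'e) conn = "'a \<Rightarrow> ('a, 'e) tvec \<Rightarrow> ('a \<Rightarrow> ('a, 'e) tvec) \<Rightarrow> ('a, 'e) tvec"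

definition connection :: "('a, 'e::euclidean_space) atlas \<Rightarrow> ('a, 'e) conn \<Rightarrow> bool" where
  "connection M nabla \<longleftrightarrow>
     (\<forall>p U V. open_nbhd M p U \<and> smooth_field_on M U V \<longrightarrow>
        (\<forall>u\<in>tangent_space M p. nabla p u V \<in> tangent_space M p \<and>
           (\<forall>v\<in>tangent_space M p. \<forall>r s.
              nabla p (tadd (tscale r u) (tscale s v)) V
              = tadd (tscale r (nabla p u V)) (tscale s (nabla p v V))) \<and>
           (\<forall>W. smooth_field_on M U W \<longrightarrow>
              nabla p u (\<lambda>q. tadd (V q) (W q)) = tadd (nabla p u V) (nabla p u W)) \<and>
           (\<forall>f. smooth_fun_on M U f \<longrightarrow>
              nabla p u (\<lambda>q. tscale (f q) (V q))
              = tadd (tscale (fun_deriv M p u f) (V p)) (tscale (f p) (nabla p u V))) \<and>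
           (\<forall>W. (\<forall>q\<in>U. W q = V q) \<longrightarrow> nabla p u W = nabla p u V))) \<and>
     (\<forall>U V W. openin (manifold_topology M) U \<and> smooth_field_on M U V \<and> smooth_field_on M U W \<longrightarrow>
        smooth_field_on M U (\<lambda>p. nabla p (W p) V))"

definition torsion_free :: "('a, 'e::euclidean_space) atlas \<Rightarrow> ('a, 'e) conn \<Rightarrow> bool" where
  "torsion_free M nabla \<longleftrightarrow>
     (\<forall>p U X Y. open_nbhd M p U \<and> smooth_field_on M U X \<and> smooth_field_on M U Y \<longrightarrow>
        tdiff (nabla p (X p) Y) (nabla p (Y p) X) = lie_bracket M X Y p)"

definition flat :: "('a, 'e::euclidean_space) atlas \<Rightarrow> ('a, 'e) conn \<Rightarrow> bool" where
  "flat M nabla \<longleftrightarrow>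
     (\<forall>p U X Y Z. open_nbhd M p U \<and> smooth_field_on M U X \<and> smooth_field_on M U Y \<and>
        smooth_field_on M U Z \<longrightarrow>
        tdiff (tdiff (nabla p (X p) (\<lambda>q. nabla q (Y q) Z)) (nabla p (Y p) (\<lambda>q. nabla q (X q) Z)))
              (nabla p (lie_bracket M X Y p) Z) = tzero)"

definition parallel_on :: "('a, 'e::euclidean_space) atlas \<Rightarrow> ('a, 'e) conn \<Rightarrow> 'a set
    \<Rightarrow> ('a \<Rightarrow> ('a, 'e) tvec) \<Rightarrow> bool" where
  "parallel_on M nabla U s \<longleftrightarrow> smooth_field_on M U s \<and>
     (\<forall>p\<in>U. \<forall>u\<in>tangent_space M p. nabla p u s = tzero)"

definition affine_chart ::
    "('a, real^'n) atlas \<Rightarrow> ('a, real^'n) conn \<Rightarrow> ('a, real^'n) chart \<Rightarrow> bool" where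
  "affine_chart M nabla c \<longleftrightarrow> c \<in> M \<and>
     (\<forall>i. parallel_on M nabla (dom_ch c) (\<lambda>q. coord_vec M c q (axis i 1)))"

definition affine_kaehler ::
    "('a, real^'n) atlas \<Rightarrow> ('a, real^'n) tensor2 \<Rightarrow> ('a, real^'n) conn \<Rightarrow> bool" where
  "affine_kaehler M g nabla \<longleftrightarrow>
     smooth_manifold M \<and> riemannian_metric M g \<and>
     connection M nabla \<and> flat M nabla \<and> torsion_free M nabla \<and>
     (\<forall>p\<in>points M. \<exists>c K. affine_chart M nabla c \<and> p \<in> dom_ch c \<and> smooth_on (img_ch c) K \<and>
        (\<forall>x\<in>img_ch c. \<forall>i j.
           tensor_comp M g c x (axis i 1) (axis j 1) = partial i (partial j K) x))"

definition dual_connection ::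
    "('a, 'e::euclidean_space) atlas \<Rightarrow> ('a, 'e) tensor2 \<Rightarrow> ('a, 'e) conn \<Rightarrow> ('a, 'e) conn" where
  "dual_connection M g nabla p u V =
     (THE z. z \<in> tangent_space M p \<and>
        (\<forall>U W. open_nbhd M p U \<and> smooth_field_on M U V \<and> smooth_field_on M U W \<longrightarrow>
           fun_deriv M p u (\<lambda>q. g q (W q) (V q)) = g p (nabla p u W) (V p) + g p (W p) z))"

text \<open>Subsets of the tangent bundle are sets of pairs of a point and a tangent vector there.\<close>

definition integral_lattice ::
    "('a, real^'n) atlas \<Rightarrow> ('a, real^'n) conn \<Rightarrow> ('a \<times> ('a, real^'n) tvec) set \<Rightarrow> bool" where
  "integral_lattice M nabla L \<longleftrightarrow>
     L \<subseteq> Sigma (points M) (tangent_space M) \<and>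
     (\<forall>p\<in>points M. \<exists>U. \<exists>s :: 'n \<Rightarrow> 'a \<Rightarrow> ('a, real^'n) tvec.
        open_nbhd M p U \<and> (\<forall>i. parallel_on M nabla U (s i)) \<and>
        (\<forall>q\<in>U. (\<forall>r. tcomb r (\<lambda>i. s i q) = tzero \<longrightarrow> (\<forall>i. r i = 0)) \<and>
                {v. (q, v) \<in> L} = {tcomb k (\<lambda>i. s i q) | k. \<forall>i. k i \<in> \<int>}))"

definition dual_lattice :: "('a, 'e::euclidean_space) atlas \<Rightarrow> ('a, 'e) tensor2
    \<Rightarrow> ('a \<times> ('a, 'e) tvec) set \<Rightarrow> ('a \<times> ('a, 'e) tvec) set" where
  "dual_lattice M g L =
     {(p, u). p \<in> points M \<and> u \<in> tangent_space M p \<and> (\<forall>v. (p, v) \<in> L \<longrightarrow> g p u v \<in> \<int>)}"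

section \<open>Distributions, leaves and Riemannian volume\<close>

type_synonym ('a, 'e) distrib = "'a \<Rightarrow> ('a, 'e) tvec set"

definition kernel_dist ::
    "('a, 'e::euclidean_space) atlas \<Rightarrow> ('a, 'e) tensor2 \<Rightarrow> ('a, 'e) distrib" where
  "kernel_dist M \<alpha> p = {v \<in> tangent_space M p. \<forall>w\<in>tangent_space M p. \<alpha> p v w = 0}"

definition sum_dist ::
    "('a, 'e::real_vector) distrib \<Rightarrow> ('a, 'e) distrib \<Rightarrow> ('a, 'e) distrib" where
  "sum_dist D E p = {tadd u v | u v. u \<in> D p \<and> v \<in> E p}"

text \<open>Integral manifolds are immersed: they carry their own (finer) manifold structure \<open>S\<close>.\<close>

definition integral_manifold :: "('a, 'e::euclidean_space) atlas \<Rightarrow> ('a, 'e) distrib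
    \<Rightarrow> ('a, 'l::euclidean_space) atlas \<Rightarrow> bool" where
  "integral_manifold M D S \<longleftrightarrow> smooth_manifold S \<and> points S \<noteq> {} \<and> smooth_map S M (\<lambda>p. p) \<and>
     (\<forall>p\<in>points S. inj_on (differential S M (\<lambda>p. p) p) (tangent_space S p) \<and>
                    differential S M (\<lambda>p. p) p ` tangent_space S p = D p)"

definition integrable_distribution :: "'l::euclidean_space itself \<Rightarrow>
    ('a, 'e::euclidean_space) atlas \<Rightarrow> ('a, 'e) distrib \<Rightarrow> bool" where
  "integrable_distribution _ M D \<longleftrightarrow>
     (\<forall>p\<in>points M. \<exists>S :: ('a, 'l) atlas. integral_manifold M D S \<and> p \<in> points S)"

definition leaf :: "('a, 'e::euclidean_space) atlas \<Rightarrow> ('a, 'e) distrib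
    \<Rightarrow> ('a, 'l::euclidean_space) atlas \<Rightarrow> bool" where
  "leaf M D S \<longleftrightarrow> integral_manifold M D S \<and> connected_space (manifold_topology S) \<and>
     (\<forall>S' :: ('a, 'l) atlas. integral_manifold M D S' \<and> connected_space (manifold_topology S') \<and>
        points S \<subseteq> points S' \<longrightarrow> points S' = points S)"

text \<open>The Riemannian measure is the Borel measure given by \<open>sqrt (det h) dx\<close> in every chart.\<close>

definition riemannian_measure :: "('a, real^'l) atlas \<Rightarrow> ('a, real^'l) tensor2 \<Rightarrow> 'a measure" where
  "riemannian_measure S h = (THE \<mu>. space \<mu> = points S \<and>
     sets \<mu> = sigma_sets (points S) {W. openin (manifold_topology S) W} \<and>
     (\<forall>c\<in>S. \<forall>B\<in>sets \<mu>. B \<subseteq> dom_ch c \<longrightarrow>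
        emeasure \<mu> B =
          (\<integral>\<^sup>+x\<in>map_ch c ` B.
             ennreal (sqrt (det (\<chi> i j. tensor_comp S h c x (axis i 1) (axis j 1)))) \<partial>lborel)))"

definition riemannian_volume :: "('a, real^'l) atlas \<Rightarrow> ('a, real^'l) tensor2 \<Rightarrow> ennreal" where
  "riemannian_volume S h = emeasure (riemannian_measure S h) (points S)"

section \<open>Almost 2-Kaehler manifolds\<close>

text \<open>With \<open>n = CARD('n)\<close>, a \<open>3n\<close>-dimensional manifold is modelled on \<open>(real^'n) \<times> (real^'n) \<times> (real^'n)\<close>,
  and the \<open>2n\<close>-dimensional leaves of \<open>\<omega>\<^sub>1\<^sup>\<bottom> + \<omega>\<^sub>2\<^sup>\<bottom>\<close> on \<open>real^('n + 'n)\<close>.\<close>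

type_synonym 'n vec3 = "(real^'n) \<times> (real^'n) \<times> (real^'n)"

definition wedge :: "('v \<Rightarrow> real) \<Rightarrow> ('v \<Rightarrow> real) \<Rightarrow> 'v \<Rightarrow> 'v \<Rightarrow> real" where
  "wedge \<alpha> \<beta> a b = \<alpha> a * \<beta> b - \<alpha> b * \<beta> a"

text \<open>A family of \<open>3n\<close> orthonormal vectors is a basis, and the dual basis covector \<open>v\<^sup>*\<close>
  of an orthonormal basis is \<open>h(v, \<cdot>)\<close>.\<close>

definition adapted_basis :: "('a, 'n::finite vec3) atlas \<Rightarrow> ('a, 'n vec3) tensor2
    \<Rightarrow> ('a, 'n vec3) tensor2 \<Rightarrow> ('a, 'n vec3) tensor2 \<Rightarrow> 'a
    \<Rightarrow> ('n \<Rightarrow> ('a, 'n vec3) tvec) \<times> ('n \<Rightarrow> ('a, 'n vec3) tvec) \<times> ('n \<Rightarrow> ('a, 'n vec3) tvec)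
    \<Rightarrow> bool" where
  "adapted_basis X \<omega>1 \<omega>2 h p = (\<lambda>(v, w1, w2).
     (\<forall>i. v i \<in> tangent_space X p \<and> w1 i \<in> tangent_space X p \<and> w2 i \<in> tangent_space X p) \<and>
     (\<forall>i j. h p (v i) (v j) = of_bool (i = j) \<and>
            h p (w1 i) (w1 j) = of_bool (i = j) \<and>
            h p (w2 i) (w2 j) = of_bool (i = j) \<and>
            h p (v i) (w1 j) = 0 \<and> h p (v i) (w2 j) = 0 \<and> h p (w1 i) (w2 j) = 0) \<and>
     (\<forall>a\<in>tangent_space X p. \<forall>b\<in>tangent_space X p.
        \<omega>1 p a b = (\<Sum>i\<in>UNIV. wedge (h p (v i)) (h p (w1 i)) a b) \<and>
        \<omega>2 p a b = (\<Sum>i\<in>UNIV. wedge (h p (v i)) (h p (w2 i)) a b)))"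

abbreviation leaf_dist :: "('a, 'e::euclidean_space) atlas \<Rightarrow> ('a, 'e) tensor2
    \<Rightarrow> ('a, 'e) tensor2 \<Rightarrow> ('a, 'e) distrib" where
  "leaf_dist X \<omega>1 \<omega>2 \<equiv> sum_dist (kernel_dist X \<omega>1) (kernel_dist X \<omega>2)"

definition almost_2_kaehler :: "('a, 'n::finite vec3) atlas \<Rightarrow> ('a, 'n vec3) tensor2
    \<Rightarrow> ('a, 'n vec3) tensor2 \<Rightarrow> ('a, 'n vec3) tensor2 \<Rightarrow> bool" where
  "almost_2_kaehler X \<omega>1 \<omega>2 h \<longleftrightarrow>
     smooth_manifold X \<and> closed_two_form X \<omega>1 \<and> closed_two_form X \<omega>2 \<and> riemannian_metric X h \<and>
     integrable_distribution TYPE(real^('n + 'n)) X (leaf_dist X \<omega>1 \<omega>2) \<and>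
     (\<forall>p\<in>points X. \<exists>B. adapted_basis X \<omega>1 \<omega>2 h p B)"

definition dualizing_form :: "('a, 'n::finite vec3) atlas \<Rightarrow> ('a, 'n vec3) tensor2
    \<Rightarrow> ('a, 'n vec3) tensor2 \<Rightarrow> ('a, 'n vec3) tensor2 \<Rightarrow> ('a, 'n vec3) tensor2" where
  "dualizing_form X \<omega>1 \<omega>2 h p a b =
     (let (v, w1, w2) = (SOME B. adapted_basis X \<omega>1 \<omega>2 h p B)
      in \<Sum>i\<in>UNIV. wedge (h p (w1 i)) (h p (w2 i)) a b)"

definition self_dual :: "('a, 'n::finite vec3) atlas \<Rightarrow> ('a, 'n vec3) tensor2
    \<Rightarrow> ('a, 'n vec3) tensor2 \<Rightarrow> ('a, 'n vec3) tensor2 \<Rightarrow> bool" where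
  "self_dual X \<omega>1 \<omega>2 h \<longleftrightarrow>
     closed_two_form X (dualizing_form X \<omega>1 \<omega>2 h) \<and>
     (\<forall>S :: ('a, real^('n + 'n)) atlas. leaf X (leaf_dist X \<omega>1 \<omega>2) S \<longrightarrow>
        riemannian_volume S (pullback S X (\<lambda>p. p) h) = 1)"

section \<open>Tangent and cotangent bundles\<close>

type_synonym ('a, 'e) tpoint = "'a \<times> ('a, 'e) tvec"

definition tangent_chart :: "('a, 'e::euclidean_space) atlas \<Rightarrow> ('a, 'e) chart
    \<Rightarrow> (('a, 'e) tpoint, 'e \<times> 'e) chart" where
  "tangent_chart M c = (Sigma (dom_ch c) (tangent_space M), \<lambda>(p, v). (map_ch c p, v c))"

definition tangent_bundle ::
    "('a, 'e::euclidean_space) atlas \<Rightarrow> (('a, 'e) tpoint, 'e \<times> 'e) atlas" where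
  "tangent_bundle M = max_atlas (tangent_chart M ` M)"

definition vertical_lift :: "('a, 'e::euclidean_space) atlas \<Rightarrow> ('a, 'e) tpoint \<Rightarrow> ('a, 'e) tvec
    \<Rightarrow> (('a, 'e) tpoint, 'e \<times> 'e) tvec" where
  "vertical_lift M z w = (let c = chart_at M (fst z) in
     coord_vec (tangent_bundle M) (tangent_chart M c) z (0, w c))"

text \<open>The horizontal space at \<open>(p, v)\<close> consists of the derivatives \<open>dV(u)\<close> of local sections \<open>V\<close>
  through \<open>(p, v)\<close> in directions \<open>u\<close> with \<open>\<nabla>\<^sub>u V = 0\<close>. The connection map is the projection to the
  vertical space along it, the vertical space being identified with the tangent space of the base.\<close>

definition horizontal_space :: "('a, 'e::euclidean_space) atlas \<Rightarrow> ('a, 'e) conn \<Rightarrow> ('a, 'e) tpoint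
    \<Rightarrow> (('a, 'e) tpoint, 'e \<times> 'e) tvec set" where
  "horizontal_space M nabla z =
     {differential M (tangent_bundle M) (\<lambda>q. (q, V q)) (fst z) u | V U u.
        open_nbhd M (fst z) U \<and> smooth_field_on M U V \<and> V (fst z) = snd z \<and>
        u \<in> tangent_space M (fst z) \<and> nabla (fst z) u V = tzero}"

definition connection_map :: "('a, 'e::euclidean_space) atlas \<Rightarrow> ('a, 'e) conn \<Rightarrow> ('a, 'e) tpoint
    \<Rightarrow> (('a, 'e) tpoint, 'e \<times> 'e) tvec \<Rightarrow> ('a, 'e) tvec" where
  "connection_map M nabla z \<xi> =
     (THE w. w \<in> tangent_space M (fst z) \<and>
        (\<exists>\<eta>\<in>horizontal_space M nabla z. \<xi> = tadd \<eta> (vertical_lift M z w)))"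

type_synonym ('a, 'e) cpoint = "'a \<times> (('a, 'e) tvec \<Rightarrow> real)"

text \<open>Covectors are functionals on the tangent space, normalized to \<open>0\<close> outside of it.\<close>

definition cotangent_space ::
    "('a, 'e::euclidean_space) atlas \<Rightarrow> 'a \<Rightarrow> (('a, 'e) tvec \<Rightarrow> real) set" where
  "cotangent_space M p = {\<alpha>. (\<forall>v. v \<notin> tangent_space M p \<longrightarrow> \<alpha> v = 0) \<and>
     (\<forall>u\<in>tangent_space M p. \<forall>v\<in>tangent_space M p. \<forall>r s.
        \<alpha> (tadd (tscale r u) (tscale s v)) = r * \<alpha> u + s * \<alpha> v)}"

definition cotangent_chart :: "('a, real^'n) atlas \<Rightarrow> ('a, real^'n) chart
    \<Rightarrow> (('a, real^'n) cpoint, (real^'n) \<times> (real^'n)) chart" where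
  "cotangent_chart M c = (Sigma (dom_ch c) (cotangent_space M),
     \<lambda>(p, \<alpha>). (map_ch c p, \<chi> i. \<alpha> (coord_vec M c p (axis i 1))))"

definition cotangent_bundle ::
    "('a, real^'n) atlas \<Rightarrow> (('a, real^'n) cpoint, (real^'n) \<times> (real^'n)) atlas" where
  "cotangent_bundle M = max_atlas (cotangent_chart M ` M)"

text \<open>\<open>\<Sum>\<^sub>i dx\<^sub>i \<and> dp\<^sub>i\<close> in the coordinates \<open>(x, p)\<close> induced by a chart of \<open>M\<close>.\<close>

definition standard_symplectic ::
    "('a, real^'n) atlas \<Rightarrow> (('a, real^'n) cpoint, (real^'n) \<times> (real^'n)) tensor2" where
  "standard_symplectic M z \<xi> \<zeta> = (let C = cotangent_chart M (chart_at M (fst z)) in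
     \<Sum>i\<in>UNIV. wedge (\<lambda>\<tau>. fst (\<tau> C) $ i) (\<lambda>\<tau>. snd (\<tau> C) $ i) \<xi> \<zeta>)"

definition flat_map :: "('a, 'e) tensor2 \<Rightarrow> ('a, 'e) tpoint \<Rightarrow> ('a, 'e) cpoint" where
  "flat_map g = (\<lambda>(p, v). (p, g p v))"

definition omega_T :: "('a, real^'n) atlas \<Rightarrow> ('a, real^'n) tensor2
    \<Rightarrow> (('a, real^'n) tpoint, (real^'n) \<times> (real^'n)) tensor2" where
  "omega_T M g = pullback (tangent_bundle M) (cotangent_bundle M) (flat_map g) (standard_symplectic M)"

section \<open>The manifold \<open>X\<^sub>Y\<close> and its canonical structure\<close>

type_synonym ('a, 'e) tpoint2 = "('a, 'e) tpoint \<times> ('a, 'e) tpoint"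

definition double_tangent_chart :: "('a, real^'n) atlas \<Rightarrow> ('a, real^'n) chart
    \<Rightarrow> (('a, real^'n) tpoint2, 'n vec3) chart" where
  "double_tangent_chart M c =
     ({(y, z). y \<in> Sigma (dom_ch c) (tangent_space M) \<and> z \<in> Sigma (dom_ch c) (tangent_space M) \<and>
               fst y = fst z},
      \<lambda>(y, z). (map_ch c (fst y), snd y c, snd z c))"

definition double_tangent_bundle ::
    "('a, real^'n) atlas \<Rightarrow> (('a, real^'n) tpoint2, 'n vec3) atlas" where
  "double_tangent_bundle M = max_atlas (double_tangent_chart M ` M)"

definition double_metric :: "('a, real^'n) atlas \<Rightarrow> ('a, real^'n) tensor2 \<Rightarrow> ('a, real^'n) conn
    \<Rightarrow> (('a, real^'n) tpoint2, 'n vec3) tensor2" where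
  "double_metric M g nabla z \<xi> \<zeta> =
     (let TM = tangent_bundle M; TT = double_tangent_bundle M; p = fst (fst z);
          d\<pi> = differential TM M fst (fst z);
          K1 = connection_map M nabla (fst z);
          K2 = connection_map M (dual_connection M g nabla) (snd z);
          a = differential TT TM fst z \<xi>; b = differential TT TM snd z \<xi>;
          a' = differential TT TM fst z \<zeta>; b' = differential TT TM snd z \<zeta>
      in if z \<in> points TT \<and> \<xi> \<in> tangent_space TT z \<and> \<zeta> \<in> tangent_space TT z
         then g p (d\<pi> a) (d\<pi> a') + g p (K1 a) (K1 a') + g p (K2 b) (K2 b') else 0)"

text \<open>Congruence modulo a fibrewise lattice; the points of the quotient of the tangent bundle by the
  lattice are its equivalence classes.\<close>

definition lattice_rel :: "('a, 'e::euclidean_space) atlas \<Rightarrow> ('a, 'e) tpoint set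
    \<Rightarrow> (('a, 'e) tpoint \<times> ('a, 'e) tpoint) set" where
  "lattice_rel M L = {((p, u), (q, v)). p \<in> points M \<and> p = q \<and>
     u \<in> tangent_space M p \<and> v \<in> tangent_space M p \<and> (p, tdiff u v) \<in> L}"

type_synonym ('a, 'e) xpoint = "('a, 'e) tpoint set \<times> ('a, 'e) tpoint set"

definition quotient_proj :: "('a, 'e::euclidean_space) atlas \<Rightarrow> ('a, 'e) tensor2
    \<Rightarrow> ('a, 'e) tpoint set \<Rightarrow> ('a, 'e) tpoint2 \<Rightarrow> ('a, 'e) xpoint" where
  "quotient_proj M g L = (\<lambda>(y, z). (lattice_rel M L `` {y}, lattice_rel M (dual_lattice M g L) `` {z}))"

text \<open>The smooth structure on the image of a (covering) map \<open>q\<close> that makes \<open>q\<close> a local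
  diffeomorphism: its charts are the charts of \<open>M\<close> on whose domain \<open>q\<close> is injective.\<close>

definition quotient_manifold ::
    "('a, 'e::euclidean_space) atlas \<Rightarrow> ('a \<Rightarrow> 'b) \<Rightarrow> ('b, 'e) atlas" where
  "quotient_manifold M q =
     max_atlas {(q ` dom_ch c, map_ch c \<circ> inv_into (dom_ch c) q) | c. c \<in> M \<and> inj_on q (dom_ch c)}"

definition X_manifold :: "('a, real^'n) atlas \<Rightarrow> ('a, real^'n) tensor2 \<Rightarrow> ('a, real^'n) tpoint set
    \<Rightarrow> (('a, real^'n) xpoint, 'n vec3) atlas" where
  "X_manifold Y g L = quotient_manifold (double_tangent_bundle Y) (quotient_proj Y g L)"

text \<open>The tensor fields on \<open>X\<^sub>Y\<close> induced by \<open>\<omega>\<^sub>1\<close>, \<open>\<omega>\<^sub>2\<close> and the metric on the fibre product of tangent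
  bundles, i.e. those that pull back to them.\<close>

definition canonical_structure :: "('a, real^'n) atlas \<Rightarrow> ('a, real^'n) tensor2 \<Rightarrow> ('a, real^'n) conn
    \<Rightarrow> ('a, real^'n) tpoint set
    \<Rightarrow> (('a, real^'n) xpoint, 'n vec3) tensor2 \<times> (('a, real^'n) xpoint, 'n vec3) tensor2
         \<times> (('a, real^'n) xpoint, 'n vec3) tensor2
    \<Rightarrow> bool" where
  "canonical_structure Y g nabla L = (\<lambda>(\<omega>1, \<omega>2, h).
     (let X = X_manifold Y g L; TT = double_tangent_bundle Y; TY = tangent_bundle Y;
          q = quotient_proj Y g L
      in tensor2_field X \<omega>1 \<and> tensor2_field X \<omega>2 \<and> tensor2_field X h \<and>
         pullback TT X q \<omega>1 = pullback TT TY fst (omega_T Y g) \<and>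
         pullback TT X q \<omega>2 = pullback TT TY snd (omega_T Y g) \<and>
         pullback TT X q h = double_metric Y g nabla))"

end

theory Submission
  imports Defs
begin

text \<open>In affine coordinates of \<open>\<nabla>\<close> adapted to the lattice, \<open>X\<^sub>Y\<close> has local coordinates \<open>(x, y, z)\<close>, where
  \<open>y\<close> are the coordinates of the first tangent vector and \<open>z = G(x) v\<close> those of the second one \<open>v\<close>, lowered with
  the metric \<open>G = Hess K\<close>; both lattices become \<open>\<int>\<^sup>n\<close>. There \<open>\<omega>\<^sub>1 = \<Sum> G\<^sub>i\<^sub>k dx\<^sub>i \<and> dy\<^sub>k\<close>, \<open>\<omega>\<^sub>2 = \<Sum> dx\<^sub>i \<and> dz\<^sub>i\<close>,
  \<open>h = G(dx,dx) + G(dy,dy) + G\<^sup>-\<^sup>1(dz,dz)\<close> and \<open>\<omega>\<^sub>D = \<Sum> dy\<^sub>i \<and> dz\<^sub>i\<close>, so that closedness is the symmetry of the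
  third derivatives of \<open>K\<close>. The leaves are the fibres \<open>x = const\<close>, which are tori with the flat metric
  \<open>G(x) \<oplus> G(x)\<^sup>-\<^sup>1\<close> of determinant one, hence of volume one.\<close>

section \<open>Calculus of smooth functions\<close>

text \<open>The coordinates \<open>z\<close> are forced by duality: a field \<open>V\<close> is
  parallel for the dual connection exactly when \<open>G V\<close> is locally constant, so
  \<open>z\<close> is to the dual connection what \<open>y\<close> is to \<open>nabla\<close>, and
  pairing with the standard basis of the first lattice reads off \<open>z\<close>. The symplectic
  form is in Darboux form only in \<open>z\<close>; in \<open>y\<close> an extra term with the
  derivative of \<open>G\<close> appears, which the Hessian symmetry removes. The definitions pick
  charts by choice or quantify over the whole maximal atlas, so much of the work reduces each notion
  to one convenient chart around each point. The dualizing form, too, is defined from a chosen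
  basis; it is pinned down by
  \<open>h(w\<^sup>j\<^sub>i, _) = \<omega>\<^sub>j(v\<^sub>i, _)\<close>. A leaf is an abstract
  maximal connected immersed manifold with its own atlas. Its base point is locally constant, which
  puts it inside a fibre, and maximality against the torus gives equality of the point sets only,
  not of the atlases. The volume is therefore computed in the atlas of the leaf, by comparing its
  Riemannian measure with the image of Lebesgue measure on the unit cube.\<close>

abbreviation fder :: "('a::real_normed_vector \<Rightarrow> 'b::real_normed_vector) \<Rightarrow> 'a \<Rightarrow> 'a \<Rightarrow> 'b" where
  "fder f x \<equiv> frechet_derivative f (at x)"

lemma fder_eq: "(f has_derivative f') (at x) \<Longrightarrow> fder f x = f'"
  using frechet_derivative_at by metis

lemma has_fder: "f differentiable at x \<Longrightarrow> (f has_derivative fder f x) (at x)"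
  using frechet_derivative_works by blast

lemma linear_fder: "f differentiable at x \<Longrightarrow> linear (fder f x)"
  using has_fder has_derivative_linear by blast

lemma Ck_on_Suc_open:
  assumes "open S"
  shows "Ck_on (Suc k) S f \<longleftrightarrow> (\<forall>x\<in>S. f differentiable at x) \<and> (\<forall>v. Ck_on k S (\<lambda>x. fder f x v))"
  using assms by (simp add: differentiable_on_eq_differentiable_at)

text \<open>On an open set, equality of functions passes to their derivatives. The closure rules
  below rely on this to replace an iterated derivative by the explicit formula from the calculus
  rule.\<close>

lemma Ck_on_cong:
  assumes "open S" "\<And>x. x \<in> S \<Longrightarrow> f x = g x" "Ck_on k S f"
  shows "Ck_on k S g"
  using assms
proof (induction k arbitrary: f g)
  case 0
  then show ?case by (auto cong: continuous_on_cong)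
next
  case (Suc k)
  have d: "f differentiable at x" if "x \<in> S" for x
    using Suc.prems that by (simp add: Ck_on_Suc_open del: Ck_on.simps)
  have h: "(g has_derivative fder f x) (at x)" if "x \<in> S" for x
    using has_derivative_transform_within_open[OF has_fder[OF d[OF that]] Suc.prems(1) that] Suc.prems(2)
    by blast
  have "Ck_on k S (\<lambda>x. fder g x v)" for v
  proof (rule Suc.IH[of "\<lambda>x. fder f x v"])
    show "Ck_on k S (\<lambda>x. fder f x v)" using Suc.prems by simp
  qed (use Suc.prems h fder_eq in \<open>force+\<close>)
  then show ?case
    using h by (auto simp: Ck_on_Suc_open[OF Suc.prems(1)] differentiable_def simp del: Ck_on.simps)
qed

lemma Ck_on_SucD: "open S \<Longrightarrow> Ck_on (Suc k) S f \<Longrightarrow> Ck_on k S f"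
proof (induction k arbitrary: f)
  case 0
  then show ?case by (auto simp: differentiable_imp_continuous_on)
next
  case (Suc k)
  then show ?case by (metis Ck_on.simps(2))
qed

lemma Ck_on_subset:
  assumes "open S" "open T" "T \<subseteq> S" "Ck_on k S f"
  shows "Ck_on k T f"
  using assms
proof (induction k arbitrary: f)
  case 0
  then show ?case by (auto intro: continuous_on_subset)
next
  case (Suc k)
  then show ?case by (auto simp: Ck_on_Suc_open simp del: Ck_on.simps)
qed

lemma Ck_on_local:
  assumes "open S" "\<And>x. x \<in> S \<Longrightarrow> \<exists>T. open T \<and> x \<in> T \<and> Ck_on k T f"
  shows "Ck_on k S f"
  using assms(2)
proof (induction k arbitrary: f)
  case 0
  then show ?case
    using assms(1) by (auto simp: continuous_on_eq_continuous_at) (metis continuous_on_eq_continuous_at)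
next
  case (Suc k)
  have "f differentiable at x" if "x \<in> S" for x
    using Suc.prems[OF that] by (metis Ck_on_Suc_open)
  moreover have "Ck_on k S (\<lambda>x. fder f x v)" for v
    by (rule Suc.IH) (metis Suc.prems Ck_on.simps(2))
  ultimately show ?case using assms(1) by (simp add: Ck_on_Suc_open del: Ck_on.simps)
qed

lemma Ck_on_const: "open S \<Longrightarrow> Ck_on k S (\<lambda>x. c)"
proof (induction k arbitrary: c)
  case (Suc k)
  have "fder (\<lambda>x. c) x = (\<lambda>v. 0)" for x :: 'a by (rule fder_eq) simp
  then show ?case using Suc by (simp add: Ck_on_Suc_open del: Ck_on.simps)
qed simp

lemma Ck_on_bounded_linear:
  assumes "bounded_linear L" "open S" "Ck_on k S f"
  shows "Ck_on k S (\<lambda>x. L (f x))"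
  using assms(3)
proof (induction k arbitrary: f)
  case 0
  then show ?case
    using bounded_linear.continuous_on[OF assms(1)] by auto
next
  case (Suc k)
  have h: "((\<lambda>x. L (f x)) has_derivative (\<lambda>v. L (fder f x v))) (at x)" if "x \<in> S" for x
    using Suc.prems that assms(2)
    by (intro bounded_linear.has_derivative[OF assms(1)] has_fder) (simp add: Ck_on_Suc_open del: Ck_on.simps)
  have "Ck_on k S (\<lambda>x. fder (\<lambda>x. L (f x)) x v)" for v
    by (rule Ck_on_cong[OF assms(2) _ Suc.IH[of "\<lambda>x. fder f x v"]])
       (use Suc.prems h fder_eq in \<open>force+\<close>)
  then show ?case using h assms(2)
    by (auto simp: Ck_on_Suc_open differentiable_def simp del: Ck_on.simps)
qed

lemma Ck_on_add:
  assumes "open S" "Ck_on k S f" "Ck_on k S g"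
  shows "Ck_on k S (\<lambda>x. f x + g x)"
  using assms(2,3)
proof (induction k arbitrary: f g)
  case 0
  then show ?case by (auto intro: continuous_on_add)
next
  case (Suc k)
  have h: "((\<lambda>x. f x + g x) has_derivative (\<lambda>v. fder f x v + fder g x v)) (at x)" if "x \<in> S" for x
    using Suc.prems that assms(1)
    by (intro has_derivative_add has_fder) (simp_all add: Ck_on_Suc_open del: Ck_on.simps)
  have "Ck_on k S (\<lambda>x. fder (\<lambda>x. f x + g x) x v)" for v
    by (rule Ck_on_cong[OF assms(1) _ Suc.IH[of "\<lambda>x. fder f x v" "\<lambda>x. fder g x v"]])
       (use Suc.prems h fder_eq in \<open>force+\<close>)
  then show ?case using h assms(1)
    by (auto simp: Ck_on_Suc_open differentiable_def simp del: Ck_on.simps)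
qed

lemma Ck_on_sum:
  assumes "open S" "finite I" "\<And>i. i \<in> I \<Longrightarrow> Ck_on k S (f i)"
  shows "Ck_on k S (\<lambda>x. \<Sum>i\<in>I. f i x)"
  using assms(2,3) by (induction I rule: finite_induct) (simp_all add: Ck_on_const Ck_on_add assms(1))

text \<open>The product rule leaves one factor undifferentiated in each term, so the induction also
  needs that order \<open>Suc k\<close> implies order \<open>k\<close>. One proof serves scalar,
  inner and matrix products.\<close>

lemma Ck_on_bilinear:
  assumes "bounded_bilinear B" "open S" "Ck_on k S f" "Ck_on k S g"
  shows "Ck_on k S (\<lambda>x. B (f x) (g x))"
  using assms(3,4)
proof (induction k arbitrary: f g)
  case 0
  then show ?case using bounded_bilinear.continuous_on[OF assms(1)] by auto
next
  case (Suc k)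
  have h: "((\<lambda>x. B (f x) (g x)) has_derivative (\<lambda>v. B (f x) (fder g x v) + B (fder f x v) (g x))) (at x)"
    if "x \<in> S" for x
    using Suc.prems that assms(2)
    by (intro bounded_bilinear.FDERIV[OF assms(1)] has_fder) (simp_all add: Ck_on_Suc_open del: Ck_on.simps)
  have "Ck_on k S (\<lambda>x. fder (\<lambda>x. B (f x) (g x)) x v)" for v
  proof (rule Ck_on_cong[OF assms(2)])
    show "Ck_on k S (\<lambda>x. B (f x) (fder g x v) + B (fder f x v) (g x))"
      using Suc.prems Ck_on_SucD[OF assms(2) Suc.prems(1)] Ck_on_SucD[OF assms(2) Suc.prems(2)]
      by (intro Ck_on_add Suc.IH assms(2)) auto
  qed (use h fder_eq in \<open>force\<close>)
  then show ?case using h assms(2)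
    by (auto simp: Ck_on_Suc_open differentiable_def simp del: Ck_on.simps)
qed

lemma fder_basis_expand:
  fixes f :: "'a::euclidean_space \<Rightarrow> 'b::real_normed_vector"
  assumes "linear L"
  shows "L v = (\<Sum>b\<in>Basis. (v \<bullet> b) *\<^sub>R L b)"
proof -
  have "L v = L (\<Sum>b\<in>Basis. (v \<bullet> b) *\<^sub>R b)" by (simp add: euclidean_representation)
  then show ?thesis using assms by (simp add: linear_sum linear_cmul)
qed

text \<open>The chain rule differentiates \<open>f\<close> in the direction
  \<open>fder g x v\<close>, which moves with \<open>x\<close>, whereas \<open>Ck_on\<close> speaks
  of fixed directions. Expanding that direction in a basis gives a finite sum of products to which
  the induction hypothesis applies.\<close>

lemma Ck_on_compose:
  fixes f :: "'e::euclidean_space \<Rightarrow> 'b::real_normed_vector" and g :: "'d::euclidean_space \<Rightarrow> 'e"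
  assumes "open S" "open T" "g ` S \<subseteq> T" "Ck_on k T f" "Ck_on k S g"
  shows "Ck_on k S (\<lambda>x. f (g x))"
  using assms(4,5)
proof (induction k arbitrary: f)
  case 0
  then show ?case using assms(3) continuous_on_compose2 by auto
next
  case (Suc k)
  have df: "f differentiable at y" if "y \<in> T" for y
    using Suc.prems that assms(2) by (simp add: Ck_on_Suc_open del: Ck_on.simps)
  have dg: "g differentiable at x" if "x \<in> S" for x
    using Suc.prems that assms(1) by (simp add: Ck_on_Suc_open del: Ck_on.simps)
  have h: "((\<lambda>x. f (g x)) has_derivative (\<lambda>v. fder f (g x) (fder g x v))) (at x)" if "x \<in> S" for x
    using diff_chain_at[OF has_fder[OF dg[OF that]] has_fder[OF df]] assms(3) that
    by (auto simp: o_def image_subset_iff)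
  have "Ck_on k S (\<lambda>x. fder (\<lambda>x. f (g x)) x v)" for v
  proof (rule Ck_on_cong[OF assms(1)])
    show "Ck_on k S (\<lambda>x. \<Sum>b\<in>Basis. (fder g x v \<bullet> b) *\<^sub>R fder f (g x) b)"
    proof (intro Ck_on_sum assms(1) finite_Basis Ck_on_bilinear[OF bounded_bilinear_scaleR]
        Ck_on_bounded_linear[OF bounded_linear_inner_left])
      show "Ck_on k S (\<lambda>x. fder g x v)" using Suc.prems by simp
      show "Ck_on k S (\<lambda>x. fder f (g x) b)" for b
        using Suc.IH[of "\<lambda>y. fder f y b"] Suc.prems Ck_on_SucD[OF assms(1)] by (auto simp del: Ck_on.simps simp: Ck_on_Suc_open assms(1,2))
    qed
    show "(\<Sum>b\<in>Basis. (fder g x v \<bullet> b) *\<^sub>R fder f (g x) b) = fder (\<lambda>x. f (g x)) x v" if "x \<in> S" for x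
      using fder_basis_expand[OF linear_fder[OF df], of "g x" "fder g x v"] fder_eq[OF h[OF that]] that assms(3)
      by auto
  qed
  then show ?case using h assms(1)
    by (auto simp: Ck_on_Suc_open differentiable_def simp del: Ck_on.simps)
qed

section \<open>Closure properties of infinitely differentiable functions\<close>

lemma smooth_on_cong: "open S \<Longrightarrow> (\<And>x. x \<in> S \<Longrightarrow> f x = g x) \<Longrightarrow> smooth_on S f \<Longrightarrow> smooth_on S g"
  unfolding smooth_on_def using Ck_on_cong by blast

lemma smooth_on_subset: "smooth_on S f \<Longrightarrow> open S \<Longrightarrow> open T \<Longrightarrow> T \<subseteq> S \<Longrightarrow> smooth_on T f"
  unfolding smooth_on_def using Ck_on_subset by blast

lemma smooth_on_local:
  "open S \<Longrightarrow> (\<And>x. x \<in> S \<Longrightarrow> \<exists>T. open T \<and> x \<in> T \<and> smooth_on T f) \<Longrightarrow> smooth_on S f"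
  unfolding smooth_on_def by (meson Ck_on_local)

lemma smooth_on_const: "open S \<Longrightarrow> smooth_on S (\<lambda>x. c)"
  unfolding smooth_on_def using Ck_on_const by blast

lemma smooth_on_imp_continuous_on: "smooth_on S f \<Longrightarrow> continuous_on S f"
  unfolding smooth_on_def using Ck_on.simps(1) by blast

lemma smooth_on_differentiable: "smooth_on S f \<Longrightarrow> open S \<Longrightarrow> x \<in> S \<Longrightarrow> f differentiable at x"
  unfolding smooth_on_def using Ck_on_Suc_open by blast

lemma smooth_on_has_derivative:
  "smooth_on S f \<Longrightarrow> open S \<Longrightarrow> x \<in> S \<Longrightarrow> (f has_derivative fder f x) (at x)"
  using smooth_on_differentiable has_fder by blast

lemma smooth_on_fder: "smooth_on S f \<Longrightarrow> smooth_on S (\<lambda>x. fder f x v)"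
  unfolding smooth_on_def using Ck_on.simps(2) by blast

lemma smooth_on_bounded_linear:
  "bounded_linear L \<Longrightarrow> open S \<Longrightarrow> smooth_on S f \<Longrightarrow> smooth_on S (\<lambda>x. L (f x))"
  unfolding smooth_on_def using Ck_on_bounded_linear by blast

lemma smooth_on_add: "open S \<Longrightarrow> smooth_on S f \<Longrightarrow> smooth_on S g \<Longrightarrow> smooth_on S (\<lambda>x. f x + g x)"
  unfolding smooth_on_def using Ck_on_add by blast

lemma smooth_on_sum:
  "open S \<Longrightarrow> finite I \<Longrightarrow> (\<And>i. i \<in> I \<Longrightarrow> smooth_on S (f i)) \<Longrightarrow> smooth_on S (\<lambda>x. \<Sum>i\<in>I. f i x)"
  unfolding smooth_on_def by (simp add: Ck_on_sum)

lemma smooth_on_bilinear: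
  "bounded_bilinear B \<Longrightarrow> open S \<Longrightarrow> smooth_on S f \<Longrightarrow> smooth_on S g \<Longrightarrow> smooth_on S (\<lambda>x. B (f x) (g x))"
  unfolding smooth_on_def using Ck_on_bilinear by blast

lemmas smooth_on_scaleR = smooth_on_bilinear[OF bounded_bilinear_scaleR]
lemmas smooth_on_mult = smooth_on_bilinear[OF bounded_bilinear_mult]
lemmas smooth_on_inner = smooth_on_bilinear[OF bounded_bilinear_inner]

lemma smooth_on_compose:
  fixes f :: "'e::euclidean_space \<Rightarrow> 'b::real_normed_vector" and g :: "'d::euclidean_space \<Rightarrow> 'e"
  shows "smooth_on T f \<Longrightarrow> smooth_on S g \<Longrightarrow> open S \<Longrightarrow> open T \<Longrightarrow> g ` S \<subseteq> T \<Longrightarrow> smooth_on S (\<lambda>x. f (g x))"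
  unfolding smooth_on_def using Ck_on_compose by blast

lemma smooth_on_id: "open S \<Longrightarrow> smooth_on S (\<lambda>x. x)"
proof -
  assume S: "open S"
  have "Ck_on k S (\<lambda>x. x)" for k
  proof (cases k)
    case (Suc j)
    have "fder (\<lambda>x. x) x = (\<lambda>v. v)" for x :: 'a by (rule fder_eq) simp
    then show ?thesis using S Suc by (simp add: Ck_on_Suc_open Ck_on_const del: Ck_on.simps)
  qed simp
  then show ?thesis by (simp add: smooth_on_def)
qed

lemma smooth_on_linear: "bounded_linear L \<Longrightarrow> open S \<Longrightarrow> smooth_on S L"
  using smooth_on_bounded_linear[OF _ _ smooth_on_id] by blast

lemma smooth_on_diff: "open S \<Longrightarrow> smooth_on S f \<Longrightarrow> smooth_on S g \<Longrightarrow> smooth_on S (\<lambda>x. f x - g x)"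
  using smooth_on_add[of S f "\<lambda>x. - g x"] smooth_on_bounded_linear[of uminus S g]
  by (simp add: bounded_linear_minus[OF bounded_linear_ident])

lemma smooth_on_componentwise:
  fixes f :: "'e::euclidean_space \<Rightarrow> 'b::euclidean_space"
  assumes "open S" "\<And>b. b \<in> Basis \<Longrightarrow> smooth_on S (\<lambda>x. f x \<bullet> b)"
  shows "smooth_on S f"
proof (rule smooth_on_cong[OF assms(1)])
  show "smooth_on S (\<lambda>x. \<Sum>b\<in>Basis. (f x \<bullet> b) *\<^sub>R b)"
    by (intro smooth_on_sum smooth_on_scaleR smooth_on_const assms finite_Basis)
qed (simp add: euclidean_representation)

lemma smooth_on_vec:
  fixes f :: "'e::euclidean_space \<Rightarrow> 'b::euclidean_space ^ 'n"
  assumes "open S" "\<And>i. smooth_on S (\<lambda>x. f x $ i)"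
  shows "smooth_on S f"
proof (rule smooth_on_componentwise[OF assms(1)])
  fix b :: "'b ^ 'n" assume "b \<in> Basis"
  then obtain i u where b: "b = axis i u" by (auto simp: Basis_vec_def)
  show "smooth_on S (\<lambda>x. f x \<bullet> b)"
    by (simp add: b inner_axis) (intro smooth_on_inner smooth_on_const assms)
qed

lemma smooth_on_vec_nth: "open S \<Longrightarrow> smooth_on S f \<Longrightarrow> smooth_on S (\<lambda>x. f x $ i)"
  using smooth_on_bounded_linear[OF bounded_linear_vec_nth] by blast

lemma smooth_on_fst: "open S \<Longrightarrow> smooth_on S f \<Longrightarrow> smooth_on S (\<lambda>x. fst (f x))"
  using smooth_on_bounded_linear[OF bounded_linear_fst] by blast

lemma smooth_on_snd: "open S \<Longrightarrow> smooth_on S f \<Longrightarrow> smooth_on S (\<lambda>x. snd (f x))"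
  using smooth_on_bounded_linear[OF bounded_linear_snd] by blast

lemma smooth_on_Pair:
  fixes f :: "'e::euclidean_space \<Rightarrow> 'b::euclidean_space" and g :: "'e::euclidean_space \<Rightarrow> 'c::euclidean_space"
  assumes "open S" "smooth_on S f" "smooth_on S g"
  shows "smooth_on S (\<lambda>x. (f x, g x))"
proof (rule smooth_on_componentwise[OF assms(1)])
  fix b :: "'b \<times> 'c" assume "b \<in> Basis"
  show "smooth_on S (\<lambda>x. (f x, g x) \<bullet> b)"
    by (simp add: inner_prod_def) (intro smooth_on_add smooth_on_inner smooth_on_const assms)
qed

lemma smooth_on_prod:
  fixes f :: "'i \<Rightarrow> 'e::euclidean_space \<Rightarrow> real"
  assumes "open S" "finite I" "\<And>i. i \<in> I \<Longrightarrow> smooth_on S (f i)"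
  shows "smooth_on S (\<lambda>x. \<Prod>i\<in>I. f i x)"
  using assms(2,3) by (induction I rule: finite_induct) (simp_all add: smooth_on_const smooth_on_mult assms(1))

text \<open>The derivative of the inverse is a product of inverses and a constant, so every order
  reduces to the previous one.\<close>

lemma smooth_on_inverse_real: "smooth_on {x::real. x \<noteq> 0} inverse"
proof -
  have S: "open {x::real. x \<noteq> 0}" by (simp add: open_Collect_neq)
  have "Ck_on k {x::real. x \<noteq> 0} inverse" for k
  proof (induction k)
    case 0
    show ?case by (auto intro!: continuous_intros)
  next
    case (Suc k)
    have h: "(inverse has_derivative (\<lambda>v. - (inverse x * v * inverse x))) (at x)" if "x \<noteq> 0" for x :: real
      using has_derivative_inverse'[OF that] .
    have "Ck_on k {x::real. x \<noteq> 0} (\<lambda>x. fder inverse x v)" for v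
    proof (rule Ck_on_cong[OF S])
      show "Ck_on k {x::real. x \<noteq> 0} (\<lambda>x. - (inverse x * v * inverse x))"
        by (intro Ck_on_bounded_linear[OF bounded_linear_minus[OF bounded_linear_ident]]
            Ck_on_bilinear[OF bounded_bilinear_mult] Ck_on_const S Suc)
    qed (use fder_eq[OF h] in auto)
    then show ?case using h by (auto simp: Ck_on_Suc_open[OF S] differentiable_def simp del: Ck_on.simps)
  qed
  then show ?thesis by (simp add: smooth_on_def)
qed

section \<open>Determinants and inverses of smooth matrix functions\<close>

lemma smooth_on_det:
  fixes M :: "'e::euclidean_space \<Rightarrow> real^'n^'n"
  assumes "open S" "smooth_on S M"
  shows "smooth_on S (\<lambda>x. det (M x))"
  unfolding det_def
  by (intro smooth_on_sum smooth_on_mult smooth_on_prod smooth_on_const smooth_on_vec_nth assms finite finite_permutations)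

lemma smooth_on_matrix_vector_mult:
  fixes M :: "'e::euclidean_space \<Rightarrow> real^'n^'m"
  assumes "open S" "smooth_on S M" "smooth_on S f"
  shows "smooth_on S (\<lambda>x. M x *v f x)"
  unfolding matrix_vector_mult_def
  by (rule smooth_on_vec) (auto intro!: smooth_on_sum smooth_on_mult smooth_on_vec_nth assms)

lemma matrix_inv_inverse:
  fixes A :: "real^'n^'n"
  assumes "invertible A"
  shows matrix_inv_right: "A ** matrix_inv A = mat 1" and matrix_inv_left: "matrix_inv A ** A = mat 1"
proof -
  have "A ** matrix_inv A = mat 1 \<and> matrix_inv A ** A = mat 1"
    using assms unfolding invertible_def matrix_inv_def by (rule someI_ex)
  then show "A ** matrix_inv A = mat 1" "matrix_inv A ** A = mat 1" by auto
qed

text \<open>By Cramer's rule each entry of the inverse is a quotient of determinants, hence of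
  polynomials in the entries.\<close>

lemma smooth_on_matrix_inv:
  fixes M :: "'e::euclidean_space \<Rightarrow> real^'n^'n"
  assumes S: "open S" and M: "smooth_on S M" and inv: "\<And>x. x \<in> S \<Longrightarrow> invertible (M x)"
  shows "smooth_on S (\<lambda>x. matrix_inv (M x))"
proof (intro smooth_on_vec S)
  fix i j
  \<comment> \<open>Column \<open>i\<close> of \<open>M x\<close> is replaced by the
    \<open>j\<close>-th unit vector: the numerator of Cramer's rule for entry \<open>(i, j)\<close>
    of the inverse.\<close>
  let ?N = "\<lambda>x. (\<chi> k l. if l = i then (axis j 1 :: real^'n) $ k else M x $ k $ l) :: real^'n^'n"
  have eq: "det (?N x) * inverse (det (M x)) = matrix_inv (M x) $ i $ j" if "x \<in> S" for x
  proof -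
    have d: "det (M x) \<noteq> 0" using inv[OF that] by (simp add: invertible_det_nz)
    have "M x *v (matrix_inv (M x) *v axis j 1) = axis j 1"
      using inv[OF that] by (simp add: matrix_vector_mul_assoc matrix_inv_right)
    then have "matrix_inv (M x) *v axis j 1 = (\<chi> k. det (\<chi> a b. if b = k then (axis j 1 :: real^'n) $ a else M x $ a $ b) / det (M x))"
      using cramer[OF d] by blast
    then have "(matrix_inv (M x) *v axis j 1) $ i = det (?N x) / det (M x)" by simp
    then show ?thesis by (simp add: matrix_vector_mult_basis column_def divide_inverse)
  qed
  have N: "smooth_on S ?N"
  proof (intro smooth_on_vec S)
    show "smooth_on S (\<lambda>x. ?N x $ k $ l)" for k l
      by (cases "l = i") (simp_all add: smooth_on_const S smooth_on_vec_nth M)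
  qed
  show "smooth_on S (\<lambda>x. matrix_inv (M x) $ i $ j)"
  proof (rule smooth_on_cong[OF S eq])
    show "smooth_on S (\<lambda>x. det (?N x) * inverse (det (M x)))"
    proof (intro smooth_on_mult smooth_on_det S N)
      show "smooth_on S (\<lambda>x. inverse (det (M x)))"
        by (rule smooth_on_compose[OF smooth_on_inverse_real smooth_on_det[OF S M] S])
           (use inv in \<open>auto simp: invertible_det_nz open_Collect_neq\<close>)
    qed
  qed
qed

section \<open>Symmetry of second derivatives\<close>

lemma second_difference:
  fixes f :: "'e::euclidean_space \<Rightarrow> real"
  assumes f: "smooth_on S f" and S: "open S"
    and h: "0 < h" and r: "ball x r \<subseteq> S" "h * (norm u + norm v) < r"
  shows "\<exists>y. dist x y \<le> h * (norm u + norm v) \<and>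
    f (x + h *\<^sub>R u + h *\<^sub>R v) - f (x + h *\<^sub>R u) - f (x + h *\<^sub>R v) + f x = h\<^sup>2 * fder (\<lambda>y. fder f y u) y v"
proof -
  have le: "norm (s *\<^sub>R u + t *\<^sub>R v) \<le> h * (norm u + norm v)" if "0 \<le> s" "s \<le> h" "0 \<le> t" "t \<le> h" for s t
  proof -
    have "norm (s *\<^sub>R u + t *\<^sub>R v) \<le> s * norm u + t * norm v"
      using that norm_triangle_ineq[of "s *\<^sub>R u" "t *\<^sub>R v"] by simp
    also have "\<dots> \<le> h * norm u + h * norm v"
      using that by (intro add_mono mult_right_mono) auto
    finally show ?thesis by (simp add: distrib_left)
  qed
  have inS: "x + s *\<^sub>R u + t *\<^sub>R v \<in> S" if "0 \<le> s" "s \<le> h" "0 \<le> t" "t \<le> h" for s t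
  proof -
    have "dist x (x + s *\<^sub>R u + t *\<^sub>R v) = norm (s *\<^sub>R u + t *\<^sub>R v)" using norm_minus_cancel[of "s *\<^sub>R u + t *\<^sub>R v"] by (simp add: dist_norm add.assoc)
    then show ?thesis using le[OF that] r by (auto simp: subset_iff)
  qed
  have d1: "((\<lambda>s. f (x + s *\<^sub>R u + t *\<^sub>R v)) has_derivative (\<lambda>a. a * fder f (x + s *\<^sub>R u + t *\<^sub>R v) u)) (at s within A)"
    if "0 \<le> s" "s \<le> h" "0 \<le> t" "t \<le> h" for s t A
  proof -
    have "((\<lambda>s. f (x + s *\<^sub>R u + t *\<^sub>R v)) has_derivative (\<lambda>a. fder f (x + s *\<^sub>R u + t *\<^sub>R v) (a *\<^sub>R u))) (at s within A)"
      by (rule has_derivative_compose[where f="\<lambda>s. x + s *\<^sub>R u + t *\<^sub>R v" and f'="\<lambda>a. a *\<^sub>R u",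
            OF _ smooth_on_has_derivative[OF f S inS[OF that]]])
         (auto intro!: derivative_eq_intros)
    then show ?thesis
      using linear_cmul[OF linear_fder[OF smooth_on_differentiable[OF f S inS[OF that]]]] by simp
  qed
  have d2: "((\<lambda>t. fder f (x + s *\<^sub>R u + t *\<^sub>R v) u) has_derivative
      (\<lambda>a. a * fder (\<lambda>y. fder f y u) (x + s *\<^sub>R u + t *\<^sub>R v) v)) (at t within A)"
    if "0 \<le> s" "s \<le> h" "0 \<le> t" "t \<le> h" for s t A
  proof -
    note D = smooth_on_fder[OF f, of u]
    have "((\<lambda>t. fder f (x + s *\<^sub>R u + t *\<^sub>R v) u) has_derivative (\<lambda>a. fder (\<lambda>y. fder f y u) (x + s *\<^sub>R u + t *\<^sub>R v) (a *\<^sub>R v))) (at t within A)"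
      by (rule has_derivative_compose[where f="\<lambda>t. x + s *\<^sub>R u + t *\<^sub>R v" and f'="\<lambda>a. a *\<^sub>R v",
            OF _ smooth_on_has_derivative[OF D S inS[OF that]]])
         (auto intro!: derivative_eq_intros)
    then show ?thesis
      using linear_cmul[OF linear_fder[OF smooth_on_differentiable[OF D S inS[OF that]]]] by simp
  qed
  \<comment> \<open>The mean value theorem is applied twice: to this difference along
    \<open>u\<close>, and then to the \<open>u\<close>-derivative along \<open>v\<close>. The
    summand \<open>0 *\<^sub>R v\<close> is kept so that \<open>d1\<close> covers both
    terms.\<close>
  let ?\<phi> = "\<lambda>s. f (x + s *\<^sub>R u + h *\<^sub>R v) - f (x + s *\<^sub>R u + 0 *\<^sub>R v)"
  have "\<exists>s\<in>{0..h}. ?\<phi> h - ?\<phi> 0 = (h - 0) * fder f (x + s *\<^sub>R u + h *\<^sub>R v) u - (h - 0) * fder f (x + s *\<^sub>R u + 0 *\<^sub>R v) u"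
    by (rule mvt_very_simple) (use h in \<open>auto intro!: has_derivative_diff d1 simp del: scaleR_zero_left\<close>)
  then obtain s where s: "0 \<le> s" "s \<le> h" and
    e1: "?\<phi> h - ?\<phi> 0 = h * (fder f (x + s *\<^sub>R u + h *\<^sub>R v) u - fder f (x + s *\<^sub>R u + 0 *\<^sub>R v) u)"
    by (auto simp: right_diff_distrib)
  have "\<exists>t\<in>{0..h}. fder f (x + s *\<^sub>R u + h *\<^sub>R v) u - fder f (x + s *\<^sub>R u + 0 *\<^sub>R v) u
      = (h - 0) * fder (\<lambda>y. fder f y u) (x + s *\<^sub>R u + t *\<^sub>R v) v"
    by (rule mvt_very_simple) (use h s in \<open>auto intro!: d2\<close>)
  then obtain t where t: "0 \<le> t" "t \<le> h" and
    e2: "fder f (x + s *\<^sub>R u + h *\<^sub>R v) u - fder f (x + s *\<^sub>R u + 0 *\<^sub>R v) u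
      = h * fder (\<lambda>y. fder f y u) (x + s *\<^sub>R u + t *\<^sub>R v) v" by auto
  have "dist x (x + s *\<^sub>R u + t *\<^sub>R v) \<le> h * (norm u + norm v)"
    using le[OF s t] norm_minus_cancel[of "s *\<^sub>R u + t *\<^sub>R v"] by (simp add: dist_norm add.assoc)
  moreover have "?\<phi> h - ?\<phi> 0 = h\<^sup>2 * fder (\<lambda>y. fder f y u) (x + s *\<^sub>R u + t *\<^sub>R v) v"
    using e1 e2 by (simp add: power2_eq_square)
  ultimately show ?thesis by (intro exI[of _ "x + s *\<^sub>R u + t *\<^sub>R v"]) simp
qed

text \<open>The second difference is symmetric in \<open>u\<close> and \<open>v\<close>, so both
  mixed derivatives take a common value at points arbitrarily near \<open>x\<close>. If they
  differed at \<open>x\<close>, continuity would keep these values apart.\<close>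

lemma fder_fder_symmetric_real:
  fixes f :: "'e::euclidean_space \<Rightarrow> real"
  assumes f: "smooth_on S f" and S: "open S" and x: "x \<in> S"
  shows "fder (\<lambda>y. fder f y u) x v = fder (\<lambda>y. fder f y v) x u"
proof (rule ccontr)
  let ?A = "\<lambda>y. fder (\<lambda>y. fder f y u) y v" and ?B = "\<lambda>y. fder (\<lambda>y. fder f y v) y u"
  assume ne: "?A x \<noteq> ?B x"
  define e where "e = dist (?A x) (?B x) / 2"
  have e: "e > 0" using ne by (simp add: e_def)
  have cont: "continuous_on S ?A" "continuous_on S ?B"
    using smooth_on_fder smooth_on_imp_continuous_on f by blast+
  obtain r where r: "r > 0" "ball x r \<subseteq> S" using S x openE by blast
  obtain d1 where d1: "d1 > 0" "\<And>y. y \<in> S \<Longrightarrow> dist y x < d1 \<Longrightarrow> dist (?A y) (?A x) < e"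
    using cont(1) x e unfolding continuous_on_iff by metis
  obtain d2 where d2: "d2 > 0" "\<And>y. y \<in> S \<Longrightarrow> dist y x < d2 \<Longrightarrow> dist (?B y) (?B x) < e"
    using cont(2) x e unfolding continuous_on_iff by metis
  define m where "m = min r (min d1 d2)"
  \<comment> \<open>The parallelogram spanned by \<open>h u\<close> and \<open>h v\<close> must stay
    in the ball of radius \<open>m\<close>; the summand 1 avoids division by zero when
    \<open>u = v = 0\<close>.\<close>
  define h where "h = m / (norm u + norm v + 1)"
  have m: "m > 0" using r d1 d2 by (simp add: m_def)
  have pos: "norm u + norm v + 1 > 0" by (simp add: add_nonneg_pos)
  have h: "h > 0" using m pos by (simp add: h_def)
  have "h * (norm u + norm v) < h * (norm u + norm v + 1)" using h by simp
  also have "\<dots> = m" using pos by (simp add: h_def)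
  finally have hm: "h * (norm u + norm v) < m" .
  then have hr: "h * (norm u + norm v) < r" "h * (norm v + norm u) < r" by (auto simp: m_def add.commute)
  obtain y where y: "dist x y \<le> h * (norm u + norm v)"
    "f (x + h *\<^sub>R u + h *\<^sub>R v) - f (x + h *\<^sub>R u) - f (x + h *\<^sub>R v) + f x = h\<^sup>2 * ?A y"
    using second_difference[OF f S h r(2) hr(1)] by blast
  obtain z where z: "dist x z \<le> h * (norm u + norm v)"
    "f (x + h *\<^sub>R v + h *\<^sub>R u) - f (x + h *\<^sub>R v) - f (x + h *\<^sub>R u) + f x = h\<^sup>2 * ?B z"
    using second_difference[OF f S h r(2) hr(2)] by (auto simp: add.commute)
  have "h\<^sup>2 * ?A y = h\<^sup>2 * ?B z" using y(2) z(2) by (simp add: algebra_simps)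
  then have AB: "?A y = ?B z" using h by simp
  have yz: "y \<in> S" "z \<in> S" "dist y x < d1" "dist z x < d2"
    using y(1) z(1) hm r(2) by (auto simp: m_def dist_commute subset_iff)
  have "dist (?A x) (?B x) \<le> dist (?A x) (?A y) + dist (?B z) (?B x)"
    using AB dist_triangle[of "?A x" "?B x" "?A y"] by simp
  also have "\<dots> < e + e" using d1(2)[OF yz(1,3)] d2(2)[OF yz(2,4)] by (simp add: dist_commute)
  finally show False by (simp add: e_def)
qed

lemma fder_inner:
  assumes "f differentiable at x"
  shows "fder (\<lambda>y. f y \<bullet> b) x v = fder f x v \<bullet> b"
  using fder_eq[OF bounded_linear.has_derivative[OF bounded_linear_inner_left has_fder[OF assms]], of b] by simp

text \<open>Needed with vector values for the transition maps: there it cancels the second-order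
  terms when forms are carried from one chart to another.\<close>

lemma fder_fder_symmetric:
  fixes f :: "'e::euclidean_space \<Rightarrow> 'b::euclidean_space"
  assumes f: "smooth_on S f" and S: "open S" and x: "x \<in> S"
  shows "fder (\<lambda>y. fder f y u) x v = fder (\<lambda>y. fder f y v) x u"
proof (rule euclidean_eqI)
  fix b :: 'b assume "b \<in> Basis"
  have sb: "smooth_on S (\<lambda>y. f y \<bullet> b)" by (intro smooth_on_inner smooth_on_const f S)
  have *: "fder (\<lambda>y. fder f y u) x v \<bullet> b = fder (\<lambda>y. fder (\<lambda>y. f y \<bullet> b) y u) x v" for u v
  proof -
    have d: "(\<lambda>y. fder f y u) differentiable at x" using smooth_on_differentiable[OF smooth_on_fder[OF f] S x] .
    have "fder (\<lambda>y. fder f y u) x v \<bullet> b = fder (\<lambda>y. fder f y u \<bullet> b) x v" using fder_inner[OF d] by simp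
    also have "\<dots> = fder (\<lambda>y. fder (\<lambda>y. f y \<bullet> b) y u) x v"
    proof (rule fun_cong[OF frechet_derivative_transform_within_open[OF _ S x]])
      show "(\<lambda>y. fder f y u \<bullet> b) differentiable at x"
        by (rule smooth_on_differentiable[OF _ S x]) (intro smooth_on_inner smooth_on_fder smooth_on_const f S)
    qed (use fder_inner smooth_on_differentiable[OF f S] in metis)
    finally show ?thesis .
  qed
  show "fder (\<lambda>y. fder f y u) x v \<bullet> b = fder (\<lambda>y. fder f y v) x u \<bullet> b"
    unfolding * by (rule fder_fder_symmetric_real[OF sb S x])
qed

section \<open>Charts, atlases and the manifold topology\<close>

lemma inv_ch_map: "is_chart c \<Longrightarrow> p \<in> dom_ch c \<Longrightarrow> inv_ch c (map_ch c p) = p"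
  by (simp add: inv_ch_def is_chart_def)

lemma map_inv_ch: "x \<in> img_ch c \<Longrightarrow> map_ch c (inv_ch c x) = x"
  by (simp add: inv_ch_def img_ch_def f_inv_into_f)

lemma inv_ch_dom: "x \<in> img_ch c \<Longrightarrow> inv_ch c x \<in> dom_ch c"
  by (simp add: inv_ch_def img_ch_def inv_into_into)

lemma pointsI: "c \<in> M \<Longrightarrow> p \<in> dom_ch c \<Longrightarrow> p \<in> points M"
  unfolding points_def by blast

lemma map_ch_img: "p \<in> dom_ch c \<Longrightarrow> map_ch c p \<in> img_ch c"
  by (simp add: img_ch_def)

lemma open_img_ch: "is_chart c \<Longrightarrow> open (img_ch c)"
  by (simp add: is_chart_def)

lemma is_chart_inj: "is_chart c \<Longrightarrow> p \<in> dom_ch c \<Longrightarrow> q \<in> dom_ch c \<Longrightarrow> map_ch c p = map_ch c q \<Longrightarrow> p = q"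
  by (metis inv_ch_map)

lemma overlap_iff:
  assumes "is_chart c"
  shows "x \<in> map_ch c ` (dom_ch c \<inter> D) \<longleftrightarrow> x \<in> img_ch c \<and> inv_ch c x \<in> D"
proof
  assume "x \<in> map_ch c ` (dom_ch c \<inter> D)"
  then show "x \<in> img_ch c \<and> inv_ch c x \<in> D" using inv_ch_map[OF assms] map_ch_img[of _ c] by auto
next
  assume "x \<in> img_ch c \<and> inv_ch c x \<in> D"
  then have "x = map_ch c (inv_ch c x)" "inv_ch c x \<in> dom_ch c \<inter> D" by (simp_all add: map_inv_ch inv_ch_dom)
  then show "x \<in> map_ch c ` (dom_ch c \<inter> D)" by (rule image_eqI)
qed

text \<open>One half of \<open>compatible\<close>, so that local arguments are made in one direction
  only and then mirrored.\<close>

definition smooth_transition :: "('a, 'e::euclidean_space) chart \<Rightarrow> ('a, 'e) chart \<Rightarrow> bool" where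
  "smooth_transition c d \<longleftrightarrow> open (map_ch c ` (dom_ch c \<inter> dom_ch d)) \<and>
     smooth_on (map_ch c ` (dom_ch c \<inter> dom_ch d)) (map_ch d \<circ> inv_ch c)"

lemma compatible_iff: "compatible c d \<longleftrightarrow> smooth_transition c d \<and> smooth_transition d c"
  by (auto simp: compatible_def smooth_transition_def Int_commute)

lemma compatible_sym: "compatible c d \<longleftrightarrow> compatible d c"
  by (auto simp: compatible_iff)

text \<open>Near a point of the overlap the change from \<open>c\<close> to \<open>d\<close> factors
  through an intermediate chart \<open>e\<close>. What has to be found is an open set on which this
  factorization is valid, since \<open>e\<close> need not cover the overlap.\<close>

lemma smooth_transition_local:
  assumes c: "is_chart c"
    and loc: "\<And>p. p \<in> dom_ch c \<inter> dom_ch d \<Longrightarrow>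
      \<exists>e. is_chart e \<and> p \<in> dom_ch e \<and> smooth_transition c e \<and> smooth_transition e d"
  shows "smooth_transition c d"
proof -
  let ?O = "map_ch c ` (dom_ch c \<inter> dom_ch d)"
  have ex: "\<exists>N. open N \<and> x \<in> N \<and> N \<subseteq> ?O \<and> smooth_on N (map_ch d \<circ> inv_ch c)" if "x \<in> ?O" for x
  proof -
    from that obtain p where p: "p \<in> dom_ch c" "p \<in> dom_ch d" "x = map_ch c p" by blast
    then obtain e where e: "is_chart e" "p \<in> dom_ch e" "smooth_transition c e" "smooth_transition e d"
      using loc by blast
    define O1 O2 where "O1 = map_ch c ` (dom_ch c \<inter> dom_ch e)" and "O2 = map_ch e ` (dom_ch e \<inter> dom_ch d)"
    have O: "open O1" "open O2" "smooth_on O1 (map_ch e \<circ> inv_ch c)" "smooth_on O2 (map_ch d \<circ> inv_ch e)"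
      using e by (auto simp: O1_def O2_def smooth_transition_def)
    \<comment> \<open>The coordinates whose points lie in \<open>e\<close> and whose image in
      \<open>e\<close> lies in the overlap with \<open>d\<close>; open because the first transition
      is continuous.\<close>
    define N where "N = O1 \<inter> (map_ch e \<circ> inv_ch c) -` O2"
    have N: "open N" unfolding N_def
      using O by (intro continuous_open_preimage smooth_on_imp_continuous_on)
    have xN: "x \<in> N" using p e by (auto simp: N_def O1_def O2_def inv_ch_map[OF c])
    have y: "inv_ch c y \<in> dom_ch c \<inter> dom_ch e \<inter> dom_ch d \<and> y \<in> img_ch c \<and> (map_ch e \<circ> inv_ch c) y \<in> O2" if "y \<in> N" for y
    proof -
      have 1: "y \<in> img_ch c" "inv_ch c y \<in> dom_ch c" "inv_ch c y \<in> dom_ch e"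
        using that overlap_iff[OF c] inv_ch_dom[of _ c] by (auto simp: N_def O1_def)
      have 2: "map_ch e (inv_ch c y) \<in> O2" using that by (simp add: N_def)
      then have "inv_ch e (map_ch e (inv_ch c y)) \<in> dom_ch d"
        unfolding O2_def using overlap_iff[OF e(1)] by blast
      then show ?thesis using 1 2 inv_ch_map[OF e(1)] by simp
    qed
    have "smooth_on N (map_ch d \<circ> inv_ch c)"
    proof (rule smooth_on_cong[OF N])
      show "smooth_on N (\<lambda>y. (map_ch d \<circ> inv_ch e) ((map_ch e \<circ> inv_ch c) y))"
        by (rule smooth_on_compose[OF O(4) smooth_on_subset[OF O(3) O(1) N] N O(2)]) (auto simp: N_def)
    qed (use y in \<open>auto simp: inv_ch_map[OF e(1)]\<close>)
    moreover have "N \<subseteq> ?O" using y overlap_iff[OF c] by auto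
    ultimately show ?thesis using N xN by blast
  qed
  have O: "open ?O" by (subst open_subopen) (metis ex)
  moreover have "smooth_on ?O (map_ch d \<circ> inv_ch c)"
    by (rule smooth_on_local[OF O]) (metis ex)
  ultimately show ?thesis by (simp add: smooth_transition_def)
qed

lemma compatible_local:
  assumes "is_chart c" "is_chart d"
    and "\<And>p. p \<in> dom_ch c \<inter> dom_ch d \<Longrightarrow> \<exists>e. is_chart e \<and> p \<in> dom_ch e \<and> compatible c e \<and> compatible e d"
  shows "compatible c d"
  unfolding compatible_iff
proof
  show "smooth_transition c d"
    by (rule smooth_transition_local[OF assms(1)]) (meson assms(3) compatible_iff)
  show "smooth_transition d c"
    by (rule smooth_transition_local[OF assms(2)]) (metis Int_commute assms(3) compatible_iff)
qed

section \<open>Maximal atlases\<close>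

definition is_atlas :: "('a, 'e::euclidean_space) atlas \<Rightarrow> bool" where
  "is_atlas A \<longleftrightarrow> (\<forall>c\<in>A. is_chart c \<and> (\<forall>d\<in>A. compatible c d))"

definition maximal_atlas :: "('a, 'e::euclidean_space) atlas \<Rightarrow> bool" where
  "maximal_atlas M \<longleftrightarrow> max_atlas M = M"

lemma atlas_subset_max: "is_atlas A \<Longrightarrow> A \<subseteq> max_atlas A"
  by (auto simp: is_atlas_def max_atlas_def points_def)

lemma points_max_atlas:
  assumes "is_atlas A"
  shows "points (max_atlas A) = points A"
proof
  show "points (max_atlas A) \<subseteq> points A"
    unfolding points_def[of "max_atlas A"] by (rule UN_least) (simp add: max_atlas_def)
  show "points A \<subseteq> points (max_atlas A)"
    unfolding points_def by (rule UN_mono[OF atlas_subset_max[OF assms]]) simp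
qed

lemma max_atlasD:
  assumes "c \<in> max_atlas A"
  shows "is_chart c" "dom_ch c \<subseteq> points A" "d \<in> A \<Longrightarrow> compatible c d"
  using assms by (simp_all add: max_atlas_def)

text \<open>Two charts compatible with the generating atlas are compatible with each other because,
  around each common point, the change of charts factors through a chart of that atlas.\<close>

lemma maximal_max_atlas:
  assumes A: "is_atlas A"
  shows "maximal_atlas (max_atlas A)"
proof -
  have "c \<in> max_atlas A" if c: "c \<in> max_atlas (max_atlas A)" for c
  proof -
    have "compatible c d" if "d \<in> A" for d
      using max_atlasD(3)[OF c, of d] atlas_subset_max[OF A] that by blast
    then show ?thesis
      using max_atlasD(1,2)[OF c] points_max_atlas[OF A] by (simp add: max_atlas_def[of A])
  qed
  moreover have "c \<in> max_atlas (max_atlas A)" if c: "c \<in> max_atlas A" for c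
  proof -
    have "compatible c d" if d: "d \<in> max_atlas A" for d
    proof (rule compatible_local[OF max_atlasD(1)[OF c] max_atlasD(1)[OF d]])
      fix p assume "p \<in> dom_ch c \<inter> dom_ch d"
      then obtain e where "e \<in> A" "p \<in> dom_ch e" using max_atlasD(2)[OF c] unfolding points_def by blast
      then show "\<exists>e. is_chart e \<and> p \<in> dom_ch e \<and> compatible c e \<and> compatible e d"
        using A max_atlasD(3)[OF c] max_atlasD(3)[OF d] compatible_sym is_atlas_def by blast
    qed
    then show ?thesis
      using max_atlasD(1,2)[OF c] points_max_atlas[OF A] by (simp add: max_atlas_def[of "max_atlas A"])
  qed
  ultimately show ?thesis unfolding maximal_atlas_def by blast
qed

lemma smooth_manifold_maximal: "smooth_manifold M \<Longrightarrow> maximal_atlas M"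
  by (simp add: smooth_manifold_def maximal_atlas_def)

lemma maximal_chart: "maximal_atlas M \<Longrightarrow> c \<in> M \<Longrightarrow> is_chart c"
  unfolding maximal_atlas_def max_atlas_def by auto

lemma maximal_compatible: "maximal_atlas M \<Longrightarrow> c \<in> M \<Longrightarrow> d \<in> M \<Longrightarrow> compatible c d"
  unfolding maximal_atlas_def max_atlas_def by auto

text \<open>Compatibility with one chart around each point suffices, since the charts of
  \<open>M\<close> are compatible with each other.\<close>

lemma maximal_memI:
  assumes M: "maximal_atlas M" and e: "is_chart e"
    and loc: "\<And>p. p \<in> dom_ch e \<Longrightarrow> \<exists>c\<in>M. p \<in> dom_ch c \<and> compatible e c"
  shows "e \<in> M"
proof -
  have "compatible e d" if d: "d \<in> M" for d
  proof (rule compatible_local[OF e maximal_chart[OF M d]])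
    fix p assume "p \<in> dom_ch e \<inter> dom_ch d"
    then obtain c where "c \<in> M" "p \<in> dom_ch c" "compatible e c" using loc by blast
    then show "\<exists>c. is_chart c \<and> p \<in> dom_ch c \<and> compatible e c \<and> compatible c d"
      using maximal_chart[OF M] maximal_compatible[OF M _ d] by blast
  qed
  moreover have "dom_ch e \<subseteq> points M" using loc by (auto simp: points_def)
  ultimately have "e \<in> max_atlas M" using e by (simp add: max_atlas_def)
  then show ?thesis using M by (simp add: maximal_atlas_def)
qed

text \<open>The source of new charts in what follows: a known chart is restricted to
  \<open>D\<close> and followed by a diffeomorphism \<open>\<phi>\<close> with inverse
  \<open>\<psi>\<close>. Restriction, translation, linear change and lowering an index with the
  metric are all of this kind.\<close>

lemma chart_change:
  assumes M: "maximal_atlas M" and c: "c \<in> M" and D: "D \<subseteq> dom_ch c"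
    and \<phi>: "open (map_ch c ` D)" "smooth_on (map_ch c ` D) \<phi>" "\<And>p. p \<in> D \<Longrightarrow> m p = \<phi> (map_ch c p)"
    and \<psi>: "open (m ` D)" "smooth_on (m ` D) \<psi>" "\<And>p. p \<in> D \<Longrightarrow> \<psi> (m p) = map_ch c p"
  shows "(D, m) \<in> M"
proof (rule maximal_memI[OF M])
  note cc = maximal_chart[OF M c]
  show ch: "is_chart (D, m)"
    unfolding is_chart_def img_ch_def using \<psi>(1,3) is_chart_inj[OF cc] D
    by (auto intro!: inj_onI) (metis subsetD)
  have e: "dom_ch c \<inter> D = D" "D \<inter> dom_ch c = D" using D by auto
  have i1: "inv_ch (D, m) (m p) = p" if "p \<in> D" for p using inv_ch_map[OF ch, of p] that by simp
  have i2: "inv_ch c (map_ch c p) = p" if "p \<in> D" for p using inv_ch_map[OF cc, of p] that D by auto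
  have "smooth_on (map_ch c ` D) (m \<circ> inv_ch c)"
    by (rule smooth_on_cong[OF \<phi>(1) _ \<phi>(2)]) (auto simp: i2 \<phi>(3))
  moreover have "smooth_on (m ` D) (map_ch c \<circ> inv_ch (D, m))"
    by (rule smooth_on_cong[OF \<psi>(1) _ \<psi>(2)]) (auto simp: i1 \<psi>(3))
  ultimately have "compatible (D, m) c"
    using \<phi>(1) \<psi>(1) by (simp add: compatible_iff smooth_transition_def e)
  then show "\<exists>c\<in>M. p \<in> dom_ch c \<and> compatible (D, m) c" if "p \<in> dom_ch (D, m)" for p
    using c D that by auto
qed

section \<open>Restricted charts and the cocycle rule for transitions\<close>

definition restrict_ch :: "('a, 'e) chart \<Rightarrow> 'e set \<Rightarrow> ('a, 'e) chart" where
  "restrict_ch c W = (dom_ch c \<inter> map_ch c -` W, map_ch c)"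

lemma dom_restrict_ch: "p \<in> dom_ch (restrict_ch c W) \<longleftrightarrow> p \<in> dom_ch c \<and> map_ch c p \<in> W"
  by (simp add: restrict_ch_def)

lemma map_restrict_ch: "map_ch (restrict_ch c W) = map_ch c"
  by (simp add: restrict_ch_def)

lemma img_restrict_ch: "img_ch (restrict_ch c W) = img_ch c \<inter> W"
  by (auto simp: restrict_ch_def img_ch_def)

lemma inv_restrict_ch:
  assumes "is_chart c" "x \<in> img_ch c" "x \<in> W"
  shows "inv_ch (restrict_ch c W) x = inv_ch c x"
proof -
  have "inj_on (map_ch c) (dom_ch (restrict_ch c W))"
    using is_chart_inj[OF assms(1)] by (auto simp: dom_restrict_ch intro!: inj_onI)
  then show ?thesis unfolding inv_ch_def map_restrict_ch
    by (rule inv_into_f_eq) (use assms in \<open>simp_all add: dom_restrict_ch map_inv_ch inv_ch_dom flip: inv_ch_def\<close>)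
qed

lemma restrict_ch_mem:
  assumes M: "maximal_atlas M" and c: "c \<in> M" and W: "open W"
  shows "restrict_ch c W \<in> M"
proof -
  have e: "map_ch c ` (dom_ch c \<inter> map_ch c -` W) = img_ch c \<inter> W" by (auto simp: img_ch_def)
  have o: "open (img_ch c \<inter> W)" using W open_img_ch[OF maximal_chart[OF M c]] by auto
  show ?thesis unfolding restrict_ch_def
    by (rule chart_change[OF M c, where \<phi>="\<lambda>x. x" and \<psi>="\<lambda>x. x"]) (use e o in \<open>auto intro: smooth_on_id\<close>)
qed

lemma transition_open:
  "maximal_atlas M \<Longrightarrow> c \<in> M \<Longrightarrow> d \<in> M \<Longrightarrow> open (map_ch c ` (dom_ch c \<inter> dom_ch d))"
  using maximal_compatible compatible_def by blast

lemma transition_smooth: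
  "maximal_atlas M \<Longrightarrow> c \<in> M \<Longrightarrow> d \<in> M \<Longrightarrow> smooth_on (map_ch c ` (dom_ch c \<inter> dom_ch d)) (map_ch d \<circ> inv_ch c)"
  using maximal_compatible compatible_def by blast

lemma transition_differentiable:
  assumes "maximal_atlas M" "c \<in> M" "d \<in> M" "p \<in> dom_ch c" "p \<in> dom_ch d"
  shows "(map_ch d \<circ> inv_ch c) differentiable at (map_ch c p)"
  using smooth_on_differentiable[OF transition_smooth[OF assms(1-3)] transition_open[OF assms(1-3)]] assms by blast

lemma transition_has_derivative:
  assumes "maximal_atlas M" "c \<in> M" "d \<in> M" "p \<in> dom_ch c" "p \<in> dom_ch d"
  shows "((map_ch d \<circ> inv_ch c) has_derivative fder (map_ch d \<circ> inv_ch c) (map_ch c p)) (at (map_ch c p))"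
  using has_fder transition_differentiable[OF assms] by blast

lemma transition_cocycle:
  assumes M: "maximal_atlas M" and c: "c \<in> M" "p \<in> dom_ch c" and d: "d \<in> M" "p \<in> dom_ch d"
    and e: "e \<in> M" "p \<in> dom_ch e"
  shows "fder (map_ch e \<circ> inv_ch c) (map_ch c p) v
    = fder (map_ch e \<circ> inv_ch d) (map_ch d p) (fder (map_ch d \<circ> inv_ch c) (map_ch c p) v)"
proof -
  let ?O = "map_ch c ` (dom_ch c \<inter> dom_ch d)"
  have p: "(map_ch d \<circ> inv_ch c) (map_ch c p) = map_ch d p" using inv_ch_map[OF maximal_chart[OF M c(1)] c(2)] by simp
  have "(((map_ch e \<circ> inv_ch d) \<circ> (map_ch d \<circ> inv_ch c)) has_derivative
      (fder (map_ch e \<circ> inv_ch d) (map_ch d p) \<circ> fder (map_ch d \<circ> inv_ch c) (map_ch c p))) (at (map_ch c p))"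
    by (rule diff_chain_at) (use p transition_has_derivative[OF M] c d e in auto)
  then have "((map_ch e \<circ> inv_ch c) has_derivative
      (fder (map_ch e \<circ> inv_ch d) (map_ch d p) \<circ> fder (map_ch d \<circ> inv_ch c) (map_ch c p))) (at (map_ch c p))"
  proof (rule has_derivative_transform_within_open[OF _ transition_open[OF M c(1) d(1)]])
    show "map_ch c p \<in> ?O" using c d by blast
    show "((map_ch e \<circ> inv_ch d) \<circ> (map_ch d \<circ> inv_ch c)) x = (map_ch e \<circ> inv_ch c) x" if "x \<in> ?O" for x
      using that overlap_iff[OF maximal_chart[OF M c(1)], of x "dom_ch d"] inv_ch_map[OF maximal_chart[OF M d(1)]] by auto
  qed
  then show ?thesis using fder_eq by fastforce
qed

lemma transition_self:
  assumes M: "maximal_atlas M" and c: "c \<in> M" "p \<in> dom_ch c"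
  shows "fder (map_ch c \<circ> inv_ch c) (map_ch c p) v = v"
proof -
  have "((map_ch c \<circ> inv_ch c) has_derivative (\<lambda>v. v)) (at (map_ch c p))"
    by (rule has_derivative_transform_within_open[OF _ open_img_ch[OF maximal_chart[OF M c(1)]] map_ch_img[OF c(2)]])
       (auto simp: map_inv_ch)
  then show ?thesis using fder_eq by fastforce
qed

section \<open>The topology induced by a maximal atlas\<close>

lemma istopology_manifold:
  assumes M: "maximal_atlas M"
  shows "istopology (\<lambda>W. W \<subseteq> points M \<and> (\<forall>c\<in>M. open (map_ch c ` (W \<inter> dom_ch c))))"
  unfolding istopology_def
proof (intro conjI allI impI; (elim conjE)?)
  fix S T assume S: "S \<subseteq> points M" "\<forall>c\<in>M. open (map_ch c ` (S \<inter> dom_ch c))"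
    and T: "T \<subseteq> points M" "\<forall>c\<in>M. open (map_ch c ` (T \<inter> dom_ch c))"
  show "S \<inter> T \<subseteq> points M" using S by auto
  show "\<forall>c\<in>M. open (map_ch c ` (S \<inter> T \<inter> dom_ch c))"
  proof
    fix c assume c: "c \<in> M"
    \<comment> \<open>Images commute with intersections here only because the chart is
      injective.\<close>
    have "map_ch c ` (S \<inter> T \<inter> dom_ch c) = map_ch c ` (S \<inter> dom_ch c) \<inter> map_ch c ` (T \<inter> dom_ch c)"
      using is_chart_inj[OF maximal_chart[OF M c]] by blast
    then show "open (map_ch c ` (S \<inter> T \<inter> dom_ch c))" using S T c by auto
  qed
next
  fix K assume K: "\<forall>S\<in>K. S \<subseteq> points M \<and> (\<forall>c\<in>M. open (map_ch c ` (S \<inter> dom_ch c)))"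
  then show "\<Union>K \<subseteq> points M" by auto
  show "\<forall>c\<in>M. open (map_ch c ` (\<Union>K \<inter> dom_ch c))"
  proof
    fix c assume c: "c \<in> M"
    have "map_ch c ` (\<Union>K \<inter> dom_ch c) = (\<Union>S\<in>K. map_ch c ` (S \<inter> dom_ch c))" by auto
    moreover have "open (\<Union>S\<in>K. map_ch c ` (S \<inter> dom_ch c))" using K c by (intro open_UN) blast
    ultimately show "open (map_ch c ` (\<Union>K \<inter> dom_ch c))" by simp
  qed
qed

lemma openin_manifold:
  "maximal_atlas M \<Longrightarrow> openin (manifold_topology M) W \<longleftrightarrow>
     W \<subseteq> points M \<and> (\<forall>c\<in>M. open (map_ch c ` (W \<inter> dom_ch c)))"
  unfolding manifold_topology_def by (simp only: topology_inverse'[OF istopology_manifold])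

lemma openin_dom_ch:
  assumes M: "maximal_atlas M" and c: "c \<in> M"
  shows "openin (manifold_topology M) (dom_ch c)"
  unfolding openin_manifold[OF M]
proof (intro conjI ballI)
  show "dom_ch c \<subseteq> points M" unfolding points_def using c by blast
  show "open (map_ch d ` (dom_ch c \<inter> dom_ch d))" if "d \<in> M" for d
    using transition_open[OF M that c] by (simp add: Int_commute)
qed

lemma openin_restrict_ch:
  assumes "maximal_atlas M" "c \<in> M" "open W"
  shows "openin (manifold_topology M) (dom_ch c \<inter> map_ch c -` W)"
  using openin_dom_ch[OF assms(1) restrict_ch_mem[OF assms]] by (simp add: restrict_ch_def)

lemma topspace_manifold:
  assumes M: "maximal_atlas M"
  shows "topspace (manifold_topology M) = points M"
proof
  show "topspace (manifold_topology M) \<subseteq> points M"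
    using openin_manifold[OF M] openin_topspace by blast
  show "points M \<subseteq> topspace (manifold_topology M)"
    unfolding points_def using openin_dom_ch[OF M] openin_subset by (intro UN_least) blast
qed

lemma openin_imp_open_image:
  assumes "maximal_atlas M" "openin (manifold_topology M) U" "c \<in> M"
  shows "open (map_ch c ` (U \<inter> dom_ch c))"
  using assms openin_manifold by blast

lemma openin_manifoldI:
  assumes M: "maximal_atlas M"
    and "\<And>p. p \<in> W \<Longrightarrow> \<exists>c V. c \<in> M \<and> open V \<and> p \<in> dom_ch c \<and> map_ch c p \<in> V \<and> dom_ch c \<inter> map_ch c -` V \<subseteq> W"
  shows "openin (manifold_topology M) W"
proof (subst openin_subopen, intro ballI)
  fix p assume "p \<in> W"
  then obtain c V where c: "c \<in> M" "open V" "p \<in> dom_ch c" "map_ch c p \<in> V" "dom_ch c \<inter> map_ch c -` V \<subseteq> W"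
    using assms(2) by blast
  then show "\<exists>T. openin (manifold_topology M) T \<and> p \<in> T \<and> T \<subseteq> W"
    using openin_restrict_ch[OF M c(1,2)] by (intro exI[of _ "dom_ch c \<inter> map_ch c -` V"]) auto
qed

lemma openin_manifoldE:
  assumes M: "maximal_atlas M" and W: "openin (manifold_topology M) W" "p \<in> W" and c: "c \<in> M" "p \<in> dom_ch c"
  obtains V where "open V" "map_ch c p \<in> V" "V \<subseteq> img_ch c" "\<And>x. x \<in> V \<Longrightarrow> inv_ch c x \<in> W \<inter> dom_ch c"
proof (rule that[of "map_ch c ` (W \<inter> dom_ch c)"])
  show "open (map_ch c ` (W \<inter> dom_ch c))" using openin_imp_open_image[OF M W(1) c(1)] .
qed (use W c inv_ch_map[OF maximal_chart[OF M c(1)]] in \<open>auto simp: img_ch_def\<close>)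

text \<open>A countable base arises by pulling a countable base of the model space back through
  countably many charts that cover the manifold.\<close>

lemma second_countable_manifoldI:
  fixes M :: "('a, 'e::euclidean_space) atlas"
  assumes M: "maximal_atlas M" and C: "countable C" "C \<subseteq> M" "points M \<subseteq> (\<Union>c\<in>C. dom_ch c)"
  shows "second_countable (manifold_topology M)"
proof -
  obtain B :: "'e set set" where B: "countable B" "topological_basis B" using ex_countable_basis by blast
  let ?B = "(\<lambda>(c, V). dom_ch c \<inter> map_ch c -` V) ` (C \<times> B)"
  show ?thesis unfolding second_countable_def
  proof (intro exI[of _ ?B] conjI allI impI ballI)
    show "countable ?B" using B C by auto
    show "openin (manifold_topology M) V" if "V \<in> ?B" for V
      using that C B topological_basis_open openin_restrict_ch[OF M] by fastforce
    fix U p assume U: "openin (manifold_topology M) U \<and> p \<in> U"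
    then have "p \<in> points M" using openin_subset topspace_manifold[OF M] by blast
    then obtain c where c: "c \<in> C" "p \<in> dom_ch c" using C by blast
    have "open (map_ch c ` (U \<inter> dom_ch c))" using U c C openin_imp_open_image[OF M] by blast
    then obtain V where V: "V \<in> B" "map_ch c p \<in> V" "V \<subseteq> map_ch c ` (U \<inter> dom_ch c)"
      using topological_basisE[OF B(2), of "map_ch c ` (U \<inter> dom_ch c)" "map_ch c p"] U c by blast
    have "dom_ch c \<inter> map_ch c -` V \<subseteq> U"
      using V is_chart_inj[OF maximal_chart[OF M], of c] c C by blast
    moreover have "dom_ch c \<inter> map_ch c -` V \<in> ?B" using c V by (intro image_eqI[of _ _ "(c, V)"]) auto
    ultimately show "\<exists>V\<in>?B. p \<in> V \<and> V \<subseteq> U"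
      using c V by (intro bexI[where x = "dom_ch c \<inter> map_ch c -` V"]) simp_all
  qed
qed

text \<open>Second countable spaces are Lindelof. This extracts countably many adapted charts, both
  for second countability of the quotient and for the uniqueness of the Riemannian measure.\<close>

lemma countable_subcover:
  assumes M: "smooth_manifold M" and C: "C \<subseteq> M" "points M \<subseteq> (\<Union>c\<in>C. dom_ch c)"
  obtains D where "countable D" "D \<subseteq> C" "(\<Union>c\<in>D. dom_ch c) = points M"
proof -
  have max: "maximal_atlas M" using M smooth_manifold_maximal by blast
  have "Lindelof_space (manifold_topology M)"
    using M second_countable_imp_Lindelof_space by (auto simp: smooth_manifold_def)
  moreover have "\<forall>U\<in>dom_ch ` C. openin (manifold_topology M) U" using C openin_dom_ch[OF max] by auto
  moreover have "\<Union>(dom_ch ` C) = points M" using C by (auto simp: points_def)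
  ultimately obtain V where V: "countable V" "V \<subseteq> dom_ch ` C" "\<Union>V = points M"
    unfolding Lindelof_space_def topspace_manifold[OF max] by meson
  obtain D where "D \<subseteq> C" "countable D" "V = dom_ch ` D"
    using V(1,2) countable_subset_image by metis
  then show ?thesis using that[of D] V(3) by simp
qed

section \<open>Tangent spaces, differentials and tensors in coordinates\<close>

context
  fixes M :: "('a, 'e::euclidean_space) atlas"
  assumes M: "maximal_atlas M"
begin

lemma tangent_space_change:
  "v \<in> tangent_space M p \<Longrightarrow> c \<in> M \<Longrightarrow> p \<in> dom_ch c \<Longrightarrow> d \<in> M \<Longrightarrow> p \<in> dom_ch d \<Longrightarrow>
     v d = fder (map_ch d \<circ> inv_ch c) (map_ch c p) (v c)"
  unfolding tangent_space_def by blast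

lemma tangent_space_other: "v \<in> tangent_space M p \<Longrightarrow> \<not> (c \<in> M \<and> p \<in> dom_ch c) \<Longrightarrow> v c = 0"
  unfolding tangent_space_def by blast

lemma tangent_spaceI:
  assumes "\<And>c. \<not> (c \<in> M \<and> p \<in> dom_ch c) \<Longrightarrow> v c = 0"
    and "\<And>c d. c \<in> M \<Longrightarrow> p \<in> dom_ch c \<Longrightarrow> d \<in> M \<Longrightarrow> p \<in> dom_ch d \<Longrightarrow>
      v d = fder (map_ch d \<circ> inv_ch c) (map_ch c p) (v c)"
  shows "v \<in> tangent_space M p"
  unfolding tangent_space_def using assms by blast

lemma coord_vec_other:
  "d \<in> M \<Longrightarrow> p \<in> dom_ch d \<Longrightarrow> coord_vec M c p e d = fder (map_ch d \<circ> inv_ch c) (map_ch c p) e"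
  by (simp add: coord_vec_def)

lemma coord_vec_self: "c \<in> M \<Longrightarrow> p \<in> dom_ch c \<Longrightarrow> coord_vec M c p e c = e"
  using transition_self[OF M] by (simp add: coord_vec_def)

lemma coord_vec_tangent:
  assumes "c \<in> M" "p \<in> dom_ch c"
  shows "coord_vec M c p e \<in> tangent_space M p"
proof (rule tangent_spaceI)
  fix d d' assume "d \<in> M" "p \<in> dom_ch d" "d' \<in> M" "p \<in> dom_ch d'"
  then show "coord_vec M c p e d' = fder (map_ch d' \<circ> inv_ch d) (map_ch d p) (coord_vec M c p e d)"
    using transition_cocycle[OF M assms, of d d'] by (simp add: coord_vec_other)
qed (auto simp: coord_vec_def)

lemma tangent_eq_coord_vec:
  assumes "v \<in> tangent_space M p" "c \<in> M" "p \<in> dom_ch c"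
  shows "coord_vec M c p (v c) = v"
proof
  fix d
  show "coord_vec M c p (v c) d = v d"
  proof (cases "d \<in> M \<and> p \<in> dom_ch d")
    case True
    then show ?thesis using tangent_space_change[OF assms, of d] by (simp add: coord_vec_def)
  next
    case False
    then show ?thesis unfolding coord_vec_def using tangent_space_other[OF assms(1) False] by presburger
  qed
qed

lemma tangent_eqI:
  "u \<in> tangent_space M p \<Longrightarrow> v \<in> tangent_space M p \<Longrightarrow> c \<in> M \<Longrightarrow> p \<in> dom_ch c \<Longrightarrow> u c = v c \<Longrightarrow> u = v"
  using tangent_eq_coord_vec by metis

lemma tangent_linear:
  assumes "c \<in> M" "d \<in> M" "p \<in> dom_ch c" "p \<in> dom_ch d"
  shows "linear (fder (map_ch d \<circ> inv_ch c) (map_ch c p))"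
  using linear_fder transition_differentiable[OF M assms] by blast

lemma tadd_tangent:
  assumes "u \<in> tangent_space M p" "v \<in> tangent_space M p"
  shows "tadd u v \<in> tangent_space M p"
proof (rule tangent_spaceI)
  fix c d assume "c \<in> M" "p \<in> dom_ch c" "d \<in> M" "p \<in> dom_ch d"
  then show "tadd u v d = fder (map_ch d \<circ> inv_ch c) (map_ch c p) (tadd u v c)"
    using assms[THEN tangent_space_change, of c d] by (simp add: tadd_def linear_add[OF tangent_linear])
qed (simp add: tadd_def assms[THEN tangent_space_other])

lemma tdiff_tangent:
  assumes "u \<in> tangent_space M p" "v \<in> tangent_space M p"
  shows "tdiff u v \<in> tangent_space M p"
proof (rule tangent_spaceI)
  fix c d assume "c \<in> M" "p \<in> dom_ch c" "d \<in> M" "p \<in> dom_ch d"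
  then show "tdiff u v d = fder (map_ch d \<circ> inv_ch c) (map_ch c p) (tdiff u v c)"
    using assms[THEN tangent_space_change, of c d] by (simp add: tdiff_def linear_diff[OF tangent_linear])
qed (simp add: tdiff_def assms[THEN tangent_space_other])

lemma tscale_tangent:
  assumes "u \<in> tangent_space M p"
  shows "tscale r u \<in> tangent_space M p"
proof (rule tangent_spaceI)
  fix c d assume "c \<in> M" "p \<in> dom_ch c" "d \<in> M" "p \<in> dom_ch d"
  then show "tscale r u d = fder (map_ch d \<circ> inv_ch c) (map_ch c p) (tscale r u c)"
    using assms[THEN tangent_space_change, of c d] by (simp add: tscale_def linear_cmul[OF tangent_linear])
qed (simp add: tscale_def assms[THEN tangent_space_other])

lemma tzero_tangent: "tzero \<in> tangent_space M p"
  by (rule tangent_spaceI) (simp_all add: tzero_def linear_0[OF tangent_linear])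

lemma tcomb_tangent:
  assumes "\<And>i. s i \<in> tangent_space M p"
  shows "tcomb r s \<in> tangent_space M p"
proof (rule tangent_spaceI)
  fix c d assume cd: "c \<in> M" "p \<in> dom_ch c" "d \<in> M" "p \<in> dom_ch d"
  have "s i d = fder (map_ch d \<circ> inv_ch c) (map_ch c p) (s i c)" for i
    using assms[THEN tangent_space_change, OF cd] .
  then show "tcomb r s d = fder (map_ch d \<circ> inv_ch c) (map_ch c p) (tcomb r s c)"
    using cd by (simp add: tcomb_def linear_sum[OF tangent_linear] linear_cmul[OF tangent_linear])
qed (simp add: tcomb_def assms[THEN tangent_space_other])

section \<open>Derivatives and differentials read in an arbitrary chart\<close>

lemma chart_at_mem:
  assumes "p \<in> points M"
  shows "chart_at M p \<in> M" "p \<in> dom_ch (chart_at M p)"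
proof -
  have "\<exists>c. c \<in> M \<and> p \<in> dom_ch c" using assms by (auto simp: points_def)
  then have "chart_at M p \<in> M \<and> p \<in> dom_ch (chart_at M p)" unfolding chart_at_def by (rule someI_ex)
  then show "chart_at M p \<in> M" "p \<in> dom_ch (chart_at M p)" by auto
qed

text \<open>\<open>fun_deriv\<close> and \<open>differential\<close> are computed in the chart that
  \<open>chart_at\<close> happens to pick. A formula \<open>F\<close> for \<open>f\<close> in a
  convenient chart is transported there by the chain rule.\<close>

lemma has_derivative_change_source:
  assumes c: "c \<in> M" "p \<in> dom_ch c" and c': "c' \<in> M" "p \<in> dom_ch c'"
    and W: "open W" "map_ch c p \<in> W" "\<And>x. x \<in> W \<Longrightarrow> x \<in> img_ch c \<Longrightarrow> f (inv_ch c x) = F x"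
    and F: "(F has_derivative F') (at (map_ch c p))"
  shows "((\<lambda>x. f (inv_ch c' x)) has_derivative (\<lambda>v. F' (fder (map_ch c \<circ> inv_ch c') (map_ch c' p) v))) (at (map_ch c' p))"
proof -
  let ?t = "map_ch c \<circ> inv_ch c'" and ?O = "map_ch c' ` (dom_ch c' \<inter> dom_ch c)"
  have tp: "?t (map_ch c' p) = map_ch c p" using inv_ch_map[OF maximal_chart[OF M c'(1)] c'(2)] by simp
  have "((F \<circ> ?t) has_derivative (F' \<circ> fder ?t (map_ch c' p))) (at (map_ch c' p))"
    by (rule diff_chain_at) (use tp transition_has_derivative[OF M] c c' F in auto)
  then have "((\<lambda>x. f (inv_ch c' x)) has_derivative (F' \<circ> fder ?t (map_ch c' p))) (at (map_ch c' p))"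
  proof (rule has_derivative_transform_within_open)
    show "open (?O \<inter> ?t -` W)"
      by (intro continuous_open_preimage W smooth_on_imp_continuous_on transition_open[OF M] transition_smooth[OF M] c c')
    show "map_ch c' p \<in> ?O \<inter> ?t -` W" using c c' tp W by auto
    show "(F \<circ> ?t) x = f (inv_ch c' x)" if "x \<in> ?O \<inter> ?t -` W" for x
    proof -
      have "inv_ch c' x \<in> dom_ch c" "map_ch c (inv_ch c' x) \<in> W"
        using that overlap_iff[OF maximal_chart[OF M c'(1)]] by auto
      then show ?thesis
        using W(3)[of "map_ch c (inv_ch c' x)"] map_ch_img[of _ c] inv_ch_map[OF maximal_chart[OF M c(1)]] by auto
    qed
  qed
  then show ?thesis by (simp add: o_def)
qed

lemma fun_deriv_eq:
  assumes c: "c \<in> M" "p \<in> dom_ch c"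
    and W: "open W" "map_ch c p \<in> W" "\<And>x. x \<in> W \<Longrightarrow> x \<in> img_ch c \<Longrightarrow> f (inv_ch c x) = F x"
    and F: "(F has_derivative F') (at (map_ch c p))" and v: "v \<in> tangent_space M p"
  shows "fun_deriv M p v f = F' (v c)"
proof -
  have p: "p \<in> points M" using c by (auto simp: points_def)
  show ?thesis
    using fder_eq[OF has_derivative_change_source[OF c chart_at_mem[OF p] W F]]
      tangent_space_change[OF v chart_at_mem[OF p] c]
    by (simp add: fun_deriv_def o_def Let_def)
qed

text \<open>Removes the choice of charts from the differential: a local expression in any one pair
  of charts determines it. Every differential below is computed through this lemma.\<close>

lemma differential_eq:
  fixes N :: "('b, 'f::euclidean_space) atlas"
  assumes N: "maximal_atlas N" and c: "c \<in> M" "p \<in> dom_ch c" and d: "d \<in> N"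
    and W: "open W" "map_ch c p \<in> W" "\<And>x. x \<in> W \<Longrightarrow> x \<in> img_ch c \<Longrightarrow> f (inv_ch c x) \<in> dom_ch d \<and> map_ch d (f (inv_ch c x)) = F x"
    and F: "(F has_derivative F') (at (map_ch c p))" and v: "v \<in> tangent_space M p"
  shows "differential M N f p v = coord_vec N d (f p) (F' (v c))"
proof
  fix d'
  let ?c' = "chart_at M p"
  have p: "p \<in> points M" using c by (auto simp: points_def)
  note c' = chart_at_mem[OF p]
  have inv: "inv_ch c (map_ch c p) = p" using inv_ch_map[OF maximal_chart[OF M c(1)] c(2)] .
  have fp: "f p \<in> dom_ch d" "map_ch d (f p) = F (map_ch c p)"
    using W(3)[OF W(2) map_ch_img[OF c(2)]] inv by auto
  show "differential M N f p v d' = coord_vec N d (f p) (F' (v c)) d'"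
  proof (cases "d' \<in> N \<and> f p \<in> dom_ch d'")
    case True
    let ?t = "map_ch d' \<circ> inv_ch d" and ?O = "map_ch d ` (dom_ch d \<inter> dom_ch d')"
    have "((?t \<circ> F) has_derivative (fder ?t (F (map_ch c p)) \<circ> F')) (at (map_ch c p))"
      using F transition_has_derivative[OF N d _ fp(1), of d'] True fp(2) by (intro diff_chain_at) simp_all
    then have "((\<lambda>x. (\<lambda>q. map_ch d' (f q)) (inv_ch ?c' x)) has_derivative
      (\<lambda>v. (fder ?t (F (map_ch c p)) \<circ> F') (fder (map_ch c \<circ> inv_ch ?c') (map_ch ?c' p) v))) (at (map_ch ?c' p))"
    proof (rule has_derivative_change_source[OF c c' W(1,2), rotated])
      show "map_ch d' (f (inv_ch c x)) = (?t \<circ> F) x" if "x \<in> W" "x \<in> img_ch c" for x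
        using W(3)[OF that] inv_ch_map[OF maximal_chart[OF N d]] by (metis comp_apply)
    qed
    then have "fder (map_ch d' \<circ> f \<circ> inv_ch ?c') (map_ch ?c' p) (v ?c') = fder ?t (F (map_ch c p)) (F' (v c))"
      using fder_eq tangent_space_change[OF v c' c] by (fastforce simp: o_def)
    then show ?thesis using True fp(2) by (simp add: differential_def coord_vec_def Let_def)
  qed (auto simp: differential_def coord_vec_def Let_def)
qed

section \<open>Coordinate representations of tensor fields\<close>

definition tensor_rep :: "('a, 'e) tensor2 \<Rightarrow> ('a, 'e) chart \<Rightarrow> ('e \<Rightarrow> 'e \<Rightarrow> 'e \<Rightarrow> real) \<Rightarrow> bool" where
  "tensor_rep T c B \<longleftrightarrow> (\<forall>p\<in>dom_ch c. \<forall>u\<in>tangent_space M p. \<forall>v\<in>tangent_space M p. T p u v = B (map_ch c p) (u c) (v c))"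

lemma tensor_repD:
  "tensor_rep T c B \<Longrightarrow> p \<in> dom_ch c \<Longrightarrow> u \<in> tangent_space M p \<Longrightarrow> v \<in> tangent_space M p \<Longrightarrow> T p u v = B (map_ch c p) (u c) (v c)"
  by (simp add: tensor_rep_def)

lemma tensor_rep_comp: "c \<in> M \<Longrightarrow> tensor_rep T c (tensor_comp M T c)"
  unfolding tensor_rep_def tensor_comp_def
  using inv_ch_map[OF maximal_chart[OF M]] tangent_eq_coord_vec by (simp add: Let_def)

lemma tensor_comp_eq:
  assumes c: "c \<in> M" "x \<in> img_ch c" and e: "e \<in> M" "inv_ch c x \<in> dom_ch e" and B: "tensor_rep T e B"
  shows "tensor_comp M T c x a b = B ((map_ch e \<circ> inv_ch c) x) (fder (map_ch e \<circ> inv_ch c) x a) (fder (map_ch e \<circ> inv_ch c) x b)"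
  using tensor_repD[OF B e(2) coord_vec_tangent coord_vec_tangent, of c c] inv_ch_dom[OF c(2)] c e
  by (simp add: tensor_comp_def Let_def coord_vec_other map_inv_ch)

lemma tensor_comp_rep:
  assumes e: "e \<in> M" and B: "tensor_rep T e B" and x: "x \<in> img_ch e"
  shows "tensor_comp M T e x a b = B x a b"
  using tensor_repD[OF B inv_ch_dom[OF x] coord_vec_tangent coord_vec_tangent, of e e] e x
  by (simp add: tensor_comp_def Let_def coord_vec_self inv_ch_dom map_inv_ch)

lemma bilinear_expand:
  fixes B :: "'e \<Rightarrow> 'e \<Rightarrow> real"
  assumes "bilinear B"
  shows "B u v = (\<Sum>i\<in>Basis. \<Sum>j\<in>Basis. (u \<bullet> i) * (v \<bullet> j) * B i j)"
proof -
  have "B u v = (\<Sum>i\<in>Basis. (u \<bullet> i) * B i v)"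
    using fder_basis_expand[of "\<lambda>u. B u v" u] assms by (simp add: bilinear_def)
  also have "\<dots> = (\<Sum>i\<in>Basis. (u \<bullet> i) * (\<Sum>j\<in>Basis. (v \<bullet> j) * B i j))"
    using fder_basis_expand[of "B _" v] assms by (simp add: bilinear_def)
  finally show ?thesis by (simp add: sum_distrib_left mult.assoc)
qed

definition smooth_rep :: "('a, 'e) chart \<Rightarrow> ('e \<Rightarrow> 'e \<Rightarrow> 'e \<Rightarrow> real) \<Rightarrow> bool" where
  "smooth_rep c B \<longleftrightarrow> (\<forall>x\<in>img_ch c. bilinear (B x)) \<and> (\<forall>a b. smooth_on (img_ch c) (\<lambda>x. B x a b))"

text \<open>The components in \<open>c\<close> are those in \<open>e\<close> composed with the
  transition and evaluated on transformed vectors. As these vectors vary with the point, smoothness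
  is read off from the expansion in a basis.\<close>

lemma tensor_comp_local:
  assumes c: "c \<in> M" and p: "p \<in> dom_ch c" and e: "e \<in> M" "p \<in> dom_ch e" and B: "tensor_rep T e B" "smooth_rep e B"
  shows "smooth_on (map_ch c ` (dom_ch c \<inter> dom_ch e)) (\<lambda>x. tensor_comp M T c x a b)"
    and "bilinear (tensor_comp M T c (map_ch c p))"
proof -
  let ?O = "map_ch c ` (dom_ch c \<inter> dom_ch e)" and ?t = "map_ch e \<circ> inv_ch c"
  note cc = maximal_chart[OF M c] and ce = maximal_chart[OF M e(1)]
  have O: "open ?O" using transition_open[OF M c e(1)] .
  have t: "smooth_on ?O ?t" using transition_smooth[OF M c e(1)] .
  have tO: "?t ` ?O \<subseteq> img_ch e" using inv_ch_map[OF cc] map_ch_img[of _ e] by auto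
  have bil: "bilinear (B (?t x))" if "x \<in> ?O" for x
    using that tO B(2) unfolding smooth_rep_def by blast
  have eq: "tensor_comp M T c x a b = B (?t x) (fder ?t x a) (fder ?t x b)" if "x \<in> ?O" for x a b
    using tensor_comp_eq[OF c _ e(1) _ B(1)] that overlap_iff[OF cc] by blast
  show "smooth_on ?O (\<lambda>x. tensor_comp M T c x a b)"
  proof (rule smooth_on_cong[OF O])
    show "smooth_on ?O (\<lambda>x. \<Sum>i\<in>Basis. \<Sum>j\<in>Basis. (fder ?t x a \<bullet> i) * (fder ?t x b \<bullet> j) * B (?t x) i j)"
    proof (intro smooth_on_sum O finite_Basis smooth_on_mult smooth_on_inner smooth_on_const smooth_on_fder t)
      show "smooth_on ?O (\<lambda>x. B (?t x) i j)" for i j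
        by (rule smooth_on_compose[OF _ t O open_img_ch[OF ce] tO]) (use B(2) in \<open>simp add: smooth_rep_def\<close>)
    qed
    show "(\<Sum>i\<in>Basis. \<Sum>j\<in>Basis. (fder ?t x a \<bullet> i) * (fder ?t x b \<bullet> j) * B (?t x) i j) = tensor_comp M T c x a b"
      if "x \<in> ?O" for x
      unfolding eq[OF that] by (rule bilinear_expand[OF bil[OF that], symmetric])
  qed
  have pO: "map_ch c p \<in> ?O" using p e by blast
  have l: "linear (fder ?t (map_ch c p))" using tangent_linear[OF c e(1) p e(2)] .
  have l1: "linear (\<lambda>v. B (?t (map_ch c p)) u v)" and l2: "linear (\<lambda>u. B (?t (map_ch c p)) u v)" for u v
    using bil[OF pO] by (simp_all add: bilinear_def)
  show "bilinear (tensor_comp M T c (map_ch c p))"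
    unfolding ext[OF ext[OF eq[OF pO]]] bilinear_def
    using linear_compose[OF l l1] linear_compose[OF l l2] by (simp add: o_def)
qed

text \<open>Being a tensor field is a condition on all charts; by the transformation law it suffices
  to know one smooth representation around each point.\<close>

lemma tensor2_fieldI:
  assumes nrm: "\<And>p u v. \<not> (p \<in> points M \<and> u \<in> tangent_space M p \<and> v \<in> tangent_space M p) \<Longrightarrow> T p u v = 0"
    and rep: "\<And>p. p \<in> points M \<Longrightarrow> \<exists>e B. e \<in> M \<and> p \<in> dom_ch e \<and> tensor_rep T e B \<and> smooth_rep e B"
  shows "tensor2_field M T"
  unfolding tensor2_field_def
proof (intro conjI allI impI ballI)
  fix c x assume c: "c \<in> M" and x: "x \<in> img_ch c"
  then obtain p where p: "p \<in> dom_ch c" "x = map_ch c p" by (auto simp: img_ch_def)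
  then obtain e B where "e \<in> M" "p \<in> dom_ch e" "tensor_rep T e B" "smooth_rep e B"
    using rep[OF pointsI[OF c p(1)]] by blast
  then show "bilinear (tensor_comp M T c x)" using tensor_comp_local(2)[OF c p(1)] p(2) by blast
next
  fix c a b assume c: "c \<in> M"
  show "smooth_on (img_ch c) (\<lambda>x. tensor_comp M T c x a b)"
  proof (rule smooth_on_local[OF open_img_ch[OF maximal_chart[OF M c]]])
    fix x assume "x \<in> img_ch c"
    then obtain p where p: "p \<in> dom_ch c" "x = map_ch c p" by (auto simp: img_ch_def)
    then obtain e B where e: "e \<in> M" "p \<in> dom_ch e" "tensor_rep T e B" "smooth_rep e B"
      using rep[OF pointsI[OF c p(1)]] by blast
    show "\<exists>T'. open T' \<and> x \<in> T' \<and> smooth_on T' (\<lambda>x. tensor_comp M T c x a b)"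
      using tensor_comp_local(1)[OF c p(1) e] transition_open[OF M c e(1)] p e by blast
  qed
qed (use nrm in auto)

lemma tensor2_field_rep:
  assumes T: "tensor2_field M T" and e: "e \<in> M"
  shows "tensor_rep T e (tensor_comp M T e)" "smooth_rep e (tensor_comp M T e)"
  using T e tensor_rep_comp by (auto simp: tensor2_field_def smooth_rep_def)

lemma tensor2_field_zero:
  "tensor2_field M T \<Longrightarrow> \<not> (p \<in> points M \<and> u \<in> tangent_space M p \<and> v \<in> tangent_space M p) \<Longrightarrow> T p u v = 0"
  unfolding tensor2_field_def by blast

text \<open>Naturality of the exterior derivative in coordinates. Differentiating the transformation
  law gives the pulled-back derivative of \<open>B\<close> and terms with second derivatives of the
  transition; in the cyclic sum the latter cancel, being symmetric in the directions while
  \<open>B\<close> is skew.\<close>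

lemma closed_two_formI:
  assumes T: "two_form M T"
    and rep: "\<And>p. p \<in> points M \<Longrightarrow> \<exists>e B. e \<in> M \<and> p \<in> dom_ch e \<and> tensor_rep T e B \<and> smooth_rep e B \<and>
       (\<forall>x\<in>img_ch e. \<forall>u v w. fder (\<lambda>y. B y v w) x u + fder (\<lambda>y. B y w u) x v + fder (\<lambda>y. B y u v) x w = 0)"
  shows "closed_two_form M T"
  unfolding closed_two_form_def
proof (intro conjI T ballI allI)
  fix c x u v w assume c: "c \<in> M" and x: "x \<in> img_ch c"
  then obtain p where p: "p \<in> dom_ch c" "x = map_ch c p" by (auto simp: img_ch_def)
  then obtain e B where e: "e \<in> M" "p \<in> dom_ch e" "tensor_rep T e B" "smooth_rep e B" and
    cl: "\<And>x u v w. x\<in>img_ch e \<Longrightarrow> fder (\<lambda>y. B y v w) x u + fder (\<lambda>y. B y w u) x v + fder (\<lambda>y. B y u v) x w = 0"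
    using rep[OF pointsI[OF c p(1)]] by blast
  let ?O = "map_ch c ` (dom_ch c \<inter> dom_ch e)" and ?t = "map_ch e \<circ> inv_ch c"
  note cc = maximal_chart[OF M c] and ce = maximal_chart[OF M e(1)]
  have O: "open ?O" "x \<in> ?O" using transition_open[OF M c e(1)] p e by auto
  have t: "smooth_on ?O ?t" using transition_smooth[OF M c e(1)] .
  have tO: "?t y \<in> img_ch e" if "y \<in> ?O" for y using that inv_ch_map[OF cc] map_ch_img[of _ e] by auto
  have bil: "bilinear (B (?t y))" if "y \<in> ?O" for y using that tO e(4) unfolding smooth_rep_def by blast
  \<comment> \<open>The derivative of \<open>B\<close> in its base point must be bilinear in the
    remaining arguments before it can be evaluated on the transformed vectors \<open>?D a\<close>
    and \<open>?D b\<close>.\<close>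
  have bil': "bilinear (\<lambda>a b. fder (\<lambda>y. B y a b) (?t x) z)" for z
  proof -
    have d: "(\<lambda>y. B y a b) differentiable at (?t x)" for a b
      using e(4) smooth_on_differentiable[OF _ open_img_ch[OF ce] tO[OF O(2)]] by (auto simp: smooth_rep_def)
    have add1: "fder (\<lambda>y. B y (a + a') b) (?t x) z = fder (\<lambda>y. B y a b) (?t x) z + fder (\<lambda>y. B y a' b) (?t x) z"
      and add2: "fder (\<lambda>y. B y b (a + a')) (?t x) z = fder (\<lambda>y. B y b a) (?t x) z + fder (\<lambda>y. B y b a') (?t x) z"
      and sc1: "fder (\<lambda>y. B y (r *\<^sub>R a) b) (?t x) z = r * fder (\<lambda>y. B y a b) (?t x) z"
      and sc2: "fder (\<lambda>y. B y b (r *\<^sub>R a)) (?t x) z = r * fder (\<lambda>y. B y b a) (?t x) z" for a a' b r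
    proof -
      have E: "B y (a + a') b = B y a b + B y a' b" "B y b (a + a') = B y b a + B y b a'"
        "B y (r *\<^sub>R a) b = r * B y a b" "B y b (r *\<^sub>R a) = r * B y b a" if "y \<in> img_ch e" for y
        using e(4) that by (simp_all add: smooth_rep_def bilinear_ladd bilinear_radd bilinear_lmul bilinear_rmul)
      have F: "fder f (?t x) z = L z" if "(g has_derivative L) (at (?t x))" "\<And>y. y \<in> img_ch e \<Longrightarrow> f y = g y" for f g :: "'e \<Rightarrow> real" and L
        using fder_eq[OF has_derivative_transform_within_open[OF that(1) open_img_ch[OF ce] tO[OF O(2)]]] that(2) by simp
      show "fder (\<lambda>y. B y (a + a') b) (?t x) z = fder (\<lambda>y. B y a b) (?t x) z + fder (\<lambda>y. B y a' b) (?t x) z"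
        by (rule F[OF has_derivative_add[OF has_fder[OF d] has_fder[OF d]]]) (rule E)
      show "fder (\<lambda>y. B y b (a + a')) (?t x) z = fder (\<lambda>y. B y b a) (?t x) z + fder (\<lambda>y. B y b a') (?t x) z"
        by (rule F[OF has_derivative_add[OF has_fder[OF d] has_fder[OF d]]]) (rule E)
      show "fder (\<lambda>y. B y (r *\<^sub>R a) b) (?t x) z = r * fder (\<lambda>y. B y a b) (?t x) z"
        by (rule F[OF has_derivative_mult_right[OF has_fder[OF d]]]) (rule E)
      show "fder (\<lambda>y. B y b (r *\<^sub>R a)) (?t x) z = r * fder (\<lambda>y. B y b a) (?t x) z"
        by (rule F[OF has_derivative_mult_right[OF has_fder[OF d]]]) (rule E)
    qed
    show ?thesis unfolding bilinear_def by (auto intro!: linearI simp: add1 add2 sc1 sc2 simp del: comp_apply)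
  qed
  let ?D = "fder ?t x" and ?D2 = "\<lambda>a z. fder (\<lambda>y. fder ?t y a) x z"
  have der: "fder (\<lambda>y. tensor_comp M T c y a b) x z
    = B (?t x) (?D2 a z) (?D b) + B (?t x) (?D a) (?D2 b z) + fder (\<lambda>y. B y (?D a) (?D b)) (?t x) (?D z)" for a b z
  proof -
    let ?g = "\<lambda>a' b' C. (\<Sum>i\<in>Basis. \<Sum>j\<in>Basis. (a' \<bullet> i) * (b' \<bullet> j) * C i j)"
    have hB: "((\<lambda>y. B (?t y) i j) has_derivative (\<lambda>z. fder (\<lambda>y. B y i j) (?t x) (?D z))) (at x)" for i j
    proof -
      have "smooth_on (img_ch e) (\<lambda>y. B y i j)" using e(4) by (simp add: smooth_rep_def)
      then show ?thesis
        using diff_chain_at[OF smooth_on_has_derivative[OF t O] smooth_on_has_derivative[of _ "\<lambda>y. B y i j", OF _ open_img_ch[OF ce] tO[OF O(2)]]]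
        by (simp add: o_def)
    qed
    have hD: "((\<lambda>y. fder ?t y a) has_derivative ?D2 a) (at x)" for a
      by (rule smooth_on_has_derivative[OF smooth_on_fder[OF t] O])
    have "((\<lambda>y. ?g (fder ?t y a) (fder ?t y b) (B (?t y))) has_derivative
      (\<lambda>z. \<Sum>i\<in>Basis. \<Sum>j\<in>Basis. (fder ?t x a \<bullet> i) * (fder ?t x b \<bullet> j) * fder (\<lambda>y. B y i j) (?t x) (?D z) +
         ((fder ?t x a \<bullet> i) * (?D2 b z \<bullet> j) + (?D2 a z \<bullet> i) * (fder ?t x b \<bullet> j)) * B (?t x) i j)) (at x)"
      by (intro has_derivative_sum has_derivative_mult has_derivative_inner_left hB hD)
    then have "((\<lambda>y. tensor_comp M T c y a b) has_derivative
      (\<lambda>z. \<Sum>i\<in>Basis. \<Sum>j\<in>Basis. (fder ?t x a \<bullet> i) * (fder ?t x b \<bullet> j) * fder (\<lambda>y. B y i j) (?t x) (?D z) +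
         ((fder ?t x a \<bullet> i) * (?D2 b z \<bullet> j) + (?D2 a z \<bullet> i) * (fder ?t x b \<bullet> j)) * B (?t x) i j)) (at x)"
    proof (rule has_derivative_transform_within_open[OF _ O])
      fix y assume y: "y \<in> ?O"
      then show "?g (fder ?t y a) (fder ?t y b) (B (?t y)) = tensor_comp M T c y a b"
        using tensor_comp_eq[OF c _ e(1) _ e(3), of y a b] overlap_iff[OF cc, of y "dom_ch e"]
          bilinear_expand[OF bil[OF y], of "fder ?t y a" "fder ?t y b"] by (simp del: comp_apply)
    qed
    then have "fder (\<lambda>y. tensor_comp M T c y a b) x z = ?g (?D a) (?D b) (\<lambda>i j. fder (\<lambda>y. B y i j) (?t x) (?D z))
      + ?g (?D a) (?D2 b z) (B (?t x)) + ?g (?D2 a z) (?D b) (B (?t x))"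
      using fder_eq by (fastforce simp: sum.distrib distrib_right)
    then show ?thesis
      unfolding bilinear_expand[OF bil[OF O(2)], of "?D a" "?D2 b z"] bilinear_expand[OF bil[OF O(2)], of "?D2 a z" "?D b"]
        bilinear_expand[OF bil', of "?D a" "?D b" "?D z"] by simp
  qed
  have sym: "?D2 a b = ?D2 b a" for a b using fder_fder_symmetric[OF t O] .
  \<comment> \<open>\<open>two_form\<close> only says that the form vanishes on equal arguments;
    polarization turns this into skew symmetry.\<close>
  have skew: "B (?t x) a b = - B (?t x) b a" for a b
  proof -
    have "B (?t x) a a = 0" for a
    proof -
      have p': "?t x = map_ch e p" "p \<in> points M"
        using p inv_ch_map[OF cc] pointsI[OF c] by auto
      have "T p (coord_vec M e p a) (coord_vec M e p a) = 0"
        using T coord_vec_tangent[OF e(1,2)] p' by (auto simp: two_form_def)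
      then show ?thesis
        using tensor_repD[OF e(3,2) coord_vec_tangent coord_vec_tangent, of e e a a] e p' by (simp add: coord_vec_self)
    qed
    from this[of "a + b"] this[of a] this[of b] show ?thesis
      using bil[OF O(2)] by (simp add: bilinear_ladd bilinear_radd)
  qed
  show "fder (\<lambda>y. tensor_comp M T c y v w) x u + fder (\<lambda>y. tensor_comp M T c y w u) x v
    + fder (\<lambda>y. tensor_comp M T c y u v) x w = 0"
    using cl[OF tO[OF O(2)], of "?D v" "?D w" "?D u"] skew[of "?D2 v u" "?D w"] skew[of "?D2 w u" "?D v"]
      skew[of "?D2 w v" "?D u"] sym[of v u] sym[of w u] sym[of w v]
    by (simp add: der)
qed

end

section \<open>Quotients by local diffeomorphisms\<close>

text \<open>The chart pushed forward along \<open>q\<close>; it is meaningful when \<open>q\<close>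
  is injective on the domain of \<open>c\<close>.\<close>

definition qchart :: "('a \<Rightarrow> 'b) \<Rightarrow> ('a, 'e) chart \<Rightarrow> ('b, 'e) chart" where
  "qchart q c = (q ` dom_ch c, map_ch c \<circ> inv_into (dom_ch c) q)"

lemma quotient_manifold_qchart:
  "quotient_manifold M q = max_atlas (qchart q ` {c \<in> M. inj_on q (dom_ch c)})"
  unfolding quotient_manifold_def qchart_def by (rule arg_cong[of _ _ max_atlas]) blast

lemma dom_qchart: "dom_ch (qchart q c) = q ` dom_ch c"
  by (simp add: qchart_def)

lemma map_qchart: "inj_on q (dom_ch c) \<Longrightarrow> z \<in> dom_ch c \<Longrightarrow> map_ch (qchart q c) (q z) = map_ch c z"
  by (simp add: qchart_def)

lemma img_qchart: "inj_on q (dom_ch c) \<Longrightarrow> img_ch (qchart q c) = img_ch c"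
  unfolding img_ch_def dom_qchart image_image by (simp add: map_qchart)

lemma inv_qchart:
  assumes c: "is_chart c" "inj_on q (dom_ch c)" and x: "x \<in> img_ch c"
  shows "inv_ch (qchart q c) x = q (inv_ch c x)"
  unfolding inv_ch_def[of "qchart q c"]
proof (rule inv_into_f_eq)
  show "inj_on (map_ch (qchart q c)) (dom_ch (qchart q c))"
  proof (rule inj_onI)
    fix P Q assume "P \<in> dom_ch (qchart q c)" "Q \<in> dom_ch (qchart q c)" and e: "map_ch (qchart q c) P = map_ch (qchart q c) Q"
    then obtain z z' where z: "z \<in> dom_ch c" "P = q z" "z' \<in> dom_ch c" "Q = q z'" by (auto simp: dom_qchart)
    then show "P = Q" using e map_qchart[OF c(2)] is_chart_inj[OF c(1)] by metis
  qed
  show "q (inv_ch c x) \<in> dom_ch (qchart q c)" "map_ch (qchart q c) (q (inv_ch c x)) = x"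
    using inv_ch_dom[OF x] map_inv_ch[OF x] map_qchart[OF c(2)] by (simp_all add: dom_qchart)
qed

lemma is_chart_qchart:
  assumes c: "is_chart c" "inj_on q (dom_ch c)"
  shows "is_chart (qchart q c)"
  unfolding is_chart_def
proof
  show "open (img_ch (qchart q c))" using img_qchart[OF c(2)] open_img_ch[OF c(1)] by simp
  show "inj_on (map_ch (qchart q c)) (dom_ch (qchart q c))"
  proof (rule inj_onI)
    fix P Q assume "P \<in> dom_ch (qchart q c)" "Q \<in> dom_ch (qchart q c)" and e: "map_ch (qchart q c) P = map_ch (qchart q c) Q"
    then obtain z z' where z: "z \<in> dom_ch c" "P = q z" "z' \<in> dom_ch c" "Q = q z'" by (auto simp: dom_qchart)
    then show "P = Q" using e map_qchart[OF c(2)] is_chart_inj[OF c(1)] by metis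
  qed
qed

text \<open>Encodes a local deck transformation from \<open>z\<close> to \<open>z'\<close> without
  naming it: the map \<open>inv_ch e' \<circ> map_ch e\<close>, which commutes with \<open>q\<close>
  and is the identity in the two coordinate systems.\<close>

definition deck_pair :: "('a, 'e::euclidean_space) atlas \<Rightarrow> ('a \<Rightarrow> 'b) \<Rightarrow> ('a, 'e) chart \<Rightarrow> ('a, 'e) chart \<Rightarrow> 'a \<Rightarrow> 'a \<Rightarrow> bool" where
  "deck_pair M q e e' z z' \<longleftrightarrow> e \<in> M \<and> e' \<in> M \<and> z \<in> dom_ch e \<and> z' \<in> dom_ch e' \<and> map_ch e z = map_ch e' z' \<and>
     img_ch e = img_ch e' \<and> inj_on q (dom_ch e) \<and> inj_on q (dom_ch e') \<and>
     (\<forall>x\<in>img_ch e. q (inv_ch e x) = q (inv_ch e' x))"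

text \<open>The assumption is also used with \<open>z = z'\<close>, where it provides a chart around
  each point on which \<open>q\<close> is injective. The locale is used twice: for
  \<open>X\<^sub>Y\<close> and for the torus
  \<open>\<real>\<^sup>2\<^sup>n / \<int>\<^sup>2\<^sup>n\<close>.\<close>

locale quotient_atlas =
  fixes M :: "('a, 'e::euclidean_space) atlas" and q :: "'a \<Rightarrow> 'b"
  assumes M: "maximal_atlas M"
    and deck: "\<And>z z'. z \<in> points M \<Longrightarrow> z' \<in> points M \<Longrightarrow> q z = q z' \<Longrightarrow> \<exists>e e'. deck_pair M q e e' z z'"
begin

abbreviation X :: "('b, 'e) atlas" where "X \<equiv> quotient_manifold M q"

lemma deck_dom_eq:
  assumes "deck_pair M q e e' z z'"
  shows "dom_ch (qchart q e) = dom_ch (qchart q e')"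
proof -
  have *: "q ` dom_ch c \<subseteq> q ` dom_ch c'" if c: "c \<in> M" and "img_ch c = img_ch c'"
    "\<forall>x\<in>img_ch c. q (inv_ch c x) = q (inv_ch c' x)" for c c'
  proof
    fix P assume "P \<in> q ` dom_ch c"
    then obtain z where z: "z \<in> dom_ch c" "P = q z" by blast
    then have "P = q (inv_ch c' (map_ch c z))" "inv_ch c' (map_ch c z) \<in> dom_ch c'"
      using that map_ch_img[OF z(1)] inv_ch_map[OF maximal_chart[OF M c] z(1)] inv_ch_dom[of "map_ch c z" c'] by metis+
    then show "P \<in> q ` dom_ch c'" by blast
  qed
  show ?thesis unfolding dom_qchart
    using *[of e e'] *[of e' e] assms unfolding deck_pair_def by (intro equalityI) auto
qed

lemma deck_map_eq:
  assumes d: "deck_pair M q e e' z z'" and P: "P \<in> dom_ch (qchart q e)"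
  shows "map_ch (qchart q e) P = map_ch (qchart q e') P"
proof -
  obtain y where y: "y \<in> dom_ch e" "P = q y" using P by (auto simp: dom_qchart)
  have x: "map_ch e y \<in> img_ch e'" using map_ch_img[OF y(1)] d by (simp add: deck_pair_def)
  have "q (inv_ch e (map_ch e y)) = q (inv_ch e' (map_ch e y))"
    using d map_ch_img[OF y(1)] unfolding deck_pair_def by blast
  moreover have "inv_ch e (map_ch e y) = y"
    using d inv_ch_map[OF maximal_chart[OF M] y(1)] unfolding deck_pair_def by blast
  ultimately have "P = q (inv_ch e' (map_ch e y))" using y(2) by simp
  then show ?thesis
    using map_qchart[of q e' "inv_ch e' (map_ch e y)"] map_qchart[of q e y] inv_ch_dom[OF x] map_inv_ch[OF x] y d
    by (simp add: deck_pair_def)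
qed

lemma deck_restrict:
  assumes d: "deck_pair M q e e' z z'" and W: "open W" "map_ch e z \<in> W"
  shows "deck_pair M q (restrict_ch e W) (restrict_ch e' W) z z'"
proof -
  have e: "e \<in> M" "e' \<in> M" "img_ch e = img_ch e'" using d by (simp_all add: deck_pair_def)
  have "q (inv_ch (restrict_ch e W) x) = q (inv_ch (restrict_ch e' W) x)" if "x \<in> img_ch (restrict_ch e W)" for x
    using that d e inv_restrict_ch[OF maximal_chart[OF M e(1)]] inv_restrict_ch[OF maximal_chart[OF M e(2)]]
    by (simp add: deck_pair_def img_restrict_ch)
  moreover have "inj_on q (dom_ch (restrict_ch e W))" "inj_on q (dom_ch (restrict_ch e' W))"
    using d unfolding deck_pair_def by (auto intro: inj_on_subset simp: restrict_ch_def)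
  ultimately show ?thesis
    using d W restrict_ch_mem[OF M e(1) W(1)] restrict_ch_mem[OF M e(2) W(1)]
    by (simp add: deck_pair_def img_restrict_ch dom_restrict_ch map_restrict_ch)
qed

lemma compatible_qchart_sub:
  assumes c: "c \<in> M" "inj_on q (dom_ch c)" and e: "e \<in> M" "inj_on q (dom_ch e)" and sub: "dom_ch e \<subseteq> dom_ch c"
  shows "compatible (qchart q c) (qchart q e)"
proof -
  note cc = maximal_chart[OF M c(1)] and ce = maximal_chart[OF M e(1)]
  have D: "dom_ch c \<inter> dom_ch e = dom_ch e" using sub by blast
  have QD: "q ` dom_ch c \<inter> q ` dom_ch e = q ` dom_ch e" using sub by blast
  have I: "map_ch (qchart q c) ` q ` dom_ch e = map_ch c ` dom_ch e"
    using map_qchart[OF c(2)] sub by (force simp: image_image)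
  have J: "map_ch (qchart q e) ` q ` dom_ch e = map_ch e ` dom_ch e"
    using map_qchart[OF e(2)] by (force simp: image_image)
  have O: "open (map_ch c ` dom_ch e)" "open (map_ch e ` dom_ch e)"
    using transition_open[OF M c(1) e(1)] transition_open[OF M e(1) c(1)] D by (simp_all add: Int_commute)
  have "smooth_on (map_ch c ` dom_ch e) (map_ch (qchart q e) \<circ> inv_ch (qchart q c))"
  proof (rule smooth_on_cong[OF O(1)])
    show "smooth_on (map_ch c ` dom_ch e) (map_ch e \<circ> inv_ch c)" using transition_smooth[OF M c(1) e(1)] D by simp
    fix x assume "x \<in> map_ch c ` dom_ch e"
    then obtain z where z: "z \<in> dom_ch e" "x = map_ch c z" by blast
    have zc: "z \<in> dom_ch c" using z sub by blast
    have "inv_ch (qchart q c) x = q z" using inv_qchart[OF cc c(2) map_ch_img[OF zc]] inv_ch_map[OF cc zc] z by simp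
    then show "(map_ch e \<circ> inv_ch c) x = (map_ch (qchart q e) \<circ> inv_ch (qchart q c)) x"
      using map_qchart[OF e(2) z(1)] inv_ch_map[OF cc zc] z(2) by simp
  qed
  moreover have "smooth_on (map_ch e ` dom_ch e) (map_ch (qchart q c) \<circ> inv_ch (qchart q e))"
  proof (rule smooth_on_cong[OF O(2)])
    show "smooth_on (map_ch e ` dom_ch e) (map_ch c \<circ> inv_ch e)" using transition_smooth[OF M e(1) c(1)] D by (simp add: Int_commute)
    fix x assume "x \<in> map_ch e ` dom_ch e"
    then obtain z where z: "z \<in> dom_ch e" "x = map_ch e z" by blast
    have zc: "z \<in> dom_ch c" using z sub by blast
    have "inv_ch (qchart q e) x = q z" using inv_qchart[OF ce e(2) map_ch_img[OF z(1)]] inv_ch_map[OF ce z(1)] z by simp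
    then show "(map_ch c \<circ> inv_ch e) x = (map_ch (qchart q c) \<circ> inv_ch (qchart q e)) x"
      using map_qchart[OF c(2) zc] inv_ch_map[OF ce z(1)] z(2) by simp
  qed
  ultimately show ?thesis
    unfolding compatible_def dom_qchart QD I J using O by blast
qed

lemma compatible_deck:
  assumes d: "deck_pair M q e e' z z'"
  shows "compatible (qchart q e) (qchart q e')"
proof -
  have e: "e \<in> M" "e' \<in> M" "img_ch e = img_ch e'" "inj_on q (dom_ch e)" "inj_on q (dom_ch e')"
    using d by (simp_all add: deck_pair_def)
  note ce = is_chart_qchart[OF maximal_chart[OF M e(1)] e(4)] and ce' = is_chart_qchart[OF maximal_chart[OF M e(2)] e(5)]
  note D = deck_dom_eq[OF d]
  have i: "map_ch (qchart q e') ` dom_ch (qchart q e') = img_ch e" "map_ch (qchart q e) ` dom_ch (qchart q e') = img_ch e"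
    using img_qchart[OF e(4)] img_qchart[OF e(5)] e(3) D unfolding img_ch_def by auto
  have o: "open (img_ch e)" using open_img_ch[OF maximal_chart[OF M e(1)]] .
  have x: "x \<in> img_ch (qchart q e)" "x \<in> img_ch (qchart q e')" if "x \<in> img_ch e" for x
    using that e(3) img_qchart[OF e(4)] img_qchart[OF e(5)] by auto
  have "smooth_on (img_ch e) (map_ch (qchart q e') \<circ> inv_ch (qchart q e))"
    by (rule smooth_on_cong[OF o _ smooth_on_id[OF o]])
       (simp add: deck_map_eq[OF d, symmetric] inv_ch_dom[OF x(1)] map_inv_ch[OF x(1)])
  moreover have "smooth_on (img_ch e) (map_ch (qchart q e) \<circ> inv_ch (qchart q e'))"
    by (rule smooth_on_cong[OF o _ smooth_on_id[OF o]])
       (simp add: deck_map_eq[OF d] D inv_ch_dom[OF x(2)] map_inv_ch[OF x(2)])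
  ultimately show ?thesis using o by (simp add: compatible_def D i)
qed

text \<open>Two charts downstairs may meet over different points \<open>z\<close> and
  \<open>z'\<close> upstairs. A deck pair joins these points, so the change of charts factors as
  \<open>c\<close> to \<open>e\<close>, \<open>e\<close> to \<open>e'\<close>, \<open>e'\<close> to
  \<open>d\<close>, where the middle step is the identity in coordinates.\<close>

lemma qatlas: "is_atlas (qchart q ` {c \<in> M. inj_on q (dom_ch c)})"
proof -
  have "compatible (qchart q c) (qchart q d)"
    if c: "c \<in> M" "inj_on q (dom_ch c)" and d: "d \<in> M" "inj_on q (dom_ch d)" for c d
  proof (rule compatible_local[OF is_chart_qchart[OF maximal_chart[OF M c(1)] c(2)] is_chart_qchart[OF maximal_chart[OF M d(1)] d(2)]])
    fix P assume "P \<in> dom_ch (qchart q c) \<inter> dom_ch (qchart q d)"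
    then obtain z z' where z: "z \<in> dom_ch c" "P = q z" and z': "z' \<in> dom_ch d" "P = q z'"
      by (auto simp: dom_qchart)
    then obtain f f' where f: "deck_pair M q f f' z z'"
      using deck[of z z'] pointsI[OF c(1) z(1)] pointsI[OF d(1) z'(1)] by auto
    \<comment> \<open>Shrinking both members of the pair to the same coordinate set makes one fit
      into \<open>c\<close> and the other into \<open>d\<close>, while they remain a deck
      pair.\<close>
    define W where "W = map_ch f ` (dom_ch f \<inter> dom_ch c) \<inter> map_ch f' ` (dom_ch f' \<inter> dom_ch d)"
    define e e' where "e = restrict_ch f W" and "e' = restrict_ch f' W"
    have fM: "f \<in> M" "f' \<in> M" "z \<in> dom_ch f" "z' \<in> dom_ch f'" "map_ch f z = map_ch f' z'" using f by (simp_all add: deck_pair_def)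
    have W: "open W" unfolding W_def using transition_open[OF M fM(1) c(1)] transition_open[OF M fM(2) d(1)] by blast
    have fW: "map_ch f z \<in> W" unfolding W_def using fM z z' by (metis IntI imageI)
    note dp = deck_restrict[OF f W fW, folded e_def e'_def]
    have e: "e \<in> M" "e' \<in> M" "z \<in> dom_ch e" "inj_on q (dom_ch e)" "inj_on q (dom_ch e')"
      using dp by (simp_all add: deck_pair_def)
    have sub: "dom_ch e \<subseteq> dom_ch c" "dom_ch e' \<subseteq> dom_ch d"
      using is_chart_inj[OF maximal_chart[OF M fM(1)]] is_chart_inj[OF maximal_chart[OF M fM(2)]]
      unfolding e_def e'_def restrict_ch_def W_def by (fastforce)+
    have k1: "compatible (qchart q c) (qchart q e)" using compatible_qchart_sub[OF c e(1,4) sub(1)] .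
    have k2: "compatible (qchart q e) (qchart q d)"
    proof (rule compatible_local[OF is_chart_qchart[OF maximal_chart[OF M e(1)] e(4)] is_chart_qchart[OF maximal_chart[OF M d(1)] d(2)]])
      fix Q assume "Q \<in> dom_ch (qchart q e) \<inter> dom_ch (qchart q d)"
      then have "Q \<in> dom_ch (qchart q e')" using deck_dom_eq[OF dp] by simp
      then show "\<exists>f. is_chart f \<and> Q \<in> dom_ch f \<and> compatible (qchart q e) f \<and> compatible f (qchart q d)"
        using is_chart_qchart[OF maximal_chart[OF M e(2)] e(5)] compatible_deck[OF dp]
          compatible_qchart_sub[OF d e(2,5) sub(2)] compatible_sym by blast
    qed
    show "\<exists>e. is_chart e \<and> P \<in> dom_ch e \<and> compatible (qchart q c) e \<and> compatible e (qchart q d)"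
      using k1 k2 is_chart_qchart[OF maximal_chart[OF M e(1)] e(4)] z(2) e(3) by (intro exI[of _ "qchart q e"]) (simp add: dom_qchart)
  qed
  then show ?thesis
    unfolding is_atlas_def using is_chart_qchart[OF maximal_chart[OF M]] by blast
qed

section \<open>The quotient manifold and its topology\<close>

lemma X_maximal: "maximal_atlas X"
  unfolding quotient_manifold_qchart by (rule maximal_max_atlas[OF qatlas])

lemma qchart_mem: "c \<in> M \<Longrightarrow> inj_on q (dom_ch c) \<Longrightarrow> qchart q c \<in> X"
  unfolding quotient_manifold_qchart using atlas_subset_max[OF qatlas] by blast

lemma qinj_chart:
  assumes "z \<in> points M"
  obtains c where "c \<in> M" "inj_on q (dom_ch c)" "z \<in> dom_ch c"
  using deck[OF assms assms refl] that unfolding deck_pair_def by blast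

lemma points_X: "points X = q ` points M"
proof -
  have "points X = (\<Union>c\<in>{c \<in> M. inj_on q (dom_ch c)}. q ` dom_ch c)"
    unfolding quotient_manifold_qchart points_max_atlas[OF qatlas] by (simp add: points_def dom_qchart)
  also have "\<dots> = q ` points M"
  proof
    show "q ` points M \<subseteq> (\<Union>c\<in>{c \<in> M. inj_on q (dom_ch c)}. q ` dom_ch c)"
    proof
      fix P assume "P \<in> q ` points M"
      then obtain z where z: "z \<in> points M" "P = q z" by blast
      obtain c where "c \<in> M" "inj_on q (dom_ch c)" "z \<in> dom_ch c" using qinj_chart[OF z(1)] .
      then show "P \<in> (\<Union>c\<in>{c \<in> M. inj_on q (dom_ch c)}. q ` dom_ch c)" using z by blast
    qed
  qed (auto simp: points_def)
  finally show ?thesis .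
qed

lemma qchart_restrict:
  assumes "z \<in> points M" "openin (manifold_topology M) U" "z \<in> U"
  obtains c where "c \<in> M" "inj_on q (dom_ch c)" "z \<in> dom_ch c" "dom_ch c \<subseteq> U"
proof -
  obtain c where c: "c \<in> M" "inj_on q (dom_ch c)" "z \<in> dom_ch c" using qinj_chart[OF assms(1)] .
  obtain V where V: "open V" "map_ch c z \<in> V" "V \<subseteq> img_ch c" "\<And>x. x \<in> V \<Longrightarrow> inv_ch c x \<in> U \<inter> dom_ch c"
    using openin_manifoldE[OF M assms(2,3) c(1,3)] by blast
  show ?thesis
  proof (rule that[OF restrict_ch_mem[OF M c(1) V(1)]])
    show "inj_on q (dom_ch (restrict_ch c V))" using c(2) by (auto simp: restrict_ch_def intro: inj_on_subset)
    show "z \<in> dom_ch (restrict_ch c V)" using c V by (simp add: dom_restrict_ch)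
    show "dom_ch (restrict_ch c V) \<subseteq> U"
      using V(4) inv_ch_map[OF maximal_chart[OF M c(1)]] by (force simp: restrict_ch_def)
  qed
qed

lemma openin_q_image:
  assumes U: "openin (manifold_topology M) U"
  shows "openin (manifold_topology X) (q ` U)"
proof (subst openin_subopen, intro ballI)
  fix P assume "P \<in> q ` U"
  then obtain z where z: "z \<in> U" "P = q z" by blast
  then have "z \<in> points M" using openin_subset[OF U] topspace_manifold[OF M] by blast
  then obtain c where c: "c \<in> M" "inj_on q (dom_ch c)" "z \<in> dom_ch c" "dom_ch c \<subseteq> U" using qchart_restrict U z by blast
  show "\<exists>T. openin (manifold_topology X) T \<and> P \<in> T \<and> T \<subseteq> q ` U"
    using openin_dom_ch[OF X_maximal qchart_mem[OF c(1,2)]] c z by (intro exI[of _ "q ` dom_ch c"]) (auto simp: dom_qchart)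
qed

lemma openin_q_preimage:
  assumes W: "openin (manifold_topology X) W"
  shows "openin (manifold_topology M) {z \<in> points M. q z \<in> W}"
proof (rule openin_manifoldI[OF M])
  fix z assume "z \<in> {z \<in> points M. q z \<in> W}"
  then have z: "z \<in> points M" "q z \<in> W" by auto
  obtain c where c: "c \<in> M" "inj_on q (dom_ch c)" "z \<in> dom_ch c" using qinj_chart[OF z(1)] .
  note cc = maximal_chart[OF M c(1)]
  obtain V where V: "open V" "map_ch (qchart q c) (q z) \<in> V" "V \<subseteq> img_ch (qchart q c)"
    "\<And>x. x \<in> V \<Longrightarrow> inv_ch (qchart q c) x \<in> W \<inter> dom_ch (qchart q c)"
    using openin_manifoldE[OF X_maximal W z(2) qchart_mem[OF c(1,2)]] c(3) by (auto simp: dom_qchart)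
  have "dom_ch c \<inter> map_ch c -` V \<subseteq> {z \<in> points M. q z \<in> W}"
  proof
    fix y assume y: "y \<in> dom_ch c \<inter> map_ch c -` V"
    then have "inv_ch (qchart q c) (map_ch c y) = q y"
      using inv_qchart[OF cc c(2) map_ch_img, of y] inv_ch_map[OF cc, of y] by simp
    then show "y \<in> {z \<in> points M. q z \<in> W}" using V(4)[of "map_ch c y"] y pointsI[OF c(1), of y] by auto
  qed
  then show "\<exists>c V. c \<in> M \<and> open V \<and> z \<in> dom_ch c \<and> map_ch c z \<in> V \<and> dom_ch c \<inter> map_ch c -` V \<subseteq> {z \<in> points M. q z \<in> W}"
    using c V(1,2) unfolding map_qchart[OF c(2,3)] by blast
qed

text \<open>\<open>q\<close> is open, so open sets upstairs with disjoint images separate points of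
  the quotient, and countably many injective charts give second countability.\<close>

lemma X_smooth_manifold:
  assumes sep: "\<And>z z'. z \<in> points M \<Longrightarrow> z' \<in> points M \<Longrightarrow> q z \<noteq> q z' \<Longrightarrow>
      \<exists>U U'. openin (manifold_topology M) U \<and> openin (manifold_topology M) U' \<and> z \<in> U \<and> z' \<in> U' \<and> q ` U \<inter> q ` U' = {}"
    and C: "countable C" "C \<subseteq> {c \<in> M. inj_on q (dom_ch c)}" "points X \<subseteq> (\<Union>c\<in>C. q ` dom_ch c)"
  shows "smooth_manifold X"
  unfolding smooth_manifold_def
proof (intro conjI)
  show "X = max_atlas X" using X_maximal by (simp add: maximal_atlas_def)
  show "Hausdorff_space (manifold_topology X)"
    unfolding Hausdorff_space_def topspace_manifold[OF X_maximal]
  proof (intro allI impI)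
    fix P Q assume "P \<in> points X \<and> Q \<in> points X \<and> P \<noteq> Q"
    then obtain z z' where z: "z \<in> points M" "P = q z" "z' \<in> points M" "Q = q z'" "q z \<noteq> q z'"
      unfolding points_X by blast
    obtain U U' where U: "openin (manifold_topology M) U" "openin (manifold_topology M) U'" "z \<in> U" "z' \<in> U'" "q ` U \<inter> q ` U' = {}"
      using sep[OF z(1,3,5)] by blast
    show "\<exists>U V. openin (manifold_topology X) U \<and> openin (manifold_topology X) V \<and> P \<in> U \<and> Q \<in> V \<and> disjnt U V"
      using openin_q_image[OF U(1)] openin_q_image[OF U(2)] U(3-5) z(2,4)
      by (intro exI[of _ "q ` U"] exI[of _ "q ` U'"]) (auto simp: disjnt_def)
  qed
  show "second_countable (manifold_topology X)"
  proof (rule second_countable_manifoldI[OF X_maximal])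
    show "countable (qchart q ` C)" using C(1) by simp
    show "qchart q ` C \<subseteq> X" using C(2) qchart_mem by blast
    show "points X \<subseteq> (\<Union>c\<in>qchart q ` C. dom_ch c)" using C(3) by (simp add: dom_qchart)
  qed
qed

section \<open>The differential of the projection\<close>

lemma differential_q:
  assumes c: "c \<in> M" "inj_on q (dom_ch c)" "z \<in> dom_ch c" and v: "v \<in> tangent_space M z"
  shows "differential M X q z v = coord_vec X (qchart q c) (q z) (v c)"
  by (rule differential_eq[OF M X_maximal c(1,3) qchart_mem[OF c(1,2)] open_UNIV, where F = "\<lambda>x. x" and F' = "\<lambda>x. x"])
     (use v map_qchart[OF c(2)] inv_ch_dom[of _ c] map_inv_ch[of _ c] in \<open>auto simp: dom_qchart\<close>)

lemma q_mem: "z \<in> dom_ch c \<Longrightarrow> q z \<in> dom_ch (qchart q c)"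
  by (simp add: dom_qchart)

lemma differential_q_tangent:
  "c \<in> M \<Longrightarrow> inj_on q (dom_ch c) \<Longrightarrow> z \<in> dom_ch c \<Longrightarrow> v \<in> tangent_space M z \<Longrightarrow> differential M X q z v \<in> tangent_space X (q z)"
  using differential_q coord_vec_tangent[OF X_maximal qchart_mem q_mem] by metis

lemma differential_q_comp:
  "c \<in> M \<Longrightarrow> inj_on q (dom_ch c) \<Longrightarrow> z \<in> dom_ch c \<Longrightarrow> v \<in> tangent_space M z \<Longrightarrow> differential M X q z v (qchart q c) = v c"
  using differential_q coord_vec_self[OF X_maximal qchart_mem q_mem] by metis

lemma differential_q_lift:
  assumes c: "c \<in> M" "inj_on q (dom_ch c)" "z \<in> dom_ch c" and \<xi>: "\<xi> \<in> tangent_space X (q z)"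
  shows "differential M X q z (coord_vec M c z (\<xi> (qchart q c))) = \<xi>"
  using differential_q[OF c coord_vec_tangent[OF M c(1,3)]] coord_vec_self[OF M c(1,3)]
    tangent_eq_coord_vec[OF X_maximal \<xi> qchart_mem[OF c(1,2)] q_mem[OF c(3)]] by simp

text \<open>The differential of \<open>q\<close> is injective at \<open>z\<close>, so the lift of a
  tangent vector to \<open>z\<close> does not depend on the chart used.\<close>

lemma lift_unique:
  assumes c: "c \<in> M" "inj_on q (dom_ch c)" "z \<in> dom_ch c" and d: "d \<in> M" "inj_on q (dom_ch d)" "z \<in> dom_ch d"
    and \<xi>: "\<xi> \<in> tangent_space X (q z)"
  shows "coord_vec M c z (\<xi> (qchart q c)) = coord_vec M d z (\<xi> (qchart q d))"
proof (rule tangent_eqI[OF M _ _ c(1,3)])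
  show t: "coord_vec M c z (\<xi> (qchart q c)) \<in> tangent_space M z" "coord_vec M d z (\<xi> (qchart q d)) \<in> tangent_space M z"
    using coord_vec_tangent[OF M] c d by auto
  show "coord_vec M c z (\<xi> (qchart q c)) c = coord_vec M d z (\<xi> (qchart q d)) c"
    using differential_q_comp[OF c t(1)] differential_q_comp[OF c t(2)] differential_q_lift[OF c \<xi>] differential_q_lift[OF d \<xi>]
    by simp
qed

text \<open>The two charts of a deck pair descend to the same coordinate function, so the transition
  between them has identity derivative.\<close>

lemma deck_component:
  assumes d: "deck_pair M q e e' z z'" and qz: "q z = q z'" and \<xi>: "\<xi> \<in> tangent_space X (q z)"
  shows "\<xi> (qchart q e) = \<xi> (qchart q e')"
proof -
  have e: "e \<in> M" "e' \<in> M" "z \<in> dom_ch e" "z' \<in> dom_ch e'" "inj_on q (dom_ch e)" "inj_on q (dom_ch e')"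
    using d by (simp_all add: deck_pair_def)
  have m: "qchart q e \<in> X" "q z \<in> dom_ch (qchart q e)" "qchart q e' \<in> X" "q z \<in> dom_ch (qchart q e')"
    using qchart_mem q_mem[OF e(3)] q_mem[OF e(4)] e qz by auto
  have o: "open (img_ch (qchart q e))" using open_img_ch[OF maximal_chart[OF X_maximal m(1)]] .
  have "((map_ch (qchart q e') \<circ> inv_ch (qchart q e)) has_derivative (\<lambda>v. v)) (at (map_ch (qchart q e) (q z)))"
  proof (rule has_derivative_transform_within_open[OF _ o map_ch_img[OF m(2)]])
    show "x = (map_ch (qchart q e') \<circ> inv_ch (qchart q e)) x" if "x \<in> img_ch (qchart q e)" for x
      using deck_map_eq[OF d inv_ch_dom[OF that]] map_inv_ch[OF that] by simp
  qed simp
  then show ?thesis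
    using fder_eq tangent_space_change[OF X_maximal \<xi> m] by metis
qed

section \<open>Descent of invariant tensor fields\<close>

definition deck_invariant :: "('a, 'e) tensor2 \<Rightarrow> bool" where
  "deck_invariant T \<longleftrightarrow> (\<forall>z\<in>points M. \<forall>z'\<in>points M. q z = q z' \<longrightarrow> (\<exists>e e'. deck_pair M q e e' z z' \<and>
     (\<forall>a b. tensor_comp M T e (map_ch e z) a b = tensor_comp M T e' (map_ch e' z') a b)))"

text \<open>Both the preimage of \<open>P\<close> and the chart are chosen arbitrarily;
  \<open>descend_eq\<close> shows that the value is the same for every choice when the tensor is
  deck invariant.\<close>

definition descend :: "('a, 'e) tensor2 \<Rightarrow> ('b, 'e) tensor2" where
  "descend T P \<xi> \<zeta> = (if P \<in> points X \<and> \<xi> \<in> tangent_space X P \<and> \<zeta> \<in> tangent_space X P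
     then (let z = (SOME z. z \<in> points M \<and> q z = P); c = (SOME c. c \<in> M \<and> inj_on q (dom_ch c) \<and> z \<in> dom_ch c)
       in T z (coord_vec M c z (\<xi> (qchart q c))) (coord_vec M c z (\<zeta> (qchart q c))))
     else 0)"

lemma tensor_at_coord:
  "c \<in> M \<Longrightarrow> z \<in> dom_ch c \<Longrightarrow> T z (coord_vec M c z a) (coord_vec M c z b) = tensor_comp M T c (map_ch c z) a b"
  using inv_ch_map[OF maximal_chart[OF M]] by (simp add: tensor_comp_def)

text \<open>From the chosen data to the given ones in three moves: change the chart at the chosen
  preimage \<open>y\<close>, pass from \<open>y\<close> to \<open>z\<close> along a deck pair,
  change the chart at \<open>z\<close>. Invariance enters in the middle move only.\<close>

lemma descend_eq:
  assumes inv: "deck_invariant T" and c: "c \<in> M" "inj_on q (dom_ch c)" "z \<in> dom_ch c"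
    and \<xi>: "\<xi> \<in> tangent_space X (q z)" and \<zeta>: "\<zeta> \<in> tangent_space X (q z)"
  shows "descend T (q z) \<xi> \<zeta> = tensor_comp M T c (map_ch c z) (\<xi> (qchart q c)) (\<zeta> (qchart q c))"
proof -
  have zM: "z \<in> points M" using pointsI[OF c(1,3)] .
  define y where "y = (SOME y. y \<in> points M \<and> q y = q z)"
  have y: "y \<in> points M" "q y = q z" using someI_ex[of "\<lambda>y. y \<in> points M \<and> q y = q z"] zM unfolding y_def by blast+
  define d where "d = (SOME d. d \<in> M \<and> inj_on q (dom_ch d) \<and> y \<in> dom_ch d)"
  have "\<exists>d. d \<in> M \<and> inj_on q (dom_ch d) \<and> y \<in> dom_ch d" using qinj_chart[OF y(1)] by metis
  then have d: "d \<in> M" "inj_on q (dom_ch d)" "y \<in> dom_ch d"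
    using someI_ex[of "\<lambda>d. d \<in> M \<and> inj_on q (dom_ch d) \<and> y \<in> dom_ch d"] unfolding d_def by blast+
  obtain e e' where ee: "deck_pair M q e e' y z" and
    TT: "\<And>a b. tensor_comp M T e (map_ch e y) a b = tensor_comp M T e' (map_ch e' z) a b"
    using inv y zM unfolding deck_invariant_def by metis
  have e: "e \<in> M" "inj_on q (dom_ch e)" "y \<in> dom_ch e" and e': "e' \<in> M" "inj_on q (dom_ch e')" "z \<in> dom_ch e'"
    using ee by (simp_all add: deck_pair_def)
  have ty: "\<xi> \<in> tangent_space X (q y)" "\<zeta> \<in> tangent_space X (q y)" using \<xi> \<zeta> y by auto
  have "descend T (q z) \<xi> \<zeta> = T y (coord_vec M d y (\<xi> (qchart q d))) (coord_vec M d y (\<zeta> (qchart q d)))"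
    using \<xi> \<zeta> zM by (simp add: descend_def points_X Let_def flip: y_def d_def)
  also have "\<dots> = T y (coord_vec M e y (\<xi> (qchart q e))) (coord_vec M e y (\<zeta> (qchart q e)))"
    using lift_unique[OF d e ty(1)] lift_unique[OF d e ty(2)] by simp
  also have "\<dots> = T z (coord_vec M e' z (\<xi> (qchart q e'))) (coord_vec M e' z (\<zeta> (qchart q e')))"
    using deck_component[OF ee y(2) ty(1)] deck_component[OF ee y(2) ty(2)] TT
    by (simp add: tensor_at_coord e e')
  also have "\<dots> = T z (coord_vec M c z (\<xi> (qchart q c))) (coord_vec M c z (\<zeta> (qchart q c)))"
    using lift_unique[OF c e' \<xi>] lift_unique[OF c e' \<zeta>] by simp
  finally show ?thesis by (simp add: tensor_at_coord c)
qed


























text \<open>Stated for any \<open>S\<close> with the prescribed pullback, because the canonical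
  structure is characterized by its pullbacks. It gives both the coordinate expressions downstairs
  and uniqueness.\<close>

lemma pullback_rep:
  assumes P: "pullback M X q S = T" and c: "c \<in> M" "inj_on q (dom_ch c)"
  shows "tensor_rep X S (qchart q c) (tensor_comp M T c)"
  unfolding tensor_rep_def[OF X_maximal]
proof (intro ballI)
  fix Q \<xi> \<zeta> assume "Q \<in> dom_ch (qchart q c)" and \<xi>: "\<xi> \<in> tangent_space X Q" and \<zeta>: "\<zeta> \<in> tangent_space X Q"
  then obtain z where z: "z \<in> dom_ch c" "Q = q z" by (auto simp: dom_qchart)
  have l: "differential M X q z (coord_vec M c z (\<xi> (qchart q c))) = \<xi>" "differential M X q z (coord_vec M c z (\<zeta> (qchart q c))) = \<zeta>"
    using differential_q_lift[OF c z(1)] \<xi> \<zeta> z by auto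
  have "tensor_comp M T c (map_ch c z) (\<xi> (qchart q c)) (\<zeta> (qchart q c)) = S (q z) \<xi> \<zeta>"
    using coord_vec_tangent[OF M c(1) z(1)] pointsI[OF c(1) z(1)] l
    unfolding tensor_at_coord[OF c(1) z(1), symmetric] P[symmetric] by (simp add: pullback_def)
  then show "S Q \<xi> \<zeta> = tensor_comp M T c (map_ch (qchart q c) Q) (\<xi> (qchart q c)) (\<zeta> (qchart q c))"
    using z map_qchart[OF c(2) z(1)] by simp
qed

lemma pullback_descend:
  assumes T: "tensor2_field M T" and inv: "deck_invariant T"
  shows "pullback M X q (descend T) = T"
proof (intro ext)
  fix z u v
  show "pullback M X q (descend T) z u v = T z u v"
  proof (cases "z \<in> points M \<and> u \<in> tangent_space M z \<and> v \<in> tangent_space M z")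
    case True
    then obtain c where c: "c \<in> M" "inj_on q (dom_ch c)" "z \<in> dom_ch c" using qinj_chart by blast
    then show ?thesis
      using True differential_q_tangent[OF c] differential_q_comp[OF c] descend_eq[OF inv c]
        tensor_repD[OF M tensor_rep_comp[OF M c(1)] c(3)] by (simp add: pullback_def)
  next
    case False
    then show ?thesis using tensor2_field_zero[OF M T False] unfolding pullback_def by presburger
  qed
qed

lemma descend_tensor:
  assumes T: "tensor2_field M T" and inv: "deck_invariant T"
  shows "tensor2_field X (descend T)"
proof (rule tensor2_fieldI[OF X_maximal])
  fix P u v assume "\<not> (P \<in> points X \<and> u \<in> tangent_space X P \<and> v \<in> tangent_space X P)"
  then show "descend T P u v = 0" unfolding descend_def by presburger
next
  fix P assume "P \<in> points X"
  then obtain z where z: "z \<in> points M" "P = q z" unfolding points_X by blast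
  then obtain c where c: "c \<in> M" "inj_on q (dom_ch c)" "z \<in> dom_ch c" using qinj_chart by blast
  have "smooth_rep (qchart q c) (tensor_comp M T c)"
    using tensor2_field_rep(2)[OF M T c(1)] by (simp add: smooth_rep_def[OF X_maximal] smooth_rep_def[OF M] img_qchart[OF c(2)])
  then show "\<exists>e B. e \<in> X \<and> P \<in> dom_ch e \<and> tensor_rep X (descend T) e B \<and> smooth_rep e B"
    using pullback_rep[OF pullback_descend[OF T inv] c(1,2)] qchart_mem[OF c(1,2)] q_mem[OF c(3)] z(2) by blast
qed

lemma descend_unique:
  assumes S: "tensor2_field X S" and P: "pullback M X q S = T"
    and S': "tensor2_field X S'" and P': "pullback M X q S' = T"
  shows "S = S'"
proof (intro ext)
  fix Q u v
  show "S Q u v = S' Q u v"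
  proof (cases "Q \<in> points X \<and> u \<in> tangent_space X Q \<and> v \<in> tangent_space X Q")
    case True
    then obtain z where z: "z \<in> points M" "Q = q z" unfolding points_X by blast
    then obtain c where c: "c \<in> M" "inj_on q (dom_ch c)" "z \<in> dom_ch c" using qinj_chart by blast
    then show ?thesis
      using True tensor_repD[OF X_maximal pullback_rep[OF P c(1,2)] q_mem[OF c(3)]]
        tensor_repD[OF X_maximal pullback_rep[OF P' c(1,2)] q_mem[OF c(3)]] z(2) by metis
  next
    case False
    then show ?thesis using tensor2_field_zero[OF X_maximal S False] tensor2_field_zero[OF X_maximal S' False] by simp
  qed
qed

end

section \<open>Charts of bundles\<close>

definition bundle_chart :: "'z set \<Rightarrow> ('z \<Rightarrow> 'a) \<Rightarrow> (('a, 'e) chart \<Rightarrow> 'z \<Rightarrow> 'f) \<Rightarrow> ('a, 'e) chart \<Rightarrow> ('z, 'e \<times> 'f) chart" where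
  "bundle_chart E base fib c = ({z \<in> E. base z \<in> dom_ch c}, \<lambda>z. (map_ch c (base z), fib c z))"

text \<open>Linearity in the fibre variable reduces joint smoothness to smoothness in the base point
  for each basis vector.\<close>

lemma smooth_on_linear_family:
  fixes A :: "'e::euclidean_space \<Rightarrow> 'f::euclidean_space \<Rightarrow> 'g::euclidean_space"
  assumes O: "open O'" and lin: "\<And>x. x \<in> O' \<Longrightarrow> linear (A x)" and sm: "\<And>b. smooth_on O' (\<lambda>x. A x b)"
  shows "smooth_on (O' \<times> UNIV) (\<lambda>y. A (fst y) (snd y))"
proof -
  have OU: "open (O' \<times> (UNIV :: 'f set))" using O by (simp add: open_Times)
  show ?thesis
  proof (rule smooth_on_cong[OF OU])
    show "smooth_on (O' \<times> (UNIV :: 'f set)) (\<lambda>y. \<Sum>b\<in>Basis. (snd y \<bullet> b) *\<^sub>R A (fst y) b)"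
    proof (intro smooth_on_sum smooth_on_scaleR smooth_on_inner smooth_on_const smooth_on_snd smooth_on_id OU finite_Basis)
      show "smooth_on (O' \<times> (UNIV :: 'f set)) (\<lambda>y. A (fst y) b)" for b
        by (rule smooth_on_compose[OF sm smooth_on_fst[OF OU smooth_on_id[OF OU]] OU O]) auto
    qed
    show "(\<Sum>b\<in>Basis. (snd y \<bullet> b) *\<^sub>R A (fst y) b) = A (fst y) (snd y)" if "y \<in> O' \<times> UNIV" for y
      using fder_basis_expand[OF lin[of "fst y"], of "snd y"] that by auto
  qed
qed














text \<open>Common axioms for \<open>TY\<close>, the fibre product of two copies of it, and
  \<open>T\<^sup>*Y\<close>: over a chart of the base, fibre coordinates are bijective on each
  fibre, and they change by linear maps that depend smoothly on the base point.\<close>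

locale fibre_bundle =
  fixes M :: "('a, 'e::euclidean_space) atlas" and E :: "'z set" and base :: "'z \<Rightarrow> 'a"
    and fib :: "('a, 'e) chart \<Rightarrow> 'z \<Rightarrow> 'f::euclidean_space"
  assumes M: "maximal_atlas M"
    and base: "\<And>z. z \<in> E \<Longrightarrow> base z \<in> points M"
    and surj: "\<And>c p a. c \<in> M \<Longrightarrow> p \<in> dom_ch c \<Longrightarrow> \<exists>z\<in>E. base z = p \<and> fib c z = a"
    and inj: "\<And>c z z'. c \<in> M \<Longrightarrow> z \<in> E \<Longrightarrow> z' \<in> E \<Longrightarrow> base z \<in> dom_ch c \<Longrightarrow> base z' = base z \<Longrightarrow> fib c z = fib c z' \<Longrightarrow> z = z'"
    and trans: "\<And>c d. c \<in> M \<Longrightarrow> d \<in> M \<Longrightarrow> \<exists>A.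
      (\<forall>z\<in>E. base z \<in> dom_ch c \<longrightarrow> base z \<in> dom_ch d \<longrightarrow> fib d z = A (map_ch c (base z)) (fib c z)) \<and>
      (\<forall>x \<in> map_ch c ` (dom_ch c \<inter> dom_ch d). linear (A x)) \<and>
      (\<forall>b. smooth_on (map_ch c ` (dom_ch c \<inter> dom_ch d)) (\<lambda>x. A x b))"
begin

abbreviation bch where "bch \<equiv> bundle_chart E base fib"
abbreviation BM where "BM \<equiv> max_atlas (bch ` M)"

lemma bch_image:
  assumes c: "c \<in> M"
  shows "map_ch (bch c) ` (dom_ch (bch c) \<inter> {z. base z \<in> D}) = map_ch c ` (dom_ch c \<inter> D) \<times> UNIV"
proof
  show "map_ch c ` (dom_ch c \<inter> D) \<times> UNIV \<subseteq> map_ch (bch c) ` (dom_ch (bch c) \<inter> {z. base z \<in> D})"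
  proof clarify
    fix p a assume p: "p \<in> dom_ch c" "p \<in> D"
    obtain z where "z \<in> E" "base z = p" "fib c z = a" using surj[OF c p(1)] by blast
    then show "(map_ch c p, a) \<in> map_ch (bch c) ` (dom_ch (bch c) \<inter> {z. base z \<in> D})"
      using p by (intro image_eqI[of _ _ z]) (auto simp: bundle_chart_def)
  qed
qed (auto simp: bundle_chart_def)

lemma bch_is_chart:
  assumes c: "c \<in> M"
  shows "is_chart (bch c)"
  unfolding is_chart_def
proof
  show "inj_on (map_ch (bch c)) (dom_ch (bch c))"
  proof (rule inj_onI)
    fix z z' assume z: "z \<in> dom_ch (bch c)" "z' \<in> dom_ch (bch c)" "map_ch (bch c) z = map_ch (bch c) z'"
    then have "base z' = base z" using is_chart_inj[OF maximal_chart[OF M c], of "base z'" "base z"] by (simp add: bundle_chart_def)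
    then show "z = z'" using z by (intro inj[OF c]) (simp_all add: bundle_chart_def)
  qed
  have "img_ch (bch c) = img_ch c \<times> UNIV"
    using bch_image[OF c, of UNIV] by (simp add: img_ch_def)
  then show "open (img_ch (bch c))" using open_img_ch[OF maximal_chart[OF M c]] by (simp add: open_Times)
qed

lemma bch_atlas: "is_atlas (bch ` M)"
proof -
  have "smooth_transition (bch c) (bch d)" if c: "c \<in> M" and d: "d \<in> M" for c d
  proof -
    let ?O = "map_ch c ` (dom_ch c \<inter> dom_ch d)"
    have "dom_ch (bch c) \<inter> dom_ch (bch d) = dom_ch (bch c) \<inter> {z. base z \<in> dom_ch d}" by (auto simp: bundle_chart_def)
    then have I: "map_ch (bch c) ` (dom_ch (bch c) \<inter> dom_ch (bch d)) = ?O \<times> UNIV" using bch_image[OF c] by simp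
    have O: "open ?O" using transition_open[OF M c d] .
    have OU: "open (?O \<times> (UNIV :: 'f set))" using O by (simp add: open_Times)
    obtain A where A: "\<And>z. z \<in> E \<Longrightarrow> base z \<in> dom_ch c \<Longrightarrow> base z \<in> dom_ch d \<Longrightarrow> fib d z = A (map_ch c (base z)) (fib c z)"
      "\<And>x. x \<in> ?O \<Longrightarrow> linear (A x)" "\<And>b. smooth_on ?O (\<lambda>x. A x b)" using trans[OF c d] by blast
    have "smooth_on (?O \<times> UNIV) (map_ch (bch d) \<circ> inv_ch (bch c))"
    proof (rule smooth_on_cong[OF OU])
      show "smooth_on (?O \<times> UNIV) (\<lambda>y. ((map_ch d \<circ> inv_ch c) (fst y), A (fst y) (snd y)))"
      proof (rule smooth_on_Pair[OF OU])
        show "smooth_on (?O \<times> (UNIV :: 'f set)) (\<lambda>y. (map_ch d \<circ> inv_ch c) (fst y))"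
          by (rule smooth_on_compose[OF transition_smooth[OF M c d] smooth_on_fst[OF OU smooth_on_id[OF OU]] OU O]) auto
        show "smooth_on (?O \<times> UNIV) (\<lambda>y. A (fst y) (snd y))"
          by (rule smooth_on_linear_family[OF O A(2,3)])
      qed
      fix y assume "y \<in> ?O \<times> (UNIV :: 'f set)"
      then obtain z where z: "z \<in> dom_ch (bch c)" "z \<in> dom_ch (bch d)" "y = map_ch (bch c) z" unfolding I[symmetric] by blast
      have "base z \<in> dom_ch c" using z(1) by (simp add: bundle_chart_def)
      then show "((map_ch d \<circ> inv_ch c) (fst y), A (fst y) (snd y)) = (map_ch (bch d) \<circ> inv_ch (bch c)) y"
        using inv_ch_map[OF bch_is_chart[OF c] z(1)] z inv_ch_map[OF maximal_chart[OF M c], of "base z"] A(1)[of z]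
        by (simp add: bundle_chart_def)
    qed
    then show ?thesis using OU by (simp add: smooth_transition_def I)
  qed
  then show ?thesis unfolding is_atlas_def compatible_iff using bch_is_chart by blast
qed

lemma BM_maximal: "maximal_atlas BM"
  by (rule maximal_max_atlas[OF bch_atlas])

lemma bch_mem: "c \<in> M \<Longrightarrow> bch c \<in> BM"
  using atlas_subset_max[OF bch_atlas] by blast

lemma points_BM: "points BM = E"
proof -
  have "points BM = (\<Union>c\<in>M. {z \<in> E. base z \<in> dom_ch c})"
    unfolding points_max_atlas[OF bch_atlas] by (simp add: points_def bundle_chart_def)
  also have "\<dots> = E" using base unfolding points_def by blast
  finally show ?thesis .
qed

lemma img_bch: "c \<in> M \<Longrightarrow> img_ch (bch c) = img_ch c \<times> UNIV"
  using bch_image[of c UNIV] by (simp add: img_ch_def)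

text \<open>Admits fibre coordinates that do not come from coordinate vector fields. The case that
  matters is lowering an index with the metric.\<close>

lemma bch_change:
  assumes c: "c \<in> M" and A: "\<And>x. x \<in> img_ch c \<Longrightarrow> linear (A x)" "\<And>b. smooth_on (img_ch c) (\<lambda>x. A x b)"
    and B: "\<And>x. x \<in> img_ch c \<Longrightarrow> linear (B x)" "\<And>b. smooth_on (img_ch c) (\<lambda>x. B x b)"
    and AB: "\<And>x a. x \<in> img_ch c \<Longrightarrow> B x (A x a) = a" "\<And>x a. x \<in> img_ch c \<Longrightarrow> A x (B x a) = a"
  shows "({z \<in> E. base z \<in> dom_ch c}, \<lambda>z. (map_ch c (base z), A (map_ch c (base z)) (fib c z))) \<in> BM"
proof -
  let ?D = "{z \<in> E. base z \<in> dom_ch c}" and ?O = "img_ch c \<times> (UNIV :: 'f set)"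
  let ?m = "\<lambda>z. (map_ch c (base z), A (map_ch c (base z)) (fib c z))"
  have O: "open (img_ch c)" using open_img_ch[OF maximal_chart[OF M c]] .
  have OU: "open ?O" using O by (simp add: open_Times)
  have D: "?D = dom_ch (bch c)" by (simp add: bundle_chart_def)
  have I: "map_ch (bch c) ` ?D = ?O" using img_bch[OF c] unfolding img_ch_def[of "bch c"] D .
  have J: "?m ` ?D = ?O"
  proof
    show "?O \<subseteq> ?m ` ?D"
    proof
      fix y assume y: "y \<in> ?O"
      then obtain x a where xa: "y = (x, a)" "x \<in> img_ch c" by auto
      then have "(x, B x a) \<in> ?O" by simp
      then obtain z where z: "z \<in> ?D" "(x, B x a) = map_ch (bch c) z" unfolding I[symmetric] by blast
      then have "B x a = fib c z" "map_ch c (base z) = x" by (auto simp: bundle_chart_def)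
      then show "y \<in> ?m ` ?D" using z(1) xa AB(2)[of x a] by (intro image_eqI[of _ _ z]) simp_all
    qed
  qed (auto simp: img_ch_def)
  show ?thesis
  proof (rule chart_change[OF BM_maximal bch_mem[OF c], where \<phi> = "\<lambda>y. (fst y, A (fst y) (snd y))" and \<psi> = "\<lambda>y. (fst y, B (fst y) (snd y))"])
    show "smooth_on (map_ch (bch c) ` ?D) (\<lambda>y. (fst y, A (fst y) (snd y)))" unfolding I
      by (intro smooth_on_Pair smooth_on_fst smooth_on_id smooth_on_linear_family OU O A)
    show "smooth_on (?m ` ?D) (\<lambda>y. (fst y, B (fst y) (snd y)))" unfolding J
      by (intro smooth_on_Pair smooth_on_fst smooth_on_id smooth_on_linear_family OU O B)
    show "(fst (?m z), B (fst (?m z)) (snd (?m z))) = map_ch (bch c) z" if "z \<in> ?D" for z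
      using AB(1)[OF map_ch_img[of "base z" c]] that by (simp add: bundle_chart_def)
  qed (use OU I J in \<open>simp_all add: bundle_chart_def\<close>)
qed

end

section \<open>Tangent and cotangent bundles\<close>

lemma linear_vec_expand:
  fixes f :: "real^'n \<Rightarrow> 'b::real_vector"
  assumes "linear f"
  shows "f w = (\<Sum>i\<in>UNIV. (w $ i) *\<^sub>R f (axis i 1))"
proof -
  have "f w = f (\<Sum>i\<in>UNIV. (w $ i) *\<^sub>R axis i 1)"
    using basis_expansion[of w] by (simp add: scalar_mult_eq_scaleR)
  then show ?thesis using assms by (simp add: linear_sum linear_cmul)
qed

locale manifold =
  fixes M :: "('a, real^'n) atlas"
  assumes M: "maximal_atlas M"
begin

lemma coord_vec_combine:
  assumes c: "c \<in> M" "p \<in> dom_ch c"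
  shows "coord_vec M c p (r *\<^sub>R a + s *\<^sub>R b) = tadd (tscale r (coord_vec M c p a)) (tscale s (coord_vec M c p b))"
  by (rule tangent_eqI[OF M _ _ c])
     (simp_all add: c coord_vec_tangent[OF M] tadd_tangent[OF M] tscale_tangent[OF M], simp add: tadd_def tscale_def c coord_vec_self[OF M])

lemma cotangent_coord:
  assumes \<alpha>: "\<alpha> \<in> cotangent_space M p" and c: "c \<in> M" "p \<in> dom_ch c"
  shows "\<alpha> (coord_vec M c p w) = w \<bullet> (\<chi> i. \<alpha> (coord_vec M c p (axis i 1)))"
proof -
  have *: "\<alpha> (coord_vec M c p (r *\<^sub>R a + s *\<^sub>R b)) = r * \<alpha> (coord_vec M c p a) + s * \<alpha> (coord_vec M c p b)" for r s a b
    unfolding coord_vec_combine[OF c] using \<alpha> coord_vec_tangent[OF M c] unfolding cotangent_space_def by blast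
  have "linear (\<lambda>w. \<alpha> (coord_vec M c p w))"
    by (rule linearI) (use *[of 1 _ 1] *[of _ _ 0 0] in simp_all)
  from linear_vec_expand[OF this, of w] show ?thesis by (simp add: inner_vec_def)
qed

lemma cotangent_coord_tangent:
  assumes \<alpha>: "\<alpha> \<in> cotangent_space M p" and c: "c \<in> M" "p \<in> dom_ch c" and v: "v \<in> tangent_space M p"
  shows "\<alpha> v = v c \<bullet> (\<chi> i. \<alpha> (coord_vec M c p (axis i 1)))"
  using cotangent_coord[OF \<alpha> c, of "v c"] tangent_eq_coord_vec[OF M v c] by simp

abbreviation "TE \<equiv> Sigma (points M) (tangent_space M)"
abbreviation "TE2 \<equiv> {w. fst w \<in> TE \<and> snd w \<in> TE \<and> fst (fst w) = fst (snd w)}"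
abbreviation "CE \<equiv> Sigma (points M) (cotangent_space M)"

sublocale TM: fibre_bundle M TE fst "\<lambda>c z. snd z c"
proof
  fix c p a assume c: "c \<in> M" "p \<in> dom_ch c"
  show "\<exists>z\<in>TE. fst z = p \<and> snd z c = a"
    using coord_vec_tangent[OF M c, of a] coord_vec_self[OF M c, of a] pointsI[OF c]
    by (intro bexI[of _ "(p, coord_vec M c p a)"]) simp_all
next
  fix c and z z' :: "('a, real^'n) tpoint"
  assume c: "c \<in> M" and z: "z \<in> TE" "z' \<in> TE" "fst z \<in> dom_ch c" "fst z' = fst z" "snd z c = snd z' c"
  obtain p v v' where zz: "z = (p, v)" "z' = (p, v')" using z(4) by (metis prod.collapse)
  have "v = v'" by (rule tangent_eqI[OF M _ _ c, of _ p]) (use z in \<open>simp_all add: zz\<close>)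
  then show "z = z'" by (simp add: zz)
next
  fix c d assume c: "c \<in> M" and d: "d \<in> M"
  show "\<exists>A. (\<forall>z\<in>TE. fst z \<in> dom_ch c \<longrightarrow> fst z \<in> dom_ch d \<longrightarrow> snd z d = A (map_ch c (fst z)) (snd z c)) \<and>
      (\<forall>x\<in>map_ch c ` (dom_ch c \<inter> dom_ch d). linear (A x)) \<and> (\<forall>b. smooth_on (map_ch c ` (dom_ch c \<inter> dom_ch d)) (\<lambda>x. A x b))"
    using tangent_space_change[OF M _ c _ d] tangent_linear[OF M c d] smooth_on_fder[OF transition_smooth[OF M c d]]
    by (intro exI[of _ "fder (map_ch d \<circ> inv_ch c)"]) auto
qed (use M in auto)

sublocale TT: fibre_bundle M TE2 "\<lambda>w. fst (fst w)" "\<lambda>c w. (snd (fst w) c, snd (snd w) c)"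
proof
  fix c p a assume c: "c \<in> M" "p \<in> dom_ch c"
  show "\<exists>z\<in>TE2. fst (fst z) = p \<and> (snd (fst z) c, snd (snd z) c) = a"
    using coord_vec_tangent[OF M c] coord_vec_self[OF M c] pointsI[OF c]
    by (intro bexI[of _ "((p, coord_vec M c p (fst a)), (p, coord_vec M c p (snd a)))"]) simp_all
next
  fix c and z z' :: "('a, real^'n) tpoint2"
  assume z: "c \<in> M" "z \<in> TE2" "z' \<in> TE2" "fst (fst z) \<in> dom_ch c" "fst (fst z') = fst (fst z)"
    "(snd (fst z) c, snd (snd z) c) = (snd (fst z') c, snd (snd z') c)"
  have "fst z = fst z'" by (rule TM.inj[of c]) (use z in simp_all)
  moreover have "snd z = snd z'" by (rule TM.inj[of c]) (use z in simp_all)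
  ultimately show "z = z'" by (rule prod_eqI)
next
  fix c d assume c: "c \<in> M" and d: "d \<in> M"
  let ?O = "map_ch c ` (dom_ch c \<inter> dom_ch d)" and ?t = "map_ch d \<circ> inv_ch c"
  let ?A = "\<lambda>x a. (fder ?t x (fst a), fder ?t x (snd a))"
  have o: "open ?O" using transition_open[OF M c d] .
  have "\<forall>z\<in>TE2. fst (fst z) \<in> dom_ch c \<longrightarrow> fst (fst z) \<in> dom_ch d \<longrightarrow>
      (snd (fst z) d, snd (snd z) d) = ?A (map_ch c (fst (fst z))) (snd (fst z) c, snd (snd z) c)"
    using tangent_space_change[OF M _ c _ d] by auto
  moreover have "linear (?A x)" if x: "x \<in> ?O" for x
  proof -
    have l: "linear (fder ?t x)" using tangent_linear[OF M c d] x by blast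
    show ?thesis by (rule linearI) (simp_all add: linear_add[OF l] linear_cmul[OF l] del: comp_apply)
  qed
  moreover have "smooth_on ?O (\<lambda>x. ?A x b)" for b
    by (intro smooth_on_Pair o smooth_on_fder transition_smooth[OF M c d])
  ultimately show "\<exists>A. (\<forall>z\<in>TE2. fst (fst z) \<in> dom_ch c \<longrightarrow> fst (fst z) \<in> dom_ch d \<longrightarrow>
         (snd (fst z) d, snd (snd z) d) = A (map_ch c (fst (fst z))) (snd (fst z) c, snd (snd z) c)) \<and>
      (\<forall>x\<in>?O. linear (A x)) \<and> (\<forall>b. smooth_on ?O (\<lambda>x. A x b))"
    by (intro exI[of _ ?A]) blast
qed (use M in auto)

sublocale CM: fibre_bundle M CE fst "\<lambda>c z. (\<chi> i. snd z (coord_vec M c (fst z) (axis i 1))) :: real^'n"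
proof
  fix c p and a :: "real^'n" assume c: "c \<in> M" "p \<in> dom_ch c"
  \<comment> \<open>The covector with prescribed components, cut off to \<open>0\<close> outside the
    tangent space as the definition of \<open>cotangent_space\<close> demands.\<close>
  let ?\<alpha> = "\<lambda>v. if v \<in> tangent_space M p then v c \<bullet> a else 0"
  have t: "tadd (tscale r u) (tscale s v) \<in> tangent_space M p" if "u \<in> tangent_space M p" "v \<in> tangent_space M p" for r s u v
    by (rule tadd_tangent[OF M tscale_tangent[OF M that(1)] tscale_tangent[OF M that(2)]])
  have "?\<alpha> \<in> cotangent_space M p"
    unfolding cotangent_space_def by (simp add: t) (simp add: tadd_def tscale_def inner_add_left)
  moreover have "(\<chi> i. ?\<alpha> (coord_vec M c p (axis i 1))) = a"
    by (simp add: coord_vec_tangent[OF M c] coord_vec_self[OF M c]) (simp add: vec_eq_iff inner_axis')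
  ultimately show "\<exists>z\<in>CE. fst z = p \<and> (\<chi> i. snd z (coord_vec M c (fst z) (axis i 1))) = a"
    using pointsI[OF c] by (intro bexI[of _ "(p, ?\<alpha>)"]) simp_all
next
  fix c and z z' :: "('a, real^'n) cpoint"
  assume c: "c \<in> M" and z: "z \<in> CE" "z' \<in> CE" "fst z \<in> dom_ch c" "fst z' = fst z" and
    e: "(\<chi> i. snd z (coord_vec M c (fst z) (axis i 1))) = ((\<chi> i. snd z' (coord_vec M c (fst z') (axis i 1))) :: real^'n)"
  obtain p \<alpha> \<beta> where zz: "z = (p, \<alpha>)" "z' = (p, \<beta>)" using z(4) by (metis prod.collapse)
  have m: "\<alpha> \<in> cotangent_space M p" "\<beta> \<in> cotangent_space M p" "p \<in> dom_ch c" using z by (simp_all add: zz)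
  have "\<alpha> v = \<beta> v" for v
  proof (cases "v \<in> tangent_space M p")
    case True
    then show ?thesis
      unfolding cotangent_coord_tangent[OF m(1) c m(3) True] cotangent_coord_tangent[OF m(2) c m(3) True]
      using e by (simp add: zz)
  next
    case False
    then show ?thesis using m unfolding cotangent_space_def by simp
  qed
  then show "z = z'" by (auto simp: zz)
next
  fix c d assume c: "c \<in> M" and d: "d \<in> M"
  let ?O = "map_ch c ` (dom_ch c \<inter> dom_ch d)" and ?t = "map_ch d \<circ> inv_ch c" and ?s = "map_ch c \<circ> inv_ch d"
  \<comment> \<open>Covectors change by the transposed Jacobian of the reverse transition
    \<open>?s\<close>, taken at the image point.\<close>
  let ?A = "\<lambda>x \<pi>. (\<chi> i. fder ?s (?t x) (axis i 1) \<bullet> \<pi>) :: real^'n"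
  have o: "open ?O" using transition_open[OF M c d] .
  have o': "open (map_ch d ` (dom_ch c \<inter> dom_ch d))" using transition_open[OF M d c] by (simp add: Int_commute)
  have im: "?t ` ?O \<subseteq> map_ch d ` (dom_ch c \<inter> dom_ch d)" using inv_ch_map[OF maximal_chart[OF M c]] by auto
  have "(\<chi> i. snd z (coord_vec M d (fst z) (axis i 1))) = ?A (map_ch c (fst z)) (\<chi> i. snd z (coord_vec M c (fst z) (axis i 1)))"
    if z: "z \<in> CE" "fst z \<in> dom_ch c" "fst z \<in> dom_ch d" for z
  proof -
    have "coord_vec M d (fst z) e = coord_vec M c (fst z) (fder ?s (map_ch d (fst z)) e)" for e
      using tangent_eq_coord_vec[OF M coord_vec_tangent[OF M d z(3)] c z(2), of e] coord_vec_other[OF M c z(2), of d e] by simp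
    then show ?thesis
      using cotangent_coord[OF _ c z(2)] z inv_ch_map[OF maximal_chart[OF M c]] by (auto simp: vec_eq_iff)
  qed
  moreover have "linear (?A x)" for x
    by (rule linearI) (simp_all add: vec_eq_iff inner_add_right)
  moreover have "smooth_on ?O (\<lambda>x. ?A x b)" for b
  proof (intro smooth_on_vec o)
    have s: "smooth_on (map_ch d ` (dom_ch c \<inter> dom_ch d)) ?s" using transition_smooth[OF M d c] by (simp add: Int_commute)
    show "smooth_on ?O (\<lambda>x. ?A x b $ i)" for i
      using smooth_on_inner[OF o smooth_on_compose[OF smooth_on_fder[OF s] transition_smooth[OF M c d] o o' im] smooth_on_const[OF o]]
      by simp
  qed
  ultimately show "\<exists>A. (\<forall>z\<in>CE. fst z \<in> dom_ch c \<longrightarrow> fst z \<in> dom_ch d \<longrightarrow>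
        (\<chi> i. snd z (coord_vec M d (fst z) (axis i 1))) = A (map_ch c (fst z)) (\<chi> i. snd z (coord_vec M c (fst z) (axis i 1)))) \<and>
      (\<forall>x\<in>?O. linear (A x)) \<and> (\<forall>b. smooth_on ?O (\<lambda>x. A x b :: real^'n))"
    by (intro exI[of _ ?A]) blast
qed (use M in auto)

section \<open>Identification with the bundles of the statement\<close>

lemma tangent_chart_bch: "c \<in> M \<Longrightarrow> tangent_chart M c = TM.bch c"
  unfolding tangent_chart_def bundle_chart_def by (auto simp: points_def)

lemma tangent_bundle_BM: "tangent_bundle M = TM.BM"
  unfolding tangent_bundle_def using tangent_chart_bch by (metis (no_types, lifting) image_cong)

lemma double_tangent_chart_bch: "c \<in> M \<Longrightarrow> double_tangent_chart M c = TT.bch c"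
  unfolding double_tangent_chart_def bundle_chart_def by (auto simp: points_def)

lemma double_tangent_bundle_BM: "double_tangent_bundle M = TT.BM"
  unfolding double_tangent_bundle_def using double_tangent_chart_bch by (metis (no_types, lifting) image_cong)

lemma cotangent_chart_bch: "c \<in> M \<Longrightarrow> cotangent_chart M c = CM.bch c"
  unfolding cotangent_chart_def bundle_chart_def by (auto simp: points_def)

lemma cotangent_bundle_BM: "cotangent_bundle M = CM.BM"
  unfolding cotangent_bundle_def using cotangent_chart_bch by (metis (no_types, lifting) image_cong)

section \<open>Smooth vector fields and functions in charts\<close>

lemma smooth_field_coord:
  assumes c: "c \<in> M" and F: "smooth_on (img_ch c) F"
  shows "smooth_field_on M (dom_ch c) (\<lambda>p. coord_vec M c p (F (map_ch c p)))"
  unfolding smooth_field_on_def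
proof (intro conjI ballI)
  fix d assume d: "d \<in> M"
  let ?O = "map_ch d ` (dom_ch c \<inter> dom_ch d)" and ?t = "map_ch d \<circ> inv_ch c" and ?s = "map_ch c \<circ> inv_ch d"
  let ?U = "map_ch c ` (dom_ch c \<inter> dom_ch d)"
  have o: "open ?O" "open ?U" using transition_open[OF M d c] transition_open[OF M c d] by (simp_all add: Int_commute)
  have s: "smooth_on ?O ?s" using transition_smooth[OF M d c] by (simp add: Int_commute)
  have im: "?s ` ?O \<subseteq> ?U" using inv_ch_map[OF maximal_chart[OF M d]] by auto
  have U: "?U \<subseteq> img_ch c" by (auto simp: img_ch_def)
  have 1: "smooth_on (?U \<times> (UNIV :: (real^'n) set)) (\<lambda>y. fder ?t (fst y) (snd y))"
    by (rule smooth_on_linear_family[OF o(2), where A = "fder ?t"]) (use tangent_linear[OF M c d] smooth_on_fder[OF transition_smooth[OF M c d]] in \<open>auto simp del: comp_apply\<close>)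
  have 2: "smooth_on ?O (\<lambda>x. (?s x, F (?s x)))"
    by (rule smooth_on_Pair[OF o(1) s smooth_on_compose[OF F s o(1) open_img_ch[OF maximal_chart[OF M c]]]]) (use im U in blast)
  have "smooth_on ?O (\<lambda>x. fder ?t (fst (?s x, F (?s x))) (snd (?s x, F (?s x))))"
    by (rule smooth_on_compose[OF 1 2 o(1)]) (use o(2) im in \<open>auto intro!: open_Times\<close>)
  then show "smooth_on ?O (\<lambda>x. coord_vec M c (inv_ch d x) (F (map_ch c (inv_ch d x))) d)"
  proof (rule smooth_on_cong[OF o(1), rotated])
    fix x assume "x \<in> ?O"
    then obtain p where p: "p \<in> dom_ch c" "p \<in> dom_ch d" "x = map_ch d p" by blast
    then show "fder ?t (fst (?s x, F (?s x))) (snd (?s x, F (?s x))) = coord_vec M c (inv_ch d x) (F (map_ch c (inv_ch d x))) d"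
      using inv_ch_map[OF maximal_chart[OF M d] p(2)] coord_vec_other[OF M d p(2)] by simp
  qed
qed (rule coord_vec_tangent[OF M c])

lemma smooth_field_on_subset:
  assumes V: "smooth_field_on M U V" and U: "openin (manifold_topology M) U" "openin (manifold_topology M) U'" "U' \<subseteq> U"
  shows "smooth_field_on M U' V"
  unfolding smooth_field_on_def
proof (intro conjI ballI)
  show "V p \<in> tangent_space M p" if "p \<in> U'" for p using V U(3) that unfolding smooth_field_on_def by blast
  show "smooth_on (map_ch c ` (U' \<inter> dom_ch c)) (\<lambda>x. V (inv_ch c x) c)" if c: "c \<in> M" for c
  proof (rule smooth_on_subset[OF _ openin_imp_open_image[OF M U(1) c] openin_imp_open_image[OF M U(2) c]])
    show "smooth_on (map_ch c ` (U \<inter> dom_ch c)) (\<lambda>x. V (inv_ch c x) c)" using V c unfolding smooth_field_on_def by blast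
  qed (use U(3) in blast)
qed

lemma smooth_field_component:
  "smooth_field_on M U V \<Longrightarrow> c \<in> M \<Longrightarrow> smooth_on (map_ch c ` (U \<inter> dom_ch c)) (\<lambda>x. V (inv_ch c x) c)"
  unfolding smooth_field_on_def by blast

lemma smooth_field_tangent: "smooth_field_on M U V \<Longrightarrow> p \<in> U \<Longrightarrow> V p \<in> tangent_space M p"
  unfolding smooth_field_on_def by blast

lemma smooth_field_tadd:
  assumes "smooth_field_on M U V" "smooth_field_on M U W" and U: "openin (manifold_topology M) U"
  shows "smooth_field_on M U (\<lambda>p. tadd (V p) (W p))"
  unfolding smooth_field_on_def
proof (intro conjI ballI)
  show "tadd (V p) (W p) \<in> tangent_space M p" if "p \<in> U" for p
    using tadd_tangent[OF M] smooth_field_tangent assms(1,2) that by blast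
  show "smooth_on (map_ch c ` (U \<inter> dom_ch c)) (\<lambda>x. tadd (V (inv_ch c x)) (W (inv_ch c x)) c)" if c: "c \<in> M" for c
    unfolding tadd_def
    by (intro smooth_on_add openin_imp_open_image[OF M U c] smooth_field_component[OF assms(1) c] smooth_field_component[OF assms(2) c])
qed

lemma smooth_field_tscale:
  assumes "smooth_fun_on M U f" "smooth_field_on M U W" and U: "openin (manifold_topology M) U"
  shows "smooth_field_on M U (\<lambda>p. tscale (f p) (W p))"
  unfolding smooth_field_on_def
proof (intro conjI ballI)
  show "tscale (f p) (W p) \<in> tangent_space M p" if "p \<in> U" for p
    using tscale_tangent[OF M] smooth_field_tangent[OF assms(2)] that by blast
  fix c assume c: "c \<in> M"
  have "smooth_on (map_ch c ` (U \<inter> dom_ch c)) (\<lambda>x. f (inv_ch c x))"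
    using assms(1) c unfolding smooth_fun_on_def o_def by blast
  then show "smooth_on (map_ch c ` (U \<inter> dom_ch c)) (\<lambda>x. tscale (f (inv_ch c x)) (W (inv_ch c x)) c)"
    unfolding tscale_def
    by (intro smooth_on_scaleR openin_imp_open_image[OF M U c] smooth_field_component[OF assms(2) c])
qed

lemma smooth_fun_onI:
  assumes c: "c \<in> M" and U: "openin (manifold_topology M) U" "U \<subseteq> dom_ch c" and f: "smooth_on (map_ch c ` U) (\<lambda>x. f (inv_ch c x))"
  shows "smooth_fun_on M U f"
  unfolding smooth_fun_on_def
proof
  fix d assume d: "d \<in> M"
  let ?O = "map_ch d ` (U \<inter> dom_ch d)" and ?s = "map_ch c \<circ> inv_ch d"
  have o: "open ?O" using openin_imp_open_image[OF M U(1) d] .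
  have oU: "open (map_ch c ` U)" using openin_imp_open_image[OF M U(1) c] U(2) by (simp add: Int_absorb2)
  have s: "smooth_on ?O ?s"
    by (rule smooth_on_subset[OF transition_smooth[OF M d c] transition_open[OF M d c] o]) (use U(2) in blast)
  have im: "?s ` ?O \<subseteq> map_ch c ` U" using inv_ch_map[OF maximal_chart[OF M d]] by auto
  show "smooth_on ?O (f \<circ> inv_ch d)"
  proof (rule smooth_on_cong[OF o _ smooth_on_compose[OF f s o oU im]])
    fix x assume "x \<in> ?O"
    then obtain p where p: "p \<in> U" "p \<in> dom_ch d" "x = map_ch d p" by blast
    then show "f (inv_ch c (?s x)) = (f \<circ> inv_ch d) x"
      using inv_ch_map[OF maximal_chart[OF M d] p(2)] inv_ch_map[OF maximal_chart[OF M c], of p] U(2) by auto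
  qed
qed

end

section \<open>Integral affine coordinates\<close>

lemma invertible_if_ker_zero:
  fixes A :: "real^'n^'n"
  assumes "\<And>x. A *v x = 0 \<Longrightarrow> x = 0"
  shows "invertible A"
  using assms matrix_left_invertible_ker[of A] by (simp add: invertible_left_inverse)

text \<open>Used to differentiate the congruence by which the Gram matrix changes under linear
  coordinates.\<close>

lemma linear_matrix_sandwich: "linear (\<lambda>X :: real^'n^'n. A ** (X ** B))"
  by (rule linearI)
     (simp_all add: vec_eq_iff matrix_matrix_mult_def sum.distrib distrib_left distrib_right sum_distrib_left sum_distrib_right mult_ac)

lemma matrix_inv_vec:
  fixes A :: "real^'n^'n"
  assumes "invertible A"
  shows "A *v (matrix_inv A *v x) = x" "matrix_inv A *v (A *v x) = x"
  using assms by (simp_all add: matrix_vector_mul_assoc matrix_inv_right matrix_inv_left)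

locale kaehler_lattice =
  fixes Y :: "('a, real^'n) atlas" and g :: "('a, real^'n) tensor2"
    and nabla :: "('a, real^'n) conn" and L :: "('a, real^'n) tpoint set"
  assumes kaehler: "affine_kaehler Y g nabla" and lattice: "integral_lattice Y nabla L"
begin

lemma Y_manifold: "smooth_manifold Y" and g_metric: "riemannian_metric Y g" and nabla_connection: "connection Y nabla"
  using kaehler unfolding affine_kaehler_def by blast+

lemma kaehler_chart:
  assumes "p \<in> points Y"
  obtains c K where "affine_chart Y nabla c" "p \<in> dom_ch c" "smooth_on (img_ch c) K"
    "\<And>x i j. x \<in> img_ch c \<Longrightarrow> tensor_comp Y g c x (axis i 1) (axis j 1) = partial i (partial j K) x"
  using kaehler assms unfolding affine_kaehler_def by metis

sublocale manifold Y
  by unfold_locales (rule smooth_manifold_maximal[OF Y_manifold])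

section \<open>The metric as a matrix function\<close>

lemma g_tensor: "tensor2_field Y g"
  using g_metric by (simp add: riemannian_metric_def)

lemma g_sym: "p \<in> points Y \<Longrightarrow> u \<in> tangent_space Y p \<Longrightarrow> v \<in> tangent_space Y p \<Longrightarrow> g p u v = g p v u"
  using g_metric unfolding riemannian_metric_def by blast

lemma g_pos: "p \<in> points Y \<Longrightarrow> u \<in> tangent_space Y p \<Longrightarrow> u \<noteq> tzero \<Longrightarrow> g p u u > 0"
  using g_metric unfolding riemannian_metric_def by blast

definition Gm :: "('a, real^'n) chart \<Rightarrow> real^'n \<Rightarrow> real^'n^'n" where
  "Gm c x = (\<chi> i j. tensor_comp Y g c x (axis i 1) (axis j 1))"

lemma tensor_comp_Gm:
  assumes c: "c \<in> Y" and x: "x \<in> img_ch c"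
  shows "tensor_comp Y g c x a b = a \<bullet> (Gm c x *v b)"
proof -
  have b: "bilinear (tensor_comp Y g c x)" using tensor2_field_rep(2)[OF M g_tensor c] x by (simp add: smooth_rep_def[OF M])
  have l1: "linear (\<lambda>a. tensor_comp Y g c x a b)" for b using b by (simp add: bilinear_def)
  have l2: "linear (\<lambda>b. tensor_comp Y g c x a b)" for a using b by (simp add: bilinear_def)
  have "tensor_comp Y g c x a b = (\<Sum>i\<in>UNIV. a $ i * (\<Sum>j\<in>UNIV. b $ j * tensor_comp Y g c x (axis i 1) (axis j 1)))"
    using linear_vec_expand[OF l1, of a b] linear_vec_expand[OF l2, of "axis _ 1" b] by simp
  then show ?thesis by (simp add: inner_vec_def matrix_vector_mult_def Gm_def mult.commute)
qed

lemma metric_Gm: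
  assumes "c \<in> Y" "p \<in> dom_ch c" "u \<in> tangent_space Y p" "v \<in> tangent_space Y p"
  shows "g p u v = u c \<bullet> (Gm c (map_ch c p) *v v c)"
  using tensor_repD[OF M tensor_rep_comp[OF M assms(1)] assms(2-4), of g] tensor_comp_Gm[OF assms(1) map_ch_img[OF assms(2)]]
  by simp

lemma Gm_smooth: "c \<in> Y \<Longrightarrow> smooth_on (img_ch c) (Gm c)"
  unfolding Gm_def
  by (intro smooth_on_vec open_img_ch maximal_chart[OF M]; simp)
     (use tensor2_field_rep(2)[OF M g_tensor] in \<open>simp add: smooth_rep_def[OF M]\<close>)

lemma Gm_sym:
  assumes c: "c \<in> Y" and x: "x \<in> img_ch c"
  shows "a \<bullet> (Gm c x *v b) = (Gm c x *v a) \<bullet> b"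
proof -
  let ?p = "inv_ch c x"
  note p = inv_ch_dom[OF x]
  have "g ?p (coord_vec Y c ?p a) (coord_vec Y c ?p b) = g ?p (coord_vec Y c ?p b) (coord_vec Y c ?p a)"
    by (rule g_sym[OF pointsI[OF c p] coord_vec_tangent[OF M c p] coord_vec_tangent[OF M c p]])
  then show ?thesis
    using metric_Gm[OF c p coord_vec_tangent[OF M c p] coord_vec_tangent[OF M c p]]
    by (simp add: coord_vec_self[OF M c p] map_inv_ch[OF x] inner_commute)
qed

lemma Gm_pos:
  assumes c: "c \<in> Y" and x: "x \<in> img_ch c" and a: "a \<noteq> 0"
  shows "a \<bullet> (Gm c x *v a) > 0"
proof -
  let ?p = "inv_ch c x"
  note p = inv_ch_dom[OF x]
  have "coord_vec Y c ?p a \<noteq> tzero" using coord_vec_self[OF M c p, of a] a by (auto simp: tzero_def)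
  then have "g ?p (coord_vec Y c ?p a) (coord_vec Y c ?p a) > 0"
    by (rule g_pos[OF pointsI[OF c p] coord_vec_tangent[OF M c p]])
  then show ?thesis
    using metric_Gm[OF c p coord_vec_tangent[OF M c p] coord_vec_tangent[OF M c p]]
    by (simp add: coord_vec_self[OF M c p] map_inv_ch[OF x])
qed

lemma Gm_invertible: "c \<in> Y \<Longrightarrow> x \<in> img_ch c \<Longrightarrow> invertible (Gm c x)"
  using Gm_pos[of c x] by (intro invertible_if_ker_zero) force

lemma Gm_nondegenerate:
  assumes "c \<in> Y" "x \<in> img_ch c" "\<And>e. e \<bullet> (Gm c x *v a) = e \<bullet> (Gm c x *v b)"
  shows "a = b"
proof -
  have "Gm c x *v a = Gm c x *v b" by (rule vector_eq_ldot[THEN iffD1]) (use assms(3) in blast)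
  then show ?thesis using matrix_inv_vec(2)[OF Gm_invertible[OF assms(1,2)]] by metis
qed

section \<open>The connection and its dual in affine coordinates\<close>

context
  fixes p U V u
  assumes U: "openin (manifold_topology Y) U" "p \<in> U" and V: "smooth_field_on Y U V" and u: "u \<in> tangent_space Y p"
begin

lemma nabla_tangent: "nabla p u V \<in> tangent_space Y p"
  using nabla_connection U V u unfolding connection_def by blast

lemma nabla_add: "smooth_field_on Y U W \<Longrightarrow> nabla p u (\<lambda>q. tadd (V q) (W q)) = tadd (nabla p u V) (nabla p u W)"
  using nabla_connection U V u unfolding connection_def by blast

lemma nabla_scale: "smooth_fun_on Y U f \<Longrightarrow>
    nabla p u (\<lambda>q. tscale (f q) (V q)) = tadd (tscale (fun_deriv Y p u f) (V p)) (tscale (f p) (nabla p u V))"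
  using nabla_connection U V u unfolding connection_def by blast

lemmas nabla_rules = nabla_connection[unfolded connection_def, THEN conjunct1, THEN spec, THEN spec, THEN spec,
    THEN mp, OF conjI[OF conjI[OF U] V], THEN bspec, OF u]

lemma nabla_local: "(\<And>q. q \<in> U \<Longrightarrow> W q = V q) \<Longrightarrow> nabla p u W = nabla p u V"
  using nabla_rules[THEN conjunct2, THEN conjunct2, THEN conjunct2, THEN conjunct2, THEN spec, of W] by blast

end

text \<open>On the intersection with the chart domain, \<open>V\<close> is the sum of its components
  times parallel coordinate fields. The Leibniz rule then leaves only the derivatives of the
  components, and locality of the connection transfers the result back to \<open>V\<close>.\<close>

lemma nabla_component:
  assumes aff: "affine_chart Y nabla c" and p: "p \<in> dom_ch c"
    and U: "openin (manifold_topology Y) U" "p \<in> U" and V: "smooth_field_on Y U V" and u: "u \<in> tangent_space Y p"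
  shows "nabla p u V c = fder (\<lambda>x. V (inv_ch c x) c) (map_ch c p) (u c)"
proof -
  have c: "c \<in> Y" using aff by (simp add: affine_chart_def)
  let ?U = "U \<inter> dom_ch c" and ?e = "\<lambda>i q. coord_vec Y c q (axis i 1)" and ?f = "\<lambda>i q. V q c $ i"
  have oc: "openin (manifold_topology Y) (dom_ch c)" using openin_dom_ch[OF M c] .
  have U': "openin (manifold_topology Y) ?U" "p \<in> ?U" using openin_Int[OF U(1) oc] U(2) p by auto
  have V': "smooth_field_on Y ?U V" using smooth_field_on_subset[OF V U(1) U'(1)] by blast
  have e: "smooth_field_on Y ?U (?e i)" for i
    using smooth_field_on_subset[OF _ oc U'(1)] aff by (simp add: affine_chart_def parallel_on_def)
  have e0: "nabla p u (?e i) = tzero" for i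
    using aff p u by (simp add: affine_chart_def parallel_on_def)
  have im: "map_ch c ` ?U = map_ch c ` (?U \<inter> dom_ch c)" by (simp add: Int_assoc)
  have oim: "open (map_ch c ` ?U)" by (subst im) (rule openin_imp_open_image[OF M U'(1) c])
  have cV: "smooth_on (map_ch c ` ?U) (\<lambda>x. V (inv_ch c x) c)" by (subst im) (rule smooth_field_component[OF V' c])
  have f: "smooth_fun_on Y ?U (?f i)" for i
    by (rule smooth_fun_onI[OF c U'(1) _ smooth_on_vec_nth[OF oim cV]]) simp
  have z: "smooth_fun_on Y ?U (\<lambda>q. 0)"
    by (rule smooth_fun_onI[OF c U'(1) _ smooth_on_const[OF oim]]) simp
  have fz: "fun_deriv Y p u (\<lambda>q. 0) = 0"
    by (rule fun_deriv_eq[OF M c p open_UNIV _ _ _ u, where F = "\<lambda>x. 0" and F' = "\<lambda>x. 0"]) auto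
  have hV: "((\<lambda>x. V (inv_ch c x) c) has_derivative fder (\<lambda>x. V (inv_ch c x) c) (map_ch c p)) (at (map_ch c p))"
    by (rule smooth_on_has_derivative[OF cV oim imageI[OF U'(2)]])
  have ff: "fun_deriv Y p u (?f i) = fder (\<lambda>x. V (inv_ch c x) c) (map_ch c p) (u c) $ i" for i
    by (rule fun_deriv_eq[OF M c p open_UNIV _ _ bounded_linear.has_derivative[OF bounded_linear_vec_nth hV] u]) auto
  let ?S = "\<lambda>I q d. \<Sum>i\<in>I. ?f i q *\<^sub>R ?e i q d"
  have S: "smooth_field_on Y ?U (?S I) \<and> nabla p u (?S I) c = (\<Sum>i\<in>I. fun_deriv Y p u (?f i) *\<^sub>R axis i 1)"
    if "finite I" for I
    using that
  proof (induction I rule: finite_induct)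
    case empty
    \<comment> \<open>The axioms of a connection do not mention the zero field, so it is written as
      \<open>0\<close> times a coordinate field and the Leibniz rule applies.\<close>
    have eq: "?S {} = (\<lambda>q. tscale 0 (?e undefined q))" by (simp add: tscale_def)
    show ?case unfolding eq nabla_scale[OF U' e u z] using smooth_field_tscale[OF z e U'(1)]
      by (simp add: tadd_def tscale_def fz)
  next
    case (insert i I)
    have eq: "?S (insert i I) = (\<lambda>q. tadd (tscale (?f i q) (?e i q)) (?S I q))"
      using insert by (simp add: tadd_def tscale_def)
    have s: "smooth_field_on Y ?U (\<lambda>q. tscale (?f i q) (?e i q))" using smooth_field_tscale[OF f e U'(1)] .
    show ?case unfolding eq nabla_add[OF U' s u conjunct1[OF insert.IH]] nabla_scale[OF U' e u f] e0
      using smooth_field_tadd[OF s conjunct1[OF insert.IH] U'(1)] insert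
      by (simp add: tadd_def tscale_def tzero_def coord_vec_self[OF M c p])
  qed
  have VS: "V q = ?S UNIV q" if q: "q \<in> ?U" for q
  proof (rule tangent_eqI[OF M _ _ c])
    show "V q \<in> tangent_space Y q" "?S UNIV q \<in> tangent_space Y q"
      using smooth_field_tangent V' S[OF finite] q by blast+
    show "V q c = ?S UNIV q c"
      using q coord_vec_self[OF M c, of q] basis_expansion[of "V q c"] by (simp add: scalar_mult_eq_scaleR)
  qed (use q in auto)
  have "nabla p u V = nabla p u (?S UNIV)"
    by (rule nabla_local[OF U' conjunct1[OF S[OF finite]] u VS])
  then show ?thesis
    using conjunct2[OF S[OF finite]] basis_expansion[of "fder (\<lambda>x. V (inv_ch c x) c) (map_ch c p) (u c)"]
    by (simp add: ff scalar_mult_eq_scaleR)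
qed

text \<open>For the lowered components \<open>G V\<close> the defining identity says that the dual
  connection is plain differentiation: the derivative of \<open>W \<bullet> G V\<close> splits into
  \<open>g(\<nabla> W, V)\<close> and the derivative of \<open>G V\<close> paired with
  \<open>W\<close>. Raising the index gives the formula.\<close>

lemma dual_connection_eq:
  assumes aff: "affine_chart Y nabla c" and p: "p \<in> dom_ch c"
    and U: "openin (manifold_topology Y) U" "p \<in> U" and V: "smooth_field_on Y U V" and u: "u \<in> tangent_space Y p"
  shows "dual_connection Y g nabla p u V =
    coord_vec Y c p (matrix_inv (Gm c (map_ch c p)) *v fder (\<lambda>x. Gm c x *v V (inv_ch c x) c) (map_ch c p) (u c))"
    (is "_ = ?z")
proof -
  have c: "c \<in> Y" using aff by (simp add: affine_chart_def)
  have oc: "openin (manifold_topology Y) (dom_ch c)" using openin_dom_ch[OF M c] .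
  note x = map_ch_img[OF p]
  let ?w = "\<lambda>x. Gm c x *v V (inv_ch c x) c"
  have zT: "?z \<in> tangent_space Y p" using coord_vec_tangent[OF M c p] .
  have main: "fun_deriv Y p u (\<lambda>q. g q (W q) (V q)) = g p (nabla p u W) (V p) + g p (W p) ?z"
    if U: "openin (manifold_topology Y) U" "p \<in> U" and V: "smooth_field_on Y U V" and W: "smooth_field_on Y U W" for U W
  proof -
    let ?O = "map_ch c ` (U \<inter> dom_ch c)"
    have o: "open ?O" "map_ch c p \<in> ?O" using openin_imp_open_image[OF M U(1) c] U(2) p by auto
    have Oc: "?O \<subseteq> img_ch c" by (auto simp: img_ch_def)
    have sw: "smooth_on ?O ?w"
      by (intro smooth_on_matrix_vector_mult o smooth_field_component[OF V c]
          smooth_on_subset[OF Gm_smooth[OF c] open_img_ch[OF maximal_chart[OF M c]] o(1) Oc])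
    note hw = smooth_on_has_derivative[OF sw o]
    note hW = smooth_on_has_derivative[OF smooth_field_component[OF W c] o]
    have "fun_deriv Y p u (\<lambda>q. g q (W q) (V q)) =
      W p c \<bullet> fder ?w (map_ch c p) (u c) + fder (\<lambda>x. W (inv_ch c x) c) (map_ch c p) (u c) \<bullet> ?w (map_ch c p)"
    proof (rule fun_deriv_eq[OF M c p o, where F = "\<lambda>x. W (inv_ch c x) c \<bullet> ?w x"])
      show "((\<lambda>x. W (inv_ch c x) c \<bullet> ?w x) has_derivative (\<lambda>v. W p c \<bullet> fder ?w (map_ch c p) v +
          fder (\<lambda>x. W (inv_ch c x) c) (map_ch c p) v \<bullet> ?w (map_ch c p))) (at (map_ch c p))"
        using has_derivative_inner[OF hW hw] inv_ch_map[OF maximal_chart[OF M c] p] by simp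
      show "g (inv_ch c x) (W (inv_ch c x)) (V (inv_ch c x)) = W (inv_ch c x) c \<bullet> ?w x" if "x \<in> ?O" "x \<in> img_ch c" for x
      proof -
        have "inv_ch c x \<in> U" "inv_ch c x \<in> dom_ch c"
          using that overlap_iff[OF maximal_chart[OF M c], of x U] inv_ch_dom[of x c] by (auto simp: Int_commute)
        then show ?thesis
          using metric_Gm[OF c _ smooth_field_tangent[OF W] smooth_field_tangent[OF V]] map_inv_ch[OF that(2)] by simp
      qed
    qed (rule u)
    moreover have "g p (nabla p u W) (V p) = fder (\<lambda>x. W (inv_ch c x) c) (map_ch c p) (u c) \<bullet> ?w (map_ch c p)"
      using metric_Gm[OF c p nabla_tangent[OF U W u] smooth_field_tangent[OF V U(2)]] nabla_component[OF aff p U W u]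
        inv_ch_map[OF maximal_chart[OF M c] p] by simp
    moreover have "g p (W p) ?z = W p c \<bullet> fder ?w (map_ch c p) (u c)"
      using metric_Gm[OF c p smooth_field_tangent[OF W U(2)] zT] matrix_inv_vec(1)[OF Gm_invertible[OF c x]]
      by (simp add: coord_vec_self[OF M c p])
    ultimately show ?thesis by simp
  qed
  \<comment> \<open>Uniqueness for the definite description: constant coordinate fields are enough
    test fields because the metric is nondegenerate.\<close>
  have "z = ?z" if z: "z \<in> tangent_space Y p" and
    zz: "\<And>U W. openin (manifold_topology Y) U \<Longrightarrow> p \<in> U \<Longrightarrow> smooth_field_on Y U V \<Longrightarrow> smooth_field_on Y U W \<Longrightarrow>
      fun_deriv Y p u (\<lambda>q. g q (W q) (V q)) = g p (nabla p u W) (V p) + g p (W p) z" for z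
  proof (rule tangent_eqI[OF M z zT c p], rule Gm_nondegenerate[OF c x])
    fix e
    let ?W = "\<lambda>q. coord_vec Y c q e" and ?U = "U \<inter> dom_ch c"
    have U': "openin (manifold_topology Y) ?U" "p \<in> ?U" using openin_Int[OF U(1) oc] U(2) p by auto
    have V': "smooth_field_on Y ?U V" using smooth_field_on_subset[OF V U(1) U'(1)] by blast
    have W: "smooth_field_on Y ?U ?W"
      using smooth_field_on_subset[OF smooth_field_coord[OF c smooth_on_const] oc U'(1)] open_img_ch[OF maximal_chart[OF M c]] by blast
    have "g p (?W p) z = g p (?W p) ?z"
      using main[OF U' V' W] zz[OF U' V' W] by simp
    then show "e \<bullet> (Gm c (map_ch c p) *v z c) = e \<bullet> (Gm c (map_ch c p) *v ?z c)"
      using metric_Gm[OF c p coord_vec_tangent[OF M c p] z] metric_Gm[OF c p coord_vec_tangent[OF M c p] zT]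
      by (simp add: coord_vec_self[OF M c p])
  qed
  then show ?thesis
    unfolding dual_connection_def using zT main by (intro the_equality) blast+
qed

section \<open>Charts adapted to the potential and to the lattice\<close>

definition ichart :: "('a, real^'n) chart \<Rightarrow> bool" where
  "ichart c \<longleftrightarrow> affine_chart Y nabla c \<and>
     (\<forall>x\<in>img_ch c. \<forall>u v. fder (Gm c) x u *v v = fder (Gm c) x v *v u) \<and>
     (\<forall>p\<in>dom_ch c. \<forall>v. (p, v) \<in> L \<longleftrightarrow> v \<in> tangent_space Y p \<and> (\<forall>i. v c $ i \<in> \<int>))"

text \<open>The entries of the derivative of \<open>G\<close> are third derivatives of
  \<open>K\<close>, hence symmetric in all indices. Of the potential only this symmetry is kept in
  \<open>ichart\<close>, since it survives linear coordinate changes and is all that the later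
  computations use.\<close>

lemma hessian_derivative_symmetric:
  assumes c: "c \<in> Y" and K: "smooth_on (img_ch c) K"
    "\<And>x i j. x \<in> img_ch c \<Longrightarrow> tensor_comp Y g c x (axis i 1) (axis j 1) = partial i (partial j K) x"
    and x: "x \<in> img_ch c"
  shows "fder (Gm c) x u *v v = fder (Gm c) x v *v u"
proof -
  let ?e = "\<lambda>i. axis i 1 :: real^'n"
  have o: "open (img_ch c)" using open_img_ch[OF maximal_chart[OF M c]] .
  have dG: "Gm c differentiable at x" using smooth_on_differentiable[OF Gm_smooth[OF c] o x] .
  define T where "T i j k = fder (\<lambda>y. fder (\<lambda>z. fder K z (?e i)) y (?e j)) x (?e k)" for i j k
  have T: "T i j k = T i k j" for i j k
    unfolding T_def by (rule fder_fder_symmetric[OF smooth_on_fder[OF K(1)] o x])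
  have G: "fder (Gm c) x (?e k) $ i $ j = T i j k" for i j k
  proof -
    have h: "((\<lambda>y. Gm c y $ i $ j) has_derivative (\<lambda>v. fder (Gm c) x v $ i $ j)) (at x)"
      by (intro bounded_linear.has_derivative[OF bounded_linear_vec_nth] has_fder dG)
    have "((\<lambda>y. fder (\<lambda>z. fder K z (?e i)) y (?e j)) has_derivative (\<lambda>v. fder (Gm c) x v $ i $ j)) (at x)"
    proof (rule has_derivative_transform_within_open[OF h o x])
      fix y assume y: "y \<in> img_ch c"
      have "Gm c y $ i $ j = fder (\<lambda>z. fder K z (?e j)) y (?e i)"
        using K(2)[OF y] by (simp add: Gm_def partial_def[abs_def])
      then show "Gm c y $ i $ j = fder (\<lambda>z. fder K z (?e i)) y (?e j)"
        using fder_fder_symmetric[OF K(1) o y] by metis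
    qed
    then show ?thesis unfolding T_def using fder_eq by metis
  qed
  have E: "(fder (Gm c) x u *v v) $ i = (\<Sum>k\<in>UNIV. \<Sum>j\<in>UNIV. u $ k * v $ j * T i j k)" for i u v
  proof -
    have "fder (Gm c) x u = (\<Sum>k\<in>UNIV. (u $ k) *\<^sub>R fder (Gm c) x (?e k))"
      by (rule linear_vec_expand[OF linear_fder[OF dG]])
    then have "(fder (Gm c) x u *v v) $ i = (\<Sum>j\<in>UNIV. (\<Sum>k\<in>UNIV. u $ k * T i j k) * v $ j)"
      by (simp add: matrix_vector_mult_def G)
    also have "\<dots> = (\<Sum>j\<in>UNIV. \<Sum>k\<in>UNIV. u $ k * v $ j * T i j k)"
      by (simp add: sum_distrib_right sum_distrib_left mult_ac)
    finally show ?thesis by (subst sum.swap) simp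
  qed
  have "(fder (Gm c) x u *v v) $ i = (fder (Gm c) x v *v u) $ i" for i
  proof -
    have "(\<Sum>k\<in>UNIV. \<Sum>j\<in>UNIV. u $ k * v $ j * T i j k) = (\<Sum>j\<in>UNIV. \<Sum>k\<in>UNIV. v $ j * u $ k * T i k j)"
      by (subst sum.swap) (simp add: T mult_ac)
    then show ?thesis by (simp add: E)
  qed
  then show ?thesis by (simp add: vec_eq_iff)
qed

text \<open>In an affine chart parallel means zero derivative of the components; convexity of
  \<open>B\<close> turns this into constancy.\<close>

lemma parallel_section_constant:
  assumes aff: "affine_chart Y nabla c" and s: "parallel_on Y nabla U s" and U: "openin (manifold_topology Y) U"
    and B: "B \<subseteq> map_ch c ` (U \<inter> dom_ch c)" "convex B" "open B"
  shows "\<exists>b. \<forall>x\<in>B. s (inv_ch c x) c = b"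
proof -
  have c: "c \<in> Y" using aff by (simp add: affine_chart_def)
  have ss: "smooth_field_on Y U s" using s by (simp add: parallel_on_def)
  have "((\<lambda>x. s (inv_ch c x) c) has_derivative (\<lambda>h. 0)) (at x within B)" if x: "x \<in> B" for x
  proof -
    let ?O = "map_ch c ` (U \<inter> dom_ch c)"
    have xO: "x \<in> ?O" using x B by blast
    obtain p where p: "p \<in> U" "p \<in> dom_ch c" "x = map_ch c p" using xO by blast
    have h: "((\<lambda>x. s (inv_ch c x) c) has_derivative fder (\<lambda>x. s (inv_ch c x) c) x) (at x)"
      by (rule smooth_on_has_derivative[OF smooth_field_component[OF ss c] openin_imp_open_image[OF M U c] xO])
    have "fder (\<lambda>x. s (inv_ch c x) c) x v = 0" for v
    proof -
      have t: "coord_vec Y c p v \<in> tangent_space Y p" using coord_vec_tangent[OF M c p(2)] .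
      have "nabla p (coord_vec Y c p v) s = tzero" using s p t by (simp add: parallel_on_def)
      then show ?thesis using nabla_component[OF aff p(2) U p(1) ss t] p(3)
        by (simp add: coord_vec_self[OF M c p(2)] tzero_def)
    qed
    then have "fder (\<lambda>x. s (inv_ch c x) c) x = (\<lambda>h. 0)" by (rule ext)
    then show ?thesis using h has_derivative_at_withinI by metis
  qed
  from has_derivative_zero_constant[OF B(2) this] show ?thesis by metis
qed

text \<open>A parallel basis of the lattice has constant components \<open>b i\<close> in an affine
  chart. The linear coordinate change that sends the \<open>b i\<close> to the standard basis makes
  the lattice \<open>\<int>\<^sup>n\<close> and keeps the chart affine.\<close>

lemma ichart_ex:
  assumes p: "p \<in> points Y"
  obtains c where "ichart c" "p \<in> dom_ch c"
proof -
  obtain c0 K where aff: "affine_chart Y nabla c0" and p0: "p \<in> dom_ch c0" and K: "smooth_on (img_ch c0) K"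
    "\<And>x i j. x \<in> img_ch c0 \<Longrightarrow> tensor_comp Y g c0 x (axis i 1) (axis j 1) = partial i (partial j K) x"
    using kaehler_chart[OF p] by metis
  have c0: "c0 \<in> Y" using aff by (simp add: affine_chart_def)
  note cc0 = maximal_chart[OF M c0]
  obtain U and s :: "'n \<Rightarrow> 'a \<Rightarrow> ('a, real^'n) tvec" where
    Us: "open_nbhd Y p U \<and> (\<forall>i. parallel_on Y nabla U (s i)) \<and>
        (\<forall>q\<in>U. (\<forall>r. tcomb r (\<lambda>i. s i q) = tzero \<longrightarrow> (\<forall>i. r i = 0)) \<and>
                {v. (q, v) \<in> L} = {tcomb k (\<lambda>i. s i q) | k. \<forall>i. k i \<in> \<int>})"
    using lattice[unfolded integral_lattice_def, THEN conjunct2, THEN bspec, OF p] by blast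
  have U: "openin (manifold_topology Y) U" "p \<in> U" and s: "\<And>i. parallel_on Y nabla U (s i)"
    using Us by auto
  have ind: "r i = 0" if "q \<in> U" "tcomb r (\<lambda>i. s i q) = tzero" for q r i
    using Us[THEN conjunct2, THEN conjunct2, THEN bspec, OF that(1)] that(2) by blast
  have Lq: "{v. (q, v) \<in> L} = {tcomb k (\<lambda>i. s i q) | k. \<forall>i. k i \<in> \<int>}" if "q \<in> U" for q
    using Us[THEN conjunct2, THEN conjunct2, THEN bspec, OF that] by blast
  have sT: "s i q \<in> tangent_space Y q" if "q \<in> U" for i q
    using s smooth_field_tangent that unfolding parallel_on_def by blast
  let ?O = "map_ch c0 ` (U \<inter> dom_ch c0)"
  \<comment> \<open>Shrinking to a ball supplies the convex set on which the sections have constant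
    components.\<close>
  obtain r where r: "r > 0" "ball (map_ch c0 p) r \<subseteq> ?O"
    using openin_imp_open_image[OF M U(1) c0] U(2) p0 by (metis IntI imageI openE)
  let ?B = "ball (map_ch c0 p) r"
  have "\<exists>b. \<forall>x\<in>?B. s i (inv_ch c0 x) c0 = b" for i
    by (rule parallel_section_constant[OF aff s U(1) r(2)]) simp_all
  then obtain b where b: "\<And>i x. x \<in> ?B \<Longrightarrow> s i (inv_ch c0 x) c0 = b i" by metis
  \<comment> \<open>The columns are the lattice basis, so the new coordinates are
    \<open>matrix_inv A\<close> applied to the old ones.\<close>
  define A :: "real^'n^'n" where "A = (\<chi> k i. b i $ k)"
  have Av: "A *v w = (\<Sum>i\<in>UNIV. (w $ i) *\<^sub>R b i)" for w
    by (simp add: A_def matrix_vector_mult_def vec_eq_iff mult.commute)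
  have Ae: "A *v axis i 1 = b i" for i
    by (simp add: A_def matrix_vector_mult_basis column_def vec_eq_iff)
  define D where "D = dom_ch c0 \<inter> map_ch c0 -` ?B"
  have D: "q \<in> U" "q \<in> dom_ch c0" "map_ch c0 q \<in> ?B" if "q \<in> D" for q
    using that r(2) is_chart_inj[OF cc0, of q] by (auto simp: D_def)
  have pD: "p \<in> D" using p0 r by (simp add: D_def)
  have sb: "s i q c0 = b i" if "q \<in> D" for i q
    using b[OF D(3)[OF that], of i] inv_ch_map[OF cc0 D(2)[OF that]] by simp
  have inv: "invertible A"
  proof (rule invertible_if_ker_zero)
    fix w assume w: "A *v w = 0"
    have "tcomb (($) w) (\<lambda>i. s i p) = tzero"
      by (rule tangent_eqI[OF M tcomb_tangent[OF M sT[OF U(2)]] tzero_tangent[OF M] c0 p0])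
         (use sb[OF pD] w in \<open>simp add: tcomb_def Av tzero_def\<close>)
    then have "w $ i = 0" for i using ind[OF U(2)] by blast
    then show "w = 0" by (simp add: vec_eq_iff)
  qed
  let ?Ai = "matrix_inv A"
  define c where "c = (D, \<lambda>q. ?Ai *v map_ch c0 q)"
  have imD: "map_ch c0 ` D = ?B" using r(2) by (auto simp: D_def)
  have imc: "(\<lambda>q. ?Ai *v map_ch c0 q) ` D = (*v) A -` ?B"
  proof
    show "(*v) A -` ?B \<subseteq> (\<lambda>q. ?Ai *v map_ch c0 q) ` D"
    proof
      fix y assume "y \<in> (*v) A -` ?B"
      then obtain q where "q \<in> D" "A *v y = map_ch c0 q" using imD by (metis imageE vimageE)
      then show "y \<in> (\<lambda>q. ?Ai *v map_ch c0 q) ` D" using matrix_inv_vec(2)[OF inv, of y] by (intro image_eqI[of _ _ q]) simp_all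
    qed
  qed (use D(3) matrix_inv_vec(1)[OF inv] in auto)
  have oc: "open ((*v) A -` ?B)"
    by (intro open_vimage open_ball linear_continuous_on matrix_vector_mul_bounded_linear)
  have sm: "smooth_on S ((*v) Z)" if "open S" for S and Z :: "real^'n^'n"
    by (rule smooth_on_linear[OF matrix_vector_mul_bounded_linear that])
  have cY: "c \<in> Y" unfolding c_def
  proof (rule chart_change[OF M c0, where \<phi> = "(*v) ?Ai" and \<psi> = "(*v) A"])
    show "smooth_on (map_ch c0 ` D) ((*v) ?Ai)" unfolding imD by (rule sm) simp
    show "smooth_on ((\<lambda>q. ?Ai *v map_ch c0 q) ` D) ((*v) A)" unfolding imc by (rule sm[OF oc])
  qed (use imD imc oc matrix_inv_vec[OF inv] D(2) in auto)
  note cc = maximal_chart[OF M cY]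
  have dc: "dom_ch c = D" "\<And>q. map_ch c q = ?Ai *v map_ch c0 q" by (simp_all add: c_def)
  have m0: "map_ch c0 q = A *v map_ch c q" for q using matrix_inv_vec(1)[OF inv] by (simp add: dc)
  have coord: "coord_vec Y c q e c0 = A *v e" if q: "q \<in> D" for q e
  proof -
    have h: "((map_ch c0 \<circ> inv_ch c) has_derivative (*v) A) (at (map_ch c q))"
    proof (rule has_derivative_transform_within_open[OF _ open_img_ch[OF cc]])
      show "((*v) A has_derivative (*v) A) (at (map_ch c q))"
        by (rule bounded_linear_imp_has_derivative[OF matrix_vector_mul_bounded_linear])
      show "map_ch c q \<in> img_ch c" using q map_ch_img[of q c] by (simp add: dc(1))
      show "A *v x = (map_ch c0 \<circ> inv_ch c) x" if "x \<in> img_ch c" for x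
        using m0[of "inv_ch c x"] map_inv_ch[OF that] by simp
    qed
    show ?thesis using fder_eq[OF h] coord_vec_other[OF M c0 D(2)[OF q], of c e] by simp
  qed
  have comp: "v c0 = A *v v c" if "q \<in> D" "v \<in> tangent_space Y q" for q v
    using coord[OF that(1), of "v c"] tangent_eq_coord_vec[OF M that(2) cY, unfolded dc(1), OF that(1)] by simp
  have sc: "coord_vec Y c q (axis i 1) = s i q" if q: "q \<in> D" for q i
    by (rule tangent_eqI[OF M coord_vec_tangent[OF M cY] sT[OF D(1)[OF q]] c0 D(2)[OF q]])
       (use q coord sb Ae in \<open>simp_all add: dc\<close>)
  have affc: "affine_chart Y nabla c"
    unfolding affine_chart_def parallel_on_def
  proof (intro conjI allI ballI cY)
    fix i
    show sf: "smooth_field_on Y (dom_ch c) (\<lambda>q. coord_vec Y c q (axis i 1))"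
      using smooth_field_coord[OF cY smooth_on_const[OF open_img_ch[OF cc]], of "axis i 1"] .
    fix q u assume q: "q \<in> dom_ch c" and u: "u \<in> tangent_space Y q"
    have "nabla q u (s i) = nabla q u (\<lambda>q. coord_vec Y c q (axis i 1))"
      by (rule nabla_local[OF openin_dom_ch[OF M cY] q sf u]) (simp add: sc dc(1))
    then show "nabla q u (\<lambda>q. coord_vec Y c q (axis i 1)) = tzero"
      using s u D(1) q by (simp add: parallel_on_def dc(1))
  qed
  \<comment> \<open>The metric changes by congruence with a constant matrix. Its derivative is
    therefore the old one between \<open>A\<close> and its transpose, evaluated on
    \<open>A u\<close>, and the symmetry in \<open>u\<close> and \<open>v\<close> is
    inherited.\<close>
  have Gc: "Gm c x = transpose A ** (Gm c0 (A *v x) ** A)" if x: "x \<in> img_ch c" for x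
  proof -
    let ?q = "inv_ch c x"
    note q = inv_ch_dom[OF x]
    have qD: "?q \<in> D" using q by (simp add: dc)
    have mq: "map_ch c0 ?q = A *v x" using m0[of ?q] map_inv_ch[OF x] by simp
    have "Gm c x $ i $ j = b i \<bullet> (Gm c0 (A *v x) *v b j)" for i j
    proof -
      have "Gm c x $ i $ j = g ?q (s i ?q) (s j ?q)"
        by (simp add: Gm_def tensor_comp_def sc[OF qD] Let_def)
      then show ?thesis using metric_Gm[OF c0 D(2)[OF qD] sT[OF D(1)[OF qD]] sT[OF D(1)[OF qD]]] by (simp add: sb[OF qD] mq)
    qed
    then show ?thesis
      by (simp add: vec_eq_iff matrix_matrix_mult_def transpose_def A_def inner_vec_def matrix_vector_mult_def)
  qed
  have sym: "fder (Gm c) x u *v v = fder (Gm c) x v *v u" if x: "x \<in> img_ch c" for x u v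
  proof -
    have Ax: "A *v x \<in> img_ch c0"
      using m0[of "inv_ch c x"] map_inv_ch[OF x] inv_ch_dom[OF x] D(2) map_ch_img[of "inv_ch c x" c0] by (simp add: dc(1))
    have "((\<lambda>x. Gm c0 (A *v x)) has_derivative (\<lambda>u. fder (Gm c0) (A *v x) (A *v u))) (at x)"
      by (rule has_derivative_compose[OF bounded_linear_imp_has_derivative[OF matrix_vector_mul_bounded_linear]
            smooth_on_has_derivative[OF Gm_smooth[OF c0] open_img_ch[OF cc0] Ax]])
    from bounded_linear.has_derivative[OF linear_matrix_sandwich[THEN linear_conv_bounded_linear[THEN iffD1]] this, of "transpose A" A]
    have "((\<lambda>x. transpose A ** (Gm c0 (A *v x) ** A)) has_derivative
       (\<lambda>u. transpose A ** (fder (Gm c0) (A *v x) (A *v u) ** A))) (at x)" .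
    from has_derivative_transform_within_open[OF this open_img_ch[OF cc] x, of "Gm c"] Gc
    have "(Gm c has_derivative (\<lambda>u. transpose A ** (fder (Gm c0) (A *v x) (A *v u) ** A))) (at x)" by simp
    from fder_eq[OF this] show ?thesis
      using hessian_derivative_symmetric[OF c0 K Ax, of "A *v u" "A *v v"]
      by (simp flip: matrix_vector_mul_assoc)
  qed
  \<comment> \<open>In the new chart the basis sections are the coordinate fields, so integer
    combinations are exactly the vectors with integer components.\<close>
  have lat: "(q, v) \<in> L \<longleftrightarrow> v \<in> tangent_space Y q \<and> (\<forall>i. v c $ i \<in> \<int>)" if q: "q \<in> D" for q v
  proof -
    have t: "tcomb k (\<lambda>i. s i q) \<in> tangent_space Y q" for k using tcomb_tangent[OF M sT[OF D(1)[OF q]]] .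
    have k: "tcomb k (\<lambda>i. s i q) c $ i = k i" for k i
    proof -
      have "tcomb k (\<lambda>i. s i q) c = (\<Sum>i\<in>UNIV. k i *\<^sub>R axis i 1)"
        using coord_vec_self[OF M cY, of q] q by (simp add: tcomb_def flip: sc[OF q], simp add: dc(1))
      then show ?thesis by (simp add: axis_def if_distrib[of "\<lambda>x. _ * x"] cong: if_cong)
    qed
    have ex: "v = tcomb (($) (v c)) (\<lambda>i. s i q)" if "v \<in> tangent_space Y q" for v
      by (rule tangent_eqI[OF M that t cY]) (use q k in \<open>simp_all add: dc(1) vec_eq_iff\<close>)
    have "(q, v) \<in> L \<longleftrightarrow> (\<exists>k. v = tcomb k (\<lambda>i. s i q) \<and> (\<forall>i. k i \<in> \<int>))" using Lq[OF D(1)[OF q]] by blast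
    then show ?thesis using t k ex by metis
  qed
  have "ichart c" unfolding ichart_def using affc sym lat by (simp add: dc(1))
  then show ?thesis using that pD by (simp add: dc(1))
qed

end

section \<open>Connection maps and the symplectic form in coordinates\<close>

lemma smooth_family_apply:
  fixes A :: "'e::euclidean_space \<Rightarrow> 'f::euclidean_space \<Rightarrow> 'g::euclidean_space" and f :: "'e \<Rightarrow> 'f"
  assumes O: "open O'" and lin: "\<And>x. x \<in> O' \<Longrightarrow> linear (A x)" and sm: "\<And>b. smooth_on O' (\<lambda>x. A x b)" and f: "smooth_on O' f"
  shows "smooth_on O' (\<lambda>x. A x (f x))"
  using smooth_on_compose[OF smooth_on_linear_family[OF O lin sm] smooth_on_Pair[OF O smooth_on_id[OF O] f] O open_Times[OF O open_UNIV]]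
  by auto

lemma bounded_bilinear_matrix_vector_mult: "bounded_bilinear ((*v) :: real^'n^'m \<Rightarrow> real^'n \<Rightarrow> real^'m)"
  unfolding bilinear_conv_bounded_bilinear[symmetric] bilinear_def
  by (auto intro!: linearI simp: matrix_vector_mult_add_rdistrib matrix_vector_right_distrib scaleR_matrix_vector_assoc
      matrix_vector_mult_scaleR)

context manifold
begin

section \<open>Fibre frames and horizontal spaces\<close>

definition frame :: "('a, real^'n) chart \<Rightarrow> (real^'n \<Rightarrow> real^'n \<Rightarrow> real^'n) \<Rightarrow> (real^'n \<Rightarrow> real^'n \<Rightarrow> real^'n) \<Rightarrow> bool" where
  "frame c A B \<longleftrightarrow> c \<in> M \<and> (\<forall>x\<in>img_ch c. linear (A x) \<and> linear (B x) \<and> (\<forall>a. B x (A x a) = a \<and> A x (B x a) = a)) \<and>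
     (\<forall>b. smooth_on (img_ch c) (\<lambda>x. A x b) \<and> smooth_on (img_ch c) (\<lambda>x. B x b))"

text \<open>Bundle chart with fibre coordinates taken in the frame \<open>A\<close>. Two frames
  occur: the identity, suited to \<open>nabla\<close>, and multiplication by the Gram matrix, suited
  to the dual connection.\<close>

definition dch :: "('a, real^'n) chart \<Rightarrow> (real^'n \<Rightarrow> real^'n \<Rightarrow> real^'n) \<Rightarrow> (('a, real^'n) tpoint, (real^'n) \<times> (real^'n)) chart" where
  "dch c A = ({z \<in> TE. fst z \<in> dom_ch c}, \<lambda>z. (map_ch c (fst z), A (map_ch c (fst z)) (snd z c)))"

lemma frame_id: "c \<in> M \<Longrightarrow> frame c (\<lambda>x a. a) (\<lambda>x a. a)"
  unfolding frame_def
  by (intro conjI ballI allI smooth_on_const open_img_ch maximal_chart[OF M]) (simp_all add: linear_iff)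

lemma frameD:
  assumes "frame c A B"
  shows "c \<in> M" "x \<in> img_ch c \<Longrightarrow> linear (A x)" "x \<in> img_ch c \<Longrightarrow> linear (B x)" "x \<in> img_ch c \<Longrightarrow> B x (A x a) = a"
    "x \<in> img_ch c \<Longrightarrow> A x (B x a) = a" "smooth_on (img_ch c) (\<lambda>x. A x b)" "smooth_on (img_ch c) (\<lambda>x. B x b)"
  using assms by (simp_all add: frame_def)

lemma dch_mem: "frame c A B \<Longrightarrow> dch c A \<in> TM.BM"
  unfolding dch_def by (rule TM.bch_change[where B = B]) (simp_all add: frameD)

lemma dom_dch: "c \<in> M \<Longrightarrow> (p, v) \<in> dom_ch (dch c A) \<longleftrightarrow> p \<in> dom_ch c \<and> v \<in> tangent_space M p"
  using pointsI[of c M p] by (auto simp: dch_def)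

lemma map_dch: "map_ch (dch c A) (p, v) = (map_ch c p, A (map_ch c p) (v c))"
  by (simp add: dch_def)

lemma img_dch:
  assumes "y \<in> img_ch (dch c A)"
  obtains p v where "p \<in> dom_ch c" "v \<in> tangent_space M p" "inv_ch (dch c A) y = (p, v)"
    "y = (map_ch c p, A (map_ch c p) (v c))" "(p, v) \<in> dom_ch (dch c A)"
proof -
  have d: "inv_ch (dch c A) y \<in> dom_ch (dch c A)" "map_ch (dch c A) (inv_ch (dch c A) y) = y"
    using inv_ch_dom[OF assms] map_inv_ch[OF assms] .
  obtain p v where pv: "inv_ch (dch c A) y = (p, v)" by (cases "inv_ch (dch c A) y")
  show ?thesis by (rule that[OF _ _ pv]) (use d pv in \<open>simp_all add: dch_def\<close>)
qed

lemma tangent_chart_dch: "c \<in> M \<Longrightarrow> tangent_chart M c = dch c (\<lambda>x a. a)"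
  by (simp add: tangent_chart_bch dch_def bundle_chart_def)

text \<open>The vertical lift is defined in the chart chosen by \<open>chart_at\<close>. Its
  components in another frame are found as the velocity of the line through \<open>v\<close> in
  direction \<open>w\<close> inside the fibre, which is affine in both fibre coordinates.\<close>

lemma vertical_lift_dch:
  assumes fr: "frame c A B" and p: "p \<in> dom_ch c" and v: "v \<in> tangent_space M p" and w: "w \<in> tangent_space M p"
  shows "vertical_lift M (p, v) w \<in> tangent_space TM.BM (p, v)"
    and "vertical_lift M (p, v) w (dch c A) = (0, A (map_ch c p) (w c))"
proof -
  note c = frameD(1)[OF fr] and dM = dch_mem[OF fr]
  define c1 where "c1 = chart_at M p"
  have c1: "c1 \<in> M" "p \<in> dom_ch c1" unfolding c1_def using chart_at_mem[OF M pointsI[OF c p]] .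
  let ?t = "dch c1 (\<lambda>x a. a)" and ?d = "dch c A"
  have tM: "?t \<in> TM.BM" by (rule dch_mem[OF frame_id[OF c1(1)]])
  have zt: "(p, v) \<in> dom_ch ?t" and zd: "(p, v) \<in> dom_ch ?d" using dom_dch c c1 p v by blast+
  have vl: "vertical_lift M (p, v) w = coord_vec TM.BM ?t (p, v) (0, w c1)"
    by (simp add: vertical_lift_def Let_def tangent_bundle_BM tangent_chart_dch c1(1) flip: c1_def)
  show "vertical_lift M (p, v) w \<in> tangent_space TM.BM (p, v)"
    unfolding vl by (rule coord_vec_tangent[OF TM.BM_maximal tM zt])
  let ?F = "map_ch ?d \<circ> inv_ch ?t" and ?y = "map_ch ?t (p, v)"
  \<comment> \<open>The curve moves in the fibre only; differentiating the transition along it in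
    two ways identifies the components.\<close>
  let ?\<gamma> = "\<lambda>s. ?y + s *\<^sub>R (0, w c1)"
  have "(?\<gamma> has_derivative (\<lambda>s. s *\<^sub>R (0, w c1))) (at 0)" by (auto intro!: derivative_eq_intros)
  moreover have "(?F has_derivative fder ?F ?y) (at (?\<gamma> 0))"
    using transition_has_derivative[OF TM.BM_maximal tM dM zt zd] by (simp only: scaleR_zero_left add_0_right)
  ultimately have 1: "((\<lambda>s. ?F (?\<gamma> s)) has_derivative (\<lambda>s. fder ?F ?y (s *\<^sub>R (0, w c1)))) (at 0)"
    by (rule has_derivative_compose)
  have "?F (?\<gamma> s) = (map_ch c p, A (map_ch c p) (v c)) + s *\<^sub>R (0, A (map_ch c p) (w c))" for s
  proof -
    let ?vs = "tadd v (tscale s w)"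
    have vs: "?vs \<in> tangent_space M p" using tadd_tangent[OF M v tscale_tangent[OF M w]] .
    have m: "map_ch ?t (p, ?vs) = ?\<gamma> s" by (simp add: map_dch tadd_def tscale_def)
    have "inv_ch ?t (?\<gamma> s) = (p, ?vs)"
      unfolding m[symmetric] by (rule inv_ch_map[OF maximal_chart[OF TM.BM_maximal tM]]) (use dom_dch c1 vs in blast)
    then show ?thesis
      using frameD(2)[OF fr map_ch_img[OF p]] by (simp add: map_dch tadd_def tscale_def linear_add linear_cmul)
  qed
  then have 2: "((\<lambda>s. ?F (?\<gamma> s)) has_derivative (\<lambda>s. s *\<^sub>R (0, A (map_ch c p) (w c)))) (at 0)"
    by (simp only:) (auto intro!: derivative_eq_intros)
  have "fder ?F ?y (1 *\<^sub>R (0, w c1)) = 1 *\<^sub>R (0, A (map_ch c p) (w c))"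
    using has_derivative_unique[OF 1 2] by metis
  then show "vertical_lift M (p, v) w ?d = (0, A (map_ch c p) (w c))"
    unfolding vl using coord_vec_other[OF TM.BM_maximal dM zd] by simp
qed

text \<open>The frame is flat for the connection. Only the vanishing of the covariant derivative is
  compared, as this is all that enters the definition of the horizontal space.\<close>

definition adapted_conn :: "('a, real^'n) conn \<Rightarrow> ('a, real^'n) chart \<Rightarrow> (real^'n \<Rightarrow> real^'n \<Rightarrow> real^'n) \<Rightarrow> bool" where
  "adapted_conn nab c A \<longleftrightarrow> (\<forall>p U V u. p \<in> dom_ch c \<and> open_nbhd M p U \<and> smooth_field_on M U V \<and> u \<in> tangent_space M p \<longrightarrow>
     (nab p u V = tzero \<longleftrightarrow> fder (\<lambda>x. A x (V (inv_ch c x) c)) (map_ch c p) (u c) = 0))"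

text \<open>In a flat frame a section with vanishing covariant derivative in direction
  \<open>u\<close> lifts \<open>u\<close> without a fibre component, and every such vector arises in
  this way from a section that is constant in the frame.\<close>

lemma horizontal_space_dch:
  assumes fr: "frame c A B" and ad: "adapted_conn nab c A" and p: "p \<in> dom_ch c" and v: "v \<in> tangent_space M p"
  shows "\<xi> \<in> horizontal_space M nab (p, v) \<longleftrightarrow> \<xi> \<in> tangent_space TM.BM (p, v) \<and> snd (\<xi> (dch c A)) = 0"
proof -
  note c = frameD(1)[OF fr] and dM = dch_mem[OF fr]
  note cc = maximal_chart[OF M c]
  let ?d = "dch c A"
  have zd: "(p, v) \<in> dom_ch ?d" using dom_dch c p v by blast
  have diff: "differential M TM.BM (\<lambda>q. (q, V q)) p u = coord_vec TM.BM ?d (p, v) (u c, fder (\<lambda>x. A x (V (inv_ch c x) c)) (map_ch c p) (u c))"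
    if U: "openin (manifold_topology M) U" "p \<in> U" and V: "smooth_field_on M U V" "V p = v" and u: "u \<in> tangent_space M p" for U V u
  proof -
    let ?O = "map_ch c ` (U \<inter> dom_ch c)" and ?f = "\<lambda>x. A x (V (inv_ch c x) c)"
    have o: "open ?O" "map_ch c p \<in> ?O" using openin_imp_open_image[OF M U(1) c] U(2) p by auto
    have Oc: "?O \<subseteq> img_ch c" by (auto simp: img_ch_def)
    have sf: "smooth_on ?O ?f"
    proof (rule smooth_family_apply[OF o(1), where A = A and f = "\<lambda>x. V (inv_ch c x) c"])
      show "linear (A x)" if "x \<in> ?O" for x using frameD(2)[OF fr] Oc that by blast
      show "smooth_on ?O (\<lambda>x. A x b)" for b by (rule smooth_on_subset[OF frameD(6)[OF fr] open_img_ch[OF cc] o(1) Oc])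
      show "smooth_on ?O (\<lambda>x. V (inv_ch c x) c)" by (rule smooth_field_component[OF V(1) c])
    qed
    have h: "((\<lambda>x. (x, ?f x)) has_derivative (\<lambda>a. (a, fder ?f (map_ch c p) a))) (at (map_ch c p))"
      by (intro has_derivative_Pair has_derivative_ident smooth_on_has_derivative[OF sf o])
    have "differential M TM.BM (\<lambda>q. (q, V q)) p u = coord_vec TM.BM ?d (p, V p) (u c, fder ?f (map_ch c p) (u c))"
    proof (rule differential_eq[OF M TM.BM_maximal c p dM o _ h u])
      fix x assume x: "x \<in> ?O" "x \<in> img_ch c"
      then have "inv_ch c x \<in> U" "inv_ch c x \<in> dom_ch c"
        using overlap_iff[OF cc, of x U] inv_ch_dom[of x c] by (auto simp: Int_commute)
      then show "(inv_ch c x, V (inv_ch c x)) \<in> dom_ch ?d \<and> map_ch ?d (inv_ch c x, V (inv_ch c x)) = (x, ?f x)"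
        using dom_dch[OF c] smooth_field_tangent[OF V(1)] map_inv_ch[OF x(2)] by (simp add: map_dch)
    qed
    then show ?thesis using V(2) by simp
  qed
  show ?thesis
  proof
    assume "\<xi> \<in> horizontal_space M nab (p, v)"
    then obtain V U u where h: "\<xi> = differential M TM.BM (\<lambda>q. (q, V q)) p u" "openin (manifold_topology M) U" "p \<in> U"
      "smooth_field_on M U V" "V p = v" "u \<in> tangent_space M p" "nab p u V = tzero"
      unfolding horizontal_space_def tangent_bundle_BM by auto
    have "fder (\<lambda>x. A x (V (inv_ch c x) c)) (map_ch c p) (u c) = 0"
      using ad h(2-7) p unfolding adapted_conn_def by blast
    then show "\<xi> \<in> tangent_space TM.BM (p, v) \<and> snd (\<xi> ?d) = 0"
      using diff[OF h(2-6)] h(1) coord_vec_tangent[OF TM.BM_maximal dM zd] coord_vec_self[OF TM.BM_maximal dM zd] by simp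
  next
    assume \<xi>: "\<xi> \<in> tangent_space TM.BM (p, v) \<and> snd (\<xi> ?d) = 0"
    let ?x = "map_ch c p"
    \<comment> \<open>The local section through \<open>(p, v)\<close> whose components in the frame
      \<open>A\<close> are constant; the given vector is its derivative.\<close>
    define V where "V = (\<lambda>q. coord_vec M c q (B (map_ch c q) (A ?x (v c))))"
    define u where "u = coord_vec M c p (fst (\<xi> ?d))"
    have u: "u \<in> tangent_space M p" "u c = fst (\<xi> ?d)"
      unfolding u_def using coord_vec_tangent[OF M c p] coord_vec_self[OF M c p] by auto
    have U: "openin (manifold_topology M) (dom_ch c)" by (rule openin_dom_ch[OF M c])
    have V: "smooth_field_on M (dom_ch c) V" unfolding V_def by (rule smooth_field_coord[OF c frameD(7)[OF fr]])
    have Vp: "V p = v"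
      unfolding V_def frameD(4)[OF fr map_ch_img[OF p]] by (rule tangent_eq_coord_vec[OF M v c p])
    have "((\<lambda>x. A x (V (inv_ch c x) c)) has_derivative (\<lambda>a. 0)) (at ?x)"
    proof (rule has_derivative_transform_within_open[OF _ open_img_ch[OF cc] map_ch_img[OF p]])
      show "((\<lambda>x. A ?x (v c)) has_derivative (\<lambda>a. 0)) (at ?x)" by simp
      show "A ?x (v c) = A x (V (inv_ch c x) c)" if "x \<in> img_ch c" for x
        using coord_vec_self[OF M c inv_ch_dom[OF that]] map_inv_ch[OF that] frameD(5)[OF fr that] by (simp add: V_def)
    qed
    from fder_eq[OF this] have D: "fder (\<lambda>x. A x (V (inv_ch c x) c)) ?x (u c) = 0" by simp
    then have "nab p u V = tzero" using ad p U V u unfolding adapted_conn_def by blast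
    moreover have e: "(fst (\<xi> ?d), 0) = \<xi> ?d" using \<xi> by (simp add: prod_eq_iff)
    have "\<xi> = differential M TM.BM (\<lambda>q. (q, V q)) p u"
      unfolding diff[OF U p V Vp u(1)] unfolding D unfolding u(2) e
      using tangent_eq_coord_vec[OF TM.BM_maximal _ dM zd, of \<xi>] \<xi> by simp
    ultimately show "\<xi> \<in> horizontal_space M nab (p, v)"
      unfolding horizontal_space_def tangent_bundle_BM using U p V Vp u by auto
  qed
qed

text \<open>Subtracting the vertical lift that has the same fibre component leaves a vector with
  fibre component zero, hence horizontal. Invertibility of the frame makes the vertical part
  unique.\<close>

lemma connection_map_dch:
  assumes fr: "frame c A B" and ad: "adapted_conn nab c A" and p: "p \<in> dom_ch c" and v: "v \<in> tangent_space M p"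
    and \<xi>: "\<xi> \<in> tangent_space TM.BM (p, v)"
  shows "connection_map M nab (p, v) \<xi> = coord_vec M c p (B (map_ch c p) (snd (\<xi> (dch c A))))"
proof -
  note c = frameD(1)[OF fr] and dM = dch_mem[OF fr]
  let ?d = "dch c A" and ?x = "map_ch c p"
  let ?w = "coord_vec M c p (B ?x (snd (\<xi> ?d)))"
  have zd: "(p, v) \<in> dom_ch ?d" using dom_dch c p v by blast
  note H = horizontal_space_dch[OF fr ad p v]
  have w: "?w \<in> tangent_space M p" by (rule coord_vec_tangent[OF M c p])
  show ?thesis
    unfolding connection_map_def fst_conv
  proof (rule the_equality)
    let ?\<eta> = "tdiff \<xi> (vertical_lift M (p, v) ?w)"
    have "?\<eta> \<in> horizontal_space M nab (p, v)"
      unfolding H using tdiff_tangent[OF TM.BM_maximal \<xi> vertical_lift_dch(1)[OF fr p v w]]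
        vertical_lift_dch(2)[OF fr p v w] coord_vec_self[OF M c p] frameD(5)[OF fr map_ch_img[OF p]] by (simp add: tdiff_def)
    moreover have "\<xi> = tadd ?\<eta> (vertical_lift M (p, v) ?w)" by (simp add: tadd_def tdiff_def)
    ultimately show "?w \<in> tangent_space M p \<and> (\<exists>\<eta>\<in>horizontal_space M nab (p, v). \<xi> = tadd \<eta> (vertical_lift M (p, v) ?w))"
      using w by blast
  next
    fix w assume "w \<in> tangent_space M p \<and> (\<exists>\<eta>\<in>horizontal_space M nab (p, v). \<xi> = tadd \<eta> (vertical_lift M (p, v) w))"
    then obtain \<eta> where w': "w \<in> tangent_space M p" and \<eta>: "snd (\<eta> ?d) = 0" and e: "\<xi> = tadd \<eta> (vertical_lift M (p, v) w)"
      using H by blast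
    have "snd (\<xi> ?d) = A ?x (w c)" unfolding e using vertical_lift_dch(2)[OF fr p v w'] \<eta> by (simp add: tadd_def)
    then show "w = ?w"
      using frameD(4)[OF fr map_ch_img[OF p]] tangent_eq_coord_vec[OF M w' c p] by simp
  qed
qed

section \<open>Chart independence of the standard symplectic form\<close>

lemma symplectic_chart_independent:
  assumes c: "c \<in> M" "p \<in> dom_ch c" and d: "d \<in> M" "p \<in> dom_ch d" and \<alpha>: "\<alpha> \<in> cotangent_space M p"
    and \<tau>: "\<tau>1 \<in> tangent_space CM.BM (p, \<alpha>)" "\<tau>2 \<in> tangent_space CM.BM (p, \<alpha>)"
  shows "fst (\<tau>1 (CM.bch c)) \<bullet> snd (\<tau>2 (CM.bch c)) - fst (\<tau>2 (CM.bch c)) \<bullet> snd (\<tau>1 (CM.bch c))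
    = fst (\<tau>1 (CM.bch d)) \<bullet> snd (\<tau>2 (CM.bch d)) - fst (\<tau>2 (CM.bch d)) \<bullet> snd (\<tau>1 (CM.bch d))"
proof -
  let ?C = "CM.bch c" and ?D = "CM.bch d" and ?z = "(p, \<alpha>)"
  have mem: "?C \<in> CM.BM" "?D \<in> CM.BM" using CM.bch_mem c d by auto
  have z: "?z \<in> dom_ch ?C" "?z \<in> dom_ch ?D" using pointsI[OF c] \<alpha> c d by (auto simp: bundle_chart_def)
  let ?\<phi> = "map_ch d \<circ> inv_ch c" and ?H = "map_ch ?D \<circ> inv_ch ?C" and ?y = "map_ch ?C ?z" and ?x = "map_ch c p"
  let ?O = "map_ch c ` (dom_ch c \<inter> dom_ch d)" and ?OO = "map_ch ?C ` (dom_ch ?C \<inter> dom_ch ?D)"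
  have O: "open ?O" "?x \<in> ?O" using transition_open[OF M c(1) d(1)] c d by auto
  have OO: "open ?OO" "?y \<in> ?OO" using transition_open[OF CM.BM_maximal mem] z by auto
  have \<phi>: "smooth_on ?O ?\<phi>" using transition_smooth[OF M c(1) d(1)] .
  have fy: "fst ?y = ?x" by (simp add: bundle_chart_def)
  \<comment> \<open>The value of a covector on a vector is the same in both charts:
    \<open>e \<bullet> \<pi> = D\<phi>(x) e \<bullet> \<pi>'\<close>. This identity takes the place
    of the tautological one-form.\<close>
  have y: "fst y \<in> ?O" "fst (?H y) = ?\<phi> (fst y)" "e \<bullet> snd y = fder ?\<phi> (fst y) e \<bullet> snd (?H y)" if yO: "y \<in> ?OO" for y e
  proof -
    obtain q \<beta> where q: "(q, \<beta>) \<in> dom_ch ?C" "(q, \<beta>) \<in> dom_ch ?D" "y = map_ch ?C (q, \<beta>)" using yO by auto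
    have qc: "q \<in> dom_ch c" "q \<in> dom_ch d" "\<beta> \<in> cotangent_space M q" using q(1,2) by (auto simp: bundle_chart_def)
    have Hy: "?H y = map_ch ?D (q, \<beta>)" using inv_ch_map[OF CM.bch_is_chart[OF c(1)] q(1)] q(3) by simp
    show "fst y \<in> ?O" using qc q(3) by (simp add: bundle_chart_def)
    show "fst (?H y) = ?\<phi> (fst y)"
      unfolding Hy using q(3) inv_ch_map[OF maximal_chart[OF M c(1)] qc(1)] by (simp add: bundle_chart_def)
    have "e \<bullet> snd y = \<beta> (coord_vec M c q e)"
      unfolding cotangent_coord[OF qc(3) c(1) qc(1), of e] by (simp add: q(3) bundle_chart_def)
    also have "coord_vec M c q e = coord_vec M d q (fder ?\<phi> (map_ch c q) e)"
      using tangent_eq_coord_vec[OF M coord_vec_tangent[OF M c(1) qc(1)] d(1) qc(2), of e] coord_vec_other[OF M d(1) qc(2), of c e] by simp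
    also have "\<beta> \<dots> = fder ?\<phi> (map_ch c q) e \<bullet> snd (?H y)"
      unfolding Hy cotangent_coord[OF qc(3) d(1) qc(2), of "fder ?\<phi> (map_ch c q) e"] by (simp add: bundle_chart_def)
    finally show "e \<bullet> snd y = fder ?\<phi> (fst y) e \<bullet> snd (?H y)" using q(3) by (simp add: bundle_chart_def)
  qed
  note hH = transition_has_derivative[OF CM.BM_maximal mem z]
  have hfst: "(fst has_derivative fst) (at ?y)"
    by (rule bounded_linear_imp_has_derivative[OF bounded_linear_fst])
  have h1: "fst (fder ?H ?y t) = fder ?\<phi> ?x (fst t)" for t
  proof -
    have a: "((\<lambda>y. fst (?H y)) has_derivative (\<lambda>t. fst (fder ?H ?y t))) (at ?y)" by (rule has_derivative_fst[OF hH])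
    have "((\<lambda>y. ?\<phi> (fst y)) has_derivative (\<lambda>t. fder ?\<phi> ?x (fst t))) (at ?y)"
      by (rule has_derivative_compose[OF hfst]) (use smooth_on_has_derivative[OF \<phi> O] in \<open>simp only: fy\<close>)
    from has_derivative_transform_within_open[OF this OO] y(2)
    have "((\<lambda>y. fst (?H y)) has_derivative (\<lambda>t. fder ?\<phi> ?x (fst t))) (at ?y)" by simp
    from has_derivative_unique[OF a this] show ?thesis by metis
  qed
  \<comment> \<open>The preceding identity differentiated along \<open>t\<close>. Its
    second-derivative term is symmetric in the two base directions and drops out of the skew
    combination.\<close>
  have h2: "e \<bullet> snd t = fder ?\<phi> ?x e \<bullet> snd (fder ?H ?y t) + fder (\<lambda>x. fder ?\<phi> x e) ?x (fst t) \<bullet> snd (?H ?y)" for e t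
  proof -
    have "((\<lambda>y. fder ?\<phi> (fst y) e) has_derivative (\<lambda>t. fder (\<lambda>x. fder ?\<phi> x e) ?x (fst t))) (at ?y)"
      by (rule has_derivative_compose[OF hfst]) (use smooth_on_has_derivative[OF smooth_on_fder[OF \<phi>] O] in \<open>simp only: fy\<close>)
    from has_derivative_inner[OF this has_derivative_snd[OF hH]]
    have "((\<lambda>y. fder ?\<phi> (fst y) e \<bullet> snd (?H y)) has_derivative
      (\<lambda>t. fder ?\<phi> ?x e \<bullet> snd (fder ?H ?y t) + fder (\<lambda>x. fder ?\<phi> x e) ?x (fst t) \<bullet> snd (?H ?y))) (at ?y)" by (simp only: fy)
    from has_derivative_transform_within_open[OF this OO] y(3)
    have a: "((\<lambda>y. e \<bullet> snd y) has_derivative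
      (\<lambda>t. fder ?\<phi> ?x e \<bullet> snd (fder ?H ?y t) + fder (\<lambda>x. fder ?\<phi> x e) ?x (fst t) \<bullet> snd (?H ?y))) (at ?y)" by simp
    have "((\<lambda>y. e \<bullet> snd y) has_derivative (\<lambda>t. e \<bullet> snd t)) (at ?y)" by (auto intro!: derivative_eq_intros)
    from has_derivative_unique[OF this a] show ?thesis by metis
  qed
  have D: "\<tau> ?D = fder ?H ?y (\<tau> ?C)" if "\<tau> \<in> tangent_space CM.BM ?z" for \<tau>
    using tangent_space_change[OF CM.BM_maximal that mem(1) z(1) mem(2) z(2)] .
  have sym: "fder (\<lambda>x. fder ?\<phi> x a) ?x b = fder (\<lambda>x. fder ?\<phi> x b) ?x a" for a b
    by (rule fder_fder_symmetric[OF \<phi> O])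
  show ?thesis
    unfolding D[OF \<tau>(1)] D[OF \<tau>(2)] h1
    using h2[of "fst (\<tau>1 ?C)" "\<tau>2 ?C"] h2[of "fst (\<tau>2 ?C)" "\<tau>1 ?C"] sym[of "fst (\<tau>1 ?C)" "fst (\<tau>2 ?C)"] by simp
qed

lemma standard_symplectic_chart:
  assumes c: "c \<in> M" "p \<in> dom_ch c" and \<alpha>: "\<alpha> \<in> cotangent_space M p"
    and \<tau>: "\<tau>1 \<in> tangent_space CM.BM (p, \<alpha>)" "\<tau>2 \<in> tangent_space CM.BM (p, \<alpha>)"
  shows "standard_symplectic M (p, \<alpha>) \<tau>1 \<tau>2 =
    fst (\<tau>1 (CM.bch c)) \<bullet> snd (\<tau>2 (CM.bch c)) - fst (\<tau>2 (CM.bch c)) \<bullet> snd (\<tau>1 (CM.bch c))"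
proof -
  note c1 = chart_at_mem[OF M pointsI[OF c]]
  have "standard_symplectic M (p, \<alpha>) \<tau>1 \<tau>2 = fst (\<tau>1 (CM.bch (chart_at M p))) \<bullet> snd (\<tau>2 (CM.bch (chart_at M p)))
      - fst (\<tau>2 (CM.bch (chart_at M p))) \<bullet> snd (\<tau>1 (CM.bch (chart_at M p)))"
    by (simp add: standard_symplectic_def Let_def cotangent_chart_bch[OF c1(1)] wedge_def inner_vec_def sum_subtractf)
  then show ?thesis using symplectic_chart_independent[OF c1 c \<alpha> \<tau>] by simp
qed

end

section \<open>Frames that are flat for the two connections\<close>

context kaehler_lattice
begin

abbreviation "ginv c x \<equiv> matrix_inv (Gm c x)"

lemma frame_metric: "c \<in> Y \<Longrightarrow> frame c (\<lambda>x. (*v) (Gm c x)) (\<lambda>x. (*v) (ginv c x))"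
  unfolding frame_def
  by (auto intro!: smooth_on_matrix_vector_mult smooth_on_matrix_inv open_img_ch maximal_chart[OF M] smooth_on_const Gm_smooth
      simp: matrix_vector_mul_linear matrix_inv_vec Gm_invertible)

lemma adapted_nabla:
  assumes c: "affine_chart Y nabla c"
  shows "adapted_conn nabla c (\<lambda>x a. a)"
  unfolding adapted_conn_def
proof (intro allI impI; elim conjE)
  have cY: "c \<in> Y" using c by (simp add: affine_chart_def)
  fix p U V u assume p: "p \<in> dom_ch c" and U: "openin (manifold_topology Y) U" "p \<in> U"
    and V: "smooth_field_on Y U V" and u: "u \<in> tangent_space Y p"
  have "nabla p u V = tzero \<longleftrightarrow> nabla p u V c = 0"
    using tangent_eqI[OF M nabla_tangent[OF U V u] tzero_tangent[OF M] cY p] by (auto simp: tzero_def)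
  then show "nabla p u V = tzero \<longleftrightarrow> fder (\<lambda>x. V (inv_ch c x) c) (map_ch c p) (u c) = 0"
    using nabla_component[OF c p U V u] by simp
qed

text \<open>The dual connection is \<open>ginv\<close> applied to the derivative of
  \<open>G V\<close>, so it vanishes exactly when the derivative of the lowered components
  does.\<close>

lemma adapted_dual:
  assumes c: "affine_chart Y nabla c"
  shows "adapted_conn (dual_connection Y g nabla) c (\<lambda>x. (*v) (Gm c x))"
  unfolding adapted_conn_def
proof (intro allI impI; elim conjE)
  have cY: "c \<in> Y" using c by (simp add: affine_chart_def)
  fix p U V u assume p: "p \<in> dom_ch c" and U: "openin (manifold_topology Y) U" "p \<in> U"
    and V: "smooth_field_on Y U V" and u: "u \<in> tangent_space Y p"
  let ?D = "fder (\<lambda>x. Gm c x *v V (inv_ch c x) c) (map_ch c p) (u c)" and ?x = "map_ch c p"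
  have "coord_vec Y c p w = tzero \<longleftrightarrow> w = 0" for w
  proof
    show "w = 0" if "coord_vec Y c p w = tzero"
      using coord_vec_self[OF M cY p, of w] that by (simp add: tzero_def)
    show "coord_vec Y c p w = tzero" if "w = 0"
      by (rule tangent_eqI[OF M coord_vec_tangent[OF M cY p] tzero_tangent[OF M] cY p])
         (simp add: coord_vec_self[OF M cY p] tzero_def that)
  qed
  then have "dual_connection Y g nabla p u V = tzero \<longleftrightarrow> ginv c ?x *v ?D = 0"
    unfolding dual_connection_eq[OF c p U V u] .
  also have "\<dots> \<longleftrightarrow> ?D = 0"
    using matrix_inv_vec(1)[OF Gm_invertible[OF cY map_ch_img[OF p]], of ?D] by auto
  finally show "dual_connection Y g nabla p u V = tzero \<longleftrightarrow> ?D = 0" .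
qed

abbreviation "tch c \<equiv> dch c (\<lambda>x a. a)"
abbreviation "wch c \<equiv> dch c (\<lambda>x. (*v) (Gm c x))"

section \<open>The symplectic form of the tangent bundle in coordinates\<close>

lemma g_cotangent:
  assumes v: "v \<in> tangent_space Y p" and c: "c \<in> Y" "p \<in> dom_ch c"
  shows "g p v \<in> cotangent_space Y p"
  unfolding cotangent_space_def
proof (intro CollectI conjI allI ballI impI)
  show "g p v w = 0" if "w \<notin> tangent_space Y p" for w using tensor2_field_zero[OF M g_tensor] that by blast
  fix a b r s assume ab: "a \<in> tangent_space Y p" "b \<in> tangent_space Y p"
  have t: "tadd (tscale r a) (tscale s b) \<in> tangent_space Y p"
    by (rule tadd_tangent[OF M tscale_tangent[OF M ab(1)] tscale_tangent[OF M ab(2)]])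
  show "g p v (tadd (tscale r a) (tscale s b)) = r * g p v a + s * g p v b"
    unfolding metric_Gm[OF c v t] metric_Gm[OF c v ab(1)] metric_Gm[OF c v ab(2)]
    by (simp add: tadd_def tscale_def matrix_vector_right_distrib matrix_vector_mult_scaleR inner_add_right)
qed

text \<open>In lowered fibre coordinates the bundle isomorphism to the cotangent bundle is the
  identity map, so the form keeps its Darboux expression.\<close>

lemma omega_rep_wch:
  assumes c: "c \<in> Y"
  shows "tensor_rep TM.BM (omega_T Y g) (wch c) (\<lambda>y a b. fst a \<bullet> snd b - fst b \<bullet> snd a)"
  unfolding tensor_rep_def[OF TM.BM_maximal]
proof (intro ballI)
  fix z \<xi> \<zeta> assume z: "z \<in> dom_ch (wch c)" and \<xi>: "\<xi> \<in> tangent_space TM.BM z" and \<zeta>: "\<zeta> \<in> tangent_space TM.BM z"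
  obtain p v where zp: "z = (p, v)" by (cases z)
  have p: "p \<in> dom_ch c" "v \<in> tangent_space Y p" using z zp dom_dch[OF c] by blast+
  have zE: "z \<in> points TM.BM" using p pointsI[OF c] by (simp add: TM.points_BM zp)
  note wM = dch_mem[OF frame_metric[OF c]]
  have F: "differential TM.BM CM.BM (flat_map g) z \<tau> = coord_vec CM.BM (CM.bch c) (p, g p v) (\<tau> (wch c))"
    if \<tau>: "\<tau> \<in> tangent_space TM.BM z" for \<tau>
  proof -
    have "differential TM.BM CM.BM (flat_map g) z \<tau> = coord_vec CM.BM (CM.bch c) (flat_map g z) (\<tau> (wch c))"
    proof (rule differential_eq[OF TM.BM_maximal CM.BM_maximal wM z CM.bch_mem[OF c] open_UNIV UNIV_I _ has_derivative_ident \<tau>])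
      fix y assume "y \<in> img_ch (wch c)"
      then obtain q v where q: "q \<in> dom_ch c" "v \<in> tangent_space Y q" "inv_ch (wch c) y = (q, v)"
        "y = (map_ch c q, Gm c (map_ch c q) *v v c)" by (rule img_dch)
      have "(\<chi> i. g q v (coord_vec Y c q (axis i 1))) = Gm c (map_ch c q) *v v c"
        using metric_Gm[OF c q(1,2) coord_vec_tangent[OF M c q(1)]] Gm_sym[OF c map_ch_img[OF q(1)]]
        by (simp add: vec_eq_iff coord_vec_self[OF M c q(1)] inner_axis)
      then show "flat_map g (inv_ch (wch c) y) \<in> dom_ch (CM.bch c) \<and> map_ch (CM.bch c) (flat_map g (inv_ch (wch c) y)) = y"
        using g_cotangent[OF q(2) c q(1)] q pointsI[OF c q(1)] by (simp add: flat_map_def bundle_chart_def)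
    qed
    then show ?thesis by (simp add: zp flat_map_def)
  qed
  have m: "CM.bch c \<in> CM.BM" "(p, g p v) \<in> dom_ch (CM.bch c)"
    using CM.bch_mem[OF c] g_cotangent[OF p(2) c p(1)] p pointsI[OF c p(1)] by (simp_all add: bundle_chart_def)
  have "omega_T Y g z \<xi> \<zeta> = standard_symplectic Y (p, g p v) (coord_vec CM.BM (CM.bch c) (p, g p v) (\<xi> (wch c)))
      (coord_vec CM.BM (CM.bch c) (p, g p v) (\<zeta> (wch c)))"
    using zE \<xi> \<zeta> by (simp add: omega_T_def pullback_def tangent_bundle_BM cotangent_bundle_BM F) (simp add: zp flat_map_def)
  then show "omega_T Y g z \<xi> \<zeta> = fst (\<xi> (wch c)) \<bullet> snd (\<zeta> (wch c)) - fst (\<zeta> (wch c)) \<bullet> snd (\<xi> (wch c))"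
    using standard_symplectic_chart[OF c p(1) g_cotangent[OF p(2) c p(1)] coord_vec_tangent[OF CM.BM_maximal m]
        coord_vec_tangent[OF CM.BM_maximal m]] by (simp add: coord_vec_self[OF CM.BM_maximal m])
qed

lemma Gm_has_derivative: "c \<in> Y \<Longrightarrow> x \<in> img_ch c \<Longrightarrow> (Gm c has_derivative fder (Gm c) x) (at x)"
  using smooth_on_has_derivative[OF Gm_smooth open_img_ch[OF maximal_chart[OF M]]] .

text \<open>The derivative of a family of symmetric matrices is symmetric. Together with the
  symmetry in \<open>ichart\<close> this makes the derivative of \<open>G\<close> totally
  symmetric.\<close>

lemma fder_Gm_sym:
  assumes c: "c \<in> Y" and x: "x \<in> img_ch c"
  shows "a \<bullet> (fder (Gm c) x u *v b) = b \<bullet> (fder (Gm c) x u *v a)"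
proof -
  have h: "((\<lambda>x. a \<bullet> (Gm c x *v b)) has_derivative (\<lambda>u. a \<bullet> (fder (Gm c) x u *v b))) (at x)" for a b
    by (intro has_derivative_inner_right bounded_linear.has_derivative[OF bounded_bilinear.bounded_linear_left[OF bounded_bilinear_matrix_vector_mult]]
        Gm_has_derivative[OF c x])
  have "((\<lambda>x. b \<bullet> (Gm c x *v a)) has_derivative (\<lambda>u. a \<bullet> (fder (Gm c) x u *v b))) (at x)"
    by (rule has_derivative_transform_within_open[OF h open_img_ch[OF maximal_chart[OF M c]] x])
       (use Gm_sym[OF c] in \<open>simp add: inner_commute\<close>)
  from has_derivative_unique[OF h this] show ?thesis by metis
qed

lemma ichart_affine: "ichart c \<Longrightarrow> affine_chart Y nabla c"
  by (simp add: ichart_def)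

lemma ichart_mem: "ichart c \<Longrightarrow> c \<in> Y"
  by (simp add: ichart_def affine_chart_def)

lemma ichart_symmetric: "ichart c \<Longrightarrow> x \<in> img_ch c \<Longrightarrow> fder (Gm c) x u *v v = fder (Gm c) x v *v u"
  by (simp add: ichart_def)

lemma ichart_lattice: "ichart c \<Longrightarrow> p \<in> dom_ch c \<Longrightarrow> (p, v) \<in> L \<longleftrightarrow> v \<in> tangent_space Y p \<and> (\<forall>i. v c $ i \<in> \<int>)"
  unfolding ichart_def by blast

text \<open>Substituting \<open>z = G(x) y\<close> produces \<open>dz = G dy + (dG) y\<close>. The
  second summand contributes a form in \<open>dx\<close> alone with symmetric coefficients, which is
  zero; this is where the Hessian condition is needed for \<open>\<omega>\<^sub>1\<close>.\<close>

lemma omega_rep_tch: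
  assumes ic: "ichart c"
  shows "tensor_rep TM.BM (omega_T Y g) (tch c) (\<lambda>y a b. fst a \<bullet> (Gm c (fst y) *v snd b) - fst b \<bullet> (Gm c (fst y) *v snd a))"
  unfolding tensor_rep_def[OF TM.BM_maximal]
proof (intro ballI)
  note c = ichart_mem[OF ic]
  fix z \<xi> \<zeta> assume z: "z \<in> dom_ch (tch c)" and \<xi>: "\<xi> \<in> tangent_space TM.BM z" and \<zeta>: "\<zeta> \<in> tangent_space TM.BM z"
  obtain p v where zp: "z = (p, v)" by (cases z)
  have p: "p \<in> dom_ch c" "v \<in> tangent_space Y p" using z zp dom_dch[OF c] by blast+
  have zw: "z \<in> dom_ch (wch c)" using p zp dom_dch[OF c] by blast
  note wM = dch_mem[OF frame_metric[OF c]] and tM = dch_mem[OF frame_id[OF c]]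
  let ?x = "map_ch c p" and ?y = "map_ch (tch c) z"
  note x = map_ch_img[OF p(1)]
  have y: "?y = (?x, v c)" by (simp add: zp map_dch)
  let ?F = "\<lambda>y. (fst y, Gm c (fst y) *v snd y)"
  let ?F' = "\<lambda>a. (fst a, Gm c ?x *v snd a + fder (Gm c) ?x (fst a) *v v c)"
  have hG: "((\<lambda>y. Gm c (fst y)) has_derivative (\<lambda>a. fder (Gm c) ?x (fst a))) (at ?y)"
    by (rule has_derivative_compose[OF bounded_linear_imp_has_derivative[OF bounded_linear_fst]])
       (use Gm_has_derivative[OF c x] y in simp)
  have "(?F has_derivative ?F') (at ?y)"
    using has_derivative_Pair[OF bounded_linear_imp_has_derivative[OF bounded_linear_fst]
        bounded_bilinear.FDERIV[OF bounded_bilinear_matrix_vector_mult hG bounded_linear_imp_has_derivative[OF bounded_linear_snd]]]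
    by (simp add: y)
  then have "((map_ch (wch c) \<circ> inv_ch (tch c)) has_derivative ?F') (at ?y)"
  proof (rule has_derivative_transform_within_open[OF _ open_img_ch[OF maximal_chart[OF TM.BM_maximal tM]] map_ch_img[OF z]])
    fix y assume "y \<in> img_ch (tch c)"
    then obtain q v where q: "inv_ch (tch c) y = (q, v)" "y = (map_ch c q, v c)" by (rule img_dch)
    then show "?F y = (map_ch (wch c) \<circ> inv_ch (tch c)) y" by (simp add: map_dch)
  qed
  from fder_eq[OF this] have w: "\<tau> (wch c) = ?F' (\<tau> (tch c))" if "\<tau> \<in> tangent_space TM.BM z" for \<tau>
    using tangent_space_change[OF TM.BM_maximal that tM z wM zw] by simp
  \<comment> \<open>Total symmetry of the derivative of \<open>G\<close>: the direction and the left
    argument may be exchanged.\<close>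
  have s: "a \<bullet> (fder (Gm c) ?x b *v v c) = b \<bullet> (fder (Gm c) ?x a *v v c)" for a b
    using ichart_symmetric[OF ic x] fder_Gm_sym[OF c x] by metis
  show "omega_T Y g z \<xi> \<zeta> = fst (\<xi> (tch c)) \<bullet> (Gm c (fst ?y) *v snd (\<zeta> (tch c))) - fst (\<zeta> (tch c)) \<bullet> (Gm c (fst ?y) *v snd (\<xi> (tch c)))"
    using tensor_repD[OF TM.BM_maximal omega_rep_wch[OF c] zw \<xi> \<zeta>] s[of "fst (\<xi> (tch c))" "fst (\<zeta> (tch c))"]
    by (simp add: w[OF \<xi>] w[OF \<zeta>] y inner_add_right)
qed

section \<open>Adapted charts of the fibre product\<close>

definition ech :: "('a, real^'n) chart \<Rightarrow> (('a, real^'n) tpoint2, 'n vec3) chart" where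
  "ech c = ({w \<in> TE2. fst (fst w) \<in> dom_ch c},
     \<lambda>w. (map_ch c (fst (fst w)), snd (fst w) c, Gm c (map_ch c (fst (fst w))) *v snd (snd w) c))"

text \<open>Only the second vector is lowered with the metric. Each factor is thereby written in the
  frame that is flat for its own connection, and in which its own lattice is
  \<open>\<int>\<^sup>n\<close>.\<close>

lemma ech_mem:
  assumes c: "c \<in> Y"
  shows "ech c \<in> TT.BM"
proof -
  let ?A = "\<lambda>x y. (fst y, Gm c x *v snd y)" and ?B = "\<lambda>x y. (fst y, ginv c x *v snd y)"
  have o: "open (img_ch c)" using open_img_ch[OF maximal_chart[OF M c]] .
  have l: "linear (\<lambda>y :: (real^'n) \<times> (real^'n). (fst y, Z *v snd y))" for Z :: "real^'n^'n"
    by (rule linearI) (simp_all add: matrix_vector_right_distrib matrix_vector_mult_scaleR)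
  have "({w \<in> TE2. fst (fst w) \<in> dom_ch c}, \<lambda>w. (map_ch c (fst (fst w)), ?A (map_ch c (fst (fst w))) (snd (fst w) c, snd (snd w) c))) \<in> TT.BM"
    by (rule TT.bch_change[OF c, where A = ?A and B = ?B])
       (use l in \<open>auto intro!: smooth_on_Pair smooth_on_matrix_vector_mult smooth_on_matrix_inv o smooth_on_const Gm_smooth c
          simp: matrix_inv_vec Gm_invertible[OF c]\<close>)
  then show ?thesis by (simp add: ech_def)
qed

lemma dom_ech: "c \<in> Y \<Longrightarrow> ((p, u), (q, v)) \<in> dom_ch (ech c) \<longleftrightarrow> p \<in> dom_ch c \<and> q = p \<and> u \<in> tangent_space Y p \<and> v \<in> tangent_space Y p"
  using pointsI[of c Y p] by (auto simp: ech_def)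

lemma map_ech: "map_ch (ech c) ((p, u), (p, v)) = (map_ch c p, u c, Gm c (map_ch c p) *v v c)"
  by (simp add: ech_def)

lemma ech_domE:
  assumes "w \<in> dom_ch (ech c)"
  obtains p u v where "w = ((p, u), (p, v))" "p \<in> dom_ch c" "u \<in> tangent_space Y p" "v \<in> tangent_space Y p"
  using assms by (cases w) (auto simp: ech_def)

lemma img_ech:
  assumes "y \<in> img_ch (ech c)"
  obtains p u v where "p \<in> dom_ch c" "u \<in> tangent_space Y p" "v \<in> tangent_space Y p" "inv_ch (ech c) y = ((p, u), (p, v))"
    "y = (map_ch c p, u c, Gm c (map_ch c p) *v v c)"
proof -
  have d: "inv_ch (ech c) y \<in> dom_ch (ech c)" "map_ch (ech c) (inv_ch (ech c) y) = y"
    using inv_ch_dom[OF assms] map_inv_ch[OF assms] .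
  obtain p u v where w: "inv_ch (ech c) y = ((p, u), (p, v))" and p: "p \<in> dom_ch c" "u \<in> tangent_space Y p" "v \<in> tangent_space Y p"
    using d(1) by (rule ech_domE)
  have "y = (map_ch c p, u c, Gm c (map_ch c p) *v v c)" using d(2) unfolding w map_ech by simp
  then show ?thesis using that[OF p w] by blast
qed

lemma differential_fst_ech:
  assumes c: "c \<in> Y" and w: "w \<in> dom_ch (ech c)" and \<xi>: "\<xi> \<in> tangent_space TT.BM w"
  shows "differential TT.BM TM.BM fst w \<xi> = coord_vec TM.BM (tch c) (fst w) (fst (\<xi> (ech c)), fst (snd (\<xi> (ech c))))"
proof (rule differential_eq[OF TT.BM_maximal TM.BM_maximal ech_mem[OF c] w dch_mem[OF frame_id[OF c]] open_UNIV UNIV_I _ _ \<xi>,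
      where F = "\<lambda>y. (fst y, fst (snd y))" and F' = "\<lambda>y. (fst y, fst (snd y))"])
  fix y assume "y \<in> img_ch (ech c)"
  then show "fst (inv_ch (ech c) y) \<in> dom_ch (tch c) \<and> map_ch (tch c) (fst (inv_ch (ech c) y)) = (fst y, fst (snd y))"
    by (rule img_ech) (simp add: dom_dch[OF c] map_dch)
qed (auto intro!: derivative_eq_intros)

lemma differential_snd_ech:
  assumes c: "c \<in> Y" and w: "w \<in> dom_ch (ech c)" and \<xi>: "\<xi> \<in> tangent_space TT.BM w"
  shows "differential TT.BM TM.BM snd w \<xi> = coord_vec TM.BM (wch c) (snd w) (fst (\<xi> (ech c)), snd (snd (\<xi> (ech c))))"
proof (rule differential_eq[OF TT.BM_maximal TM.BM_maximal ech_mem[OF c] w dch_mem[OF frame_metric[OF c]] open_UNIV UNIV_I _ _ \<xi>,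
      where F = "\<lambda>y. (fst y, snd (snd y))" and F' = "\<lambda>y. (fst y, snd (snd y))"])
  fix y assume "y \<in> img_ch (ech c)"
  then show "snd (inv_ch (ech c) y) \<in> dom_ch (wch c) \<and> map_ch (wch c) (snd (inv_ch (ech c) y)) = (fst y, snd (snd y))"
    by (rule img_ech) (simp add: dom_dch[OF c] map_dch)
qed (auto intro!: derivative_eq_intros)

section \<open>The two forms and the metric in adapted charts\<close>

abbreviation "\<Omega>1 \<equiv> pullback TT.BM TM.BM fst (omega_T Y g)"
abbreviation "\<Omega>2 \<equiv> pullback TT.BM TM.BM snd (omega_T Y g)"
abbreviation "HH \<equiv> double_metric Y g nabla"

definition "rep1 c = (\<lambda>y a b. fst a \<bullet> (Gm c (fst y) *v fst (snd b)) - fst b \<bullet> (Gm c (fst y) *v fst (snd a)))"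
definition "rep2 = (\<lambda>(y :: 'n vec3) (a :: 'n vec3) (b :: 'n vec3). fst a \<bullet> snd (snd b) - fst b \<bullet> snd (snd a))"
definition "reph c = (\<lambda>y a b. fst a \<bullet> (Gm c (fst y) *v fst b) + fst (snd a) \<bullet> (Gm c (fst y) *v fst (snd b))
  + snd (snd a) \<bullet> (ginv c (fst y) *v snd (snd b)))"

context
  fixes c assumes ic: "ichart c"
begin

lemma rep1: "tensor_rep TT.BM \<Omega>1 (ech c) (rep1 c)"
  unfolding tensor_rep_def[OF TT.BM_maximal]
proof (intro ballI)
  note c = ichart_mem[OF ic]
  fix w \<xi> \<zeta> assume w: "w \<in> dom_ch (ech c)" and \<xi>: "\<xi> \<in> tangent_space TT.BM w" and \<zeta>: "\<zeta> \<in> tangent_space TT.BM w"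
  obtain p u v where wp: "w = ((p, u), (p, v))" and p: "p \<in> dom_ch c" "u \<in> tangent_space Y p" "v \<in> tangent_space Y p"
    using w by (rule ech_domE)
  have d: "fst w \<in> dom_ch (tch c)" using p wp dom_dch[OF c] by simp
  note tM = dch_mem[OF frame_id[OF c]]
  have "\<Omega>1 w \<xi> \<zeta> = omega_T Y g (fst w) (coord_vec TM.BM (tch c) (fst w) (fst (\<xi> (ech c)), fst (snd (\<xi> (ech c)))))
     (coord_vec TM.BM (tch c) (fst w) (fst (\<zeta> (ech c)), fst (snd (\<zeta> (ech c)))))"
    using pointsI[OF ech_mem[OF c] w] \<xi> \<zeta> by (simp add: pullback_def differential_fst_ech[OF c w])
  then show "\<Omega>1 w \<xi> \<zeta> = rep1 c (map_ch (ech c) w) (\<xi> (ech c)) (\<zeta> (ech c))"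
    using tensor_repD[OF TM.BM_maximal omega_rep_tch[OF ic] d coord_vec_tangent[OF TM.BM_maximal tM d] coord_vec_tangent[OF TM.BM_maximal tM d]]
    by (simp add: coord_vec_self[OF TM.BM_maximal tM d] rep1_def) (simp add: wp map_dch map_ech)
qed

lemma rep2: "tensor_rep TT.BM \<Omega>2 (ech c) rep2"
  unfolding tensor_rep_def[OF TT.BM_maximal]
proof (intro ballI)
  note c = ichart_mem[OF ic]
  fix w \<xi> \<zeta> assume w: "w \<in> dom_ch (ech c)" and \<xi>: "\<xi> \<in> tangent_space TT.BM w" and \<zeta>: "\<zeta> \<in> tangent_space TT.BM w"
  obtain p u v where wp: "w = ((p, u), (p, v))" and p: "p \<in> dom_ch c" "u \<in> tangent_space Y p" "v \<in> tangent_space Y p"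
    using w by (rule ech_domE)
  have d: "snd w \<in> dom_ch (wch c)" using p wp dom_dch[OF c] by simp
  note wM = dch_mem[OF frame_metric[OF c]]
  have "\<Omega>2 w \<xi> \<zeta> = omega_T Y g (snd w) (coord_vec TM.BM (wch c) (snd w) (fst (\<xi> (ech c)), snd (snd (\<xi> (ech c)))))
     (coord_vec TM.BM (wch c) (snd w) (fst (\<zeta> (ech c)), snd (snd (\<zeta> (ech c)))))"
    using pointsI[OF ech_mem[OF c] w] \<xi> \<zeta> by (simp add: pullback_def differential_snd_ech[OF c w])
  then show "\<Omega>2 w \<xi> \<zeta> = rep2 (map_ch (ech c) w) (\<xi> (ech c)) (\<zeta> (ech c))"
    using tensor_repD[OF TM.BM_maximal omega_rep_wch[OF c] d coord_vec_tangent[OF TM.BM_maximal wM d] coord_vec_tangent[OF TM.BM_maximal wM d]]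
    by (simp add: coord_vec_self[OF TM.BM_maximal wM d] rep2_def)
qed

lemma differential_base_tch:
  assumes z: "(p, v) \<in> dom_ch (tch c)" and \<xi>: "\<xi> \<in> tangent_space TM.BM (p, v)"
  shows "differential TM.BM Y fst (p, v) \<xi> = coord_vec Y c p (fst (\<xi> (tch c)))"
proof -
  note c = ichart_mem[OF ic]
  have "differential TM.BM Y fst (p, v) \<xi> = coord_vec Y c (fst (p, v)) (fst (\<xi> (tch c)))"
  proof (rule differential_eq[OF TM.BM_maximal M dch_mem[OF frame_id[OF c]] z c open_UNIV UNIV_I _ _ \<xi>])
    fix y assume "y \<in> img_ch (tch c)"
    then show "fst (inv_ch (tch c) y) \<in> dom_ch c \<and> map_ch c (fst (inv_ch (tch c) y)) = fst y"
      by (rule img_dch) simp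
  qed (auto intro!: derivative_eq_intros)
  then show ?thesis by simp
qed

text \<open>The first connection map reads off \<open>dy\<close> and the second one returns
  \<open>ginv\<close> applied to \<open>dz\<close>, so the last summand of the metric becomes the
  inverse Gram form of \<open>dz\<close>.\<close>

lemma reph: "tensor_rep TT.BM HH (ech c) (reph c)"
  unfolding tensor_rep_def[OF TT.BM_maximal]
proof (intro ballI)
  note c = ichart_mem[OF ic] and aff = ichart_affine[OF ic]
  fix w \<xi> \<zeta> assume w: "w \<in> dom_ch (ech c)" and \<xi>: "\<xi> \<in> tangent_space TT.BM w" and \<zeta>: "\<zeta> \<in> tangent_space TT.BM w"
  obtain p u v where wp: "w = ((p, u), (p, v))" and p: "p \<in> dom_ch c" "u \<in> tangent_space Y p" "v \<in> tangent_space Y p"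
    using w by (rule ech_domE)
  let ?x = "map_ch c p"
  note x = map_ch_img[OF p(1)]
  note tM = dch_mem[OF frame_id[OF c]] and wM = dch_mem[OF frame_metric[OF c]]
  have dt: "(p, u) \<in> dom_ch (tch c)" and dw: "(p, v) \<in> dom_ch (wch c)" using p dom_dch[OF c] by auto
  note st = coord_vec_self[OF TM.BM_maximal tM dt] coord_vec_self[OF TM.BM_maximal wM dw]
    and tt = coord_vec_tangent[OF TM.BM_maximal tM dt] coord_vec_tangent[OF TM.BM_maximal wM dw]
  have dp: "differential TM.BM Y fst (p, u) (differential TT.BM TM.BM fst w \<tau>) = coord_vec Y c p (fst (\<tau> (ech c)))"
    and k1: "connection_map Y nabla (p, u) (differential TT.BM TM.BM fst w \<tau>) = coord_vec Y c p (fst (snd (\<tau> (ech c))))"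
    and k2: "connection_map Y (dual_connection Y g nabla) (p, v) (differential TT.BM TM.BM snd w \<tau>)
      = coord_vec Y c p (ginv c ?x *v snd (snd (\<tau> (ech c))))"
    if \<tau>: "\<tau> \<in> tangent_space TT.BM w" for \<tau>
    using differential_fst_ech[OF c w \<tau>] differential_snd_ech[OF c w \<tau>] differential_base_tch[OF dt tt(1)]
      connection_map_dch[OF frame_id[OF c] adapted_nabla[OF aff] p(1,2) tt(1)]
      connection_map_dch[OF frame_metric[OF c] adapted_dual[OF aff] p(1,3) tt(2)]
    by (simp_all add: wp st)
  have gg: "g p (coord_vec Y c p a) (coord_vec Y c p b) = a \<bullet> (Gm c ?x *v b)" for a b
    using metric_Gm[OF c p(1) coord_vec_tangent[OF M c p(1)] coord_vec_tangent[OF M c p(1)]] by (simp add: coord_vec_self[OF M c p(1)])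
  \<comment> \<open>Evaluating \<open>G\<close> on raised vectors leaves one copy of the inverse
    matrix.\<close>
  have E: "(ginv c ?x *v a) \<bullet> (Gm c ?x *v (ginv c ?x *v b)) = a \<bullet> (ginv c ?x *v b)" for a b
    using Gm_sym[OF c x, of "ginv c ?x *v a" "ginv c ?x *v b"] matrix_inv_vec(1)[OF Gm_invertible[OF c x]] by simp
  have "HH w \<xi> \<zeta> = g p (coord_vec Y c p (fst (\<xi> (ech c)))) (coord_vec Y c p (fst (\<zeta> (ech c))))
     + g p (coord_vec Y c p (fst (snd (\<xi> (ech c))))) (coord_vec Y c p (fst (snd (\<zeta> (ech c)))))
     + g p (coord_vec Y c p (ginv c ?x *v snd (snd (\<xi> (ech c))))) (coord_vec Y c p (ginv c ?x *v snd (snd (\<zeta> (ech c)))))"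
    using pointsI[OF ech_mem[OF c] w] \<xi> \<zeta> dp[OF \<xi>] dp[OF \<zeta>] k1[OF \<xi>] k1[OF \<zeta>] k2[OF \<xi>] k2[OF \<zeta>]
    unfolding double_metric_def tangent_bundle_BM double_tangent_bundle_BM Let_def by (simp add: wp)
  then show "HH w \<xi> \<zeta> = reph c (map_ch (ech c) w) (\<xi> (ech c)) (\<zeta> (ech c))"
    by (simp add: gg E reph_def) (simp add: wp map_ech)
qed

lemma fst_img_ech: "y \<in> img_ch (ech c) \<Longrightarrow> fst y \<in> img_ch c"
  by (erule img_ech) (simp add: map_ch_img)

lemma rep_smooth: "smooth_rep (ech c) (rep1 c)" "smooth_rep (ech c) rep2" "smooth_rep (ech c) (reph c)"
proof -
  note c = ichart_mem[OF ic]
  have o: "open (img_ch (ech c))" using open_img_ch[OF maximal_chart[OF TT.BM_maximal ech_mem[OF c]]] .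
  have oc: "open (img_ch c)" using open_img_ch[OF maximal_chart[OF M c]] .
  have G: "smooth_on (img_ch (ech c)) (\<lambda>y. Gm c (fst y))"
    by (rule smooth_on_compose[OF Gm_smooth[OF c] smooth_on_fst[OF o smooth_on_id[OF o]] o oc]) (use fst_img_ech in blast)
  have Gi: "smooth_on (img_ch (ech c)) (\<lambda>y. ginv c (fst y))"
    by (rule smooth_on_matrix_inv[OF o G]) (use Gm_invertible[OF c] fst_img_ech in blast)
  note sm = smooth_on_add smooth_on_diff smooth_on_inner smooth_on_matrix_vector_mult smooth_on_const o G Gi
  have lin: "linear (\<lambda>b. a \<bullet> (Z *v L b))" "linear (\<lambda>b. L b \<bullet> z)" "linear (\<lambda>b. a \<bullet> L b)"
    if "linear L" for a z :: "real^'n" and Z :: "real^'n^'n" and L :: "'n vec3 \<Rightarrow> real^'n"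
    by (rule linearI; simp add: linear_add[OF that] linear_cmul[OF that] matrix_vector_right_distrib matrix_vector_mult_scaleR
        inner_add_right inner_add_left)+
  have L: "linear (fst :: 'n vec3 \<Rightarrow> _)" "linear (\<lambda>y :: 'n vec3. fst (snd y))" "linear (\<lambda>y :: 'n vec3. snd (snd y))"
    by (auto intro!: linearI)
  show "smooth_rep (ech c) (rep1 c)" "smooth_rep (ech c) rep2" "smooth_rep (ech c) (reph c)"
    unfolding smooth_rep_def[OF TT.BM_maximal] bilinear_def rep1_def rep2_def reph_def
    by (intro conjI ballI allI sm linear_compose_add linear_compose_sub lin L)+
qed

end

lemma ech_cover:
  assumes "w \<in> points TT.BM"
  obtains c where "ichart c" "w \<in> dom_ch (ech c)"
proof -
  have w: "w \<in> TE2" using assms TT.points_BM by blast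
  then have "fst (fst w) \<in> points Y" by auto
  then obtain c where "ichart c" "fst (fst w) \<in> dom_ch c" by (rule ichart_ex)
  then show ?thesis using that w by (simp add: ech_def)
qed

lemma TT_tensors: "tensor2_field TT.BM \<Omega>1" "tensor2_field TT.BM \<Omega>2" "tensor2_field TT.BM HH"
proof -
  have *: "\<exists>e B. e \<in> TT.BM \<and> w \<in> dom_ch e \<and> tensor_rep TT.BM T e B \<and> smooth_rep e B"
    if w: "w \<in> points TT.BM" and R: "\<And>c. ichart c \<Longrightarrow> tensor_rep TT.BM T (ech c) (B c) \<and> smooth_rep (ech c) (B c)" for w T B
  proof -
    obtain c where c: "ichart c" "w \<in> dom_ch (ech c)" using ech_cover[OF w] .
    show ?thesis using R[OF c(1)] c(2) ech_mem[OF ichart_mem[OF c(1)]] by blast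
  qed
  show "tensor2_field TT.BM \<Omega>1"
    by (rule tensor2_fieldI[OF TT.BM_maximal _ *[of _ _ rep1]]) (use rep1 rep_smooth in \<open>auto simp: pullback_def\<close>)
  show "tensor2_field TT.BM \<Omega>2"
    by (rule tensor2_fieldI[OF TT.BM_maximal _ *[of _ _ "\<lambda>_. rep2"]]) (use rep2 rep_smooth in \<open>auto simp: pullback_def\<close>)
  show "tensor2_field TT.BM HH"
    by (rule tensor2_fieldI[OF TT.BM_maximal _ *[of _ _ reph]])
       (use reph rep_smooth in \<open>auto simp: double_metric_def double_tangent_bundle_BM Let_def\<close>)
qed

end

section \<open>The manifold \<open>X\<^sub>Y\<close>\<close>

definition int_vec :: "real^'n \<Rightarrow> bool" where
  "int_vec v \<longleftrightarrow> (\<forall>i. v $ i \<in> \<int>)"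

lemma int_vec_zero: "int_vec 0"
  and int_vec_add: "int_vec u \<Longrightarrow> int_vec v \<Longrightarrow> int_vec (u + v)"
  and int_vec_minus: "int_vec u \<Longrightarrow> int_vec (- u)"
  and int_vec_diff: "int_vec u \<Longrightarrow> int_vec v \<Longrightarrow> int_vec (u - v)"
  by (simp_all add: int_vec_def)

lemma int_vec_small:
  assumes "int_vec v" "norm v < 1"
  shows "v = 0"
proof -
  have "v $ i = 0" for i
  proof -
    obtain k :: int where k: "v $ i = of_int k" using assms(1) by (auto simp: int_vec_def elim: Ints_cases)
    have "\<bar>v $ i\<bar> < 1" using component_le_norm_cart[of v i] assms(2) by simp
    then show ?thesis using k by simp
  qed
  then show ?thesis by (simp add: vec_eq_iff)
qed

lemma non_integer_gap:
  fixes s :: real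
  assumes "s \<notin> \<int>"
  shows "\<exists>\<epsilon>>0. \<forall>k\<in>\<int>. \<bar>s - k\<bar> \<ge> 2 * \<epsilon>"
proof -
  have f: "0 < frac s" "frac s < 1" using assms frac_lt_1 frac_gt_0_iff by auto
  show ?thesis
  \<comment> \<open>Half the distance from \<open>s\<close> to the nearest integer, so that two
    perturbations of size \<open>\<epsilon>\<close> cannot reach an integer.\<close>
  proof (intro exI[of _ "min (frac s) (1 - frac s) / 2"] conjI ballI)
    show "min (frac s) (1 - frac s) / 2 > 0" using f by simp
    fix k :: real assume "k \<in> \<int>"
    then obtain j :: int where j: "k = of_int j" by (auto elim: Ints_cases)
    have "min (frac s) (1 - frac s) \<le> \<bar>s - k\<bar>"
    proof (cases "j \<le> \<lfloor>s\<rfloor>")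
      case True
      then have "k \<le> of_int \<lfloor>s\<rfloor>" by (simp add: j)
      then have "frac s \<le> \<bar>s - k\<bar>" using frac_def[of s] by linarith
      then show ?thesis by (rule min.coboundedI1)
    next
      case False
      then have "j \<ge> \<lfloor>s\<rfloor> + 1" by simp
      then have "k \<ge> of_int \<lfloor>s\<rfloor> + 1" unfolding j by (metis of_int_1 of_int_add of_int_le_iff)
      then have "1 - frac s \<le> \<bar>s - k\<bar>" using frac_def[of s] by linarith
      then show ?thesis by (rule min.coboundedI2)
    qed
    then show "\<bar>s - k\<bar> \<ge> 2 * (min (frac s) (1 - frac s) / 2)" by simp
  qed
qed

lemma disjoint_images: "(\<And>x y. x \<in> A \<Longrightarrow> y \<in> B \<Longrightarrow> f x \<noteq> f y) \<Longrightarrow> f ` A \<inter> f ` B = {}"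
  by blast

text \<open>The transition between charts that differ by a translation has identity derivative, so
  tangent vectors have equal components in both.\<close>

lemma component_translate:
  assumes M: "maximal_atlas M" and c: "c \<in> M" and d: "d \<in> M" and sub: "dom_ch d \<subseteq> dom_ch c"
    and t: "\<And>p. p \<in> dom_ch d \<Longrightarrow> map_ch d p = map_ch c p + t" and p: "p \<in> dom_ch d" and v: "v \<in> tangent_space M p"
  shows "v d = v c"
proof -
  have pc: "p \<in> dom_ch c" using p sub by blast
  have "((map_ch d \<circ> inv_ch c) has_derivative (\<lambda>v. v)) (at (map_ch c p))"
  proof (rule has_derivative_transform_within_open[OF _ transition_open[OF M c d]])
    show "((\<lambda>x. x + t) has_derivative (\<lambda>v. v)) (at (map_ch c p))" by (auto intro!: derivative_eq_intros)
    show "map_ch c p \<in> map_ch c ` (dom_ch c \<inter> dom_ch d)" using p pc by blast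
    fix x assume "x \<in> map_ch c ` (dom_ch c \<inter> dom_ch d)"
    then obtain q where "q \<in> dom_ch c" "q \<in> dom_ch d" "x = map_ch c q" by blast
    then show "x + t = (map_ch d \<circ> inv_ch c) x" using t inv_ch_map[OF maximal_chart[OF M c]] by simp
  qed
  then show ?thesis using tangent_space_change[OF M v c pc d p] fder_eq by metis
qed

context kaehler_lattice
begin

section \<open>Congruence modulo the two lattices in coordinates\<close>

abbreviation "q \<equiv> quotient_proj Y g L"
abbreviation "dualL \<equiv> dual_lattice Y g L"

text \<open>The pairing with a lattice vector is the inner product of \<open>G v\<close> with an
  integer vector. Testing with the standard basis forces the entries of \<open>G v\<close> to be
  integers, and conversely such entries give integer sums.\<close>

lemma dual_lattice_ichart:
  assumes ic: "ichart c" and p: "p \<in> dom_ch c"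
  shows "(p, v) \<in> dualL \<longleftrightarrow> v \<in> tangent_space Y p \<and> int_vec (Gm c (map_ch c p) *v v c)"
proof -
  note c = ichart_mem[OF ic]
  have gv: "g p v w = (Gm c (map_ch c p) *v v c) \<bullet> w c" if "v \<in> tangent_space Y p" "w \<in> tangent_space Y p" for w
    using metric_Gm[OF c p that] Gm_sym[OF c map_ch_img[OF p]] by simp
  show ?thesis
  proof
    assume "(p, v) \<in> dualL"
    then have v: "v \<in> tangent_space Y p" and int: "\<And>w. (p, w) \<in> L \<Longrightarrow> g p v w \<in> \<int>" by (auto simp: dual_lattice_def)
    have "(Gm c (map_ch c p) *v v c) $ i \<in> \<int>" for i
    proof -
      let ?e = "coord_vec Y c p (axis i 1)"
      have e: "?e \<in> tangent_space Y p" "?e c = axis i 1" using coord_vec_tangent[OF M c p] coord_vec_self[OF M c p] by auto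
      have "(p, ?e) \<in> L" using ichart_lattice[OF ic p] e by (simp add: axis_def)
      from int[OF this] show ?thesis using gv[OF v e(1)] e(2) by (simp add: inner_axis)
    qed
    then show "v \<in> tangent_space Y p \<and> int_vec (Gm c (map_ch c p) *v v c)" using v by (simp add: int_vec_def)
  next
    assume v: "v \<in> tangent_space Y p \<and> int_vec (Gm c (map_ch c p) *v v c)"
    have "g p v w \<in> \<int>" if "(p, w) \<in> L" for w
      using that ichart_lattice[OF ic p, of w] v gv[of w] by (auto simp: inner_vec_def int_vec_def intro!: Ints_sum Ints_mult)
    then show "(p, v) \<in> dualL" using v pointsI[OF c p] by (simp add: dual_lattice_def)
  qed
qed

text \<open>Covers both lattices: \<open>F\<close> is the identity for the first and the Gram matrix
  for the dual one.\<close>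

lemma lattice_class_eq:
  assumes c: "c \<in> Y" "p \<in> dom_ch c" and lin: "linear F"
    and \<Lambda>: "\<And>v. (p, v) \<in> \<Lambda> \<longleftrightarrow> v \<in> tangent_space Y p \<and> int_vec (F (v c))"
    and u: "u \<in> tangent_space Y p" and v: "v \<in> tangent_space Y p"
  shows "lattice_rel Y \<Lambda> `` {(p, u)} = lattice_rel Y \<Lambda> `` {(p, v)} \<longleftrightarrow> int_vec (F (u c) - F (v c))"
proof -
  have R: "((p, u), z) \<in> lattice_rel Y \<Lambda> \<longleftrightarrow> (\<exists>w. z = (p, w) \<and> w \<in> tangent_space Y p \<and> int_vec (F (u c) - F (w c)))"
    if u: "u \<in> tangent_space Y p" for u z
    using u pointsI[OF c] tdiff_tangent[OF M u] \<Lambda> linear_diff[OF lin]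
    by (cases z) (auto simp: lattice_rel_def tdiff_def)
  show ?thesis
  proof
    assume e: "lattice_rel Y \<Lambda> `` {(p, u)} = lattice_rel Y \<Lambda> `` {(p, v)}"
    have "((p, v), (p, v)) \<in> lattice_rel Y \<Lambda>" unfolding R[OF v] using v int_vec_zero by simp
    then have "((p, u), (p, v)) \<in> lattice_rel Y \<Lambda>" using e by blast
    then show "int_vec (F (u c) - F (v c))" unfolding R[OF u] by simp
  next
    assume d: "int_vec (F (u c) - F (v c))"
    have "int_vec (F (u c) - F (w c)) \<longleftrightarrow> int_vec (F (v c) - F (w c))" for w
      using int_vec_add[OF d, of "F (v c) - F (w c)"] int_vec_diff[OF _ d, of "F (u c) - F (w c)"] by (auto simp: algebra_simps)
    then show "lattice_rel Y \<Lambda> `` {(p, u)} = lattice_rel Y \<Lambda> `` {(p, v)}" using R[OF u] R[OF v] by (auto simp: Image_def)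
  qed
qed

text \<open>A class remembers its base point and an adapted chart covers whole fibres, so its domain
  contains every point with the same image under \<open>q\<close>.\<close>

lemma q_ech:
  assumes ic: "ichart c" and w: "w \<in> dom_ch (ech c)" and w': "w' \<in> points TT.BM" and eq: "q w = q w'"
  shows "w' \<in> dom_ch (ech c)"
proof -
  note c = ichart_mem[OF ic]
  obtain p u v where wp: "w = ((p, u), (p, v))" and p: "p \<in> dom_ch c" "u \<in> tangent_space Y p" "v \<in> tangent_space Y p"
    using w by (rule ech_domE)
  have "w' \<in> TE2" using w' TT.points_BM by blast
  then obtain r u' v' where wr: "w' = ((r, u'), (r, v'))" and r: "r \<in> points Y" "u' \<in> tangent_space Y r" "v' \<in> tangent_space Y r"
    by (cases w') auto
  obtain d where d: "ichart d" "r \<in> dom_ch d" using r(1) by (rule ichart_ex)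
  \<comment> \<open>Reflexivity at \<open>u'\<close> shows that the class is inhabited by its own
    representative, from which the base point is recovered.\<close>
  have "tdiff u' u' = tzero" by (simp add: tdiff_def tzero_def)
  then have "((r, u'), (r, u')) \<in> lattice_rel Y L"
    using r ichart_lattice[OF d] tzero_tangent[OF M] by (simp add: lattice_rel_def) (simp add: tzero_def)
  then have "((p, u), (r, u')) \<in> lattice_rel Y L" using eq unfolding wp wr quotient_proj_def by auto
  then have "r = p" by (simp add: lattice_rel_def)
  then show ?thesis using p r dom_ech[OF c] wr by simp
qed

text \<open>All further work on the quotient goes through this: in adapted coordinates the
  projection divides by translations in
  \<open>{0} \<times> \<int>\<^sup>n \<times> \<int>\<^sup>n\<close>. The case of different base
  points has to be excluded separately, as the classes could only agree if they were empty.\<close>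

lemma q_eq_iff:
  assumes ic: "ichart c" and w: "w \<in> dom_ch (ech c)" and w': "w' \<in> dom_ch (ech c)"
  defines "y \<equiv> map_ch (ech c) w" and "y' \<equiv> map_ch (ech c) w'"
  shows "q w = q w' \<longleftrightarrow> fst y = fst y' \<and> int_vec (fst (snd y) - fst (snd y')) \<and> int_vec (snd (snd y) - snd (snd y'))"
proof -
  note c = ichart_mem[OF ic]
  obtain p u v where wp: "w = ((p, u), (p, v))" and p: "p \<in> dom_ch c" "u \<in> tangent_space Y p" "v \<in> tangent_space Y p"
    using w by (rule ech_domE)
  obtain r u' v' where wr: "w' = ((r, u'), (r, v'))" and r: "r \<in> dom_ch c" "u' \<in> tangent_space Y r" "v' \<in> tangent_space Y r"
    using w' by (rule ech_domE)
  have id: "linear (\<lambda>a :: real^'n. a)" by (simp add: linear_iff)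
  have Lc: "(p, v) \<in> L \<longleftrightarrow> v \<in> tangent_space Y p \<and> int_vec (v c)" for v
    using ichart_lattice[OF ic p(1)] by (simp add: int_vec_def)
  show ?thesis
  proof (cases "r = p")
    case True
    then show ?thesis
      using lattice_class_eq[OF c p(1) id Lc p(2), of u'] r
        lattice_class_eq[OF c p(1) matrix_vector_mul_linear dual_lattice_ichart[OF ic p(1)] p(3), of v']
      unfolding y_def y'_def wp wr by (simp add: quotient_proj_def map_ech)
  next
    case False
    have "q w \<noteq> q w'"
    proof
      assume "q w = q w'"
      moreover have "((r, u'), (r, u')) \<in> lattice_rel Y L"
        using r pointsI[OF c r(1)] ichart_lattice[OF ic r(1)] tzero_tangent[OF M, of r] tdiff_tangent[OF M r(2) r(2)]
        by (simp add: lattice_rel_def) (simp add: tdiff_def)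
      ultimately have "((p, u), (r, u')) \<in> lattice_rel Y L" unfolding wp wr quotient_proj_def by auto
      then show False using False by (simp add: lattice_rel_def)
    qed
    moreover have "fst y \<noteq> fst y'"
      using False is_chart_inj[OF maximal_chart[OF M c] p(1) r(1)] by (auto simp: y_def y'_def wp wr map_ech)
    ultimately show ?thesis by blast
  qed
qed

lemma img_ech_eq:
  assumes c: "c \<in> Y"
  shows "img_ch (ech c) = img_ch c \<times> UNIV"
proof
  show "img_ch c \<times> UNIV \<subseteq> img_ch (ech c)"
  proof
    fix y assume "y \<in> img_ch c \<times> (UNIV :: ((real^'n) \<times> (real^'n)) set)"
    then obtain x a b where y: "y = (x, a, b)" "x \<in> img_ch c" by auto
    let ?p = "inv_ch c x"
    note p = inv_ch_dom[OF y(2)]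
    have "((?p, coord_vec Y c ?p a), (?p, coord_vec Y c ?p (ginv c x *v b))) \<in> dom_ch (ech c)"
      using dom_ech[OF c] p coord_vec_tangent[OF M c p] by simp
    from map_ch_img[OF this] show "y \<in> img_ch (ech c)"
      by (simp add: map_ech coord_vec_self[OF M c p] map_inv_ch[OF y(2)] matrix_inv_vec[OF Gm_invertible[OF c y(2)]] y)
  qed
qed (auto elim!: img_ech simp: map_ch_img)

section \<open>Boxes on which the projection is injective, and their translates\<close>

definition xbox :: "'n vec3 \<Rightarrow> 'n vec3 set" where
  "xbox y = UNIV \<times> ball (fst (snd y)) (1/4) \<times> ball (snd (snd y)) (1/4)"

lemma open_xbox: "open (xbox y)"
  unfolding xbox_def by (intro open_Times open_UNIV open_ball)

lemma xbox_centre: "y \<in> xbox y"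
  by (cases y) (simp add: xbox_def)

definition rch :: "('a, real^'n) chart \<Rightarrow> 'n vec3 \<Rightarrow> (('a, real^'n) tpoint2, 'n vec3) chart" where
  "rch c y = restrict_ch (ech c) (xbox y)"

lemma rch_mem: "c \<in> Y \<Longrightarrow> rch c y \<in> TT.BM"
  unfolding rch_def by (rule restrict_ch_mem[OF TT.BM_maximal ech_mem open_xbox])

text \<open>Radius 1/4 keeps points of a box at distance less than 1/2 in each fibre factor, while a
  nonzero integer vector has norm at least 1. The base needs no restriction.\<close>

lemma xbox_small:
  assumes "y1 \<in> xbox y" "y2 \<in> xbox y" "fst y1 = fst y2" "int_vec (fst (snd y1) - fst (snd y2))" "int_vec (snd (snd y1) - snd (snd y2))"
  shows "y1 = y2"
proof -
  have tri: "norm (a1 - a2) < 1" if "a1 \<in> ball a (1/4)" "a2 \<in> ball a (1/4)" for a a1 a2 :: "real^'n"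
    using dist_triangle3[of a1 a2 a] that by (simp add: dist_norm)
  have b: "fst (snd y1) \<in> ball (fst (snd y)) (1/4)" "fst (snd y2) \<in> ball (fst (snd y)) (1/4)"
    "snd (snd y1) \<in> ball (snd (snd y)) (1/4)" "snd (snd y2) \<in> ball (snd (snd y)) (1/4)"
    using assms(1,2) unfolding xbox_def mem_Times_iff by auto
  have "fst (snd y1) - fst (snd y2) = 0" by (rule int_vec_small[OF assms(4) tri[OF b(1,2)]])
  moreover have "snd (snd y1) - snd (snd y2) = 0" by (rule int_vec_small[OF assms(5) tri[OF b(3,4)]])
  ultimately have "fst (snd y1) - fst (snd y2) = 0" "snd (snd y1) - snd (snd y2) = 0" by simp_all
  then show ?thesis using assms(3) by (simp add: prod_eq_iff)
qed

lemma rch_inj: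
  assumes ic: "ichart c"
  shows "inj_on q (dom_ch (rch c y))"
proof (rule inj_onI)
  fix w w' assume w: "w \<in> dom_ch (rch c y)" "w' \<in> dom_ch (rch c y)" and e: "q w = q w'"
  have d: "w \<in> dom_ch (ech c)" "w' \<in> dom_ch (ech c)" "map_ch (ech c) w \<in> xbox y" "map_ch (ech c) w' \<in> xbox y"
    using w by (simp_all add: rch_def dom_restrict_ch)
  have "map_ch (ech c) w = map_ch (ech c) w'"
    by (rule xbox_small[OF d(3,4)]) (use e q_eq_iff[OF ic d(1,2)] in blast)+
  then show "w = w'" using is_chart_inj[OF maximal_chart[OF TT.BM_maximal ech_mem[OF ichart_mem[OF ic]]] d(1,2)] by simp
qed

text \<open>The adapted chart shifted back by \<open>t\<close>: for an integer translation
  \<open>t\<close> along the fibre it is the partner of \<open>rch c y\<close> in a deck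
  pair.\<close>

definition sch :: "('a, real^'n) chart \<Rightarrow> 'n vec3 \<Rightarrow> 'n vec3 \<Rightarrow> (('a, real^'n) tpoint2, 'n vec3) chart" where
  "sch c y t = ({w \<in> dom_ch (ech c). map_ch (ech c) w - t \<in> xbox y}, \<lambda>w. map_ch (ech c) w - t)"

context
  fixes c and t :: "'n vec3"
  assumes ic: "ichart c" and t: "fst t = 0"
begin

lemma sch_image: "(\<lambda>w. map_ch (ech c) w - t) ` {w \<in> dom_ch (ech c). map_ch (ech c) w - t \<in> xbox y} = img_ch (ech c) \<inter> xbox y"
proof
  note c = ichart_mem[OF ic]
  \<comment> \<open>The image of an adapted chart is \<open>img_ch c \<times> UNIV\<close>, hence
    invariant under translations whose base part is zero.\<close>
  have inv: "s \<in> img_ch (ech c) \<longleftrightarrow> s - t \<in> img_ch (ech c)" for s using t by (auto simp: img_ech_eq[OF c] mem_Times_iff)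
  show "(\<lambda>w. map_ch (ech c) w - t) ` {w \<in> dom_ch (ech c). map_ch (ech c) w - t \<in> xbox y} \<subseteq> img_ch (ech c) \<inter> xbox y"
    using inv map_ch_img[of _ "ech c"] by blast
  show "img_ch (ech c) \<inter> xbox y \<subseteq> (\<lambda>w. map_ch (ech c) w - t) ` {w \<in> dom_ch (ech c). map_ch (ech c) w - t \<in> xbox y}"
  proof
    fix s assume s: "s \<in> img_ch (ech c) \<inter> xbox y"
    then have "s + t \<in> img_ch (ech c)" using inv[of "s + t"] by simp
    then obtain w where "w \<in> dom_ch (ech c)" "map_ch (ech c) w = s + t" using inv_ch_dom map_inv_ch by metis
    then show "s \<in> (\<lambda>w. map_ch (ech c) w - t) ` {w \<in> dom_ch (ech c). map_ch (ech c) w - t \<in> xbox y}"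
      using s by (intro image_eqI[of _ _ w]) simp_all
  qed
qed

lemma sch_mem: "sch c y t \<in> TT.BM"
proof -
  note c = ichart_mem[OF ic]
  let ?D = "{w \<in> dom_ch (ech c). map_ch (ech c) w - t \<in> xbox y}"
  have o: "open (img_ch (ech c) \<inter> xbox y)"
    using open_img_ch[OF maximal_chart[OF TT.BM_maximal ech_mem[OF c]]] open_xbox by blast
  have i: "map_ch (ech c) ` ?D = (\<lambda>s. s - t) -` (img_ch (ech c) \<inter> xbox y)"
  proof
    show "map_ch (ech c) ` ?D \<subseteq> (\<lambda>s. s - t) -` (img_ch (ech c) \<inter> xbox y)" using sch_image[of y] by blast
    show "(\<lambda>s. s - t) -` (img_ch (ech c) \<inter> xbox y) \<subseteq> map_ch (ech c) ` ?D"
    proof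
      fix s assume "s \<in> (\<lambda>s. s - t) -` (img_ch (ech c) \<inter> xbox y)"
      then have "s - t \<in> (\<lambda>w. map_ch (ech c) w - t) ` ?D" unfolding sch_image by simp
      then show "s \<in> map_ch (ech c) ` ?D" by auto
    qed
  qed
  have o': "open (map_ch (ech c) ` ?D)" unfolding i by (intro open_vimage o continuous_intros)
  show ?thesis unfolding sch_def
    by (rule chart_change[OF TT.BM_maximal ech_mem[OF c], where \<phi> = "\<lambda>s. s - t" and \<psi> = "\<lambda>s. s + t"])
       (use o o' sch_image in \<open>auto intro!: smooth_on_diff smooth_on_add smooth_on_id smooth_on_const\<close>)
qed

lemma inv_sch:
  assumes s: "s \<in> img_ch (ech c) \<inter> xbox y"
  shows "inv_ch (sch c y t) s = inv_ch (ech c) (s + t)" "s + t \<in> img_ch (ech c)"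
proof -
  note ce = maximal_chart[OF TT.BM_maximal ech_mem[OF ichart_mem[OF ic]]]
  obtain w where w: "w \<in> dom_ch (ech c)" "map_ch (ech c) w - t \<in> xbox y" "s = map_ch (ech c) w - t"
    using s sch_image[of y] by blast
  have st: "s + t = map_ch (ech c) w" using w(3) by simp
  show "s + t \<in> img_ch (ech c)" unfolding st by (rule map_ch_img[OF w(1)])
  have "inv_ch (sch c y t) (map_ch (sch c y t) w) = w"
    by (rule inv_ch_map[OF maximal_chart[OF TT.BM_maximal sch_mem]]) (use w in \<open>simp add: sch_def\<close>)
  then show "inv_ch (sch c y t) s = inv_ch (ech c) (s + t)"
    unfolding st inv_ch_map[OF ce w(1)] by (simp add: sch_def w(3))
qed

lemma sch_inj: "inj_on q (dom_ch (sch c y t))"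
proof (rule inj_onI)
  fix w w' assume w: "w \<in> dom_ch (sch c y t)" "w' \<in> dom_ch (sch c y t)" and e: "q w = q w'"
  have d: "w \<in> dom_ch (ech c)" "w' \<in> dom_ch (ech c)" "map_ch (ech c) w - t \<in> xbox y" "map_ch (ech c) w' - t \<in> xbox y"
    using w by (simp_all add: sch_def)
  have "map_ch (ech c) w - t = map_ch (ech c) w' - t"
    by (rule xbox_small[OF d(3,4)]) (use e q_eq_iff[OF ic d(1,2)] in simp_all)
  then show "w = w'" using is_chart_inj[OF maximal_chart[OF TT.BM_maximal ech_mem[OF ichart_mem[OF ic]]] d(1,2)] by simp
qed

end

text \<open>The explicit form of the pair, beyond mere existence, is recorded because the invariance
  of the tensors is checked on exactly these charts.\<close>

lemma deck_exists:
  assumes w: "w \<in> points TT.BM" and w': "w' \<in> points TT.BM" and e: "q w = q w'"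
  obtains c y t where "ichart c" "fst t = 0" "deck_pair TT.BM q (rch c y) (sch c y t) w w'"
proof -
  obtain c where ic: "ichart c" and wc: "w \<in> dom_ch (ech c)" using w by (rule ech_cover)
  note c = ichart_mem[OF ic] and wc' = q_ech[OF ic wc w' e]
  note ce = maximal_chart[OF TT.BM_maximal ech_mem[OF c]]
  let ?y = "map_ch (ech c) w" and ?y' = "map_ch (ech c) w'"
  \<comment> \<open>The coordinate difference of the two points: zero in the base and integral in
    the fibre, because they have the same image under \<open>q\<close>.\<close>
  define t where "t = ?y' - ?y"
  note qq = q_eq_iff[OF ic wc wc', THEN iffD1, OF e]
  have t0: "fst t = 0" using qq by (simp add: t_def)
  have ti: "int_vec (fst (snd t))" "int_vec (snd (snd t))"
    using int_vec_minus[of "fst (snd ?y) - fst (snd ?y')"] int_vec_minus[of "snd (snd ?y) - snd (snd ?y')"] qq by (simp_all add: t_def)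
  have img: "img_ch (sch c ?y t) = img_ch (ech c) \<inter> xbox ?y"
    using sch_image[OF ic t0, of ?y] by (simp add: sch_def img_ch_def)
  have "q (inv_ch (rch c ?y) x) = q (inv_ch (sch c ?y t) x)" if x: "x \<in> img_ch (ech c) \<inter> xbox ?y" for x
  proof -
    note s = inv_sch[OF ic t0 x]
    have x': "x \<in> img_ch (ech c)" "x \<in> xbox ?y" using x by auto
    have "q (inv_ch (ech c) x) = q (inv_ch (ech c) (x + t))"
      unfolding q_eq_iff[OF ic inv_ch_dom[OF x'(1)] inv_ch_dom[OF s(2)]] map_inv_ch[OF x'(1)] map_inv_ch[OF s(2)]
      using t0 int_vec_minus[OF ti(1)] int_vec_minus[OF ti(2)] by simp
    then show ?thesis unfolding s(1) rch_def inv_restrict_ch[OF ce x'] .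
  qed
  then have "deck_pair TT.BM q (rch c ?y) (sch c ?y t) w w'"
    unfolding deck_pair_def
    using rch_mem[OF c] sch_mem[OF ic t0] rch_inj[OF ic] sch_inj[OF ic t0] wc wc' xbox_centre img
    by (simp add: rch_def dom_restrict_ch map_restrict_ch img_restrict_ch) (simp add: sch_def t_def xbox_centre)
  then show ?thesis using that ic t0 by blast
qed

sublocale Q: quotient_atlas TT.BM q
proof
  show "\<exists>e e'. deck_pair TT.BM q e e' w w'" if "w \<in> points TT.BM" "w' \<in> points TT.BM" "q w = q w'" for w w'
    using deck_exists[OF that] by metis
qed (rule TT.BM_maximal)

lemma X_manifold_eq: "X_manifold Y g L = Q.X"
  by (simp add: X_manifold_def double_tangent_bundle_BM)

section \<open>Invariance and descent of the three tensors\<close>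

lemma rch_component:
  assumes c: "c \<in> Y" and w: "w \<in> dom_ch (rch c y)" and v: "v \<in> tangent_space TT.BM w"
  shows "v (rch c y) = v (ech c)"
  by (rule component_translate[OF TT.BM_maximal ech_mem[OF c] rch_mem[OF c] _ _ w v, where t = 0])
     (auto simp: rch_def restrict_ch_def)

lemma sch_component:
  assumes ic: "ichart c" "fst t = 0" and w: "w \<in> dom_ch (sch c y t)" and v: "v \<in> tangent_space TT.BM w"
  shows "v (sch c y t) = v (ech c)"
  by (rule component_translate[OF TT.BM_maximal ech_mem[OF ichart_mem[OF ic(1)]] sch_mem[OF ic] _ _ w v, where t = "- t"])
     (auto simp: sch_def)

definition base_rep :: "('n vec3 \<Rightarrow> 'n vec3 \<Rightarrow> 'n vec3 \<Rightarrow> real) \<Rightarrow> bool" where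
  "base_rep B \<longleftrightarrow> (\<forall>y y'. fst y = fst y' \<longrightarrow> B y = B y')"

lemma rep_rch:
  assumes c: "c \<in> Y" and T: "tensor_rep TT.BM T (ech c) B"
  shows "tensor_rep TT.BM T (rch c y) B"
  unfolding tensor_rep_def[OF TT.BM_maximal]
proof (intro ballI)
  fix w u v assume w: "w \<in> dom_ch (rch c y)" and uv: "u \<in> tangent_space TT.BM w" "v \<in> tangent_space TT.BM w"
  have "w \<in> dom_ch (ech c)" using w by (simp add: rch_def dom_restrict_ch)
  then show "T w u v = B (map_ch (rch c y) w) (u (rch c y)) (v (rch c y))"
    using tensor_repD[OF TT.BM_maximal T _ uv] rch_component[OF c w uv(1)] rch_component[OF c w uv(2)]
    by (simp add: rch_def map_restrict_ch)
qed

lemma rep_sch: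
  assumes ic: "ichart c" "fst t = 0" and B: "base_rep B" and T: "tensor_rep TT.BM T (ech c) B"
  shows "tensor_rep TT.BM T (sch c y t) B"
  unfolding tensor_rep_def[OF TT.BM_maximal]
proof (intro ballI)
  fix w u v assume w: "w \<in> dom_ch (sch c y t)" and uv: "u \<in> tangent_space TT.BM w" "v \<in> tangent_space TT.BM w"
  have w': "w \<in> dom_ch (ech c)" using w by (simp add: sch_def)
  have "B (map_ch (sch c y t) w) = B (map_ch (ech c) w)"
    using B[unfolded base_rep_def, rule_format, of "map_ch (sch c y t) w" "map_ch (ech c) w"] ic(2) by (simp add: sch_def)
  then show "T w u v = B (map_ch (sch c y t) w) (u (sch c y t)) (v (sch c y t))"
    using tensor_repD[OF TT.BM_maximal T w' uv] sch_component[OF ic w uv(1)] sch_component[OF ic w uv(2)] by simp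
qed

text \<open>A coordinate expression that depends on the base point only is unchanged by the fibre
  translations, and the deck pairs consist of such translations.\<close>

lemma deck_invariantI:
  assumes B: "\<And>c. ichart c \<Longrightarrow> base_rep (B c)" and T: "\<And>c. ichart c \<Longrightarrow> tensor_rep TT.BM T (ech c) (B c)"
  shows "Q.deck_invariant T"
  unfolding Q.deck_invariant_def
proof (intro ballI impI)
  fix w w' assume w: "w \<in> points TT.BM" "w' \<in> points TT.BM" "q w = q w'"
  obtain c y t where ic: "ichart c" "fst t = 0" and d: "deck_pair TT.BM q (rch c y) (sch c y t) w w'"
    using deck_exists[OF w] .
  note c = ichart_mem[OF ic(1)]
  have m: "w \<in> dom_ch (rch c y)" "w' \<in> dom_ch (sch c y t)" "map_ch (rch c y) w = map_ch (sch c y t) w'"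
    using d by (simp_all add: deck_pair_def)
  have "tensor_comp TT.BM T (rch c y) (map_ch (rch c y) w) a b = tensor_comp TT.BM T (sch c y t) (map_ch (sch c y t) w') a b" for a b
    using tensor_comp_rep[OF TT.BM_maximal rch_mem[OF c] rep_rch[OF c T[OF ic(1)]] map_ch_img[OF m(1)]]
      tensor_comp_rep[OF TT.BM_maximal sch_mem[OF ic] rep_sch[OF ic B[OF ic(1)] T[OF ic(1)]] map_ch_img[OF m(2)]] m(3) by simp
  then show "\<exists>e e'. deck_pair TT.BM q e e' w w' \<and> (\<forall>a b. tensor_comp TT.BM T e (map_ch e w) a b = tensor_comp TT.BM T e' (map_ch e' w') a b)"
    using d by blast
qed

lemma base_reps: "base_rep (rep1 c)" "base_rep rep2" "base_rep (reph c)"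
  by (simp_all add: base_rep_def rep1_def rep2_def reph_def)

lemma deck_invariants: "Q.deck_invariant \<Omega>1" "Q.deck_invariant \<Omega>2" "Q.deck_invariant HH"
  using deck_invariantI[of rep1] deck_invariantI[of "\<lambda>_. rep2"] deck_invariantI[of reph] base_reps rep1 rep2 reph by blast+

lemma canonical_iff:
  "canonical_structure Y g nabla L (\<omega>1, \<omega>2, h) \<longleftrightarrow>
     tensor2_field Q.X \<omega>1 \<and> tensor2_field Q.X \<omega>2 \<and> tensor2_field Q.X h \<and>
     pullback TT.BM Q.X q \<omega>1 = \<Omega>1 \<and> pullback TT.BM Q.X q \<omega>2 = \<Omega>2 \<and> pullback TT.BM Q.X q h = HH"
  by (simp add: canonical_structure_def X_manifold_eq double_tangent_bundle_BM tangent_bundle_BM Let_def)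

lemma canonical_ex1: "\<exists>!S. canonical_structure Y g nabla L S"
proof (rule ex1I[of _ "(Q.descend \<Omega>1, Q.descend \<Omega>2, Q.descend HH)"])
  show "canonical_structure Y g nabla L (Q.descend \<Omega>1, Q.descend \<Omega>2, Q.descend HH)"
    unfolding canonical_iff
    using Q.descend_tensor Q.pullback_descend TT_tensors deck_invariants by blast
  fix S assume S: "canonical_structure Y g nabla L S"
  obtain \<omega>1 \<omega>2 h where e: "S = (\<omega>1, \<omega>2, h)" by (cases S)
  note S' = S[unfolded e canonical_iff]
  have *: "S = Q.descend T" if "tensor2_field Q.X S" "pullback TT.BM Q.X q S = T" "tensor2_field TT.BM T" "Q.deck_invariant T" for S T
    by (rule Q.descend_unique[OF that(1,2) Q.descend_tensor[OF that(3,4)] Q.pullback_descend[OF that(3,4)]])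
  have "\<omega>1 = Q.descend \<Omega>1" "\<omega>2 = Q.descend \<Omega>2" "h = Q.descend HH"
    using S' by (intro * TT_tensors deck_invariants; blast)+
  then show "S = (Q.descend \<Omega>1, Q.descend \<Omega>2, Q.descend HH)" by (simp add: e)
qed

section \<open>Separation and countability of the quotient\<close>

lemma openin_TT_base:
  assumes U: "openin (manifold_topology Y) U"
  shows "openin (manifold_topology TT.BM) {w \<in> TE2. fst (fst w) \<in> U}"
proof (rule openin_manifoldI[OF TT.BM_maximal])
  fix w assume w: "w \<in> {w \<in> TE2. fst (fst w) \<in> U}"
  then have "w \<in> points TT.BM" unfolding TT.points_BM by blast
  then obtain c where ic: "ichart c" and wc: "w \<in> dom_ch (ech c)" by (rule ech_cover)
  note c = ichart_mem[OF ic]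
  let ?V = "map_ch c ` (U \<inter> dom_ch c) \<times> (UNIV :: ((real^'n) \<times> (real^'n)) set)"
  have "open ?V" using openin_imp_open_image[OF M U c] by (simp add: open_Times)
  moreover have "map_ch (ech c) w \<in> ?V" using w wc by (auto simp: ech_def)
  moreover have "dom_ch (ech c) \<inter> map_ch (ech c) -` ?V \<subseteq> {w \<in> TE2. fst (fst w) \<in> U}"
    using is_chart_inj[OF maximal_chart[OF M c]] by (auto simp: ech_def)
  ultimately show "\<exists>e V. e \<in> TT.BM \<and> open V \<and> w \<in> dom_ch e \<and> map_ch e w \<in> V \<and> dom_ch e \<inter> map_ch e -` V \<subseteq> {w \<in> TE2. fst (fst w) \<in> U}"
    using ech_mem[OF c] wc by (intro exI[of _ "ech c"] exI[of _ ?V] conjI)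
qed

lemma q_base:
  assumes w: "w \<in> points TT.BM" "w' \<in> points TT.BM" "q w = q w'"
  shows "fst (fst w) = fst (fst w')"
proof -
  obtain c where ic: "ichart c" and wc: "w \<in> dom_ch (ech c)" using w(1) by (rule ech_cover)
  note wc' = q_ech[OF ic wc w(2,3)]
  have "fst (map_ch (ech c) w) = fst (map_ch (ech c) w')" using q_eq_iff[OF ic wc wc'] w(3) by blast
  then have "map_ch c (fst (fst w)) = map_ch c (fst (fst w'))" by (simp add: ech_def)
  moreover have "fst (fst w) \<in> dom_ch c" "fst (fst w') \<in> dom_ch c" using wc wc' unfolding ech_def by auto
  ultimately show ?thesis by (intro is_chart_inj[OF maximal_chart[OF M ichart_mem[OF ic]]])
qed

text \<open>Points over different base points are separated by the Hausdorff property of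
  \<open>Y\<close>. Over the same base point some fibre coordinate differs by a non-integer, and
  that coordinate modulo the integers is preserved by \<open>q\<close>.\<close>

lemma q_separated:
  assumes w: "w \<in> points TT.BM" "w' \<in> points TT.BM" "q w \<noteq> q w'"
  shows "\<exists>U U'. openin (manifold_topology TT.BM) U \<and> openin (manifold_topology TT.BM) U' \<and> w \<in> U \<and> w' \<in> U' \<and> q ` U \<inter> q ` U' = {}"
proof (cases "fst (fst w) = fst (fst w')")
  case False
  have TE2: "w \<in> TE2" "w' \<in> TE2" using w TT.points_BM by auto
  have "fst (fst w) \<in> topspace (manifold_topology Y)" "fst (fst w') \<in> topspace (manifold_topology Y)"
    unfolding topspace_manifold[OF M] using TE2 by auto
  then obtain U V where U: "openin (manifold_topology Y) U" "openin (manifold_topology Y) V" "fst (fst w) \<in> U" "fst (fst w') \<in> V" "disjnt U V"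
    using Y_manifold False unfolding smooth_manifold_def Hausdorff_space_def by blast
  let ?U = "\<lambda>U. {w \<in> TE2. fst (fst w) \<in> U}"
  have "q w1 \<noteq> q w2" if "w1 \<in> ?U U" "w2 \<in> ?U V" for w1 w2
  proof
    assume e: "q w1 = q w2"
    have "w1 \<in> points TT.BM" "w2 \<in> points TT.BM" unfolding TT.points_BM using that by auto
    from q_base[OF this e] show False using that U(5) unfolding disjnt_def by auto
  qed
  then have "q ` ?U U \<inter> q ` ?U V = {}" by (rule disjoint_images)
  then show ?thesis
    using openin_TT_base[OF U(1)] openin_TT_base[OF U(2)] U(3,4) TE2 by (intro exI[of _ "?U U"] exI[of _ "?U V"]) simp
next
  case True
  obtain c where ic: "ichart c" and wc: "w \<in> dom_ch (ech c)" using w(1) by (rule ech_cover)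
  note c = ichart_mem[OF ic]
  have "w' \<in> TE2" using w(2) TT.points_BM by blast
  moreover have "fst (fst w) \<in> dom_ch c" using wc unfolding ech_def by auto
  then have "fst (fst w') \<in> dom_ch c" unfolding True .
  ultimately have wc': "w' \<in> dom_ch (ech c)" unfolding ech_def by auto
  let ?y = "map_ch (ech c) w" and ?y' = "map_ch (ech c) w'"
  have "fst ?y = fst ?y'" using True by (simp add: ech_def)
  then have "\<not> (int_vec (fst (snd ?y) - fst (snd ?y')) \<and> int_vec (snd (snd ?y) - snd (snd ?y')))"
    using w(3) q_eq_iff[OF ic wc wc'] by blast
  then obtain i where "fst (snd ?y) $ i - fst (snd ?y') $ i \<notin> \<int> \<or> snd (snd ?y) $ i - snd (snd ?y') $ i \<notin> \<int>"
    by (auto simp: int_vec_def)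
  \<comment> \<open>A single name for the offending coordinate, of either kind, avoids doing the
    separation argument twice.\<close>
  then have "\<exists>f :: 'n vec3 \<Rightarrow> real. f ?y - f ?y' \<notin> \<int> \<and> (f = (\<lambda>y. fst (snd y) $ i) \<or> f = (\<lambda>y. snd (snd y) $ i))"
    by (elim disjE) (rule exI[of _ "\<lambda>y. fst (snd y) $ i"], simp, rule exI[of _ "\<lambda>y. snd (snd y) $ i"], simp)
  then obtain f :: "'n vec3 \<Rightarrow> real" where f: "f ?y - f ?y' \<notin> \<int>" and ff: "f = (\<lambda>y. fst (snd y) $ i) \<or> f = (\<lambda>y. snd (snd y) $ i)"
    by (elim exE conjE) (rule that)
  have cont: "continuous_on UNIV f" using ff by (auto intro!: continuous_intros)
  obtain \<epsilon> where \<epsilon>: "\<epsilon> > 0" "\<forall>k\<in>\<int>. \<bar>(f ?y - f ?y') - k\<bar> \<ge> 2 * \<epsilon>" using non_integer_gap[OF f] by auto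
  let ?V = "\<lambda>y. f -` ball (f y) \<epsilon>"
  have oV: "open (?V y)" for y using cont by (simp add: open_vimage)
  let ?U = "\<lambda>y. dom_ch (ech c) \<inter> map_ch (ech c) -` ?V y"
  \<comment> \<open>Each value of \<open>f\<close> moves by less than \<open>\<epsilon>\<close>, so
    the difference stays within \<open>2 * \<epsilon>\<close> of a number that is at least that far
    from every integer.\<close>
  have "q w1 \<noteq> q w2" if "w1 \<in> ?U ?y" "w2 \<in> ?U ?y'" for w1 w2
  proof
    assume "q w1 = q w2"
    then have "f (map_ch (ech c) w1) - f (map_ch (ech c) w2) \<in> \<int>"
      using q_eq_iff[OF ic, of w1 w2] that ff by (auto simp: int_vec_def)
    from \<epsilon>(2)[rule_format, OF this] show False using that by (simp add: dist_real_def) linarith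
  qed
  then have "q ` ?U ?y \<inter> q ` ?U ?y' = {}" by (rule disjoint_images)
  moreover have "openin (manifold_topology TT.BM) (?U y)" for y by (rule openin_restrict_ch[OF TT.BM_maximal ech_mem[OF c] oV])
  ultimately show ?thesis using wc wc' \<epsilon>(1) by (intro exI[of _ "?U ?y"] exI[of _ "?U ?y'"]) simp
qed

lemma X_smooth: "smooth_manifold Q.X"
proof -
  have ich: "{c. ichart c} \<subseteq> Y" "points Y \<subseteq> (\<Union>c\<in>{c. ichart c}. dom_ch c)"
    using ichart_mem ichart_ex by (blast, metis (mono_tags, lifting) UN_I mem_Collect_eq subsetI)
  obtain D where D: "countable D" "D \<subseteq> {c. ichart c}" "(\<Union>c\<in>D. dom_ch c) = points Y"
    using countable_subcover[OF Y_manifold ich] .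
  obtain S :: "((real^'n) \<times> (real^'n)) set" where S: "countable S" "\<And>V. open V \<Longrightarrow> V \<noteq> {} \<Longrightarrow> \<exists>d\<in>S. d \<in> V"
    using countable_dense_exists by metis
  \<comment> \<open>Countably many adapted charts cover \<open>Y\<close>, and boxes centred in a
    countable dense set cover the fibres. The base part \<open>0\<close> of a centre is a dummy
    value, since \<open>xbox\<close> does not restrict the base.\<close>
  let ?C = "(\<lambda>(c, s). rch c (0, s)) ` (D \<times> S)"
  show ?thesis
  proof (rule Q.X_smooth_manifold[OF q_separated])
    show "countable ?C" using D S by simp
    show "?C \<subseteq> {e \<in> TT.BM. inj_on q (dom_ch e)}"
    proof
      fix e assume "e \<in> ?C"
      then obtain c s where "c \<in> D" "e = rch c (0, s)" by auto
      then show "e \<in> {e \<in> TT.BM. inj_on q (dom_ch e)}" using D(2) rch_mem[OF ichart_mem] rch_inj by blast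
    qed
    show "points Q.X \<subseteq> (\<Union>e\<in>?C. q ` dom_ch e)"
    proof
      fix P assume "P \<in> points Q.X"
      then obtain w where w: "w \<in> points TT.BM" "P = q w" unfolding Q.points_X by blast
      have TE2: "w \<in> TE2" using w(1) TT.points_BM by blast
      then have "fst (fst w) \<in> points Y" by auto
      then obtain c where c: "c \<in> D" "fst (fst w) \<in> dom_ch c" unfolding D(3)[symmetric] by blast
      have wc: "w \<in> dom_ch (ech c)" using TE2 c(2) by (simp add: ech_def)
      let ?y = "map_ch (ech c) w"
      have "open (ball (fst (snd ?y)) (1/4) \<times> ball (snd (snd ?y)) (1/4))" by (intro open_Times open_ball)
      moreover have "snd ?y \<in> ball (fst (snd ?y)) (1/4) \<times> ball (snd (snd ?y)) (1/4)" by (simp add: mem_Times_iff)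
      ultimately obtain s where s: "s \<in> S" "s \<in> ball (fst (snd ?y)) (1/4) \<times> ball (snd (snd ?y)) (1/4)" using S(2) by blast
      then have "?y \<in> xbox (0, s)" by (simp add: xbox_def mem_Times_iff dist_commute)
      then have "w \<in> dom_ch (rch c (0, s))" using wc by (simp add: rch_def dom_restrict_ch)
      then show "P \<in> (\<Union>e\<in>?C. q ` dom_ch e)" using w(2) c(1) s(1) by blast
    qed
  qed
qed

section \<open>Adapted charts of the quotient\<close>

definition xch :: "('a, real^'n) chart \<Rightarrow> 'n vec3 \<Rightarrow> (('a, real^'n) xpoint, 'n vec3) chart" where
  "xch c y = qchart q (rch c y)"

lemma xch_mem: "ichart c \<Longrightarrow> xch c y \<in> Q.X"
  unfolding xch_def by (rule Q.qchart_mem[OF rch_mem[OF ichart_mem] rch_inj])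

lemma img_xch:
  assumes ic: "ichart c"
  shows "img_ch (xch c y) = img_ch (ech c) \<inter> xbox y"
  unfolding xch_def img_qchart[OF rch_inj[OF ic]] by (simp add: rch_def img_restrict_ch)

lemma map_xch:
  assumes ic: "ichart c" and w: "w \<in> dom_ch (ech c)" "map_ch (ech c) w \<in> xbox y"
  shows "q w \<in> dom_ch (xch c y)" "map_ch (xch c y) (q w) = map_ch (ech c) w"
proof -
  have "w \<in> dom_ch (rch c y)" using w by (simp add: rch_def dom_restrict_ch)
  then show "q w \<in> dom_ch (xch c y)" "map_ch (xch c y) (q w) = map_ch (ech c) w"
    using map_qchart[OF rch_inj[OF ic]] by (simp_all add: xch_def dom_qchart) (simp add: rch_def map_restrict_ch)
qed

lemma xch_cover:
  assumes "P \<in> points Q.X"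
  obtains c y where "ichart c" "P \<in> dom_ch (xch c y)" "map_ch (xch c y) P = y"
proof -
  obtain w where w: "w \<in> points TT.BM" "P = q w" using assms unfolding Q.points_X by blast
  obtain c where c: "ichart c" "w \<in> dom_ch (ech c)" using w(1) by (rule ech_cover)
  show ?thesis using that[OF c(1)] map_xch[OF c xbox_centre] w(2) by blast
qed

lemma xch_rep:
  assumes P: "pullback TT.BM Q.X q S = T" and ic: "ichart c" and T: "tensor_rep TT.BM T (ech c) B"
  shows "tensor_rep Q.X S (xch c y) B"
  unfolding tensor_rep_def[OF Q.X_maximal]
proof (intro ballI)
  fix R u v assume R: "R \<in> dom_ch (xch c y)" and uv: "u \<in> tangent_space Q.X R" "v \<in> tangent_space Q.X R"
  note rm = rch_mem[OF ichart_mem[OF ic], of y]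
  have "map_ch (xch c y) R \<in> img_ch (rch c y)"
    using map_ch_img[OF R] img_qchart[OF rch_inj[OF ic], of y] by (simp add: xch_def)
  then show "S R u v = B (map_ch (xch c y) R) (u (xch c y)) (v (xch c y))"
    using tensor_repD[OF Q.X_maximal Q.pullback_rep[OF P rm rch_inj[OF ic]] _ uv] R
      tensor_comp_rep[OF TT.BM_maximal rm rep_rch[OF ichart_mem[OF ic] T]] by (simp add: xch_def)
qed

lemma smooth_rep_xch:
  assumes ic: "ichart c" and B: "smooth_rep (ech c) B"
  shows "smooth_rep (xch c y) B"
  unfolding smooth_rep_def[OF Q.X_maximal] img_xch[OF ic]
proof (intro conjI ballI allI)
  have o: "open (img_ch (ech c))" using open_img_ch[OF maximal_chart[OF TT.BM_maximal ech_mem[OF ichart_mem[OF ic]]]] .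
  show "bilinear (B x)" if "x \<in> img_ch (ech c) \<inter> xbox y" for x using B that by (simp add: smooth_rep_def[OF TT.BM_maximal])
  have "smooth_on (img_ch (ech c)) (\<lambda>x. B x a b)" for a b using B unfolding smooth_rep_def[OF TT.BM_maximal] by blast
  then show "smooth_on (img_ch (ech c) \<inter> xbox y) (\<lambda>x. B x a b)" for a b
    by (rule smooth_on_subset[OF _ o open_Int[OF o open_xbox]]) blast
qed

end

section \<open>The almost 2-Kaehler structure\<close>

text \<open>Gram-Schmidt for the inner product of \<open>G\<close>, carried out over finite subsets
  of the index type and extending by one index at a time.\<close>

lemma G_orthonormal_exists:
  fixes G :: "real^'n^'n"
  assumes sym: "\<And>a b. a \<bullet> (G *v b) = (G *v a) \<bullet> b" and pos: "\<And>a. a \<noteq> 0 \<Longrightarrow> a \<bullet> (G *v a) > 0"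
  shows "\<exists>e :: 'n \<Rightarrow> real^'n. \<forall>i j. e i \<bullet> (G *v e j) = of_bool (i = j)"
proof -
  have "\<exists>e :: 'n \<Rightarrow> real^'n. \<forall>i\<in>I. \<forall>j\<in>I. e i \<bullet> (G *v e j) = of_bool (i = j)" if "finite I" for I
    using that
  proof (induction I rule: finite_induct)
    case (insert i I)
    then obtain e :: "'n \<Rightarrow> real^'n" where e: "\<And>j k. j \<in> I \<Longrightarrow> k \<in> I \<Longrightarrow> e j \<bullet> (G *v e k) = of_bool (j = k)" by blast
    \<comment> \<open>Fewer vectors than the dimension cannot span the space, so there is a vector
      \<open>x\<close> to orthogonalize.\<close>
    have "card I < CARD('n)" using insert.hyps psubset_card_mono[of UNIV I] by auto
    then have "dim (span (e ` I)) < DIM(real^'n)"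
      using dim_le_card'[of "e ` I"] card_image_le[OF insert.hyps(1), of e] insert.hyps(1) by (simp add: dim_span)
    then have "span (e ` I) \<noteq> UNIV" by (metis dim_UNIV less_irrefl)
    then obtain x where x: "x \<notin> span (e ` I)" by blast
    define z where "z = x - (\<Sum>j\<in>I. (e j \<bullet> (G *v x)) *\<^sub>R e j)"
    have "(\<Sum>j\<in>I. (e j \<bullet> (G *v x)) *\<^sub>R e j) \<in> span (e ` I)" by (intro span_sum span_scale span_base) simp
    then have z0: "z \<noteq> 0" using x by (auto simp: z_def)
    have orth: "e j \<bullet> (G *v z) = 0" if j: "j \<in> I" for j
    proof -
      have "e j \<bullet> (G *v z) = e j \<bullet> (G *v x) - (\<Sum>k\<in>I. (e k \<bullet> (G *v x)) * (e j \<bullet> (G *v e k)))"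
        by (simp add: z_def matrix_vector_mult_diff_distrib inner_diff_right inner_sum_right
            linear_sum[OF matrix_vector_mul_linear] matrix_vector_mult_scaleR)
      also have "(\<Sum>k\<in>I. (e k \<bullet> (G *v x)) * (e j \<bullet> (G *v e k))) = (\<Sum>k\<in>I. if k = j then e j \<bullet> (G *v x) else 0)"
        by (rule sum.cong) (use e[OF j] in auto)
      finally show ?thesis using j insert.hyps(1) by simp
    qed
    have orth': "z \<bullet> (G *v e j) = 0" if "j \<in> I" for j using orth[OF that] sym[of z "e j"] by (simp add: inner_commute)
    define s where "s = sqrt (z \<bullet> (G *v z))"
    have s: "s > 0" "s * s = z \<bullet> (G *v z)" using pos[OF z0] by (simp_all add: s_def)
    let ?e = "e(i := (1 / s) *\<^sub>R z)"
    have "?e j \<bullet> (G *v ?e k) = of_bool (j = k)" if "j \<in> insert i I" "k \<in> insert i I" for j k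
      using that e orth orth' insert.hyps(2) s by (auto simp: matrix_vector_mult_scaleR)
    then show ?case by blast
  qed simp
  from this[of UNIV] show ?thesis by simp
qed

text \<open>With the \<open>e i\<close> as rows of \<open>E\<close>, orthonormality reads
  \<open>E G E\<^sup>T = 1\<close>. For square matrices this can be cycled to
  \<open>E\<^sup>T E G = 1\<close>, which is the claim after pairing with \<open>s\<close> and
  \<open>t\<close>.\<close>

lemma G_orthonormal_expand:
  fixes G :: "real^'n^'n" and e :: "'n \<Rightarrow> real^'n"
  assumes e: "\<And>i j. e i \<bullet> (G *v e j) = of_bool (i = j)"
  shows "(\<Sum>i\<in>UNIV. (e i \<bullet> (G *v s)) * (e i \<bullet> t)) = s \<bullet> t"
proof -
  define E :: "real^'n^'n" where "E = (\<chi> i. e i)"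
  have Ev: "(E *v x) $ i = e i \<bullet> x" for x i by (simp add: E_def matrix_vector_mul_component)
  have "(E ** (G ** transpose E)) *v axis j 1 = mat 1 *v axis j 1" for j
  proof -
    have "transpose E *v axis j 1 = e j" by (simp add: matrix_vector_mult_basis column_def transpose_def E_def vec_eq_iff)
    then have "(E ** (G ** transpose E)) *v axis j 1 = E *v (G *v e j)" by (simp flip: matrix_vector_mul_assoc)
    then show ?thesis by (simp add: vec_eq_iff Ev e axis_def)
  qed
  then have "(E ** (G ** transpose E)) $ i $ j = mat 1 $ i $ j" for i j
    using matrix_vector_mult_basis[of "E ** (G ** transpose E)" j] matrix_vector_mult_basis[of "mat 1 :: real^'n^'n" j]
    by (simp add: column_def vec_eq_iff)
  then have "E ** (G ** transpose E) = mat 1" by (simp add: vec_eq_iff)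
  then have "(G ** transpose E) ** E = mat 1" by (rule matrix_left_right_inverse[THEN iffD1])
  then have "G ** (transpose E ** E) = mat 1" by (simp only: matrix_mul_assoc)
  then have I: "(transpose E ** E) ** G = mat 1" by (rule matrix_left_right_inverse[THEN iffD1])
  have "(\<Sum>i\<in>UNIV. (e i \<bullet> (G *v s)) * (e i \<bullet> t)) = (E *v (G *v s)) \<bullet> (E *v t)" by (simp add: inner_vec_def[of "E *v (G *v s)"] Ev)
  also have "\<dots> = (transpose E *v (E *v (G *v s))) \<bullet> t" by (simp only: transpose_matrix_vector dot_lmul_matrix)
  also have "transpose E *v (E *v (G *v s)) = s" using I by (simp add: matrix_vector_mul_assoc matrix_mul_assoc)
  finally show ?thesis .
qed

locale canonical = kaehler_lattice Y g nabla L
  for Y :: "('a, real^'n) atlas" and g nabla L +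
  fixes \<omega>1 \<omega>2 h
  assumes can: "canonical_structure Y g nabla L (\<omega>1, \<omega>2, h)"
begin

abbreviation "X \<equiv> Q.X"

lemmas can' = can[unfolded canonical_iff]

lemma fields: "tensor2_field X \<omega>1" "tensor2_field X \<omega>2" "tensor2_field X h"
  using can' by blast+

lemma
  assumes ic: "ichart c"
  shows xrep1: "tensor_rep X \<omega>1 (xch c y) (rep1 c)" and xrep2: "tensor_rep X \<omega>2 (xch c y) rep2"
    and xreph: "tensor_rep X h (xch c y) (reph c)"
  using can' xch_rep[OF _ ic] rep1[OF ic] rep2[OF ic] reph[OF ic] by blast+

definition "repD = (\<lambda>(y :: 'n vec3) (a :: 'n vec3) (b :: 'n vec3). fst (snd a) \<bullet> snd (snd b) - fst (snd b) \<bullet> snd (snd a))"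

lemma xch_base:
  assumes "ichart c" "P \<in> dom_ch (xch c y)"
  shows "fst (map_ch (xch c y) P) \<in> img_ch c"
  using map_ch_img[OF assms(2)] img_xch[OF assms(1)] fst_img_ech[OF assms(1)] by blast

section \<open>Positivity of the descended metric\<close>

lemma ginv_sym:
  assumes c: "c \<in> Y" "x \<in> img_ch c"
  shows "a \<bullet> (ginv c x *v b) = b \<bullet> (ginv c x *v a)"
  using Gm_sym[OF c, of "ginv c x *v b" "ginv c x *v a"] matrix_inv_vec(1)[OF Gm_invertible[OF c]] by (simp add: inner_commute)

lemma ginv_pos:
  assumes c: "c \<in> Y" "x \<in> img_ch c" and a: "a \<noteq> 0"
  shows "a \<bullet> (ginv c x *v a) > 0"
proof -
  have e: "Gm c x *v (ginv c x *v a) = a" by (rule matrix_inv_vec(1)[OF Gm_invertible[OF c]])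
  then have "ginv c x *v a \<noteq> 0" using a by auto
  from Gm_pos[OF c this] show ?thesis unfolding e by (simp add: inner_commute)
qed

lemma reph_pos:
  assumes c: "c \<in> Y" "fst y \<in> img_ch c" and a: "a \<noteq> 0"
  shows "reph c y a a > 0"
proof -
  have G0: "s \<bullet> (Gm c (fst y) *v s) \<ge> 0" for s using Gm_pos[OF c, of s] by (cases "s = 0") auto
  have g0: "s \<bullet> (ginv c (fst y) *v s) \<ge> 0" for s using ginv_pos[OF c, of s] by (cases "s = 0") auto
  have "fst a \<noteq> 0 \<or> fst (snd a) \<noteq> 0 \<or> snd (snd a) \<noteq> 0" using a by (auto simp: prod_eq_iff)
  then show ?thesis
    unfolding reph_def
    using Gm_pos[OF c, of "fst a"] Gm_pos[OF c, of "fst (snd a)"] ginv_pos[OF c, of "snd (snd a)"]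
      G0[of "fst a"] G0[of "fst (snd a)"] g0[of "snd (snd a)"] by (elim disjE) linarith+
qed

lemma h_riemannian: "riemannian_metric X h"
  unfolding riemannian_metric_def
proof (intro conjI fields ballI impI)
  fix P u v assume P: "P \<in> points X" and u: "u \<in> tangent_space X P" and v: "v \<in> tangent_space X P"
  obtain c y where ic: "ichart c" and Pc: "P \<in> dom_ch (xch c y)" using P by (rule xch_cover)
  note c = ichart_mem[OF ic] and x = xch_base[OF ic Pc]
  note hr = tensor_repD[OF Q.X_maximal xreph[OF ic] Pc]
  show "h P u v = h P v u"
    unfolding hr[OF u v] hr[OF v u] reph_def
    using Gm_sym[OF c x] ginv_sym[OF c x] by (simp add: inner_commute)
  assume "u \<noteq> tzero"
  then have "u (xch c y) \<noteq> 0"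
    using tangent_eqI[OF Q.X_maximal u tzero_tangent[OF Q.X_maximal] xch_mem[OF ic] Pc] by (auto simp: tzero_def)
  then show "h P u u > 0" unfolding hr[OF u u] by (rule reph_pos[OF c x])
qed

section \<open>Closedness of the two-forms\<close>

lemma zero_self: "rep1 c y a a = 0" "rep2 y a a = 0" "repD y a a = 0"
  by (simp_all add: rep1_def rep2_def repD_def)

lemma two_formI:
  assumes T: "tensor2_field X T" and R: "\<And>c y. ichart c \<Longrightarrow> tensor_rep X T (xch c y) (B c)" and z: "\<And>c y a. B c y a a = 0"
  shows "two_form X T"
  unfolding two_form_def
proof (intro conjI T ballI)
  fix P u assume P: "P \<in> points X" and u: "u \<in> tangent_space X P"
  obtain c y where ic: "ichart c" and Pc: "P \<in> dom_ch (xch c y)" using P by (rule xch_cover)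
  show "T P u u = 0" unfolding tensor_repD[OF Q.X_maximal R[OF ic] Pc u u] z ..
qed

lemma closed_cover:
  assumes T: "tensor2_field X T" and R: "\<And>c y. ichart c \<Longrightarrow> tensor_rep X T (xch c y) (B c)" and z: "\<And>c y a. B c y a a = 0"
    and S: "\<And>c. ichart c \<Longrightarrow> smooth_rep (ech c) (B c)"
    and d: "\<And>c x u v w. ichart c \<Longrightarrow> x \<in> img_ch (ech c) \<Longrightarrow>
      fder (\<lambda>y. B c y v w) x u + fder (\<lambda>y. B c y w u) x v + fder (\<lambda>y. B c y u v) x w = 0"
  shows "closed_two_form X T"
proof (rule closed_two_formI[OF Q.X_maximal two_formI[OF T R z]])
  fix P assume "P \<in> points X"
  then obtain c y where ic: "ichart c" and Pc: "P \<in> dom_ch (xch c y)" by (rule xch_cover)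
  have "\<forall>x\<in>img_ch (xch c y). \<forall>u v w. fder (\<lambda>y. B c y v w) x u + fder (\<lambda>y. B c y w u) x v + fder (\<lambda>y. B c y u v) x w = 0"
    using d[OF ic] unfolding img_xch[OF ic] by blast
  then show "\<exists>e B. e \<in> X \<and> P \<in> dom_ch e \<and> tensor_rep X T e B \<and> smooth_rep e B \<and>
       (\<forall>x\<in>img_ch e. \<forall>u v w. fder (\<lambda>y. B y v w) x u + fder (\<lambda>y. B y w u) x v + fder (\<lambda>y. B y u v) x w = 0)"
    using xch_mem[OF ic] Pc R[OF ic] smooth_rep_xch[OF ic S[OF ic]]
    by (intro exI[of _ "xch c y"] exI[of _ "B c"] conjI)
qed assumption+

lemma fder_const: "fder (\<lambda>y. k) x u = 0"
  using fder_eq[OF has_derivative_const[of k "at x"]] by simp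

text \<open>The cyclic sum consists of third derivatives of the potential paired with fibre
  directions; total symmetry cancels the terms in pairs.\<close>

lemma closed1: "closed_two_form X \<omega>1"
proof (rule closed_cover[OF fields(1) xrep1 zero_self(1) rep_smooth(1)])
  fix c x u v w assume ic: "ichart c" and x: "x \<in> img_ch (ech c)"
  note c = ichart_mem[OF ic] and fx = fst_img_ech[OF ic x]
  let ?D = "fder (Gm c) (fst x)"
  have der: "fder (\<lambda>y. rep1 c y v w) x u = fst v \<bullet> (?D (fst u) *v fst (snd w)) - fst w \<bullet> (?D (fst u) *v fst (snd v))" for u v w
  proof -
    have G: "((\<lambda>y :: 'n vec3. Gm c (fst y)) has_derivative (\<lambda>u. ?D (fst u))) (at x)"
      by (rule has_derivative_compose[OF bounded_linear_imp_has_derivative[OF bounded_linear_fst] Gm_has_derivative[OF c fx]])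
    have "((\<lambda>y. rep1 c y v w) has_derivative (\<lambda>u. fst v \<bullet> (?D (fst u) *v fst (snd w)) - fst w \<bullet> (?D (fst u) *v fst (snd v)))) (at x)"
      unfolding rep1_def
      by (intro has_derivative_diff has_derivative_inner_right
          bounded_linear.has_derivative[OF bounded_bilinear.bounded_linear_left[OF bounded_bilinear_matrix_vector_mult] G])
    from fder_eq[OF this] show ?thesis by simp
  qed
  have s: "a \<bullet> (?D b *v d) = b \<bullet> (?D a *v d)" for a b d
    using fder_Gm_sym[OF c fx] ichart_symmetric[OF ic fx] by metis
  show "fder (\<lambda>y. rep1 c y v w) x u + fder (\<lambda>y. rep1 c y w u) x v + fder (\<lambda>y. rep1 c y u v) x w = 0"
    unfolding der using s[of "fst u" "fst v"] s[of "fst u" "fst w"] s[of "fst v" "fst w"] by simp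
qed

lemma closed2: "closed_two_form X \<omega>2"
  by (rule closed_cover[OF fields(2) xrep2 zero_self(2) rep_smooth(2)]) (simp_all add: rep2_def fder_const)

section \<open>Kernels and adapted bases at a point\<close>

context
  fixes c y P
  assumes ic: "ichart c" and Pc: "P \<in> dom_ch (xch c y)"
begin

abbreviation "base_pt \<equiv> fst (map_ch (xch c y) P)"
abbreviation "cv \<equiv> coord_vec X (xch c y) P"

lemma cv_tangent: "cv a \<in> tangent_space X P"
  by (rule coord_vec_tangent[OF Q.X_maximal xch_mem[OF ic] Pc])

lemma cv_self: "cv a (xch c y) = a"
  by (rule coord_vec_self[OF Q.X_maximal xch_mem[OF ic] Pc])

lemma
  assumes u: "u \<in> tangent_space X P" and v: "v \<in> tangent_space X P"
  shows form1: "\<omega>1 P u v = fst (u (xch c y)) \<bullet> (Gm c base_pt *v fst (snd (v (xch c y)))) - fst (v (xch c y)) \<bullet> (Gm c base_pt *v fst (snd (u (xch c y))))"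
    and form2: "\<omega>2 P u v = fst (u (xch c y)) \<bullet> snd (snd (v (xch c y))) - fst (v (xch c y)) \<bullet> snd (snd (u (xch c y)))"
    and formh: "h P u v = fst (u (xch c y)) \<bullet> (Gm c base_pt *v fst (v (xch c y)))
      + fst (snd (u (xch c y))) \<bullet> (Gm c base_pt *v fst (snd (v (xch c y))))
      + snd (snd (u (xch c y))) \<bullet> (ginv c base_pt *v snd (snd (v (xch c y))))"
  using tensor_repD[OF Q.X_maximal xrep1[OF ic] Pc u v] tensor_repD[OF Q.X_maximal xrep2[OF ic] Pc u v]
    tensor_repD[OF Q.X_maximal xreph[OF ic] Pc u v] by (simp_all add: rep1_def rep2_def reph_def)

lemma h_sym: "u \<in> tangent_space X P \<Longrightarrow> v \<in> tangent_space X P \<Longrightarrow> h P u v = h P v u"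
  using h_riemannian pointsI[OF xch_mem[OF ic] Pc] unfolding riemannian_metric_def by blast

text \<open>Pairing with a fibre vector in the \<open>y\<close> direction kills the base part and
  pairing with a base vector kills the \<open>y\<close> part, both by definiteness of
  \<open>G\<close>. The \<open>z\<close> directions remain.\<close>

lemma kernel1: "kernel_dist X \<omega>1 P = {v \<in> tangent_space X P. fst (v (xch c y)) = 0 \<and> fst (snd (v (xch c y))) = 0}"
proof -
  note c = ichart_mem[OF ic] and x = xch_base[OF ic Pc]
  have "fst (v (xch c y)) = 0 \<and> fst (snd (v (xch c y))) = 0"
    if v: "v \<in> tangent_space X P" and k: "\<forall>w\<in>tangent_space X P. \<omega>1 P v w = 0" for v
  proof -
    let ?a = "v (xch c y)"
    have "fst ?a \<bullet> (Gm c base_pt *v fst ?a) = 0"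
      using k[rule_format, OF cv_tangent[of "(0, fst ?a, 0)"]] form1[OF v cv_tangent] by (simp add: cv_self)
    then have a0: "fst ?a = 0" using Gm_pos[OF c x, of "fst ?a"] by force
    have "fst (snd ?a) \<bullet> (Gm c base_pt *v fst (snd ?a)) = 0"
      using k[rule_format, OF cv_tangent[of "(fst (snd ?a), 0, 0)"]] form1[OF v cv_tangent] by (simp add: cv_self a0)
    then show ?thesis using a0 Gm_pos[OF c x, of "fst (snd ?a)"] by force
  qed
  then show ?thesis unfolding kernel_dist_def using form1 by auto
qed

lemma kernel2: "kernel_dist X \<omega>2 P = {v \<in> tangent_space X P. fst (v (xch c y)) = 0 \<and> snd (snd (v (xch c y))) = 0}"
proof -
  have "fst (v (xch c y)) = 0 \<and> snd (snd (v (xch c y))) = 0"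
    if v: "v \<in> tangent_space X P" and k: "\<forall>w\<in>tangent_space X P. \<omega>2 P v w = 0" for v
  proof -
    let ?a = "v (xch c y)"
    have a0: "fst ?a = 0"
      using k[rule_format, OF cv_tangent[of "(0, 0, fst ?a)"]] form2[OF v cv_tangent] by (simp add: cv_self)
    show ?thesis
      using k[rule_format, OF cv_tangent[of "(snd (snd ?a), 0, 0)"]] form2[OF v cv_tangent] by (simp add: cv_self a0)
  qed
  then show ?thesis unfolding kernel_dist_def using form2 by auto
qed

text \<open>The first kernel consists of the \<open>z\<close> directions and the second of the
  \<open>y\<close> directions; together they span the tangent space of the fibre.\<close>

lemma leaf_dist_eq: "leaf_dist X \<omega>1 \<omega>2 P = {v \<in> tangent_space X P. fst (v (xch c y)) = 0}"
proof
  show "leaf_dist X \<omega>1 \<omega>2 P \<subseteq> {v \<in> tangent_space X P. fst (v (xch c y)) = 0}"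
  proof
    fix w assume "w \<in> leaf_dist X \<omega>1 \<omega>2 P"
    then obtain u v where uv: "w = tadd u v" "u \<in> kernel_dist X \<omega>1 P" "v \<in> kernel_dist X \<omega>2 P" unfolding sum_dist_def by blast
    then have "w \<in> tangent_space X P" unfolding kernel1 kernel2 uv(1) by (intro tadd_tangent[OF Q.X_maximal]) simp_all
    then show "w \<in> {v \<in> tangent_space X P. fst (v (xch c y)) = 0}" using uv unfolding kernel1 kernel2 by (simp add: tadd_def)
  qed
  show "{v \<in> tangent_space X P. fst (v (xch c y)) = 0} \<subseteq> leaf_dist X \<omega>1 \<omega>2 P"
  proof
    fix v assume v: "v \<in> {v \<in> tangent_space X P. fst (v (xch c y)) = 0}"
    let ?a = "v (xch c y)" and ?u1 = "cv (0, 0, snd (snd (v (xch c y))))" and ?u2 = "cv (0, fst (snd (v (xch c y))), 0)"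
    have "v = tadd ?u1 ?u2"
    proof (rule tangent_eqI[OF Q.X_maximal _ tadd_tangent[OF Q.X_maximal cv_tangent cv_tangent] xch_mem[OF ic] Pc])
      show "v (xch c y) = tadd ?u1 ?u2 (xch c y)"
        unfolding tadd_def cv_self using v by (simp add: prod_eq_iff)
    qed (use v in simp)
    moreover have "?u1 \<in> kernel_dist X \<omega>1 P" "?u2 \<in> kernel_dist X \<omega>2 P"
      unfolding kernel1 kernel2 by (simp_all add: cv_tangent cv_self)
    ultimately show "v \<in> leaf_dist X \<omega>1 \<omega>2 P" unfolding sum_dist_def by blast
  qed
qed

text \<open>A \<open>G\<close>-orthonormal basis \<open>e\<close> serves for the base and for
  \<open>y\<close>. For \<open>z\<close> the vectors \<open>G e i\<close> are taken, because the
  metric there is the inverse of \<open>G\<close> and their dual covectors pair \<open>e i\<close>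
  with \<open>dz\<close>.\<close>

lemma adapted_exists: "\<exists>B. adapted_basis X \<omega>1 \<omega>2 h P B"
proof -
  note c = ichart_mem[OF ic] and x = xch_base[OF ic Pc]
  obtain e :: "'n \<Rightarrow> real^'n" where e: "\<And>i j. e i \<bullet> (Gm c base_pt *v e j) = of_bool (i = j)"
    using G_orthonormal_exists[of "Gm c base_pt"] Gm_sym[OF c x] Gm_pos[OF c x] by metis
  let ?v = "\<lambda>i. cv (e i, 0, 0)" and ?w1 = "\<lambda>i. cv (0, e i, 0)" and ?w2 = "\<lambda>i. cv (0, 0, Gm c base_pt *v e i)"
  have gG: "ginv c base_pt *v (Gm c base_pt *v t) = t" for t by (rule matrix_inv_vec(2)[OF Gm_invertible[OF c x]])
  have Gg: "(Gm c base_pt *v t) \<bullet> (ginv c base_pt *v s) = t \<bullet> s" for s t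
    using ginv_sym[OF c x, of "Gm c base_pt *v t" s] by (simp add: gG inner_commute)
  have ex: "(\<Sum>i\<in>UNIV. (e i \<bullet> (Gm c base_pt *v s)) * (e i \<bullet> t)) = s \<bullet> t" for s t by (rule G_orthonormal_expand[OF e])
  have hv: "h P (?v i) a = e i \<bullet> (Gm c base_pt *v fst (a (xch c y)))"
    "h P (?w1 i) a = e i \<bullet> (Gm c base_pt *v fst (snd (a (xch c y))))"
    "h P (?w2 i) a = e i \<bullet> snd (snd (a (xch c y)))" if "a \<in> tangent_space X P" for a i
    using formh[OF cv_tangent that] by (simp_all add: cv_self Gg)
  have "adapted_basis X \<omega>1 \<omega>2 h P (?v, ?w1, ?w2)"
    unfolding adapted_basis_def prod.case
  proof (intro conjI allI ballI)
    fix a b assume a: "a \<in> tangent_space X P" and b: "b \<in> tangent_space X P"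
    show "\<omega>1 P a b = (\<Sum>i\<in>UNIV. wedge (h P (?v i)) (h P (?w1 i)) a b)"
      unfolding wedge_def hv[OF a] hv[OF b] sum_subtractf ex form1[OF a b] ..
    show "\<omega>2 P a b = (\<Sum>i\<in>UNIV. wedge (h P (?v i)) (h P (?w2 i)) a b)"
      unfolding wedge_def hv[OF a] hv[OF b] sum_subtractf ex form2[OF a b] ..
  qed (simp_all add: cv_tangent hv cv_self e)
  then show ?thesis by blast
qed

text \<open>Evaluating \<open>\<omega>\<^sub>j\<close> on \<open>v i\<close> gives
  \<open>h (w\<^sub>j i)\<close> as a covector, so the \<open>v i\<close> determine the rest of the
  basis. The \<open>v i\<close> themselves are orthogonal to both kernels, hence horizontal, and
  their base parts form a \<open>G\<close>-orthonormal basis, over which the sum collapses.\<close>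

lemma dualizing_independent:
  assumes B: "adapted_basis X \<omega>1 \<omega>2 h P (v, w1, w2)" and a: "a \<in> tangent_space X P" and b: "b \<in> tangent_space X P"
  shows "(\<Sum>i\<in>UNIV. wedge (h P (w1 i)) (h P (w2 i)) a b) = repD (map_ch (xch c y) P) (a (xch c y)) (b (xch c y))"
proof -
  note c = ichart_mem[OF ic] and x = xch_base[OF ic Pc]
  note B' = B[unfolded adapted_basis_def prod.case]
  have T: "v i \<in> tangent_space X P" "w1 i \<in> tangent_space X P" "w2 i \<in> tangent_space X P" for i using B' by blast+
  have o: "h P (v i) (v j) = of_bool (i = j)" "h P (w1 i) (w1 j) = of_bool (i = j)" "h P (w2 i) (w2 j) = of_bool (i = j)"
    "h P (v i) (w1 j) = 0" "h P (v i) (w2 j) = 0" "h P (w1 i) (w2 j) = 0" for i j using B' by blast+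
  have o': "h P (w1 i) (v j) = 0" "h P (w2 i) (v j) = 0" for i j using o(4,5) h_sym[OF T(1) T(2)] h_sym[OF T(1) T(3)] by metis+
  have w1: "\<omega>1 P a b = (\<Sum>i\<in>UNIV. wedge (h P (v i)) (h P (w1 i)) a b)"
    and w2: "\<omega>2 P a b = (\<Sum>i\<in>UNIV. wedge (h P (v i)) (h P (w2 i)) a b)"
    if "a \<in> tangent_space X P" "b \<in> tangent_space X P" for a b using B' that by blast+
  have sel: "(\<Sum>j\<in>UNIV. of_bool (j = i) * f j) = f i" "(\<Sum>j\<in>UNIV. f j * of_bool (j = i)) = f i" for f :: "'n \<Rightarrow> real" and i
    by (simp_all add: of_bool_def if_distrib[of "\<lambda>x. _ * x"] if_distrib[of "\<lambda>x. x * _"] cong: if_cong)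
  have f1: "h P (w1 i) b = \<omega>1 P (v i) b" and f2: "h P (w2 i) b = \<omega>2 P (v i) b" if b: "b \<in> tangent_space X P" for i b
    unfolding w1[OF T(1) b] w2[OF T(1) b] by (simp_all add: wedge_def o o' sel)
  \<comment> \<open>Read the other way, these covectors vanish on the kernels, which gives the
    orthogonality of \<open>v i\<close> to both of them.\<close>
  have k1: "h P (v i) k = \<omega>1 P k (w1 i)" and k2: "h P (v i) k = \<omega>2 P k (w2 i)" if k: "k \<in> tangent_space X P" for i k
    unfolding w1[OF k T(2)] w2[OF k T(3)] by (simp_all add: wedge_def o sel)
  \<comment> \<open>A pure \<open>z\<close> vector lies in the first kernel; choosing the
    \<open>z\<close> part of \<open>v i\<close> itself makes the inverse metric vanish on
    it.\<close>
  have z1: "snd (snd (v i (xch c y))) = 0" for i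
  proof -
    have "snd (snd (v i (xch c y))) \<bullet> (ginv c base_pt *v snd (snd (v i (xch c y)))) = 0"
      using k1[OF cv_tangent[of "(0, 0, snd (snd (v i (xch c y))))"], of i] form1[OF cv_tangent T(2)] formh[OF T(1) cv_tangent]
      by (simp add: cv_self)
    then show ?thesis using ginv_pos[OF c x, of "snd (snd (v i (xch c y)))"] by force
  qed
  have z2: "fst (snd (v i (xch c y))) = 0" for i
  proof -
    have "fst (snd (v i (xch c y))) \<bullet> (Gm c base_pt *v fst (snd (v i (xch c y)))) = 0"
      using k2[OF cv_tangent[of "(0, fst (snd (v i (xch c y))), 0)"], of i] form2[OF cv_tangent T(3)] formh[OF T(1) cv_tangent]
      by (simp add: cv_self)
    then show ?thesis using Gm_pos[OF c x, of "fst (snd (v i (xch c y)))"] by force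
  qed
  let ?e = "\<lambda>i. fst (v i (xch c y))"
  have e: "?e i \<bullet> (Gm c base_pt *v ?e j) = of_bool (i = j)" for i j
    using o(1)[of i j] formh[OF T(1) T(1)] by (simp add: z1 z2)
  have ex: "(\<Sum>i\<in>UNIV. (?e i \<bullet> (Gm c base_pt *v s)) * (?e i \<bullet> t)) = s \<bullet> t" for s t by (rule G_orthonormal_expand[OF e])
  have F1: "h P (w1 i) b = ?e i \<bullet> (Gm c base_pt *v fst (snd (b (xch c y))))" and F2: "h P (w2 i) b = ?e i \<bullet> snd (snd (b (xch c y)))"
    if b: "b \<in> tangent_space X P" for i b
    unfolding f1[OF b] f2[OF b] form1[OF T(1) b] form2[OF T(1) b] by (simp_all add: z1 z2)
  show ?thesis
    unfolding wedge_def F1[OF a] F1[OF b] F2[OF a] F2[OF b] sum_subtractf ex repD_def ..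
qed

end

section \<open>The dualizing form as a closed two-form\<close>

abbreviation "\<omega>D \<equiv> dualizing_form X \<omega>1 \<omega>2 h"

lemma dual_rep:
  assumes ic: "ichart c"
  shows "tensor_rep X \<omega>D (xch c y) repD"
  unfolding tensor_rep_def[OF Q.X_maximal]
proof (intro ballI)
  fix P a b assume P: "P \<in> dom_ch (xch c y)" and a: "a \<in> tangent_space X P" and b: "b \<in> tangent_space X P"
  obtain v w1 w2 where S: "(SOME B. adapted_basis X \<omega>1 \<omega>2 h P B) = (v, w1, w2)" by (rule prod_cases3)
  have "adapted_basis X \<omega>1 \<omega>2 h P (v, w1, w2)"
    unfolding S[symmetric] by (rule someI_ex[OF adapted_exists[OF ic P]])
  from dualizing_independent[OF ic P this a b]
  show "\<omega>D P a b = repD (map_ch (xch c y) P) (a (xch c y)) (b (xch c y))"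
    by (simp add: dualizing_form_def S)
qed

lemma repD_smooth: "ichart c \<Longrightarrow> smooth_rep (ech c) repD"
  unfolding smooth_rep_def[OF TT.BM_maximal] bilinear_def repD_def
  by (auto intro!: linearI smooth_on_const open_img_ch maximal_chart[OF TT.BM_maximal] ech_mem ichart_mem
      simp: inner_add_left inner_add_right algebra_simps)

lemma dual_field: "tensor2_field X \<omega>D"
proof (rule tensor2_fieldI[OF Q.X_maximal])
  fix P u v assume n: "\<not> (P \<in> points X \<and> u \<in> tangent_space X P \<and> v \<in> tangent_space X P)"
  have z: "h P a b = 0" if "\<not> (P \<in> points X \<and> a \<in> tangent_space X P \<and> b \<in> tangent_space X P)" for a b
    using tensor2_field_zero[OF Q.X_maximal fields(3)] that by blast
  have "h P a u = 0 \<or> h P b v = 0" "wedge (h P a) (h P b) u v = 0" for a b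
    using n z[of a u] z[of b u] z[of a v] z[of b v] by (auto simp: wedge_def)
  then show "\<omega>D P u v = 0" by (simp add: dualizing_form_def split: prod.split)
next
  fix P assume "P \<in> points X"
  then obtain c y where ic: "ichart c" and Pc: "P \<in> dom_ch (xch c y)" by (rule xch_cover)
  then show "\<exists>e B. e \<in> X \<and> P \<in> dom_ch e \<and> tensor_rep X \<omega>D e B \<and> smooth_rep e B"
    using xch_mem[OF ic] dual_rep[OF ic] smooth_rep_xch[OF ic repD_smooth[OF ic]] by blast
qed

lemma closedD: "closed_two_form X \<omega>D"
  by (rule closed_cover[OF dual_field dual_rep zero_self(3) repD_smooth]) (simp_all add: repD_def fder_const)

lemma almost_2_kaehlerI:
  assumes "integrable_distribution TYPE(real^('n + 'n)) X (leaf_dist X \<omega>1 \<omega>2)"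
  shows "almost_2_kaehler X \<omega>1 \<omega>2 h"
  unfolding almost_2_kaehler_def
proof (intro conjI X_smooth closed1 closed2 h_riemannian assms ballI)
  fix P assume "P \<in> points X"
  then obtain c y where "ichart c" "P \<in> dom_ch (xch c y)" by (rule xch_cover)
  then show "\<exists>B. adapted_basis X \<omega>1 \<omega>2 h P B" by (rule adapted_exists)
qed

end

section \<open>Change of variables and determinants over arbitrary finite index types\<close>

text \<open>The change of variables theorem of the library needs a well-ordered index type, so it is
  transported along a bijection from the following copy of an arbitrary finite type.\<close>

typedef (overloaded) 'a ordered_copy = "{k::nat. k < CARD('a::finite)}"
  by (rule exI[of _ 0]) (simp add: zero_less_card_finite)

setup_lifting type_definition_ordered_copy

instantiation ordered_copy :: (finite) linorder
begin
lift_definition less_eq_ordered_copy :: "'a ordered_copy \<Rightarrow> 'a ordered_copy \<Rightarrow> bool" is "(\<le>)" .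
lift_definition less_ordered_copy :: "'a ordered_copy \<Rightarrow> 'a ordered_copy \<Rightarrow> bool" is "(<)" .
instance by standard (transfer; linarith)+
end

instance ordered_copy :: (finite) finite
proof
  have "(UNIV :: 'a ordered_copy set) = Abs_ordered_copy ` {k. k < CARD('a)}"
    by (rule type_definition.Abs_image[OF type_definition_ordered_copy, symmetric])
  moreover have "finite (Abs_ordered_copy ` {k. k < CARD('a)} :: 'a ordered_copy set)"
    by (rule finite_imageI) simp
  ultimately show "finite (UNIV :: 'a ordered_copy set)" by (rule ssubst)
qed

instance ordered_copy :: (finite) wellorder
proof
  fix P and a :: "'a ordered_copy"
  assume step: "\<And>x :: 'a ordered_copy. (\<And>y. y < x \<Longrightarrow> P y) \<Longrightarrow> P x"
  show "P a"
  proof (induction "Rep_ordered_copy a" arbitrary: a rule: less_induct)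
    case less
    show ?case
    proof (rule step)
      fix y :: "'a ordered_copy" assume "y < a"
      then have "Rep_ordered_copy y < Rep_ordered_copy a" by (simp add: less_ordered_copy.rep_eq)
      then show "P y" by (rule less)
    qed
  qed
qed

lemma card_ordered_copy: "CARD('a ordered_copy) = CARD('a::finite)"
  using type_definition.card[OF type_definition_ordered_copy[where 'a = 'a]] by simp

lemma ordered_copy_bij: "\<exists>\<beta> :: 'a ordered_copy \<Rightarrow> 'a::finite. bij \<beta>"
  by (rule finite_same_card_bij) (simp_all add: card_ordered_copy)

section \<open>Signs and determinants under reindexing\<close>

lemma sign_conjugate:
  fixes \<beta> :: "'k::finite \<Rightarrow> 'm::finite"
  assumes \<beta>: "bij \<beta>" and p: "p permutes UNIV"
  shows "sign (\<beta> \<circ> p \<circ> inv \<beta>) = sign p"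
  using p finite[of UNIV]
proof (induction p rule: permutes_induct)
  case id
  have "\<beta> \<circ> id \<circ> inv \<beta> = id" using \<beta> by (simp add: fun_eq_iff bij_is_surj surj_f_inv_f)
  then show ?case by simp
next
  case (swap a b p)
  have i: "inv \<beta> (\<beta> x) = x" "\<beta> (inv \<beta> y) = y" for x y using \<beta> by (simp_all add: bij_is_inj bij_is_surj surj_f_inv_f)
  \<comment> \<open>Conjugation by \<open>\<beta>\<close> turns the transposition of
    \<open>a\<close> and \<open>b\<close> into that of their images, so the sign changes in step on
    both sides.\<close>
  have e: "\<beta> \<circ> (Transposition.transpose a b \<circ> p) \<circ> inv \<beta> = Transposition.transpose (\<beta> a) (\<beta> b) \<circ> (\<beta> \<circ> p \<circ> inv \<beta>)"
    by (rule ext) (auto simp: Transposition.transpose_def i bij_is_inj[OF \<beta>, THEN inj_eq])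
  have bp: "bij p" using swap by (simp add: permutes_bij)
  have "bij (\<beta> \<circ> p \<circ> inv \<beta>)" using \<beta> bp by (intro bij_comp bij_imp_bij_inv)
  then have P: "permutation (\<beta> \<circ> p \<circ> inv \<beta>)" "permutation p" using bp by (auto simp: permutation)
  show ?case unfolding e sign_compose[OF permutation_swap_id P(1)] sign_compose[OF permutation_swap_id P(2)] swap.IH
    by (simp add: sign_swap_id bij_is_inj[OF \<beta>, THEN inj_eq])
qed

lemma det_reindex:
  fixes A :: "real^'m^'m" and \<beta> :: "'k::finite \<Rightarrow> 'm"
  assumes \<beta>: "bij \<beta>"
  shows "det (\<chi> i j. A $ \<beta> i $ \<beta> j) = det A"
proof -
  have i: "inv \<beta> (\<beta> x) = x" "\<beta> (inv \<beta> y) = y" for x y using \<beta> by (simp_all add: bij_is_inj bij_is_surj surj_f_inv_f)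
  have perm: "\<beta> \<circ> p \<circ> inv \<beta> permutes UNIV" if "p permutes UNIV" for p
    by (rule bij_imp_permutes) (use \<beta> permutes_bij[OF that] in \<open>intro bij_comp bij_imp_bij_inv; simp\<close>, simp)
  have perm': "inv \<beta> \<circ> p \<circ> \<beta> permutes UNIV" if "p permutes UNIV" for p
    by (rule bij_imp_permutes) (use \<beta> permutes_bij[OF that] in \<open>intro bij_comp bij_imp_bij_inv; simp\<close>, simp)
  show ?thesis unfolding det_def
  proof (rule sum.reindex_bij_witness[of _ "\<lambda>p. inv \<beta> \<circ> p \<circ> \<beta>" "\<lambda>p. \<beta> \<circ> p \<circ> inv \<beta>"])
    fix p :: "'k \<Rightarrow> 'k" assume "p \<in> {p. p permutes UNIV}"
    then have p: "p permutes UNIV" by simp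
    show "inv \<beta> \<circ> (\<beta> \<circ> p \<circ> inv \<beta>) \<circ> \<beta> = p" by (simp add: fun_eq_iff i)
    show "\<beta> \<circ> p \<circ> inv \<beta> \<in> {p. p permutes UNIV}" using perm[OF p] by simp
    have "(\<Prod>j\<in>UNIV. A $ j $ (\<beta> \<circ> p \<circ> inv \<beta>) j) = (\<Prod>i\<in>UNIV. A $ \<beta> i $ \<beta> (p i))"
      by (rule prod.reindex_bij_witness[of _ "\<beta>" "inv \<beta>"]) (simp_all add: i)
    then show "of_int (sign (\<beta> \<circ> p \<circ> inv \<beta>)) * (\<Prod>j\<in>UNIV. A $ j $ (\<beta> \<circ> p \<circ> inv \<beta>) j)
        = of_int (sign p) * (\<Prod>j\<in>UNIV. (\<chi> i j. A $ \<beta> i $ \<beta> j) $ j $ p j)"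
      by (simp add: sign_conjugate[OF \<beta> p] del: comp_apply)
  next
    fix p :: "'m \<Rightarrow> 'm" assume "p \<in> {p. p permutes UNIV}"
    then have p: "p permutes UNIV" by simp
    show "\<beta> \<circ> (inv \<beta> \<circ> p \<circ> \<beta>) \<circ> inv \<beta> = p" by (simp add: fun_eq_iff i)
    show "inv \<beta> \<circ> p \<circ> \<beta> \<in> {p. p permutes UNIV}" using perm'[OF p] by simp
  qed
qed

section \<open>Integrals of a density that cancels the Jacobian\<close>

lemma nn_integral_unit_jacobian_wellorder:
  fixes \<psi> :: "real^'k::{finite,wellorder} \<Rightarrow> real^'k::_" and f :: "real^'k::_ \<Rightarrow> real"
  assumes A: "A \<in> sets borel" "emeasure lborel A < \<infinity>"
    and der: "\<And>t. t \<in> A \<Longrightarrow> (\<psi> has_derivative \<psi>' t) (at t)" and inj: "inj_on \<psi> A"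
    and pos: "\<And>z. z \<in> \<psi> ` A \<Longrightarrow> f z \<ge> 0" and one: "\<And>t. t \<in> A \<Longrightarrow> \<bar>det (matrix (\<psi>' t))\<bar> * f (\<psi> t) = 1"
  shows "(\<integral>\<^sup>+z\<in>\<psi> ` A. ennreal (f z) \<partial>lborel) = emeasure lborel A"
proof -
  have AL: "A \<in> lmeasurable" using A by (simp add: fmeasurable_def)
  have der': "(\<psi> has_derivative \<psi>' t) (at t within A)" if "t \<in> A" for t using der[OF that] has_derivative_at_withinI by blast
  \<comment> \<open>The change of variables theorem takes integrands with values in a vector type,
    hence the detour through \<open>real^1\<close>.\<close>
  let ?F = "\<lambda>z. (\<chi> i. f z) :: real^1"
  have e: "\<bar>det (matrix (\<psi>' t))\<bar> *\<^sub>R ?F (\<psi> t) = (1 :: real^1)" if "t \<in> A" for t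
    using one[OF that] by (simp add: vec_eq_iff)
  have c: "((\<lambda>t. 1 :: real^1) absolutely_integrable_on A)"
    using AL by (simp add: absolutely_integrable_on_const)
  have c1: "(\<lambda>t. \<bar>det (matrix (\<psi>' t))\<bar> *\<^sub>R ?F (\<psi> t)) absolutely_integrable_on A"
    using c by (rule absolutely_integrable_spike[where S = "{}"]) (use e in auto)
  have i1: "integral A (\<lambda>t. \<bar>det (matrix (\<psi>' t))\<bar> *\<^sub>R ?F (\<psi> t)) = integral A (\<lambda>t. 1 :: real^1)"
    by (rule integral_cong) (use e in auto)
  have "?F absolutely_integrable_on \<psi> ` A \<and> integral (\<psi> ` A) ?F = integral A (\<lambda>t. 1 :: real^1)"
    using has_absolute_integral_change_of_variables[OF _ der' inj, of ?F "integral A (\<lambda>t. 1)"] c1 i1 AL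
    by (simp add: fmeasurable_def)
  then have I: "(?F has_integral integral A (\<lambda>t. 1 :: real^1)) (\<psi> ` A)"
    using has_integral_integral set_lebesgue_integral_eq_integral(1) by metis
  have C: "((\<lambda>t. 1 :: real) has_integral measure lborel A) A" by (rule has_integral_measure_lborel[OF A])
  have "((\<lambda>t. 1 :: real^1) has_integral measure lborel A *\<^sub>R 1) A"
    using has_integral_linear[OF C bounded_linear_scaleR_left[of "1 :: real^1"]] by (simp add: o_def)
  then have "integral A (\<lambda>t. 1 :: real^1) $ 1 = measure lborel A" by (simp add: integral_unique)
  then have "(f has_integral measure lborel A) (\<psi> ` A)"
    using has_integral_linear[OF I bounded_linear_vec_nth[of 1]] by (simp add: o_def)
  from nn_integral_has_integral_lebesgue'[OF pos this]
  have "(\<integral>\<^sup>+z\<in>\<psi> ` A. ennreal (f z) \<partial>lborel) = ennreal (measure lborel A)" by simp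
  also have "\<dots> = emeasure lborel A" by (rule emeasure_eq_ennreal_measure[symmetric]) (use A(2) in auto)
  finally show ?thesis .
qed

lemma nn_integral_unit_jacobian:
  fixes \<psi> :: "real^'m \<Rightarrow> real^'m" and f :: "real^'m \<Rightarrow> real"
  assumes A: "A \<in> sets borel" "emeasure lborel A < \<infinity>"
    and der: "\<And>t. t \<in> A \<Longrightarrow> (\<psi> has_derivative \<psi>' t) (at t)" and inj: "inj_on \<psi> A"
    and pos: "\<And>z. z \<in> \<psi> ` A \<Longrightarrow> f z \<ge> 0" and one: "\<And>t. t \<in> A \<Longrightarrow> \<bar>det (matrix (\<psi>' t))\<bar> * f (\<psi> t) = 1"
    and meas: "(\<lambda>z. ennreal (f z) * indicator (\<psi> ` A) z) \<in> borel_measurable borel"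
  shows "(\<integral>\<^sup>+z\<in>\<psi> ` A. ennreal (f z) \<partial>lborel) = emeasure lborel A"
proof -
  obtain \<beta> :: "'m ordered_copy \<Rightarrow> 'm" where \<beta>: "bij \<beta>" using ordered_copy_bij by blast
  have ii: "inv \<beta> (\<beta> x) = x" "\<beta> (inv \<beta> y) = y" for x y using \<beta> by (simp_all add: bij_is_inj bij_is_surj surj_f_inv_f)
  define R :: "real^'m \<Rightarrow> real^'m ordered_copy" where "R = (\<lambda>v. \<chi> k. v $ \<beta> k)"
  define S :: "real^'m ordered_copy \<Rightarrow> real^'m" where "S = (\<lambda>v. \<chi> k. v $ inv \<beta> k)"
  have RS: "R (S v) = v" and SR: "S (R w) = w" for v w by (simp_all add: R_def S_def vec_eq_iff ii)
  have lin: "linear R" "linear S" by (auto intro!: linearI simp: R_def S_def vec_eq_iff)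
  note bl = lin[THEN linear_conv_bounded_linear[THEN iffD1]]
  have cR: "R \<in> borel_measurable borel" and cS: "S \<in> borel_measurable borel"
    using bl by (auto intro!: borel_measurable_continuous_onI linear_continuous_on)
  \<comment> \<open>Permuting coordinates preserves the volume of boxes, and Lebesgue measure is
    determined by these.\<close>
  have dS: "distr lborel lborel S = lborel"
  proof (rule lborel_eqI[symmetric])
    fix l u :: "real^'m" assume lu: "\<And>b. b \<in> Basis \<Longrightarrow> l \<bullet> b \<le> u \<bullet> b"
    have "emeasure (distr lborel lborel S) (box l u) = emeasure lborel (S -` box l u \<inter> space lborel)"
      using cS by (intro emeasure_distr) simp_all
    also have "S -` box l u \<inter> space lborel = box (R l) (R u)"
      by (auto simp: mem_box_cart S_def R_def) (metis ii)+
    also have "emeasure lborel \<dots> = (\<Prod>b\<in>Basis. (R u - R l) \<bullet> b)"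
    proof (rule emeasure_lborel_box)
      fix b :: "real^'m ordered_copy" assume "b \<in> Basis"
      then obtain i where "b = axis i 1" by (auto simp: Basis_vec_def)
      then show "R l \<bullet> b \<le> R u \<bullet> b" using lu[of "axis (\<beta> i) 1"] by (simp add: inner_axis R_def)
    qed
    also have "(\<Prod>b\<in>Basis. (R u - R l) \<bullet> b) = (\<Prod>i\<in>UNIV. u $ \<beta> i - l $ \<beta> i)"
      by (simp add: Basis_vec_def UNION_singleton_eq_range prod.reindex inj_on_def axis_eq_axis inner_axis R_def)
    also have "\<dots> = (\<Prod>i\<in>UNIV. u $ i - l $ i)"
      by (rule prod.reindex_bij_witness[of _ "inv \<beta>" \<beta>]) (simp_all add: ii)
    also have "\<dots> = (\<Prod>b\<in>Basis. (u - l) \<bullet> b)"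
      by (simp add: Basis_vec_def UNION_singleton_eq_range prod.reindex inj_on_def axis_eq_axis inner_axis)
    finally show "emeasure (distr lborel lborel S) (box l u) = (\<Prod>b\<in>Basis. (u - l) \<bullet> b)" by simp
  qed simp
  let ?\<psi> = "\<lambda>t. R (\<psi> (S t))" and ?\<psi>' = "\<lambda>t v. R (\<psi>' (S t) (S v))" and ?A = "S -` A"
  have SA: "?A = S -` A \<inter> space lborel" by simp
  have A': "?A \<in> sets borel" using measurable_sets[OF cS A(1)] by simp
  have eA: "emeasure lborel ?A = emeasure lborel A"
  proof -
    have "emeasure lborel A = emeasure (distr lborel lborel S) A" by (simp add: dS)
    also have "\<dots> = emeasure lborel (S -` A \<inter> space lborel)" using cS A by (intro emeasure_distr) simp_all
    finally show ?thesis by simp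
  qed
  have im: "?\<psi> ` ?A = S -` (\<psi> ` A)"
  proof
    show "?\<psi> ` ?A \<subseteq> S -` (\<psi> ` A)" by (auto simp: SR)
    show "S -` (\<psi> ` A) \<subseteq> ?\<psi> ` ?A"
    proof
      fix v assume "v \<in> S -` (\<psi> ` A)"
      then obtain t where "t \<in> A" "S v = \<psi> t" by auto
      then show "v \<in> ?\<psi> ` ?A" using RS[of v] SR by (intro image_eqI[of _ _ "R t"]) simp_all
    qed
  qed
  have "(\<integral>\<^sup>+z\<in>?\<psi> ` ?A. ennreal (f (S z)) \<partial>lborel) = emeasure lborel ?A"
  proof (rule nn_integral_unit_jacobian_wellorder[where \<psi>' = ?\<psi>'])
    show "emeasure lborel ?A < \<infinity>" using A(2) eA by simp
    show "inj_on ?\<psi> ?A" using inj SR RS by (auto simp: inj_on_def) metis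
    fix t assume t: "t \<in> ?A"
    have "(\<psi> has_derivative \<psi>' (S t)) (at (S t))" using der t by simp
    from bounded_linear.has_derivative[OF bl(1) has_derivative_compose[OF bounded_linear_imp_has_derivative[OF bl(2)] this]]
    show "(?\<psi> has_derivative ?\<psi>' t) (at t)" .
    have "matrix (?\<psi>' t) = (\<chi> i j. matrix (\<psi>' (S t)) $ \<beta> i $ \<beta> j)"
    proof -
      have Sax: "S (axis j 1) = axis (\<beta> j) 1" for j using ii by (auto simp: S_def vec_eq_iff axis_def)
      show ?thesis unfolding matrix_def Sax by (simp add: vec_eq_iff R_def)
    qed
    then have "det (matrix (?\<psi>' t)) = det (matrix (\<psi>' (S t)))" by (simp add: det_reindex[OF \<beta>])
    then show "\<bar>det (matrix (?\<psi>' t))\<bar> * f (S (?\<psi> t)) = 1" using one t by (simp add: SR)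
  qed (use A' pos im in auto)
  also have "(\<integral>\<^sup>+z\<in>?\<psi> ` ?A. ennreal (f (S z)) \<partial>lborel) = (\<integral>\<^sup>+z. ennreal (f (S z)) * indicator (\<psi> ` A) (S z) \<partial>lborel)"
    unfolding im by (intro nn_integral_cong) (simp add: indicator_def)
  also have "\<dots> = (\<integral>\<^sup>+z. ennreal (f z) * indicator (\<psi> ` A) z \<partial>(distr lborel lborel S))"
    by (subst nn_integral_distr) (use cS meas in simp_all)
  finally show ?thesis by (simp add: dS eA)
qed

section \<open>Splitting vectors and matrices over a sum of index types\<close>

lemma sum_UNIV_Plus: "(\<Sum>k\<in>(UNIV :: ('a::finite + 'b::finite) set). f k) = (\<Sum>i\<in>UNIV. f (Inl i)) + (\<Sum>i\<in>UNIV. f (Inr i))"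
proof -
  have "(\<Sum>k\<in>(UNIV :: 'a set) <+> (UNIV :: 'b set). f k) = (\<Sum>i\<in>UNIV. f (Inl i)) + (\<Sum>i\<in>UNIV. f (Inr i))"
    by (subst sum.Plus) (simp_all add: o_def)
  then show ?thesis unfolding UNIV_Plus_UNIV .
qed

definition lo :: "real^('n::finite + 'n) \<Rightarrow> real^'n" where "lo t = (\<chi> i. t $ Inl i)"
definition hi :: "real^('n::finite + 'n) \<Rightarrow> real^'n" where "hi t = (\<chi> i. t $ Inr i)"
definition jn :: "real^'n \<Rightarrow> real^'n \<Rightarrow> real^('n::finite + 'n)" where
  "jn a b = (\<chi> k. case k of Inl i \<Rightarrow> a $ i | Inr i \<Rightarrow> b $ i)"

lemma lo_jn: "lo (jn a b) = a" and hi_jn: "hi (jn a b) = b" and jn_lo_hi: "jn (lo t) (hi t) = t"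
  by (simp_all add: lo_def hi_def jn_def vec_eq_iff split: sum.split)

lemma linear_lo: "linear lo" and linear_hi: "linear hi" and linear_jn: "linear (\<lambda>p. jn (fst p) (snd p))"
  by (auto intro!: linearI simp: lo_def hi_def jn_def vec_eq_iff split: sum.split)

lemma lo_hi_eqI: "lo t = lo t' \<Longrightarrow> hi t = hi t' \<Longrightarrow> t = t'"
  using jn_lo_hi by metis

lemma norm_lo: "norm (lo t) \<le> norm t" and norm_hi: "norm (hi t) \<le> norm t"
proof -
  have e: "(norm t)\<^sup>2 = (norm (lo t))\<^sup>2 + (norm (hi t))\<^sup>2"
    by (simp add: power2_norm_eq_inner inner_vec_def sum_UNIV_Plus lo_def hi_def)
  have "(norm (lo t))\<^sup>2 \<le> (norm t)\<^sup>2" "(norm (hi t))\<^sup>2 \<le> (norm t)\<^sup>2" unfolding e by simp_all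
  then show "norm (lo t) \<le> norm t" "norm (hi t) \<le> norm t" by (blast intro: power2_le_imp_le norm_ge_zero)+
qed

definition blk :: "real^'n^'n \<Rightarrow> real^'n^'n \<Rightarrow> real^('n::finite + 'n)^('n + 'n)" where
  "blk A B = (\<chi> k l. case k of Inl i \<Rightarrow> (case l of Inl j \<Rightarrow> A $ i $ j | Inr j \<Rightarrow> 0)
     | Inr i \<Rightarrow> (case l of Inl j \<Rightarrow> 0 | Inr j \<Rightarrow> B $ i $ j))"

lemma blk_mult: "blk A B ** blk C D = blk (A ** C) (B ** D)"
  by (simp add: blk_def matrix_matrix_mult_def vec_eq_iff sum_UNIV_Plus split: sum.split)

lemma blk_one: "blk (mat 1) (mat 1) = mat 1"
  by (simp add: blk_def mat_def vec_eq_iff split: sum.split)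

lemma inner_blk: "t \<bullet> (blk A B *v t') = lo t \<bullet> (A *v lo t') + hi t \<bullet> (B *v hi t')"
  by (simp add: inner_vec_def matrix_vector_mult_def sum_UNIV_Plus blk_def lo_def hi_def)

text \<open>Exchanging the two halves of the index set conjugates one block matrix into the
  other.\<close>

lemma det_blk_swap:
  fixes N :: "real^'n^'n"
  shows "det (blk (mat 1) N) = det (blk N (mat 1))"
proof -
  define s :: "'n + 'n \<Rightarrow> 'n + 'n" where "s = (\<lambda>k. case k of Inl i \<Rightarrow> Inr i | Inr i \<Rightarrow> Inl i)"
  have ss: "s (s k) = k" for k by (simp add: s_def split: sum.split)
  have "bij s" by (rule o_bij[of s]) (auto simp: ss)
  note d = det_reindex[OF this, of "blk N (mat 1)"]
  have e: "(\<chi> i j. blk N (mat 1) $ s i $ s j) = blk (mat 1) N"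
    unfolding vec_eq_iff split_sum_all by (simp add: blk_def s_def)
  show ?thesis using d unfolding e .
qed

text \<open>The \<open>2n\<close>-dimensional fibre metric has determinant one because both blocks of it factor through
  the multiplicative function \<open>N \<mapsto> det (N \<oplus> 1)\<close>.\<close>

lemma det_blk_inverse:
  assumes "A ** B = mat 1"
  shows "det (blk A B) = 1"
proof -
  have "blk A B = blk A (mat 1) ** blk (mat 1) B" by (simp add: blk_mult)
  then have "det (blk A B) = det (blk A (mat 1)) * det (blk B (mat 1))" by (simp add: det_mul det_blk_swap)
  also have "\<dots> = det (blk (A ** B) (mat 1))" by (simp add: blk_mult flip: det_mul)
  finally show ?thesis by (simp add: assms blk_one)
qed

section \<open>Leaves are tori\<close>

text \<open>\<open>smooth_map\<close> quantifies over all pairs of charts; one pair around each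
  point suffices, after composing with the transitions on both sides and shrinking.\<close>

lemma smooth_mapI:
  assumes M: "maximal_atlas M" and N: "maximal_atlas N" and im: "f ` points M \<subseteq> points N"
    and loc: "\<And>p. p \<in> points M \<Longrightarrow> \<exists>c d W. c \<in> M \<and> d \<in> N \<and> p \<in> dom_ch c \<and> open W \<and> map_ch c p \<in> W \<and> W \<subseteq> img_ch c \<and>
      (\<forall>x\<in>W. f (inv_ch c x) \<in> dom_ch d) \<and> smooth_on W (\<lambda>x. map_ch d (f (inv_ch c x)))"
  shows "smooth_map M N f"
  unfolding smooth_map_def
proof (intro conjI im ballI impI; elim conjE)
  fix p c' d' assume p: "p \<in> points M" and c': "c' \<in> M" "p \<in> dom_ch c'" and d': "d' \<in> N" "f p \<in> dom_ch d'"
  obtain c d W where c: "c \<in> M" "p \<in> dom_ch c" and d: "d \<in> N" and W: "open W" "map_ch c p \<in> W" "W \<subseteq> img_ch c"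
    and fW: "\<And>x. x \<in> W \<Longrightarrow> f (inv_ch c x) \<in> dom_ch d" and sm: "smooth_on W (\<lambda>x. map_ch d (f (inv_ch c x)))"
    using loc[OF p] by blast
  note cc = maximal_chart[OF M c(1)] and cc' = maximal_chart[OF M c'(1)] and cd = maximal_chart[OF N d]
  let ?t = "map_ch c \<circ> inv_ch c'" and ?O = "map_ch c' ` (dom_ch c' \<inter> dom_ch c)"
  let ?F = "\<lambda>x. map_ch d (f (inv_ch c x))" and ?O2 = "map_ch d ` (dom_ch d \<inter> dom_ch d')"
  have O: "open ?O" "open ?O2" "smooth_on ?O ?t" "smooth_on ?O2 (map_ch d' \<circ> inv_ch d)"
    using transition_open[OF M c'(1) c(1)] transition_open[OF N d d'(1)] transition_smooth[OF M c'(1) c(1)]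
      transition_smooth[OF N d d'(1)] by auto
  let ?W = "W \<inter> ?F -` ?O2"
  have oW: "open ?W" by (rule continuous_open_preimage[OF smooth_on_imp_continuous_on[OF sm] W(1) O(2)])
  let ?V = "?O \<inter> ?t -` ?W"
  have oV: "open ?V" by (rule continuous_open_preimage[OF smooth_on_imp_continuous_on[OF O(3)] O(1) oW])
  have ip: "inv_ch c (map_ch c p) = p" "inv_ch c' (map_ch c' p) = p" using inv_ch_map[OF cc c(2)] inv_ch_map[OF cc' c'(2)] .
  have "f p \<in> dom_ch d" using fW[OF W(2)] ip by simp
  then have pV: "map_ch c' p \<in> ?V" using c c' d' W(2) ip by auto
  have y: "y \<in> img_ch c' \<and> f (inv_ch c' y) \<in> dom_ch d' \<and> f (inv_ch c' y) \<in> dom_ch d \<and> ?F (?t y) = map_ch d (f (inv_ch c' y))"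
    if y: "y \<in> ?V" for y
  proof -
    obtain r where r: "r \<in> dom_ch c'" "r \<in> dom_ch c" "y = map_ch c' r" using y by blast
    have iy: "inv_ch c' y = r" "?t y = map_ch c r" "inv_ch c (map_ch c r) = r"
      using inv_ch_map[OF cc' r(1)] inv_ch_map[OF cc r(2)] r(3) by auto
    have m: "map_ch c r \<in> W" "?F (map_ch c r) \<in> ?O2" using y iy(2) by auto
    have fd: "f r \<in> dom_ch d" using fW[OF m(1)] iy(3) by simp
    have "map_ch d (f r) \<in> ?O2" using m(2) iy(3) by simp
    then have "f r \<in> dom_ch d'" using overlap_iff[OF cd] inv_ch_map[OF cd fd] by metis
    then show ?thesis using fd iy map_ch_img[OF r(1)] r(3) by simp
  qed
  have "smooth_on ?V (map_ch d' \<circ> f \<circ> inv_ch c')"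
  proof (rule smooth_on_cong[OF oV])
    have 1: "smooth_on ?V (\<lambda>x. ?F (?t x))"
      by (rule smooth_on_compose[OF sm smooth_on_subset[OF O(3) O(1) oV] oV W(1)]) auto
    show "smooth_on ?V (\<lambda>x. (map_ch d' \<circ> inv_ch d) (?F (?t x)))"
      by (rule smooth_on_compose[OF O(4) 1 oV O(2)]) auto
    show "(map_ch d' \<circ> inv_ch d) (?F (?t x)) = (map_ch d' \<circ> f \<circ> inv_ch c') x" if "x \<in> ?V" for x
    proof -
      note yx = y[OF that]
      show ?thesis unfolding comp_def[of "map_ch d'" "inv_ch d"] yx[THEN conjunct2, THEN conjunct2, THEN conjunct2]
        using inv_ch_map[OF cd] yx by simp
    qed
  qed
  then show "\<exists>W. open W \<and> map_ch c' p \<in> W \<and> W \<subseteq> img_ch c' \<and> f ` inv_ch c' ` W \<subseteq> dom_ch d' \<and> smooth_on W (map_ch d' \<circ> f \<circ> inv_ch c')"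
    using oV pV y by (intro exI[of _ ?V] conjI subsetI) blast+
qed

section \<open>Euclidean space as a manifold\<close>

definition stdR :: "(real^'m, real^'m) atlas" where
  "stdR = max_atlas {(UNIV, \<lambda>x. x)}"

lemma stdR_atlas: "is_atlas {(UNIV :: (real^'m) set, \<lambda>x. x)}"
proof -
  let ?c = "(UNIV :: (real^'m) set, \<lambda>x :: real^'m. x)"
  have ch: "is_chart ?c" by (simp add: is_chart_def img_ch_def)
  have "map_ch ?c \<circ> inv_ch ?c = (\<lambda>x. x)" using inv_ch_map[OF ch] by (simp add: fun_eq_iff)
  then have "compatible ?c ?c" by (simp add: compatible_def smooth_on_id)
  then show ?thesis using ch by (simp add: is_atlas_def)
qed

lemma stdR_maximal: "maximal_atlas stdR"
  unfolding stdR_def by (rule maximal_max_atlas[OF stdR_atlas])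

lemma stdR_id: "(UNIV, \<lambda>x. x) \<in> stdR"
  unfolding stdR_def using atlas_subset_max[OF stdR_atlas] by blast

lemma points_stdR: "points stdR = UNIV"
  unfolding stdR_def points_max_atlas[OF stdR_atlas] by (simp add: points_def)

lemma stdR_chart: "open D \<Longrightarrow> (D, \<lambda>x. x - k) \<in> stdR"
proof (rule chart_change[OF stdR_maximal stdR_id, where \<phi> = "\<lambda>x. x - k" and \<psi> = "\<lambda>x. x + k"])
  assume D: "open D"
  have e: "(\<lambda>x. x - k) ` D = (\<lambda>x. x + k) -` D" by (auto intro: image_eqI[of _ _ "_ + k"])
  then show o: "open ((\<lambda>x. x - k) ` D)" using D by (simp add: open_vimage continuous_intros)
  show "smooth_on (map_ch (UNIV, \<lambda>x. x) ` D) (\<lambda>x. x - k)" "smooth_on ((\<lambda>x. x - k) ` D) (\<lambda>x. x + k)"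
    using D o by (auto intro!: smooth_on_diff smooth_on_add smooth_on_id smooth_on_const)
qed simp_all

lemma openin_stdR: "openin (manifold_topology stdR) U \<longleftrightarrow> open U"
  using openin_restrict_ch[OF stdR_maximal stdR_id, of U] openin_imp_open_image[OF stdR_maximal _ stdR_id, of U] by auto

section \<open>The torus over a fixed base point\<close>

locale leaf_torus = canonical Y g nabla L \<omega>1 \<omega>2 h
  for Y :: "('a, real^'n) atlas" and g nabla L \<omega>1 \<omega>2 h +
  fixes p c0
  assumes ic0: "ichart c0" and p0: "p \<in> dom_ch c0"
begin

abbreviation "x0 \<equiv> map_ch c0 p"
abbreviation "D \<equiv> leaf_dist X \<omega>1 \<omega>2"

definition tpt :: "real^('n + 'n) \<Rightarrow> 'n vec3" where "tpt t = (x0, lo t, hi t)"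
text \<open>The universal covering of the fibre over \<open>p\<close>, written in fibre coordinates:
  \<open>lo\<close> carries \<open>y\<close> and \<open>hi\<close> carries \<open>z\<close>.\<close>

definition tau where "tau t = q (inv_ch (ech c0) (tpt t))"

lemma tpt_img: "tpt t \<in> img_ch (ech c0)"
  by (simp add: tpt_def img_ech_eq[OF ichart_mem[OF ic0]] map_ch_img[OF p0])

lemma int_vec_lo_hi: "int_vec t \<longleftrightarrow> int_vec (lo t) \<and> int_vec (hi t)"
  unfolding int_vec_def lo_def hi_def by (auto simp: split_sum_all)

lemma lo_diff: "lo (s - t) = lo s - lo t" and hi_diff: "hi (s - t) = hi s - hi t"
  by (rule linear_diff[OF linear_lo], rule linear_diff[OF linear_hi])

lemma tau_eq_iff: "tau t = tau t' \<longleftrightarrow> int_vec (t - t')"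
  unfolding tau_def q_eq_iff[OF ic0 inv_ch_dom[OF tpt_img] inv_ch_dom[OF tpt_img]] map_inv_ch[OF tpt_img]
  by (simp add: tpt_def int_vec_lo_hi lo_diff hi_diff)

text \<open>The ball around \<open>t + k\<close>, shifted back by \<open>k\<close>: all these charts
  have the same image, so for integral \<open>k\<close> they form deck pairs. The radius 1/4 again
  keeps \<open>tau\<close> injective.\<close>

definition tb :: "real^('n + 'n) \<Rightarrow> real^('n + 'n) \<Rightarrow> (real^('n + 'n), real^('n + 'n)) chart" where
  "tb t k = (ball (t + k) (1/4), \<lambda>x. x - k)"

lemma tb_mem: "tb t k \<in> stdR"
  unfolding tb_def by (rule stdR_chart) simp

lemma tb_inj: "inj_on tau (dom_ch (tb t k))"
proof (rule inj_onI)
  fix s s' assume "s \<in> dom_ch (tb t k)" "s' \<in> dom_ch (tb t k)" and e: "tau s = tau s'"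
  then have "dist (t + k) s < 1/4" "dist (t + k) s' < 1/4" by (simp_all add: tb_def)
  then have "norm (s - s') < 1" using dist_triangle3[of s s' "t + k"] by (simp add: dist_norm)
  then have "s - s' = 0" using e int_vec_small unfolding tau_eq_iff by blast
  then show "s = s'" by simp
qed

lemma tb_img: "img_ch (tb t k) = ball t (1/4)"
proof -
  have "(\<lambda>x. x - k) ` ball (t + k) (1/4) = ball t (1/4)"
  proof
    show "ball t (1/4) \<subseteq> (\<lambda>x. x - k) ` ball (t + k) (1/4)"
      by (auto intro!: image_eqI[of _ _ "_ + k"] simp: dist_norm)
  qed (auto simp: dist_norm algebra_simps)
  then show ?thesis by (simp add: img_ch_def tb_def)
qed

lemma tb_inv: "x \<in> ball t (1/4) \<Longrightarrow> inv_ch (tb t k) x = x + k"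
  using inv_ch_map[OF maximal_chart[OF stdR_maximal tb_mem[of t k]], of "x + k"] by (simp add: tb_def dist_norm)

sublocale T: quotient_atlas stdR tau
proof
  show "\<exists>e e'. deck_pair stdR tau e e' t t'" if "tau t = tau t'" for t t'
  proof (intro exI)
    let ?k = "t' - t"
    have k: "int_vec (t - t')" using that tau_eq_iff by blast
    have "tau x = tau (x + ?k)" for x unfolding tau_eq_iff using k by simp
    then show "deck_pair stdR tau (tb t 0) (tb t ?k) t t'"
      using tb_mem tb_inj by (simp add: deck_pair_def tb_img tb_inv) (simp add: tb_def)
  qed
qed (rule stdR_maximal)

abbreviation "F \<equiv> T.X"

lemma points_F: "points F = range tau"
  by (simp add: T.points_X points_stdR)

lemma F_smooth: "smooth_manifold F"
proof -
  obtain S :: "(real^('n + 'n)) set" where S: "countable S" "\<And>V. open V \<Longrightarrow> V \<noteq> {} \<Longrightarrow> \<exists>d\<in>S. d \<in> V"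
    using countable_dense_exists by metis
  show ?thesis
  proof (rule T.X_smooth_manifold)
    fix t t' assume "tau t \<noteq> tau t'"
    then obtain i where "t $ i - t' $ i \<notin> \<int>" unfolding tau_eq_iff int_vec_def by auto
    then obtain \<epsilon> where \<epsilon>: "\<epsilon> > 0" "\<forall>k\<in>\<int>. \<bar>(t $ i - t' $ i) - k\<bar> \<ge> 2 * \<epsilon>" using non_integer_gap by blast
    let ?U = "\<lambda>t. {s :: real^('n + 'n). \<bar>s $ i - t $ i\<bar> < \<epsilon>}"
    have o: "open (?U t)" for t by (intro open_Collect_less continuous_intros)
    have "tau s \<noteq> tau s'" if "s \<in> ?U t" "s' \<in> ?U t'" for s s'
    proof
      assume "tau s = tau s'"
      then have "s $ i - s' $ i \<in> \<int>" unfolding tau_eq_iff int_vec_def by auto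
      from \<epsilon>(2)[rule_format, OF this] show False using that by (simp add: abs_less_iff) linarith
    qed
    then have "tau ` ?U t \<inter> tau ` ?U t' = {}" by (rule disjoint_images)
    then show "\<exists>U U'. openin (manifold_topology stdR) U \<and> openin (manifold_topology stdR) U' \<and> t \<in> U \<and> t' \<in> U' \<and> tau ` U \<inter> tau ` U' = {}"
      unfolding openin_stdR using o \<epsilon>(1) by (intro exI[of _ "?U t"] exI[of _ "?U t'"]) simp
  next
    show "countable ((\<lambda>s. tb s 0) ` S)" using S by simp
    show "(\<lambda>s. tb s 0) ` S \<subseteq> {c \<in> stdR. inj_on tau (dom_ch c)}" using tb_mem tb_inj by blast
    show "points F \<subseteq> (\<Union>c\<in>(\<lambda>s. tb s 0) ` S. tau ` dom_ch c)"
    proof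
      fix P assume "P \<in> points F"
      then obtain t where t: "P = tau t" unfolding points_F by blast
      obtain s where s: "s \<in> S" "s \<in> ball t (1/4)" using S(2)[of "ball t (1/4)"] by auto
      then have "t \<in> dom_ch (tb s 0)" by (simp add: tb_def dist_commute)
      then show "P \<in> (\<Union>c\<in>(\<lambda>s. tb s 0) ` S. tau ` dom_ch c)" using t s(1) by blast
    qed
  qed
qed

abbreviation "lch t \<equiv> xch c0 (tpt t)"

lemma tau_xch:
  assumes "s \<in> ball t (1/4)"
  shows "tau s \<in> dom_ch (lch t)" "map_ch (lch t) (tau s) = tpt s"
proof -
  have "dist (lo t) (lo s) < 1/4" "dist (hi t) (hi s) < 1/4"
    using assms norm_lo[of "t - s"] norm_hi[of "t - s"] by (auto simp: dist_norm lo_diff hi_diff)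
  then have "map_ch (ech c0) (inv_ch (ech c0) (tpt s)) \<in> xbox (tpt t)"
    unfolding map_inv_ch[OF tpt_img] by (simp add: tpt_def xbox_def)
  from map_xch[OF ic0 inv_ch_dom[OF tpt_img] this]
  show "tau s \<in> dom_ch (lch t)" "map_ch (lch t) (tau s) = tpt s" by (simp_all add: tau_def map_inv_ch[OF tpt_img])
qed

lemma tau_X: "tau t \<in> points X"
  using pointsI[OF xch_mem[OF ic0] tau_xch(1)[of t t]] by simp

section \<open>Points of the fibre in charts of the quotient\<close>

lemma xch_point:
  assumes ic: "ichart c" and R: "R \<in> dom_ch (xch c y)"
  obtains w where "w \<in> dom_ch (ech c)" "R = q w" "map_ch (ech c) w = map_ch (xch c y) R"
proof -
  obtain w where w: "w \<in> dom_ch (rch c y)" "R = q w" using R by (auto simp: xch_def dom_qchart)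
  have d: "w \<in> dom_ch (ech c)" "map_ch (ech c) w \<in> xbox y" using w(1) by (simp_all add: rch_def dom_restrict_ch)
  show ?thesis by (rule that[OF d(1) w(2)]) (use map_xch(2)[OF ic d] w(2) in simp)
qed

lemma fibre_iff:
  assumes w: "w \<in> points TT.BM"
  shows "q w \<in> range tau \<longleftrightarrow> fst (fst w) = p"
proof
  assume "q w \<in> range tau"
  then obtain t where t: "q w = q (inv_ch (ech c0) (tpt t))" unfolding tau_def by blast
  let ?v = "inv_ch (ech c0) (tpt t)"
  note v = inv_ch_dom[OF tpt_img, of t]
  have "fst (fst w) = fst (fst ?v)" by (rule q_base[OF w pointsI[OF ech_mem[OF ichart_mem[OF ic0]] v] t])
  moreover have "map_ch c0 (fst (fst ?v)) = x0"
    using map_inv_ch[OF tpt_img, of t] by (simp add: ech_def tpt_def)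
  moreover have "fst (fst ?v) \<in> dom_ch c0" using v unfolding ech_def by auto
  ultimately show "fst (fst w) = p" using is_chart_inj[OF maximal_chart[OF M ichart_mem[OF ic0]] _ p0] by metis
next
  assume b: "fst (fst w) = p"
  have "w \<in> TE2" using w TT.points_BM by blast
  then have wd: "w \<in> dom_ch (ech c0)" unfolding ech_def using b p0 by auto
  let ?y = "map_ch (ech c0) w"
  have "tpt (jn (fst (snd ?y)) (snd (snd ?y))) = ?y" by (simp add: tpt_def lo_jn hi_jn ech_def b)
  then have "tau (jn (fst (snd ?y)) (snd (snd ?y))) = q w"
    using inv_ch_map[OF maximal_chart[OF TT.BM_maximal ech_mem[OF ichart_mem[OF ic0]]] wd] by (simp add: tau_def)
  then show "q w \<in> range tau" by (metis rangeI)
qed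

text \<open>For points known to lie in the fibre, the fibre coordinates of an adapted chart provide
  a local inverse of \<open>tau\<close>.\<close>

lemma xch_fibre:
  assumes P: "P \<in> dom_ch (lch t)" "P \<in> range tau"
  defines "s \<equiv> jn (fst (snd (map_ch (lch t) P))) (snd (snd (map_ch (lch t) P)))"
  shows "map_ch (lch t) P = tpt s" "P = tau s"
proof -
  obtain w where w: "w \<in> dom_ch (ech c0)" "P = q w" "map_ch (ech c0) w = map_ch (lch t) P"
    using xch_point[OF ic0 P(1)] .
  have "fst (fst w) = p" using P(2) fibre_iff[OF pointsI[OF ech_mem[OF ichart_mem[OF ic0]] w(1)]] w(2) by simp
  then have "fst (map_ch (lch t) P) = x0" unfolding w(3)[symmetric] by (simp add: ech_def)
  then show e: "map_ch (lch t) P = tpt s" by (simp add: tpt_def s_def lo_jn hi_jn prod_eq_iff)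
  show "P = tau s"
    unfolding tau_def e[symmetric] w(3)[symmetric]
    using inv_ch_map[OF maximal_chart[OF TT.BM_maximal ech_mem[OF ichart_mem[OF ic0]]] w(1)] w(2) by simp
qed

lemma linear_tpt0: "linear (\<lambda>t. (0 :: real^'n, lo t, hi t))"
  using linear_lo linear_hi by (auto simp: linear_iff)

lemma tpt_has_derivative: "(tpt has_derivative (\<lambda>t. (0, lo t, hi t))) (at t)"
proof -
  have "((\<lambda>t. (x0, 0, 0) + (0, lo t, hi t)) has_derivative (\<lambda>t. 0 + (0, lo t, hi t))) (at t)"
    by (intro has_derivative_add has_derivative_const bounded_linear_imp_has_derivative
        linear_tpt0[THEN linear_conv_bounded_linear[THEN iffD1]])
  then show ?thesis by (simp add: tpt_def[abs_def])
qed

lemma smooth_tpt: "open U \<Longrightarrow> smooth_on U tpt"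
  unfolding tpt_def[abs_def]
  by (intro smooth_on_Pair smooth_on_const smooth_on_linear linear_lo[THEN linear_conv_bounded_linear[THEN iffD1]]
      linear_hi[THEN linear_conv_bounded_linear[THEN iffD1]])

section \<open>The torus as a connected integral manifold\<close>

abbreviation "fch t \<equiv> qchart tau (tb t 0)"

lemma fch: "fch t \<in> F" "tau t \<in> dom_ch (fch t)" "img_ch (fch t) = ball t (1/4)" "map_ch (fch t) (tau t) = t"
    "x \<in> ball t (1/4) \<Longrightarrow> inv_ch (fch t) x = tau x"
proof -
  show "fch t \<in> F" by (rule T.qchart_mem[OF tb_mem tb_inj])
  have t: "t \<in> dom_ch (tb t 0)" by (simp add: tb_def)
  show "tau t \<in> dom_ch (fch t)" by (rule T.q_mem[OF t])
  show "img_ch (fch t) = ball t (1/4)" by (simp add: img_qchart[OF tb_inj] tb_img)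
  show "map_ch (fch t) (tau t) = t" unfolding map_qchart[OF tb_inj t] by (simp add: tb_def)
  show "inv_ch (fch t) x = tau x" if "x \<in> ball t (1/4)"
    using inv_qchart[OF maximal_chart[OF stdR_maximal tb_mem] tb_inj, of x t 0] that by (simp add: tb_img tb_inv)
qed

text \<open>In the charts \<open>fch t\<close> and \<open>lch t\<close> the inclusion is the affine
  map \<open>tpt\<close>, whose derivative is an isomorphism onto the vectors without base
  component, that is, onto the distribution.\<close>

lemma F_integral: "integral_manifold X D F"
  unfolding integral_manifold_def
proof (intro conjI F_smooth ballI)
  show "points F \<noteq> {}" by (simp add: points_F)
  show "smooth_map F X (\<lambda>p. p)"
  proof (rule smooth_mapI[OF T.X_maximal Q.X_maximal])
    show "(\<lambda>p. p) ` points F \<subseteq> points X" using tau_X by (auto simp: points_F)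
    fix P assume "P \<in> points F"
    then obtain t where t: "P = tau t" unfolding points_F by blast
    have "smooth_on (ball t (1/4)) (\<lambda>x. map_ch (lch t) (inv_ch (fch t) x))"
      by (rule smooth_on_cong[OF open_ball _ smooth_tpt[OF open_ball]]) (simp add: fch(5) tau_xch(2))
    moreover have "inv_ch (fch t) x \<in> dom_ch (lch t)" if "x \<in> ball t (1/4)" for x
      using tau_xch(1)[OF that] fch(5)[OF that] by simp
    ultimately show "\<exists>c d W. c \<in> F \<and> d \<in> X \<and> P \<in> dom_ch c \<and> open W \<and> map_ch c P \<in> W \<and> W \<subseteq> img_ch c \<and>
      (\<forall>x\<in>W. inv_ch c x \<in> dom_ch d) \<and> smooth_on W (\<lambda>x. map_ch d (inv_ch c x))"
      using fch(1-4)[of t] xch_mem[OF ic0] t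
      by (intro exI[of _ "fch t"] exI[of _ "lch t"] exI[of _ "ball t (1/4)"]) simp
  qed
  fix P assume "P \<in> points F"
  then obtain t where t: "P = tau t" unfolding points_F by blast
  note fm = fch(1)[of t] and fP = fch(2)[of t, folded t]
  have dP: "P \<in> dom_ch (lch t)" using tau_xch(1)[of t t] t by simp
  have diff: "differential F X (\<lambda>p. p) P v = coord_vec X (lch t) P (0, lo (v (fch t)), hi (v (fch t)))"
    if "v \<in> tangent_space F P" for v
    by (rule differential_eq[where W = "ball t (1/4)" and F = tpt, OF T.X_maximal Q.X_maximal fm fP xch_mem[OF ic0] open_ball _ _ _ that])
       (use t fch tau_xch tpt_has_derivative[of t] in auto)
  show "inj_on (differential F X (\<lambda>p. p) P) (tangent_space F P)"
  proof (rule inj_onI)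
    fix u v assume u: "u \<in> tangent_space F P" and v: "v \<in> tangent_space F P"
      and e: "differential F X (\<lambda>p. p) P u = differential F X (\<lambda>p. p) P v"
    have "(0 :: real^'n, lo (u (fch t)), hi (u (fch t))) = (0, lo (v (fch t)), hi (v (fch t)))"
      using fun_cong[OF e[unfolded diff[OF u] diff[OF v]], of "lch t"] unfolding cv_self[OF ic0 dP] .
    then have "u (fch t) = v (fch t)" using lo_hi_eqI by auto
    then show "u = v" by (rule tangent_eqI[OF T.X_maximal u v fm fP])
  qed
  show "differential F X (\<lambda>p. p) P ` tangent_space F P = D P"
  proof
    show "differential F X (\<lambda>p. p) P ` tangent_space F P \<subseteq> D P"
      unfolding leaf_dist_eq[OF ic0 dP] using diff cv_tangent[OF ic0 dP] cv_self[OF ic0 dP] by auto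
    show "D P \<subseteq> differential F X (\<lambda>p. p) P ` tangent_space F P"
    proof
      fix v assume "v \<in> D P"
      then have v: "v \<in> tangent_space X P" "fst (v (lch t)) = 0" unfolding leaf_dist_eq[OF ic0 dP] by auto
      let ?s = "jn (fst (snd (v (lch t)))) (snd (snd (v (lch t))))"
      let ?u = "coord_vec F (fch t) P ?s"
      have u: "?u \<in> tangent_space F P" by (rule coord_vec_tangent[OF T.X_maximal fm fP])
      have "(0, lo (?u (fch t)), hi (?u (fch t))) = v (lch t)"
        unfolding coord_vec_self[OF T.X_maximal fm fP] using v(2) by (simp add: lo_jn hi_jn prod_eq_iff)
      then have e: "differential F X (\<lambda>p. p) P ?u = v"
        unfolding diff[OF u] using tangent_eq_coord_vec[OF Q.X_maximal v(1) xch_mem[OF ic0] dP] by simp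
      show "v \<in> differential F X (\<lambda>p. p) P ` tangent_space F P" using imageI[OF u, of "differential F X (\<lambda>p. p) P"] unfolding e .
    qed
  qed
qed

lemma F_connected: "connected_space (manifold_topology F)"
  unfolding connected_space_def topspace_manifold[OF T.X_maximal] points_F
proof (intro notI, elim exE conjE)
  fix E1 E2 assume E: "openin (manifold_topology F) E1" "openin (manifold_topology F) E2" "range tau \<subseteq> E1 \<union> E2" "E1 \<inter> E2 = {}" "E1 \<noteq> {}" "E2 \<noteq> {}"
  have o: "open {t. tau t \<in> E}" if "openin (manifold_topology F) E" for E
    using T.openin_q_preimage[OF that] unfolding openin_stdR points_stdR by simp
  have sub: "E \<subseteq> range tau" if "openin (manifold_topology F) E" for E
    using openin_subset[OF that] topspace_manifold[OF T.X_maximal] points_F by simp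
  have "{t. tau t \<in> E1} \<noteq> {}" "{t. tau t \<in> E2} \<noteq> {}" using E sub by blast+
  moreover have "{t. tau t \<in> E1} \<inter> {t. tau t \<in> E2} \<inter> UNIV = {}" "UNIV \<subseteq> {t. tau t \<in> E1} \<union> {t. tau t \<in> E2}" using E(3,4) by blast+
  ultimately show False
    using connectedD[OF connected_UNIV o[OF E(1)] o[OF E(2)]] by blast
qed

end

section \<open>The volume of the leaves\<close>

lemma det_gram:
  fixes A G :: "real^'m^'m"
  shows "det (\<chi> i j. (A *v axis i 1) \<bullet> (G *v (A *v axis j 1))) = (det A)^2 * det G"
proof -
  have "(\<chi> i j. (A *v axis i 1) \<bullet> (G *v (A *v axis j 1))) = transpose A ** (G ** A)"
    unfolding matrix_vector_mult_basis
    by (simp add: vec_eq_iff inner_vec_def column_def matrix_matrix_mult_def matrix_vector_mult_def Finite_Cartesian_Product.transpose_def)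
  then show ?thesis by (simp add: det_mul det_transpose power2_eq_square)
qed

text \<open>Making the countable cover disjoint reduces any set to pieces inside single members, and
  countable additivity reassembles them.\<close>

lemma measure_eq_on_cover:
  fixes A :: "nat \<Rightarrow> 'b set"
  assumes s: "sets \<mu> = sets \<nu>" and A: "\<And>i. A i \<in> sets \<mu>" "(\<Union>i. A i) = space \<mu>"
    and e: "\<And>i B. B \<in> sets \<mu> \<Longrightarrow> B \<subseteq> A i \<Longrightarrow> emeasure \<mu> B = emeasure \<nu> B"
  shows "\<mu> = \<nu>"
proof (rule measure_eqI[OF s])
  fix B assume B: "B \<in> sets \<mu>"
  let ?B = "\<lambda>i. B \<inter> disjointed A i"
  have m: "?B i \<in> sets \<mu>" for i
    using sets.range_disjointed_sets[of A \<mu>] A(1) B by (intro sets.Int) auto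
  have dj: "disjoint_family ?B" using disjoint_family_disjointed[of A] unfolding disjoint_family_on_def by blast
  have U: "(\<Union>i. ?B i) = B" using sets.sets_into_space[OF B] A(2) UN_disjointed_eq[of A] by blast
  have eq: "emeasure \<mu> (?B i) = emeasure \<nu> (?B i)" for i
    using e[OF m, of i i] disjointed_subset[of A i] by blast
  have "(\<Sum>i. emeasure \<mu> (?B i)) = emeasure \<mu> B" using suminf_emeasure[of ?B \<mu>] m dj U by auto
  moreover have "(\<Sum>i. emeasure \<nu> (?B i)) = emeasure \<nu> B" using suminf_emeasure[of ?B \<nu>] m dj U s by auto
  ultimately show "emeasure \<mu> B = emeasure \<nu> B" using eq by simp
qed

section \<open>The half-open unit cube, a fundamental domain\<close>

definition ucube :: "(real^'m) set" where "ucube = {t. \<forall>i. 0 \<le> t $ i \<and> t $ i < 1}"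

lemma ucube_borel: "(ucube :: (real^'m) set) \<in> sets borel"
proof -
  have e: "(ucube :: (real^'m) set) = (\<Inter>i\<in>UNIV. {t. 0 \<le> t $ i} \<inter> {t. t $ i < 1})" by (auto simp: ucube_def)
  have "{t :: real^'m. 0 \<le> t $ i} \<inter> {t. t $ i < 1} \<in> sets borel" for i
    by (intro sets.Int borel_closed borel_open closed_Collect_le open_Collect_less continuous_intros)
  then show ?thesis unfolding e by (intro sets.finite_INT) auto
qed

lemma emeasure_ucube: "emeasure lborel (ucube :: (real^'m) set) = 1"
proof -
  let ?e = "(\<chi> i. 1) :: real^'m"
  have b: "b \<in> Basis \<Longrightarrow> ?e \<bullet> b = 1" for b by (auto simp: Basis_vec_def inner_axis)
  have B: "(\<Prod>b\<in>Basis. (?e - 0) \<bullet> b) = 1" using b by (intro prod.neutral) simp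
  have l: "b \<in> Basis \<Longrightarrow> 0 \<bullet> b \<le> ?e \<bullet> b" for b using b[of b] by simp
  \<comment> \<open>The cube lies between the open and the closed box with the same corners, both of
    measure one.\<close>
  have "emeasure lborel (ucube :: (real^'m) set) \<le> emeasure lborel (cbox 0 ?e)"
    by (intro emeasure_mono) (auto simp: ucube_def mem_box_cart less_imp_le)
  also have "\<dots> = 1" using emeasure_lborel_cbox[of 0 ?e, OF l] B by simp
  finally have 1: "emeasure lborel (ucube :: (real^'m) set) \<le> 1" .
  have "1 = emeasure lborel (box 0 ?e)" using emeasure_lborel_box[of 0 ?e, OF l] B by simp
  also have "\<dots> \<le> emeasure lborel (ucube :: (real^'m) set)"
    using ucube_borel by (intro emeasure_mono) (auto simp: ucube_def mem_box_cart less_imp_le)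
  finally show ?thesis using 1 by (rule antisym[rotated])
qed

section \<open>Arbitrary integral manifolds in adapted charts\<close>

context canonical
begin

text \<open>Nothing is assumed about the atlas \<open>S\<close> beyond the definition. Tangency to
  the distribution says that the base part of the derivative of \<open>\<sigma>\<close> is zero, and
  immersion says that this derivative is injective.\<close>

lemma integral_chart:
  assumes S: "integral_manifold X (leaf_dist X \<omega>1 \<omega>2) S" and s: "s \<in> S" and R: "R \<in> dom_ch s"
    and ic: "ichart c" and Rc: "R \<in> dom_ch (xch c y)"
  defines "\<sigma> \<equiv> \<lambda>z. map_ch (xch c y) (inv_ch s z)"
  obtains W where "open W" "map_ch s R \<in> W" "W \<subseteq> img_ch s" "\<forall>z. z \<in> W \<longrightarrow> inv_ch s z \<in> dom_ch (xch c y)" "smooth_on W \<sigma>"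
    "\<forall>z v. z \<in> W \<longrightarrow> fst (fder \<sigma> z v) = 0" "\<forall>z v. z \<in> W \<longrightarrow> fder \<sigma> z v = 0 \<longrightarrow> v = 0"
    "\<forall>z v. z \<in> W \<longrightarrow> differential S X (\<lambda>p. p) (inv_ch s z) (coord_vec S s (inv_ch s z) v) = coord_vec X (xch c y) (inv_ch s z) (fder \<sigma> z v)"
proof -
  have sm: "smooth_map S X (\<lambda>p. p)" and SM: "smooth_manifold S" using S unfolding integral_manifold_def by blast+
  note M = smooth_manifold_maximal[OF SM]
  have "\<exists>W. open W \<and> map_ch s R \<in> W \<and> W \<subseteq> img_ch s \<and> (\<lambda>p. p) ` inv_ch s ` W \<subseteq> dom_ch (xch c y) \<and> smooth_on W (map_ch (xch c y) \<circ> (\<lambda>p. p) \<circ> inv_ch s)"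
    using sm[unfolded smooth_map_def, THEN conjunct2, rule_format, OF pointsI[OF s R] s xch_mem[OF ic, of y]] R Rc by blast
  then obtain W where W: "open W" "map_ch s R \<in> W" "W \<subseteq> img_ch s" and Wd: "(\<lambda>p. p) ` inv_ch s ` W \<subseteq> dom_ch (xch c y)"
    and "smooth_on W (map_ch (xch c y) \<circ> (\<lambda>p. p) \<circ> inv_ch s)" by (elim exE conjE)
  then have sW: "smooth_on W \<sigma>" unfolding \<sigma>_def comp_def by simp
  have d: "inv_ch s z \<in> dom_ch (xch c y)" if "z \<in> W" for z using Wd that by blast
  have diff: "differential S X (\<lambda>p. p) (inv_ch s z) (coord_vec S s (inv_ch s z) v) = coord_vec X (xch c y) (inv_ch s z) (fder \<sigma> z v)"
    if z: "z \<in> W" for z v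
  proof -
    have zi: "z \<in> img_ch s" using z W(3) by blast
    note ps = inv_ch_dom[OF zi]
    have zz: "map_ch s (inv_ch s z) = z" by (rule map_inv_ch[OF zi])
    have "differential S X (\<lambda>p. p) (inv_ch s z) (coord_vec S s (inv_ch s z) v)
        = coord_vec X (xch c y) (inv_ch s z) (fder \<sigma> z (coord_vec S s (inv_ch s z) v s))"
    proof (rule differential_eq[where W = W and F = \<sigma>, OF M Q.X_maximal s ps xch_mem[OF ic] W(1)])
      show "map_ch s (inv_ch s z) \<in> W" using z zz by simp
      show "inv_ch s x \<in> dom_ch (xch c y) \<and> map_ch (xch c y) (inv_ch s x) = \<sigma> x" if "x \<in> W" for x
        using d[OF that] by (simp add: \<sigma>_def)
      show "(\<sigma> has_derivative fder \<sigma> z) (at (map_ch s (inv_ch s z)))"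
        unfolding zz by (rule smooth_on_has_derivative[OF sW W(1) z])
      show "coord_vec S s (inv_ch s z) v \<in> tangent_space S (inv_ch s z)" by (rule coord_vec_tangent[OF M s ps])
    qed
    then show ?thesis unfolding coord_vec_self[OF M s ps] .
  qed
  have fst0: "fst (fder \<sigma> z v) = 0" if z: "z \<in> W" for z v
  proof -
    have zi: "z \<in> img_ch s" using z W(3) by blast
    note ps = inv_ch_dom[OF zi]
    have "differential S X (\<lambda>p. p) (inv_ch s z) (coord_vec S s (inv_ch s z) v) \<in> leaf_dist X \<omega>1 \<omega>2 (inv_ch s z)"
      using S[unfolded integral_manifold_def] pointsI[OF s ps] coord_vec_tangent[OF M s ps, of v] by blast
    then show ?thesis unfolding diff[OF z] leaf_dist_eq[OF ic d[OF z]] using cv_self[OF ic d[OF z], of "fder \<sigma> z v"] by simp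
  qed
  have inj: "v = 0" if z: "z \<in> W" and v: "fder \<sigma> z v = 0" for z v
  proof -
    have zi: "z \<in> img_ch s" using z W(3) by blast
    note ps = inv_ch_dom[OF zi]
    have "linear (fder \<sigma> z)" by (rule has_derivative_linear[OF smooth_on_has_derivative[OF sW W(1) z]])
    then have "fder \<sigma> z 0 = 0" by (rule linear_0)
    then have "differential S X (\<lambda>p. p) (inv_ch s z) (coord_vec S s (inv_ch s z) v) = differential S X (\<lambda>p. p) (inv_ch s z) (coord_vec S s (inv_ch s z) 0)"
      unfolding diff[OF z] v by simp
    moreover have "inj_on (differential S X (\<lambda>p. p) (inv_ch s z)) (tangent_space S (inv_ch s z))"
      using S[unfolded integral_manifold_def] pointsI[OF s ps] by blast
    ultimately have "coord_vec S s (inv_ch s z) v = coord_vec S s (inv_ch s z) 0"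
      using coord_vec_tangent[OF M s ps] by (blast dest: inj_onD)
    then show ?thesis using coord_vec_self[OF M s ps] by metis
  qed
  have "\<forall>z. z \<in> W \<longrightarrow> inv_ch s z \<in> dom_ch (xch c y)" by (intro allI impI) (rule d)
  moreover have "\<forall>z v. z \<in> W \<longrightarrow> fst (fder \<sigma> z v) = 0" by (intro allI impI) (rule fst0)
  moreover have "\<forall>z v. z \<in> W \<longrightarrow> fder \<sigma> z v = 0 \<longrightarrow> v = 0" by (intro allI impI) (rule inj)
  moreover have "\<forall>z v. z \<in> W \<longrightarrow> differential S X (\<lambda>p. p) (inv_ch s z) (coord_vec S s (inv_ch s z) v) = coord_vec X (xch c y) (inv_ch s z) (fder \<sigma> z v)"
    by (intro allI impI) (rule diff)
  ultimately show ?thesis using W sW by - (rule that)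
qed

end

context leaf_torus
begin

lemma fibre_const:
  assumes ic: "ichart c" and R: "R \<in> dom_ch (xch c y)" "R' \<in> dom_ch (xch c y)"
    and e: "fst (map_ch (xch c y) R) = fst (map_ch (xch c y) R')"
  shows "R \<in> range tau \<longleftrightarrow> R' \<in> range tau"
proof -
  obtain w where w: "w \<in> dom_ch (ech c)" "R = q w" "map_ch (ech c) w = map_ch (xch c y) R" by (rule xch_point[OF ic R(1)])
  obtain w' where w': "w' \<in> dom_ch (ech c)" "R' = q w'" "map_ch (ech c) w' = map_ch (xch c y) R'" by (rule xch_point[OF ic R(2)])
  have "map_ch c (fst (fst w)) = map_ch c (fst (fst w'))"
    using e unfolding w(3)[symmetric] w'(3)[symmetric] by (simp add: ech_def)
  moreover have "fst (fst w) \<in> dom_ch c" "fst (fst w') \<in> dom_ch c" using w(1) w'(1) unfolding ech_def by auto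
  ultimately have "fst (fst w) = fst (fst w')" using is_chart_inj[OF maximal_chart[OF M ichart_mem[OF ic]]] by blast
  then show ?thesis unfolding w(2) w'(2)
    using fibre_iff[OF pointsI[OF ech_mem[OF ichart_mem[OF ic]] w(1)]] fibre_iff[OF pointsI[OF ech_mem[OF ichart_mem[OF ic]] w'(1)]] by simp
qed

text \<open>The base coordinate has zero derivative along \<open>S\<close>, so it is locally
  constant and lying in the given fibre is an open and closed condition. Connectedness in the
  topology of \<open>S\<close> itself then decides.\<close>

lemma integral_in_fibre:
  assumes S: "integral_manifold X D S" and con: "connected_space (manifold_topology S)"
    and R0: "R0 \<in> points S" "R0 \<in> range tau"
  shows "points S \<subseteq> range tau"
proof -
  have sm: "smooth_map S X (\<lambda>p. p)" and SM: "smooth_manifold S" using S unfolding integral_manifold_def by blast+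
  note M = smooth_manifold_maximal[OF SM]
  have loc: "\<exists>s V. s \<in> S \<and> open V \<and> R \<in> dom_ch s \<and> map_ch s R \<in> V \<and> (\<forall>R'\<in>dom_ch s \<inter> map_ch s -` V. R' \<in> points S \<and> (R' \<in> range tau \<longleftrightarrow> R \<in> range tau))"
    if RS: "R \<in> points S" for R
  proof -
    obtain s where s: "s \<in> S" "R \<in> dom_ch s" using RS unfolding points_def by blast
    have "R \<in> points X" using sm RS unfolding smooth_map_def by blast
    then obtain c y where ic: "ichart c" and Rc: "R \<in> dom_ch (xch c y)" by (rule xch_cover)
    obtain W where W: "open W" "map_ch s R \<in> W" "W \<subseteq> img_ch s" and Wd: "\<forall>z. z \<in> W \<longrightarrow> inv_ch s z \<in> dom_ch (xch c y)"
      and sW: "smooth_on W (\<lambda>z. map_ch (xch c y) (inv_ch s z))"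
      and f0: "\<forall>z v. z \<in> W \<longrightarrow> fst (fder (\<lambda>z. map_ch (xch c y) (inv_ch s z)) z v) = 0"
      and "\<forall>z v. z \<in> W \<longrightarrow> fder (\<lambda>z. map_ch (xch c y) (inv_ch s z)) z v = 0 \<longrightarrow> v = 0"
      and "\<forall>z v. z \<in> W \<longrightarrow> differential S X (\<lambda>p. p) (inv_ch s z) (coord_vec S s (inv_ch s z) v)
        = coord_vec X (xch c y) (inv_ch s z) (fder (\<lambda>z. map_ch (xch c y) (inv_ch s z)) z v)"
      by (rule integral_chart[OF S s ic Rc])
    note Wd = Wd[rule_format] and f0 = f0[rule_format]
    let ?\<sigma> = "\<lambda>z. map_ch (xch c y) (inv_ch s z)"
    obtain e where e: "e > 0" "ball (map_ch s R) e \<subseteq> W" using W(1,2) open_contains_ball by blast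
    have "((\<lambda>z. fst (?\<sigma> z)) has_derivative (\<lambda>h. 0)) (at z within ball (map_ch s R) e)" if "z \<in> ball (map_ch s R) e" for z
    proof -
      have z: "z \<in> W" using that e by blast
      have "((\<lambda>z. fst (?\<sigma> z)) has_derivative (\<lambda>v. fst (fder ?\<sigma> z v))) (at z)"
        by (rule has_derivative_fst[OF smooth_on_has_derivative[OF sW W(1) z]])
      then have "((\<lambda>z. fst (?\<sigma> z)) has_derivative (\<lambda>v. 0)) (at z)" unfolding f0[OF z] .
      then show ?thesis by (rule has_derivative_at_withinI)
    qed
    then obtain k where k: "\<And>z. z \<in> ball (map_ch s R) e \<Longrightarrow> fst (?\<sigma> z) = k"
      using has_derivative_zero_constant[OF convex_ball, of "map_ch s R" e "\<lambda>z. fst (?\<sigma> z)"] by blast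
    have hR: "R' \<in> points S \<and> (R' \<in> range tau \<longleftrightarrow> R \<in> range tau)" if R': "R' \<in> dom_ch s \<inter> map_ch s -` ball (map_ch s R) e" for R'
    proof
      have i: "inv_ch s (map_ch s R') = R'" "inv_ch s (map_ch s R) = R"
        using inv_ch_map[OF maximal_chart[OF M s(1)]] R' s(2) by blast+
      have b: "map_ch s R' \<in> ball (map_ch s R) e" "map_ch s R \<in> ball (map_ch s R) e" using R' e(1) by auto
      have "R' \<in> dom_ch (xch c y)" using Wd[of "map_ch s R'"] b(1) e(2) i(1) by auto
      then show "R' \<in> range tau \<longleftrightarrow> R \<in> range tau"
        by (rule fibre_const[OF ic _ Rc]) (use k[OF b(1)] k[OF b(2)] i in simp)
      show "R' \<in> points S" using pointsI[OF s(1)] R' by blast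
    qed
    have mem: "map_ch s R \<in> ball (map_ch s R) e" using e(1) by simp
    show ?thesis by (rule exI[of _ s], rule exI[of _ "ball (map_ch s R) e"], intro conjI s open_ball mem, rule ballI, rule hR)
  qed
  \<comment> \<open>Stated for a truth value \<open>b\<close>, it gives openness of the part inside
    the fibre and of its complement at once.\<close>
  have op: "openin (manifold_topology S) {R \<in> points S. R \<in> range tau \<longleftrightarrow> b}" for b
  proof (rule openin_manifoldI[OF M])
    fix R assume R: "R \<in> {R \<in> points S. R \<in> range tau \<longleftrightarrow> b}"
    then have RS: "R \<in> points S" by blast
    obtain s V where sV: "s \<in> S" "open V" "R \<in> dom_ch s" "map_ch s R \<in> V"
      "\<forall>R'\<in>dom_ch s \<inter> map_ch s -` V. R' \<in> points S \<and> (R' \<in> range tau \<longleftrightarrow> R \<in> range tau)" using loc[OF RS] by (elim exE conjE) (rule that)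
    have bb: "R \<in> range tau \<longleftrightarrow> b" using R by blast
    have "dom_ch s \<inter> map_ch s -` V \<subseteq> {R \<in> points S. R \<in> range tau \<longleftrightarrow> b}"
    proof
      fix R' assume "R' \<in> dom_ch s \<inter> map_ch s -` V"
      note x = bspec[OF sV(5) this]
      show "R' \<in> {R \<in> points S. R \<in> range tau \<longleftrightarrow> b}"
        by (rule CollectI) (simp only: x[THEN conjunct1] x[THEN conjunct2] bb simp_thms)
    qed
    then show "\<exists>c V. c \<in> S \<and> open V \<and> R \<in> dom_ch c \<and> map_ch c R \<in> V \<and> dom_ch c \<inter> map_ch c -` V \<subseteq> {R \<in> points S. R \<in> range tau \<longleftrightarrow> b}"
      using sV(1-4) by (intro exI[of _ s] exI[of _ V] conjI)
  qed
  have "{R \<in> points S. R \<in> range tau \<longleftrightarrow> False} = {}"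
  proof (rule ccontr)
    assume "{R \<in> points S. R \<in> range tau \<longleftrightarrow> False} \<noteq> {}"
    moreover have "{R \<in> points S. R \<in> range tau \<longleftrightarrow> True} \<noteq> {}" using R0 by blast
    moreover have "points S \<subseteq> {R \<in> points S. R \<in> range tau \<longleftrightarrow> False} \<union> {R \<in> points S. R \<in> range tau \<longleftrightarrow> True}" by blast
    moreover have "{R \<in> points S. R \<in> range tau \<longleftrightarrow> False} \<inter> {R \<in> points S. R \<in> range tau \<longleftrightarrow> True} = {}" by blast
    ultimately show False using con op[of False] op[of True] unfolding connected_space_def topspace_manifold[OF M] by blast
  qed
  then show ?thesis by blast
qed

abbreviation "fibre_metric \<equiv> blk (Gm c0 x0) (ginv c0 x0)"

lemma det_fibre_metric: "det fibre_metric = 1"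
  by (rule det_blk_inverse[OF matrix_inv_right[OF Gm_invertible[OF ichart_mem[OF ic0] map_ch_img[OF p0]]]])

section \<open>Integral manifolds inside one fibre\<close>

context
  fixes S :: "(('a, real^'n) xpoint, real^('n + 'n)) atlas"
  assumes S: "integral_manifold X D S" and S_sub: "points S \<subseteq> range tau"
begin

lemma S_manifold: "smooth_manifold S"
  using S unfolding integral_manifold_def by blast

lemmas S_maximal = smooth_manifold_maximal[OF S_manifold]

abbreviation "hS \<equiv> pullback S X (\<lambda>p. p) h"
abbreviation "dens s z \<equiv> sqrt (det (\<chi> i j. tensor_comp S hS s z (axis i 1) (axis j 1)))"

text \<open>\<open>\<rho>\<close> reads off the fibre coordinates in a chart of \<open>S\<close> and
  so inverts \<open>tau\<close> locally. In it the induced metric is the constant one of determinant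
  one, so the Riemannian density is the absolute Jacobian of \<open>\<rho>\<close>.\<close>

lemma leaf_local:
  assumes s: "s \<in> S" and t: "tau t \<in> dom_ch s"
  obtains W \<rho> where "open W" "map_ch s (tau t) \<in> W" "W \<subseteq> img_ch s" "\<rho> (map_ch s (tau t)) = t" "smooth_on W \<rho>" "inj_on \<rho> W"
    "\<forall>z. z \<in> W \<longrightarrow> tau (\<rho> z) = inv_ch s z" "\<forall>z v. z \<in> W \<longrightarrow> fder \<rho> z v = 0 \<longrightarrow> v = 0"
    "\<forall>z. z \<in> W \<longrightarrow> dens s z = \<bar>det (matrix (fder \<rho> z))\<bar>"
proof -
  have Rd: "tau t \<in> dom_ch (lch t)" and Rt: "map_ch (lch t) (tau t) = tpt t" using tau_xch[of t t] by simp_all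
  let ?\<sigma> = "\<lambda>z. map_ch (lch t) (inv_ch s z)"
  obtain W where W: "open W" "map_ch s (tau t) \<in> W" "W \<subseteq> img_ch s" and Wd: "\<forall>z. z \<in> W \<longrightarrow> inv_ch s z \<in> dom_ch (lch t)"
    and sW: "smooth_on W (\<lambda>z. map_ch (lch t) (inv_ch s z))"
    and f0: "\<forall>z v. z \<in> W \<longrightarrow> fst (fder (\<lambda>z. map_ch (lch t) (inv_ch s z)) z v) = 0"
    and inj: "\<forall>z v. z \<in> W \<longrightarrow> fder (\<lambda>z. map_ch (lch t) (inv_ch s z)) z v = 0 \<longrightarrow> v = 0"
    and diff: "\<forall>z v. z \<in> W \<longrightarrow> differential S X (\<lambda>p. p) (inv_ch s z) (coord_vec S s (inv_ch s z) v)
      = coord_vec X (lch t) (inv_ch s z) (fder (\<lambda>z. map_ch (lch t) (inv_ch s z)) z v)"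
    by (rule integral_chart[OF S s t ic0 Rd])
  note Wd = Wd[rule_format] and f0 = f0[rule_format] and inj = inj[rule_format] and diff = diff[rule_format]
  define \<rho> where "\<rho> = (\<lambda>z. jn (fst (snd (?\<sigma> z))) (snd (snd (?\<sigma> z))))"
  have st: "inv_ch s (map_ch s (tau t)) = tau t" by (rule inv_ch_map[OF maximal_chart[OF S_maximal s] t])
  have \<rho>t: "\<rho> (map_ch s (tau t)) = t" unfolding \<rho>_def st Rt by (simp add: tpt_def jn_lo_hi)
  note bj = linear_jn[THEN linear_conv_bounded_linear[THEN iffD1]]
  have s\<rho>: "smooth_on W \<rho>"
    unfolding \<rho>_def by (rule smooth_on_bounded_linear[OF bj W(1) smooth_on_snd[OF W(1) sW]])
  have d\<rho>: "fder \<rho> z = (\<lambda>v. jn (fst (snd (fder ?\<sigma> z v))) (snd (snd (fder ?\<sigma> z v))))" if z: "z \<in> W" for z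
    unfolding \<rho>_def
    by (rule fder_eq[OF bounded_linear.has_derivative[OF bj has_derivative_snd[OF smooth_on_has_derivative[OF sW W(1) z]]]])
  have rng: "inv_ch s z \<in> range tau" if "z \<in> W" for z
  proof -
    have "z \<in> img_ch s" using W(3) that by blast
    from pointsI[OF s inv_ch_dom[OF this]] show ?thesis using S_sub by blast
  qed
  have \<sigma>\<rho>: "?\<sigma> z = tpt (\<rho> z)" and \<tau>\<rho>: "tau (\<rho> z) = inv_ch s z" if "z \<in> W" for z
    using xch_fibre[OF Wd[OF that] rng[OF that]] unfolding \<rho>_def by simp_all
  have inj\<rho>: "inj_on \<rho> W"
  proof (rule inj_onI)
    fix z z' assume z: "z \<in> W" "z' \<in> W" and e: "\<rho> z = \<rho> z'"
    have "inv_ch s z = inv_ch s z'" using \<tau>\<rho>[OF z(1)] \<tau>\<rho>[OF z(2)] e by simp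
    then have "map_ch s (inv_ch s z) = map_ch s (inv_ch s z')" by simp
    moreover have "z \<in> img_ch s" "z' \<in> img_ch s" using z W(3) by blast+
    ultimately show "z = z'" using map_inv_ch[of z s] map_inv_ch[of z' s] by simp
  qed
  have l0: "lo 0 = 0" "hi 0 = 0" by (simp_all add: linear_0 linear_lo linear_hi)
  have inj': "v = 0" if z: "z \<in> W" and v: "fder \<rho> z v = 0" for z v
  proof -
    have "fst (snd (fder ?\<sigma> z v)) = 0" "snd (snd (fder ?\<sigma> z v)) = 0"
      using v unfolding d\<rho>[OF z] by (metis lo_jn l0(1), metis hi_jn l0(2))
    then have "fder ?\<sigma> z v = 0" using f0[OF z, of v] by (simp add: prod_eq_iff)
    then show ?thesis by (rule inj[OF z])
  qed
  have tc: "tensor_comp S hS s z u v = fder \<rho> z u \<bullet> (fibre_metric *v fder \<rho> z v)" if z: "z \<in> W" for z u v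
  proof -
    have zi: "z \<in> img_ch s" using z W(3) by blast
    note ps = inv_ch_dom[OF zi]
    have "tensor_comp S hS s z u v = h (inv_ch s z) (coord_vec X (lch t) (inv_ch s z) (fder ?\<sigma> z u)) (coord_vec X (lch t) (inv_ch s z) (fder ?\<sigma> z v))"
      unfolding tensor_comp_def Let_def pullback_def diff[OF z] using pointsI[OF s ps] coord_vec_tangent[OF S_maximal s ps] by simp
    also have "\<dots> = fder \<rho> z u \<bullet> (fibre_metric *v fder \<rho> z v)"
      unfolding formh[OF ic0 Wd[OF z] cv_tangent[OF ic0 Wd[OF z]] cv_tangent[OF ic0 Wd[OF z]]] cv_self[OF ic0 Wd[OF z]] f0[OF z] \<sigma>\<rho>[OF z] inner_blk d\<rho>[OF z] lo_jn hi_jn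
      by (simp add: tpt_def)
    finally show ?thesis .
  qed
  have dens: "dens s z = \<bar>det (matrix (fder \<rho> z))\<bar>" if z: "z \<in> W" for z
  proof -
    have "linear (fder \<rho> z)" by (rule has_derivative_linear[OF smooth_on_has_derivative[OF s\<rho> W(1) z]])
    then have m: "fder \<rho> z u = matrix (fder \<rho> z) *v u" for u by (simp add: matrix_vector_mul)
    have "(\<chi> i j. tensor_comp S hS s z (axis i 1) (axis j 1)) = (\<chi> i j. (matrix (fder \<rho> z) *v axis i 1) \<bullet> (fibre_metric *v (matrix (fder \<rho> z) *v axis j 1)))"
      by (simp only: tc[OF z] m[symmetric])
    then show ?thesis by (simp only: det_gram det_fibre_metric) simp
  qed
  have "\<forall>z. z \<in> W \<longrightarrow> tau (\<rho> z) = inv_ch s z" by (intro allI impI) (rule \<tau>\<rho>)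
  moreover have "\<forall>z v. z \<in> W \<longrightarrow> fder \<rho> z v = 0 \<longrightarrow> v = 0" by (intro allI impI) (rule inj')
  moreover have "\<forall>z. z \<in> W \<longrightarrow> dens s z = \<bar>det (matrix (fder \<rho> z))\<bar>" by (intro allI impI) (rule dens)
  ultimately show ?thesis using W \<rho>t s\<rho> inj\<rho> by - (rule that)
qed

lemma dens_cont:
  assumes s: "s \<in> S"
  shows "continuous_on (img_ch s) (dens s)"
proof (rule continuous_at_imp_continuous_on, rule ballI)
  fix z assume z: "z \<in> img_ch s"
  have "inv_ch s z \<in> range tau" using pointsI[OF s inv_ch_dom[OF z]] S_sub by blast
  then obtain t where t: "tau t = inv_ch s z" by (metis imageE)
  have td: "tau t \<in> dom_ch s" using inv_ch_dom[OF z] t by simp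
  obtain W \<rho> where W: "open W" "map_ch s (tau t) \<in> W" "W \<subseteq> img_ch s" "\<rho> (map_ch s (tau t)) = t" "smooth_on W \<rho>" "inj_on \<rho> W"
    "\<forall>z. z \<in> W \<longrightarrow> tau (\<rho> z) = inv_ch s z" "\<forall>z v. z \<in> W \<longrightarrow> fder \<rho> z v = 0 \<longrightarrow> v = 0"
    "\<forall>z. z \<in> W \<longrightarrow> dens s z = \<bar>det (matrix (fder \<rho> z))\<bar>"
    by (rule leaf_local[OF s td])
  note W = W(1-6) W(7-9)[rule_format]
  have zW: "z \<in> W" using W(2) map_inv_ch[OF z] t by simp
  have "smooth_on W (\<lambda>z. matrix (fder \<rho> z))"
    unfolding matrix_def by (intro smooth_on_vec W(1)) (simp add: smooth_on_vec_nth smooth_on_fder W(1,5))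
  then have "continuous_on W (\<lambda>z. \<bar>det (matrix (fder \<rho> z))\<bar>)"
    by (intro continuous_on_rabs smooth_on_imp_continuous_on smooth_on_det W(1))
  then have "continuous_on W (dens s)" by (rule continuous_on_eq) (rule W(9)[symmetric])
  then show "isCont (dens s) z" using continuous_on_eq_continuous_at[OF W(1), of "dens s"] zW by blast
qed

text \<open>The topology of \<open>S\<close> could a priori be finer than that of the torus. Since
  \<open>S\<close> and the torus have equal dimension, the local inverse \<open>\<rho>\<close> is an
  open map, which makes \<open>tau\<close> continuous into \<open>S\<close>.\<close>

lemma tau_open_preimage:
  assumes U: "openin (manifold_topology S) U"
  shows "open {t. tau t \<in> U}"
proof (subst open_subopen, intro ballI)
  fix t assume "t \<in> {t. tau t \<in> U}"
  then have tU: "tau t \<in> U" by simp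
  then have "tau t \<in> points S" using openin_subset[OF U] topspace_manifold[OF S_maximal] by blast
  then obtain s where s: "s \<in> S" "tau t \<in> dom_ch s" unfolding points_def by blast
  obtain W \<rho> where W: "open W" "map_ch s (tau t) \<in> W" "W \<subseteq> img_ch s" "\<rho> (map_ch s (tau t)) = t" "smooth_on W \<rho>" "inj_on \<rho> W"
    "\<forall>z. z \<in> W \<longrightarrow> tau (\<rho> z) = inv_ch s z" "\<forall>z v. z \<in> W \<longrightarrow> fder \<rho> z v = 0 \<longrightarrow> v = 0"
    "\<forall>z. z \<in> W \<longrightarrow> dens s z = \<bar>det (matrix (fder \<rho> z))\<bar>"
    by (rule leaf_local[OF s])
  note W = W(1-6) W(7-9)[rule_format]
  define V where "V = map_ch s ` (dom_ch s \<inter> U)"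
  have V: "open V" unfolding V_def by (subst Int_commute) (rule openin_imp_open_image[OF S_maximal U s(1)])
  have tV: "map_ch s (tau t) \<in> V" unfolding V_def by (rule imageI[OF IntI[OF s(2) tU]])
  have V3: "inv_ch s x \<in> U" if "x \<in> V" for x
    using that overlap_iff[OF maximal_chart[OF S_maximal s(1)], of x U] unfolding V_def by blast
  \<comment> \<open>Invariance of domain: \<open>\<rho>\<close> is continuous and injective between
    spaces of the same dimension.\<close>
  have "open (\<rho> ` (W \<inter> V))"
    by (rule invariance_of_domain[OF continuous_on_subset[OF smooth_on_imp_continuous_on[OF W(5)] Int_lower1] open_Int[OF W(1) V] inj_on_subset[OF W(6) Int_lower1]])
  moreover have "t \<in> \<rho> ` (W \<inter> V)" using W(2,4) tV by (intro image_eqI[of _ _ "map_ch s (tau t)"]) simp_all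
  moreover have "\<rho> ` (W \<inter> V) \<subseteq> {t. tau t \<in> U}" by (auto simp: W(7) V3)
  ultimately show "\<exists>T. open T \<and> t \<in> T \<and> T \<subseteq> {t. tau t \<in> U}" by blast
qed

text \<open>The inverse function argument in a chart of \<open>S\<close>: the derivative of
  \<open>\<psi>\<close> inverts that of \<open>\<rho>\<close>, so its Jacobian cancels the density,
  which was the Jacobian of \<open>\<rho>\<close>.\<close>

lemma psi_derivative:
  assumes s: "s \<in> S" and t: "tau t \<in> dom_ch s"
  defines "\<psi> \<equiv> \<lambda>t. map_ch s (tau t)"
  shows "(\<psi> has_derivative fder \<psi> t) (at t)" "\<bar>det (matrix (fder \<psi> t))\<bar> * dens s (\<psi> t) = 1"
proof -
  obtain W \<rho> where W: "open W" "map_ch s (tau t) \<in> W" "W \<subseteq> img_ch s" "\<rho> (map_ch s (tau t)) = t" "smooth_on W \<rho>" "inj_on \<rho> W"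
    "\<forall>z. z \<in> W \<longrightarrow> tau (\<rho> z) = inv_ch s z" "\<forall>z v. z \<in> W \<longrightarrow> fder \<rho> z v = 0 \<longrightarrow> v = 0"
    "\<forall>z. z \<in> W \<longrightarrow> dens s z = \<bar>det (matrix (fder \<rho> z))\<bar>"
    by (rule leaf_local[OF s t])
  note W = W(1-6) W(7-9)[rule_format]
  let ?z = "map_ch s (tau t)"
  note d\<rho> = smooth_on_has_derivative[OF W(5,1,2)]
  have lin: "linear (fder \<rho> ?z)" by (rule has_derivative_linear[OF d\<rho>])
  define A where "A = matrix (fder \<rho> ?z)"
  have A: "fder \<rho> ?z = (\<lambda>v. A *v v)" unfolding A_def using lin by (intro ext) (simp add: matrix_vector_mul)
  have inv: "invertible A"
  proof (rule invertible_if_ker_zero)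
    fix v assume "A *v v = 0"
    then have "fder \<rho> ?z v = 0" unfolding A .
    then show "v = 0" by (rule W(8)[OF W(2)])
  qed
  define g' where "g' = (\<lambda>v. matrix_inv A *v v)"
  have g': "linear g'" "\<forall>x. g' (fder \<rho> ?z x) = x" "\<forall>x. fder \<rho> ?z (g' x) = x"
    unfolding g'_def A
    by (simp_all add: matrix_vector_mul_linear matrix_vector_mul_assoc matrix_inv_left[OF inv] matrix_inv_right[OF inv])
  have "(\<psi> has_derivative g') (at (\<rho> ?z))"
  proof (rule has_derivative_inverse_strong[OF W(1,2) smooth_on_imp_continuous_on[OF W(5)] _ d\<rho>])
    fix z assume z: "z \<in> W"
    then have "z \<in> img_ch s" using W(3) by blast
    then show "\<psi> (\<rho> z) = z" unfolding \<psi>_def W(7)[OF z] by (rule map_inv_ch)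
  next
    show "fder \<rho> ?z \<circ> g' = id" using g'(3) by (simp add: fun_eq_iff)
  qed
  then have d: "(\<psi> has_derivative g') (at t)" unfolding W(4) .
  note e = fder_eq[OF d]
  show "(\<psi> has_derivative fder \<psi> t) (at t)" using d unfolding e .
  have "matrix g' ** matrix (fder \<rho> ?z) = matrix (g' \<circ> fder \<rho> ?z)" by (rule matrix_compose[OF lin g'(1), symmetric])
  also have "g' \<circ> fder \<rho> ?z = id" using g'(2) by (simp add: fun_eq_iff)
  finally have "matrix g' ** matrix (fder \<rho> ?z) = mat 1" by (simp only: matrix_id_mat_1)
  then have "det (matrix g' ** matrix (fder \<rho> ?z)) = 1" by (simp only: det_I)
  then have "det (matrix g') * det (matrix (fder \<rho> ?z)) = 1" by (simp only: det_mul)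
  then have "\<bar>det (matrix g')\<bar> * \<bar>det (matrix (fder \<rho> ?z))\<bar> = 1" by (metis abs_mult abs_one)
  then show "\<bar>det (matrix (fder \<psi> t))\<bar> * dens s (\<psi> t) = 1" unfolding e unfolding \<psi>_def W(9)[OF W(2)] .
qed

section \<open>The Riemannian measure as an image of Lebesgue measure\<close>

abbreviation "borelS \<equiv> {W. openin (manifold_topology S) W}"

lemma borelS_sub: "borelS \<subseteq> Pow (points S)"
  using openin_subset topspace_manifold[OF S_maximal] by blast

text \<open>The image under the chart is the preimage under its inverse, which is Borel measurable
  on the open image because charts are open maps.\<close>

lemma chart_image_borel:
  assumes s: "s \<in> S" and B: "B \<in> sigma_sets (points S) borelS" "B \<subseteq> dom_ch s"
  shows "map_ch s ` B \<in> sets borel"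
proof -
  note ch = maximal_chart[OF S_maximal s]
  let ?R = "restrict_space borel (img_ch s)"
  have oi: "img_ch s \<inter> space borel \<in> sets borel" using borel_open[OF open_img_ch[OF ch]] by simp
  have sp: "space ?R = img_ch s" by (simp add: space_restrict_space)
  have e: "inv_ch s -` U \<inter> img_ch s = map_ch s ` (dom_ch s \<inter> U)" for U
    by (rule set_eqI, subst overlap_iff[OF ch]) blast
  have "inv_ch s \<in> measurable ?R (sigma (points S) borelS)"
  proof (rule measurable_measure_of[OF borelS_sub])
    show "inv_ch s \<in> space ?R \<rightarrow> points S"
      unfolding sp by (rule Pi_I) (rule pointsI[OF s inv_ch_dom])
    fix U assume "U \<in> borelS"
    then have "openin (manifold_topology S) U" by (rule CollectD)
    from openin_imp_open_image[OF S_maximal this s] have "open (map_ch s ` (dom_ch s \<inter> U))" by (simp only: Int_commute)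
    then have "map_ch s ` (dom_ch s \<inter> U) \<in> sets borel" by (rule borel_open)
    moreover have "map_ch s ` (dom_ch s \<inter> U) \<subseteq> img_ch s" unfolding img_ch_def by blast
    ultimately show "inv_ch s -` U \<inter> space ?R \<in> sets ?R"
      unfolding sp e sets_restrict_space_iff[OF oi] by blast
  qed
  moreover have "B \<in> sets (sigma (points S) borelS)" unfolding sets_measure_of[OF borelS_sub] by (rule B(1))
  ultimately have "inv_ch s -` B \<inter> space ?R \<in> sets ?R" by (rule measurable_sets)
  moreover have "dom_ch s \<inter> B = B" using B(2) by blast
  ultimately show ?thesis unfolding sp e sets_restrict_space_iff[OF oi] by argo
qed

text \<open>The candidate for the Riemannian measure. Its total mass is that of the cube, so the
  volume is known once the local density formula and uniqueness are established.\<close>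

definition vol :: "('a, real^'n) xpoint measure" where
  "vol = distr (restrict_space lborel ucube) (sigma (points S) borelS) tau"

context
  assumes S_pts: "points S = range tau"
begin

lemma tau_measurable: "tau \<in> measurable (restrict_space lborel ucube) (sigma (points S) borelS)"
proof (rule measurable_measure_of[OF borelS_sub])
  show "tau \<in> space (restrict_space lborel ucube) \<rightarrow> points S" by (rule Pi_I) (simp add: S_pts)
  fix U assume "U \<in> borelS"
  then have "open {t. tau t \<in> U}" using tau_open_preimage by simp
  then have "{t. tau t \<in> U} \<inter> ucube \<in> sets lborel" unfolding sets_lborel by (intro sets.Int ucube_borel borel_open)
  moreover have "tau -` U \<inter> space (restrict_space lborel ucube) = {t. tau t \<in> U} \<inter> ucube" by (auto simp: space_restrict_space)
  moreover have "ucube \<inter> space lborel \<in> sets lborel" using ucube_borel by simp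
  ultimately show "tau -` U \<inter> space (restrict_space lborel ucube) \<in> sets (restrict_space lborel ucube)"
    using sets_restrict_space_iff[of ucube lborel "{t. tau t \<in> U} \<inter> ucube"] Int_lower2 by metis
qed

lemma sets_vol: "sets vol = sigma_sets (points S) borelS"
  unfolding vol_def sets_distr by (rule sets_measure_of[OF borelS_sub])

lemma space_vol: "space vol = points S"
  unfolding vol_def space_distr by (rule space_measure_of[OF borelS_sub])

lemma vol_preimage:
  assumes B: "B \<in> sets vol"
  shows "tau -` B \<inter> ucube \<in> sets borel" "emeasure vol B = emeasure lborel (tau -` B \<inter> ucube)"
proof -
  have B': "B \<in> sets (sigma (points S) borelS)" using B unfolding vol_def sets_distr .
  have sp: "space (restrict_space lborel ucube) = ucube" by (simp add: space_restrict_space)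
  have uc: "ucube \<inter> space lborel \<in> sets lborel" using ucube_borel by simp
  have m: "tau -` B \<inter> ucube \<in> sets (restrict_space lborel ucube)"
    using measurable_sets[OF tau_measurable B'] unfolding sp .
  then show "tau -` B \<inter> ucube \<in> sets borel" unfolding sets_restrict_space_iff[OF uc] by simp
  have "emeasure vol B = emeasure (restrict_space lborel ucube) (tau -` B \<inter> ucube)"
    unfolding vol_def emeasure_distr[OF tau_measurable B'] sp ..
  also have "\<dots> = emeasure lborel (tau -` B \<inter> ucube)" by (rule emeasure_restrict_space[OF uc]) blast
  finally show "emeasure vol B = emeasure lborel (tau -` B \<inter> ucube)" .
qed

lemma tau_inj_ucube: "inj_on tau ucube"
proof (rule inj_onI)
  fix t t' :: "real^('n + 'n)" assume t: "t \<in> ucube" "t' \<in> ucube" and "tau t = tau t'"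
  then have i: "(t - t') $ i \<in> \<int>" for i unfolding tau_eq_iff int_vec_def by blast
  have "(t - t') $ i = 0" for i
  proof (rule Ints_nonzero_abs_less1[OF i])
    have "0 \<le> t $ i" "t $ i < 1" "0 \<le> t' $ i" "t' $ i < 1" using t unfolding ucube_def by blast+
    then show "\<bar>(t - t') $ i\<bar> < 1" by (simp add: abs_less_iff)
  qed
  then show "t = t'" by (simp add: vec_eq_iff)
qed

lemma tau_ucube: "range tau = tau ` ucube"
proof
  show "range tau \<subseteq> tau ` ucube"
  proof
    fix P assume "P \<in> range tau"
    then obtain t where t: "P = tau t" by (rule rangeE)
    let ?t = "\<chi> i. frac (t $ i)"
    have "int_vec (t - ?t)" by (simp add: int_vec_def frac_def)
    then have "P = tau ?t" unfolding t tau_eq_iff .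
    moreover have "?t \<in> ucube" by (simp add: ucube_def frac_lt_1)
    ultimately show "P \<in> tau ` ucube" by blast
  qed
qed blast

text \<open>Change of variables along \<open>\<psi>\<close> on the part of the cube that
  \<open>tau\<close> maps into \<open>B\<close>: the density times the Jacobian is one, so the
  integral counts Lebesgue measure in the cube.\<close>

lemma vol_formula:
  assumes s: "s \<in> S" and B: "B \<in> sets vol" "B \<subseteq> dom_ch s"
  shows "emeasure vol B = (\<integral>\<^sup>+z\<in>map_ch s ` B. ennreal (dens s z) \<partial>lborel)"
proof -
  let ?\<psi> = "\<lambda>t. map_ch s (tau t)" and ?A = "tau -` B \<inter> ucube"
  note ch = maximal_chart[OF S_maximal s]
  have "B \<subseteq> range tau" using B(1) sets.sets_into_space[OF B(1)] S_pts unfolding space_vol by blast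
  then have tA: "tau ` ?A = B" unfolding tau_ucube by blast
  have im: "?\<psi> ` ?A = map_ch s ` B"
    by (rule trans[OF image_image[symmetric] arg_cong[OF tA, of "\<lambda>B. map_ch s ` B"]])
  have td: "tau t \<in> dom_ch s" if "t \<in> ?A" for t using that B(2) by blast
  have E: "map_ch s ` B \<in> sets borel"
    by (rule chart_image_borel[OF s _ B(2)]) (use B(1) in \<open>simp only: sets_vol\<close>)
  have "map_ch s ` B \<subseteq> img_ch s" using B(2) unfolding img_ch_def by blast
  then have cE: "continuous_on (map_ch s ` B) (dens s)" by (rule continuous_on_subset[OF dens_cont[OF s]])
  have m: "(\<lambda>z. ennreal (indicator (map_ch s ` B) z *\<^sub>R dens s z)) \<in> borel_measurable borel"
    using borel_measurable_continuous_on_indicator[OF E cE] by (rule measurable_compose[OF _ measurable_ennreal])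
  have e: "(\<lambda>z. ennreal (indicator (map_ch s ` B) z *\<^sub>R dens s z)) = (\<lambda>z. ennreal (dens s z) * indicator (map_ch s ` B) z)"
    by (rule ext) (simp add: indicator_def)
  have meas: "(\<lambda>z. ennreal (dens s z) * indicator (map_ch s ` B) z) \<in> borel_measurable borel"
    by (rule subst[where P = "\<lambda>f. f \<in> borel_measurable borel", OF e m])
  have fin: "emeasure lborel ?A < \<infinity>"
  proof -
    have "emeasure lborel ?A \<le> emeasure lborel (ucube :: (real^('n + 'n)) set)" using ucube_borel by (intro emeasure_mono) auto
    also have "\<dots> < \<infinity>" by (simp add: emeasure_ucube)
    finally show ?thesis .
  qed
  have "(\<integral>\<^sup>+z\<in>?\<psi> ` ?A. ennreal (dens s z) \<partial>lborel) = emeasure lborel ?A"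
  proof (rule nn_integral_unit_jacobian[OF vol_preimage(1)[OF B(1)] fin])
    show "(?\<psi> has_derivative fder ?\<psi> t) (at t)" "\<bar>det (matrix (fder ?\<psi> t))\<bar> * dens s (?\<psi> t) = 1" if "t \<in> ?A" for t
      using psi_derivative[OF s td[OF that]] .
    show "inj_on ?\<psi> ?A"
    proof (rule inj_onI)
      fix t t' assume t: "t \<in> ?A" "t' \<in> ?A" and e: "?\<psi> t = ?\<psi> t'"
      have "tau t = tau t'" by (rule is_chart_inj[OF ch td[OF t(1)] td[OF t(2)] e])
      then show "t = t'" using inj_onD[OF tau_inj_ucube] t by blast
    qed
    \<comment> \<open>\<open>sqrt\<close> of a negative real is negative, so the sign is not
      automatic; it follows from the product with a nonnegative Jacobian being one.\<close>
    show "0 \<le> dens s z" if "z \<in> ?\<psi> ` ?A" for z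
    proof -
      from that obtain t where t: "z = ?\<psi> t" "t \<in> ?A" by (rule imageE)
      have one: "\<bar>det (matrix (fder ?\<psi> t))\<bar> * dens s z = 1" unfolding t(1) by (rule psi_derivative(2)[OF s td[OF t(2)]])
      show ?thesis
      proof (rule ccontr)
        assume "\<not> 0 \<le> dens s z"
        then have "dens s z \<le> 0" by linarith
        from mult_nonneg_nonpos[OF abs_ge_zero this, of "det (matrix (fder ?\<psi> t))"] one show False by linarith
      qed
    qed
    show "(\<lambda>z. ennreal (dens s z) * indicator (?\<psi> ` ?A) z) \<in> borel_measurable borel" unfolding im by (rule meas)
  qed
  then show ?thesis unfolding im vol_preimage(2)[OF B(1)] by (rule sym)
qed

text \<open>The definite description needs uniqueness too: a measure with the prescribed densities
  is determined on every chart domain, and countably many of these cover \<open>S\<close>.\<close>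

lemma volume_one: "riemannian_volume S hS = 1"
proof -
  have "riemannian_measure S hS = vol"
    unfolding riemannian_measure_def
  proof (rule the_equality)
    show "space vol = points S \<and> sets vol = sigma_sets (points S) borelS \<and>
      (\<forall>c\<in>S. \<forall>B\<in>sets vol. B \<subseteq> dom_ch c \<longrightarrow> emeasure vol B = (\<integral>\<^sup>+z\<in>map_ch c ` B. ennreal (dens c z) \<partial>lborel))"
      by (intro conjI ballI impI space_vol sets_vol vol_formula)
    fix \<mu> assume \<mu>: "space \<mu> = points S \<and> sets \<mu> = sigma_sets (points S) borelS \<and>
      (\<forall>c\<in>S. \<forall>B\<in>sets \<mu>. B \<subseteq> dom_ch c \<longrightarrow> emeasure \<mu> B = (\<integral>\<^sup>+z\<in>map_ch c ` B. ennreal (dens c z) \<partial>lborel))"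
    have ss: "sets \<mu> = sets vol" using \<mu> sets_vol by simp
    obtain C where C: "countable C" "C \<subseteq> S" "(\<Union>c\<in>C. dom_ch c) = points S"
      by (rule countable_subcover[OF S_manifold subset_refl eq_refl[OF points_def]])
    have "points S \<noteq> {}" using S unfolding integral_manifold_def by blast
    then have "C \<noteq> {}" using C(3) by blast
    note r = range_from_nat_into[OF this C(1)]
    have cS: "from_nat_into C i \<in> S" for i using r C(2) by blast
    show "\<mu> = vol"
    proof (rule measure_eq_on_cover[OF ss, of "\<lambda>i. dom_ch (from_nat_into C i)"])
      show "dom_ch (from_nat_into C i) \<in> sets \<mu>" for i
        unfolding ss sets_vol by (rule sigma_sets.Basic, rule CollectI, rule openin_dom_ch[OF S_maximal cS])
      have "(\<Union>i. dom_ch (from_nat_into C i)) = (\<Union>c\<in>range (from_nat_into C). dom_ch c)" by blast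
      then show "(\<Union>i. dom_ch (from_nat_into C i)) = space \<mu>" unfolding r C(3) using \<mu> by simp
      show "emeasure \<mu> B = emeasure vol B" if B: "B \<in> sets \<mu>" "B \<subseteq> dom_ch (from_nat_into C i)" for i B
      proof -
        have Bv: "B \<in> sets vol" using B(1) unfolding ss .
        show ?thesis unfolding vol_formula[OF cS Bv B(2)]
          by (rule \<mu>[THEN conjunct2, THEN conjunct2, rule_format, OF cS B])
      qed
    qed
  qed
  then have "riemannian_volume S hS = emeasure vol (points S)" unfolding riemannian_volume_def by simp
  also have "\<dots> = emeasure lborel (tau -` points S \<inter> ucube)"
    by (rule vol_preimage(2)) (metis sets.top space_vol)
  also have "tau -` points S \<inter> ucube = ucube" unfolding S_pts by blast
  finally show ?thesis unfolding emeasure_ucube .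
qed

end

end

end

section \<open>Integrability and self-duality\<close>

context canonical
begin

lemma fibre_chart_ex:
  assumes "P \<in> points X"
  obtains w c where "w \<in> points TT.BM" "P = q w" "ichart c" "fst (fst w) \<in> dom_ch c"
proof -
  obtain w where w: "w \<in> points TT.BM" "P = q w" using assms unfolding Q.points_X by blast
  obtain c where c: "ichart c" "w \<in> dom_ch (ech c)" using w(1) by (rule ech_cover)
  have "fst (fst w) \<in> dom_ch c" using c(2) unfolding ech_def by auto
  then show ?thesis by (rule that[OF w c(1)])
qed

lemma integrable: "integrable_distribution TYPE(real^('n + 'n)) X (leaf_dist X \<omega>1 \<omega>2)"
  unfolding integrable_distribution_def
proof
  fix P assume "P \<in> points X"
  then obtain w c where w: "w \<in> points TT.BM" "P = q w" and c: "ichart c" "fst (fst w) \<in> dom_ch c"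
    by (rule fibre_chart_ex)
  interpret LT: leaf_torus Y g nabla L \<omega>1 \<omega>2 h "fst (fst w)" c
    by (intro leaf_torus.intro canonical_axioms leaf_torus_axioms.intro c)
  have "P \<in> points LT.F" unfolding LT.points_F w(2) LT.fibre_iff[OF w(1)] ..
  then show "\<exists>S :: (_, real^('n + 'n)) atlas. integral_manifold X (leaf_dist X \<omega>1 \<omega>2) S \<and> P \<in> points S"
    by (intro exI[of _ LT.F] conjI LT.F_integral)
qed

lemma self_dualI: "self_dual X \<omega>1 \<omega>2 h"
  unfolding self_dual_def
proof (intro conjI closedD allI impI)
  fix S :: "(_, real^('n + 'n)) atlas" assume S: "leaf X (leaf_dist X \<omega>1 \<omega>2) S"
  then have i: "integral_manifold X (leaf_dist X \<omega>1 \<omega>2) S" and co: "connected_space (manifold_topology S)"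
    and mx: "\<And>S' :: (_, real^('n + 'n)) atlas. integral_manifold X (leaf_dist X \<omega>1 \<omega>2) S' \<Longrightarrow> connected_space (manifold_topology S') \<Longrightarrow> points S \<subseteq> points S' \<Longrightarrow> points S' = points S"
    unfolding leaf_def by blast+
  obtain P where P: "P \<in> points S" using i unfolding integral_manifold_def by blast
  have "P \<in> points X" using i P unfolding integral_manifold_def smooth_map_def by blast
  then obtain w c where w: "w \<in> points TT.BM" "P = q w" and c: "ichart c" "fst (fst w) \<in> dom_ch c"
    by (rule fibre_chart_ex)
  interpret LT: leaf_torus Y g nabla L \<omega>1 \<omega>2 h "fst (fst w)" c
    by (intro leaf_torus.intro canonical_axioms leaf_torus_axioms.intro c)
  have Pt: "P \<in> range LT.tau" unfolding w(2) LT.fibre_iff[OF w(1)] ..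
  note sub = LT.integral_in_fibre[OF i co P Pt]
  \<comment> \<open>The torus is a connected integral manifold containing \<open>S\<close>, so
    maximality of the leaf gives equality of point sets. This is all that
    \<open>LT.volume_one\<close> asks about the relation between the two atlases.\<close>
  have "points LT.F = points S" by (rule mx[OF LT.F_integral LT.F_connected]) (simp only: LT.points_F sub)
  then have "points S = range LT.tau" unfolding LT.points_F by (rule sym)
  then show "riemannian_volume S (pullback S X (\<lambda>p. p) h) = 1" by (rule LT.volume_one[OF i sub])
qed

end

theorem theorem4p4:
  fixes Y :: "('a, real^'n) atlas"
    and g :: "('a, real^'n) tensor2"
    and nabla :: "('a, real^'n) conn"
    and L :: "('a, real^'n) tpoint set"
  assumes "affine_kaehler Y g nabla"
    and "integral_lattice Y nabla L"
  shows "(\<exists>!S. canonical_structure Y g nabla L S) \<and>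
         (\<forall>\<omega>1 \<omega>2 h. canonical_structure Y g nabla L (\<omega>1, \<omega>2, h) \<longrightarrow>
            almost_2_kaehler (X_manifold Y g L) \<omega>1 \<omega>2 h \<and>
            self_dual (X_manifold Y g L) \<omega>1 \<omega>2 h)"
proof (intro conjI allI impI)
  interpret K: kaehler_lattice Y g nabla L using assms by unfold_locales
  show "\<exists>!S. canonical_structure Y g nabla L S" by (rule K.canonical_ex1)
  fix \<omega>1 \<omega>2 h assume "canonical_structure Y g nabla L (\<omega>1, \<omega>2, h)"
  then interpret C: canonical Y g nabla L \<omega>1 \<omega>2 h by unfold_locales
  show "almost_2_kaehler (X_manifold Y g L) \<omega>1 \<omega>2 h" unfolding K.X_manifold_eq by (rule C.almost_2_kaehlerI[OF C.integrable])
  show "self_dual (X_manifold Y g L) \<omega>1 \<omega>2 h" unfolding K.X_manifold_eq by (rule C.self_dualI)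
qed

end
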